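(* Let $\kappa$ be a prime power, $q=\kappa^2$, and let $n$ be an integer with $2\le n$ and $\sqrt{q}=\kappa\ge 2n$. Let $F_n=\mathbb{F}_q(x_1,\dots,x_n)$ be the function field of the Hermitian tower, defined by $x_{i+1}^\kappa+x_{i+1}=x_i^{\kappa+1}$ for $i=1,\dots,n-1$. If $q$ or $q-1$ is $O(1)$-smooth, then there exists a family of one-point algebraic geometry codes over $\mathbb{F}_q$ from $F_n$ of length $N=q^{(n+1)/2}\to\infty$ whose encoding can be carried out with $O(N\log N)$ operations in $\mathbb{F}_q$.
   Context: A one-point algebraic geometry code from a function field $E/\mathbb{F}_q$ is $C(\mathcal{P},\lambda P_\infty)=\{(f(P_1),\dots,f(P_N)): f\in\mathcal{L}(\lambda P_\infty)\}$, where $P_\infty,P_1,\dots,P_N$ are distinct rational places, $\mathcal{P}=\{P_1,\dots,P_N\}$, and $\mathcal{L}(\lambda P_\infty)=\{z\in E\setminus\{0\}:\mathrm{div}(z)+\lambda P_\infty\ge0\}\cup\{0\}$; encoding means computing this evaluation vector for $f$ given in an explicit $\mathbb{F}_q$-basis of $\mathcal{L}(\lambda P_\infty)$. An integer is $O(1)$-smooth if all of its prime factors are bounded by an absolute constant ("$q$ is $O(1)$-smooth" means the characteristic of $\mathbb{F}_q$ is bounded by a constant). Complexity counts arithmetic operations in $\mathbb{F}_q$. *)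

theory Defs
  imports Complex_Main "HOL-Algebra.Algebra" "HOL-Number_Theory.Prime_Powers"
begin

section \<open>Places of a function field \<open>E/K\<close>\<close>

text \<open>Throughout, \<open>E\<close> is a field (as an algebraic structure with a carrier) and \<open>K\<close> is a
  subfield of it, given as a subset of the carrier.\<close>

definition valuation_ring :: "'a set \<Rightarrow> ('a, 'b) ring_scheme \<Rightarrow> 'a set \<Rightarrow> bool" where
  "valuation_ring K E V \<longleftrightarrow>
     subring V E \<and> K \<subset> V \<and> V \<subset> carrier E \<and>
     (\<forall>z \<in> carrier E - {\<zero>\<^bsub>E\<^esub>}. z \<in> V \<or> inv\<^bsub>E\<^esub> z \<in> V)"

definition is_place_of :: "'a set \<Rightarrow> ('a, 'b) ring_scheme \<Rightarrow> 'a set \<Rightarrow> 'a set \<Rightarrow> bool" where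
  "is_place_of K E V P \<longleftrightarrow> valuation_ring K E V \<and> maximalideal P (E\<lparr>carrier := V\<rparr>)"

definition place :: "'a set \<Rightarrow> ('a, 'b) ring_scheme \<Rightarrow> 'a set \<Rightarrow> bool" where
  "place K E P \<longleftrightarrow> (\<exists>V. is_place_of K E V P)"

text \<open>A place \<open>P\<close> determines its valuation ring, namely the set of all \<open>z\<close> that are zero or
  whose inverse is not in \<open>P\<close>; so the description below is proper.\<close>

definition place_ring :: "'a set \<Rightarrow> ('a, 'b) ring_scheme \<Rightarrow> 'a set \<Rightarrow> ('a, 'b) ring_scheme" where
  "place_ring K E P = E\<lparr>carrier := (THE V. is_place_of K E V P)\<rparr>"

text \<open>\<open>v\<^sub>P(z) = m\<close> for \<open>z = t\<^sup>m u\<close>, where \<open>t\<close> is a prime element of \<open>P\<close> and \<open>u\<close> a unit of the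
  valuation ring. It is only meaningful, and only used, for \<open>z \<noteq> 0\<close>.\<close>

definition place_val :: "'a set \<Rightarrow> ('a, 'b) ring_scheme \<Rightarrow> 'a set \<Rightarrow> 'a \<Rightarrow> int" where
  "place_val K E P z =
     (THE m. \<exists>t \<in> P. \<exists>u \<in> Units (place_ring K E P).
        P = PIdl\<^bsub>place_ring K E P\<^esub> t \<and> z = t [^]\<^bsub>E\<^esub> m \<otimes>\<^bsub>E\<^esub> u)"

text \<open>Rational places are those whose residue class field has dimension one over
  (the image of) \<open>K\<close>.\<close>

definition rational_place :: "'a set \<Rightarrow> ('a, 'b) ring_scheme \<Rightarrow> 'a set \<Rightarrow> bool" where
  "rational_place K E P \<longleftrightarrow> place K E P \<and>
     ring.dimension (place_ring K E P Quot P) 1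
       ((\<lambda>a. P +>\<^bsub>place_ring K E P\<^esub> a) ` K) (carrier (place_ring K E P Quot P))"

text \<open>The value \<open>f(P)\<close>: the residue class of \<open>f\<close> modulo the rational place \<open>P\<close>, identified with
  the element of \<open>K\<close> representing it.\<close>

definition place_value :: "'a set \<Rightarrow> ('a, 'b) ring_scheme \<Rightarrow> 'a set \<Rightarrow> 'a \<Rightarrow> 'a" where
  "place_value K E P f = (THE a. a \<in> K \<and> f \<ominus>\<^bsub>E\<^esub> a \<in> P)"


section \<open>One-point algebraic geometry codes\<close>

definition one_point_RR_space ::
    "'a set \<Rightarrow> ('a, 'b) ring_scheme \<Rightarrow> 'a set \<Rightarrow> nat \<Rightarrow> 'a set" where
  "one_point_RR_space K E Pinf l =
     {z \<in> carrier E - {\<zero>\<^bsub>E\<^esub>}.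
        \<forall>P. place K E P \<longrightarrow> place_val K E P z + (if P = Pinf then int l else 0) \<ge> 0} \<union> {\<zero>\<^bsub>E\<^esub>}"

definition one_point_places ::
    "'a set \<Rightarrow> ('a, 'b) ring_scheme \<Rightarrow> 'a set \<Rightarrow> 'a set list \<Rightarrow> bool" where
  "one_point_places K E Pinf Ps \<longleftrightarrow>
     distinct (Pinf # Ps) \<and> (\<forall>P \<in> set (Pinf # Ps). rational_place K E P)"

definition ag_codeword :: "'a set \<Rightarrow> ('a, 'b) ring_scheme \<Rightarrow> 'a set list \<Rightarrow> 'a \<Rightarrow> 'a list" where
  "ag_codeword K E Ps f = map (\<lambda>P. place_value K E P f) Ps"

definition one_point_code ::
    "'a set \<Rightarrow> ('a, 'b) ring_scheme \<Rightarrow> 'a set \<Rightarrow> 'a set list \<Rightarrow> nat \<Rightarrow> 'a list set" where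
  "one_point_code K E Pinf Ps l = ag_codeword K E Ps ` one_point_RR_space K E Pinf l"

definition one_point_basis ::
    "'a set \<Rightarrow> ('a, 'b) ring_scheme \<Rightarrow> 'a set \<Rightarrow> nat \<Rightarrow> 'a list \<Rightarrow> bool" where
  "one_point_basis K E Pinf l bs \<longleftrightarrow>
     ring.independent E K bs \<and> ring.Span E K bs = one_point_RR_space K E Pinf l"

definition one_point_encoder ::
    "'a set \<Rightarrow> ('a, 'b) ring_scheme \<Rightarrow> 'a set list \<Rightarrow> 'a list \<Rightarrow> 'a list \<Rightarrow> 'a list" where
  "one_point_encoder K E Ps bs cs = ag_codeword K E Ps (ring.combine E cs bs)"

lemma one_point_encoder_image:
  assumes "field E" "subfield K E" "one_point_basis K E Pinf l bs"
  shows "one_point_encoder K E Ps bs ` {cs. set cs \<subseteq> K \<and> length cs = length bs} =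
         one_point_code K E Pinf Ps l"
proof -
  interpret field E by fact
  have "set bs \<subseteq> carrier E"
    using assms(3) independent_in_carrier unfolding one_point_basis_def by blast
  hence "Span K bs = {combine cs bs | cs. length cs = length bs \<and> set cs \<subseteq> K}"
    using Span_eq_combine_set_length_version[OF assms(2)] by blast
  moreover have "Span K bs = one_point_RR_space K E Pinf l"
    using assms(3) unfolding one_point_basis_def by blast
  ultimately have "one_point_RR_space K E Pinf l =
      (\<lambda>cs. combine cs bs) ` {cs. set cs \<subseteq> K \<and> length cs = length bs}"
    by (auto simp del: Span.simps)
  thus ?thesis
    unfolding one_point_code_def one_point_encoder_def by (simp add: image_image)
qed


section \<open>Straight-line programs over a field\<close>

text \<open>Every instruction appends one value to the memory; the operands are addressed by their
  position in the memory, which initially holds the input. Division by zero and invalid addresses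
  are errors.\<close>

datatype 'a slp_instr =
    Load 'a
  | Add nat nat
  | Sub nat nat
  | Mul nat nat
  | Div nat nat

fun slp_step :: "('a, 'b) ring_scheme \<Rightarrow> 'a slp_instr \<Rightarrow> 'a list \<Rightarrow> 'a option" where
  "slp_step R (Load c) mem = Some c"
| "slp_step R (Add i j) mem =
     (if i < length mem \<and> j < length mem then Some (mem ! i \<oplus>\<^bsub>R\<^esub> mem ! j) else None)"
| "slp_step R (Sub i j) mem =
     (if i < length mem \<and> j < length mem then Some (mem ! i \<ominus>\<^bsub>R\<^esub> mem ! j) else None)"
| "slp_step R (Mul i j) mem =
     (if i < length mem \<and> j < length mem then Some (mem ! i \<otimes>\<^bsub>R\<^esub> mem ! j) else None)"
| "slp_step R (Div i j) mem =
     (if i < length mem \<and> j < length mem \<and> mem ! j \<noteq> \<zero>\<^bsub>R\<^esub>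
      then Some (mem ! i \<otimes>\<^bsub>R\<^esub> inv\<^bsub>R\<^esub> (mem ! j)) else None)"

fun slp_run :: "('a, 'b) ring_scheme \<Rightarrow> 'a slp_instr list \<Rightarrow> 'a list \<Rightarrow> 'a list option" where
  "slp_run R [] mem = Some mem"
| "slp_run R (ins # prog) mem =
     (case slp_step R ins mem of None \<Rightarrow> None | Some v \<Rightarrow> slp_run R prog (mem @ [v]))"

text \<open>Loading a constant is not an arithmetic operation, so it is not counted.\<close>

definition slp_cost :: "'a slp_instr list \<Rightarrow> nat" where
  "slp_cost prog = length (filter (\<lambda>ins. \<forall>c. ins \<noteq> Load c) prog)"

text \<open>The program, using constants from \<open>K\<close> only, maps every input vector in \<open>K\<^sup>k\<close> to its image
  under \<open>f\<close>; \<open>outs\<close> lists the memory positions of the output entries.\<close>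

definition slp_computes ::
    "'a set \<Rightarrow> ('a, 'b) ring_scheme \<Rightarrow> 'a slp_instr list \<Rightarrow> nat list \<Rightarrow> nat \<Rightarrow>
     ('a list \<Rightarrow> 'a list) \<Rightarrow> bool" where
  "slp_computes K R prog outs k f \<longleftrightarrow>
     (\<Union>ins \<in> set prog. set_slp_instr ins) \<subseteq> K \<and>
     (\<forall>cs. set cs \<subseteq> K \<and> length cs = k \<longrightarrow>
        (\<exists>mem. slp_run R prog cs = Some mem \<and> (\<forall>i \<in> set outs. i < length mem) \<and>
               map ((!) mem) outs = f cs))"

definition encodable_within ::
    "'a set \<Rightarrow> ('a, 'b) ring_scheme \<Rightarrow> 'a set \<Rightarrow> 'a set list \<Rightarrow> nat \<Rightarrow> real \<Rightarrow> bool" where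
  "encodable_within K E Pinf Ps l T \<longleftrightarrow>
     (\<exists>bs prog outs. one_point_basis K E Pinf l bs \<and>
        slp_computes K E prog outs (length bs) (one_point_encoder K E Ps bs) \<and>
        real (slp_cost prog) \<le> T)"


section \<open>The Hermitian tower\<close>

text \<open>These conditions determine \<open>E\<close> up to isomorphism: the pole of \<open>x\<^sub>1\<close> is totally ramified, so
  every step has degree \<open>\<kappa>\<close>. Since \<open>K\<close> is finite, \<open>E\<close> is countable, and hence every such tower
  has a copy whose elements are taken from any prescribed infinite type.\<close>

definition hermitian_tower ::
    "'a set \<Rightarrow> ('a, 'b) ring_scheme \<Rightarrow> nat \<Rightarrow> nat \<Rightarrow> (nat \<Rightarrow> 'a) \<Rightarrow> bool" where
  "hermitian_tower K E \<kappa> n x \<longleftrightarrow>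
     field E \<and> subfield K E \<and> card K = \<kappa>\<^sup>2 \<and>
     x ` {1..n} \<subseteq> carrier E \<and>
     ring.transcendental E K (x 1) \<and>
     (\<forall>i \<in> {1..<n}. x (i + 1) [^]\<^bsub>E\<^esub> \<kappa> \<oplus>\<^bsub>E\<^esub> x (i + 1) = x i [^]\<^bsub>E\<^esub> (\<kappa> + 1)) \<and>
     generate_field E (K \<union> x ` {1..n}) = carrier E"

definition smooth :: "nat \<Rightarrow> nat \<Rightarrow> bool" where
  "smooth B m \<longleftrightarrow> (\<forall>p \<in> prime_factors m. p \<le> B)"

end

theory Submission
  imports Defs "HOL-Number_Theory.Cong"
begin

text \<open>
  Let \<open>R\<close> be the coordinate ring \<open>K[x\<^sub>1, \<dots>, x\<^sub>n]\<close> of the tower. Counting \<open>x\<^sub>i\<close> with weight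
  \<open>\<kappa>\<close> to the power \<open>n - i\<close> times \<open>\<kappa> + 1\<close> to the power \<open>i - 1\<close> makes the relations homogeneous up to
  lower terms, so every nonzero element of \<open>R\<close> has a well-defined leading weight, which is its
  pole order at the only place \<open>P\<^sub>\<infinity>\<close> above the pole of \<open>x\<^sub>1\<close>. Modulo \<open>D\<^sub>s = x\<^sub>1^(q^s) - x\<^sub>1\<close> some
  power of the Frobenius map is the identity on \<open>R\<close>; this makes \<open>D\<^sub>s\<close> a uniformiser at each of its
  zeros, and it follows that an element with poles only at \<open>P\<^sub>\<infinity>\<close> lies in \<open>R\<close>. Hence any elements of
  \<open>R\<close> that realise each leading weight up to \<open>l\<close> exactly once form a basis of the Riemann--Roch space.

  If \<open>q\<close> is smooth, take products of polynomials vanishing on the members of chains of additive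
  subgroups of \<open>K\<close> and of the kernel of \<open>y^\<kappa> + y\<close>, and evaluate in the order \<open>x\<^sub>1, \<dots>, x\<^sub>n\<close> by
  additive fast Fourier transforms on cosets of that kernel. If \<open>q - 1\<close> is smooth, take monomials
  with all exponents but that of \<open>x\<^sub>n\<close> at most \<open>\<kappa>\<close>, and evaluate in the order \<open>x\<^sub>n, \<dots>, x\<^sub>1\<close>: now each
  fibre is \<open>{0}\<close> or a coset of the group of roots of unity of order \<open>\<kappa> + 1\<close>, a divisor of \<open>q - 1\<close>. This
  enlarges the coefficient array only by the factor \<open>(1 + 1/\<kappa>)^(n - 1) \<le> 2\<close>, thanks to \<open>2 n \<le> \<kappa>\<close>.
\<close>

section \<open>Finite fields and Frobenius\<close>

text \<open>The degrees of the steps are not part of the hypotheses, so the independence of the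
  reduced monomials has to come from the transcendence of \<open>x1\<close> alone. The device is a
  pigeonhole argument. Almost every natural number is the weight of a monomial, so remainders modulo
  a function F with a leading term range over a finite set. Two powers x1^(q^i) and x1^(q^j)
  therefore share a remainder, and F divides their difference, which is a nonzero power of some
  \<open>D s\<close>. Hence F does not vanish at the generic point \<open>xs\<close>, and a function
  that does vanish there vanishes at every point of the tower. For this reason elements of
  \<open>R\<close> are handled as functions on all points with coordinates in E: one function serves
  the generic point and the rational points, and its value at a rational point depends only on its
  value at \<open>xs\<close>. On the computational side both transforms are instances of one scheme,
  driven by a tree of splittings of the evaluation set.\<close>

lemma (in cring) pow_add_binomial:
  assumes a: "a \<in> carrier R" and b: "b \<in> carrier R"
  shows "(a \<oplus> b) [^] (n::nat) = (\<Oplus>i\<in>{..n}. add_pow R (n choose i) (a [^] i \<otimes> b [^] (n - i)))"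
proof (induction n)
  case 0
  then show ?case using a b by simp
next
  case (Suc n)
  define f where "f i = add_pow R (n choose i) (a [^] i \<otimes> b [^] (n - i))" for i
  define g where "g i = add_pow R (n choose i) (a [^] i \<otimes> b [^] (Suc n - i))" for i
  define h where "h i = add_pow R (Suc n choose i) (a [^] i \<otimes> b [^] (Suc n - i))" for i
  have cl [simp]: "f i \<in> carrier R" "g i \<in> carrier R" "h i \<in> carrier R" for i
    using a b by (auto simp: f_def g_def h_def)
  have h0: "h 0 = g 0" by (simp add: h_def g_def)
  have hS: "h (Suc i) = f i \<otimes> a \<oplus> g (Suc i)" for i
  proof -
    have "h (Suc i) = add_pow R (n choose i) (a [^] Suc i \<otimes> b [^] (n - i)) \<oplus> g (Suc i)"
      using a b by (simp add: h_def g_def add.nat_pow_mult[symmetric])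
    also have "a [^] Suc i \<otimes> b [^] (n - i) = (a [^] i \<otimes> b [^] (n - i)) \<otimes> a"
      using a b by (simp add: m_ac)
    also have "add_pow R (n choose i) ((a [^] i \<otimes> b [^] (n - i)) \<otimes> a) = f i \<otimes> a"
      using a b by (simp add: f_def add_pow_ldistr)
    finally show ?thesis .
  qed
  have gf: "g i = f i \<otimes> b" if "i \<le> n" for i
    using a b that by (simp add: g_def f_def add_pow_ldistr Suc_diff_le m_assoc)
  have gS: "g (Suc n) = \<zero>" using a b by (simp add: g_def binomial_eq_0)
  have "finsum R h {..Suc n} = h 0 \<oplus> (\<Oplus>i\<in>{..n}. h (Suc i))"
    using finsum_Suc2[of h n] by (simp add: a_comm)
  also have "(\<Oplus>i\<in>{..n}. h (Suc i)) = (\<Oplus>i\<in>{..n}. f i \<otimes> a) \<oplus> (\<Oplus>i\<in>{..n}. g (Suc i))"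
    unfolding hS using a by (subst finsum_addf) auto
  also have "(\<Oplus>i\<in>{..n}. f i \<otimes> a) = finsum R f {..n} \<otimes> a"
    using a by (subst finsum_ldistr) auto
  also have "h 0 \<oplus> (finsum R f {..n} \<otimes> a \<oplus> (\<Oplus>i\<in>{..n}. g (Suc i)))
      = finsum R f {..n} \<otimes> a \<oplus> (g 0 \<oplus> (\<Oplus>i\<in>{..n}. g (Suc i)))"
    unfolding h0 by (rule a_lcomm) (use a in \<open>auto intro!: finsum_closed\<close>)
  also have "g 0 \<oplus> (\<Oplus>i\<in>{..n}. g (Suc i)) = finsum R g {..Suc n}"
    using finsum_Suc2[of g n] by (simp add: a_comm)
  also have "\<dots> = finsum R g {..n}"
    by (subst finsum_Suc) (auto simp: gS)
  also have "\<dots> = finsum R f {..n} \<otimes> b"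
    using b gf by (subst finsum_ldistr) (auto intro!: finsum_cong')
  also have "finsum R f {..n} \<otimes> a \<oplus> finsum R f {..n} \<otimes> b = finsum R f {..n} \<otimes> (a \<oplus> b)"
    using a b by (simp add: r_distr)
  finally have "finsum R h {..Suc n} = (a \<oplus> b) [^] n \<otimes> (a \<oplus> b)"
    unfolding Suc.IH f_def .
  then show ?case by (simp add: h_def[abs_def])
qed

lemma (in cring) freshman_dream:
  fixes p :: nat
  assumes p: "Factorial_Ring.prime p" and ch: "add_pow R (p) \<one> = \<zero>"
    and a: "a \<in> carrier R" and b: "b \<in> carrier R"
  shows "(a \<oplus> b) [^] (p ^ m) = a [^] (p ^ m) \<oplus> b [^] (p ^ m)"
proof -
  have mult0: "add_pow R (p) c = \<zero>" if "c \<in> carrier R" for c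
    using add_pow_ldistr[of \<one> c p] that ch by simp
  have step: "(u \<oplus> v) [^] p = u [^] p \<oplus> v [^] p" if u: "u \<in> carrier R" and v: "v \<in> carrier R" for u v
  proof -
    define f where "f i = add_pow R (p choose i) (u [^] i \<otimes> v [^] (p - i))" for i
    have cl: "f i \<in> carrier R" for i using u v by (auto simp: f_def)
    have z: "f i = \<zero>" if "i \<noteq> 0" "i < p" for i
    proof -
      have "p dvd (p choose i)"
        using p that by (intro dvd_choose_prime) auto
      then obtain k where k: "p choose i = p * k" by blast
      show ?thesis unfolding f_def k
        using mult0[of "add_pow R (k) (u [^] i \<otimes> v [^] (p - i))"] u v add.nat_pow_pow[of "u [^] i \<otimes> v [^] (p - i)" p k]
        by (simp add: mult.commute)
    qed
    obtain p' where p': "p = Suc p'" using p by (metis not0_implies_Suc not_prime_0)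
    have "(u \<oplus> v) [^] p = finsum R f {..Suc p'}"
      using pow_add_binomial[OF u v, of p] by (simp add: f_def[abs_def] p')
    also have "\<dots> = f (Suc p') \<oplus> finsum R f {..p'}" using cl by (subst finsum_Suc) auto
    also have "finsum R f {..p'} = finsum R (\<lambda>i. if 0 = i then f i else \<zero>) {..p'}"
      using z cl by (intro finsum_cong') (auto simp: p')
    also have "\<dots> = f 0"
      using finsum_singleton[of 0 "{..p'}" f] cl by simp
    finally show ?thesis using u v by (simp add: f_def p')
  qed
  show ?thesis
  proof (induction m)
    case 0
    then show ?case using a b by simp
  next
    case (Suc m)
    have "(a \<oplus> b) [^] (p ^ Suc m) = ((a \<oplus> b) [^] (p ^ m)) [^] p"
      using a b by (simp add: nat_pow_pow mult.commute)
    also have "\<dots> = (a [^] (p ^ m)) [^] p \<oplus> (b [^] (p ^ m)) [^] p"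
      using a b Suc step by simp
    finally show ?case using a b by (simp add: nat_pow_pow mult.commute)
  qed
qed

locale const_field = field E for E (structure) +
  fixes K and p r \<kappa> q :: nat
  assumes K: "subfield K E" and p: "Factorial_Ring.prime p" and r: "0 < r" and \<kappa>: "\<kappa> = p ^ r" and q: "q = \<kappa>\<^sup>2"
    and card_K: "card K = q"
begin

lemma p_gt_1: "1 < p" using p prime_gt_1_nat by blast
lemma kappa_ge_p: "p \<le> \<kappa>" using r p_gt_1 self_le_power[of p r] by (simp add: \<kappa>)
lemma kappa_gt_1: "1 < \<kappa>" using kappa_ge_p p_gt_1 by simp
lemma q_gt_1: "1 < q" using kappa_gt_1 one_less_power[of \<kappa> 2] by (simp add: q)
lemma q_eq: "q = p ^ (2 * r)" by (simp add: q \<kappa> power_mult[symmetric] mult.commute)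
lemma finite_K: "finite K" using card_K q_gt_1 by (metis card.infinite not_one_less_zero)
lemma K_sub: "K \<subseteq> carrier E" using subfieldE(3)[OF K] .
lemma K_carr [simp]: "a \<in> K \<Longrightarrow> a \<in> carrier E" using K_sub by blast
lemma K_subring: "subring K E" using subfieldE(1)[OF K] .
lemmas K_closed [simp] = subringE(2,3,5-7)[OF K_subring]

lemma K_minus [simp]: "a \<in> K \<Longrightarrow> b \<in> K \<Longrightarrow> a \<ominus> b \<in> K"
  by (simp add: minus_eq)

lemma K_inv [simp]: "a \<in> K \<Longrightarrow> a \<noteq> \<zero> \<Longrightarrow> inv a \<in> K"
  using subfield_m_inv(1)[OF K, of a] by simp

lemma K_pow [simp]: "a \<in> K \<Longrightarrow> a [^] (m::nat) \<in> K"
  by (induction m) auto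

lemma K_field: "field (E\<lparr>carrier := K\<rparr>)"
  using subfield_iff(2)[OF K] .

lemma K_nat_pow: "a [^]\<^bsub>E\<lparr>carrier := K\<rparr>\<^esub> (m::nat) = a [^] m"
  by (simp add: nat_pow_def)

lemma K_roots_of_unity: "0 < d \<Longrightarrow> card {u \<in> K. u [^] (d::nat) = \<one>} \<le> d"
proof -
  assume "0 < d"
  interpret F: field "E\<lparr>carrier := K\<rparr>" by (rule K_field)
  show ?thesis using F.num_roots_le_deg[of d] finite_K \<open>0 < d\<close> by (simp add: K_nat_pow)
qed

lemma K_pow_q: assumes "a \<in> K" shows "a [^] q = a"
proof (cases "a = \<zero>")
  case True
  then show ?thesis using q_gt_1 by (simp add: nat_pow_zero)
next
  case False
  interpret F: field "E\<lparr>carrier := K\<rparr>" by (rule K_field)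
  have U: "Units (E\<lparr>carrier := K\<rparr>) = K - {\<zero>}" using F.field_Units by simp
  have fin: "finite (Units (E\<lparr>carrier := K\<rparr>))" using finite_K U by simp
  have "a [^]\<^bsub>E\<lparr>carrier := K\<rparr>\<^esub> card (Units (E\<lparr>carrier := K\<rparr>)) = \<one>"
    using F.units_power_order_eq_one[OF fin, of a] assms False U by simp
  moreover have "card (Units (E\<lparr>carrier := K\<rparr>)) = q - 1"
    using U finite_K card_K by (simp add: card_Diff_singleton)
  ultimately have 1: "a [^] (q - 1) = \<one>" by (simp add: K_nat_pow)
  have "a [^] q = a [^] (q - 1) \<otimes> a"
    using q_gt_1 by (metis One_nat_def Suc_pred' less_trans nat_pow_Suc zero_less_one)
  then show ?thesis using 1 assms by simp
qed

lemma K_pow_qm: "a \<in> K \<Longrightarrow> a [^] (q ^ m) = a"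
  by (induction m) (auto simp: nat_pow_pow[symmetric] K_pow_q)

text \<open>Lagrange in the additive group of K gives only that q times 1 vanishes. But this is the
  power 2r of p times 1, and E has no zero divisors.\<close>

lemma char_p: "add_pow E (p) \<one> = \<zero>"
proof -
  interpret F: field "E\<lparr>carrier := K\<rparr>" by (rule K_field)
  have pw: "add_pow (E\<lparr>carrier := K\<rparr>) m a = add_pow E m a" for m :: nat and a
    by (simp add: add_pow_def nat_pow_def)
  have "add_pow (E\<lparr>carrier := K\<rparr>) (order (add_monoid (E\<lparr>carrier := K\<rparr>))) \<one> = \<zero>"
    using F.add.pow_order_eq_1[of \<one>] by simp
  then have 0: "add_pow E q \<one> = \<zero>" by (simp add: pw order_def card_K)
  have pm: "add_pow E (p ^ m) \<one> = (add_pow E (p) \<one>) [^] m" for m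
  proof (induction m)
    case (Suc m)
    have "add_pow E (p ^ Suc m) \<one> = add_pow E (p) (add_pow E (p ^ m) \<one>)"
      by (simp add: add.nat_pow_pow mult.commute)
    also have "\<dots> = (add_pow E (p ^ m) \<one>) \<otimes> (add_pow E (p) \<one>)"
      using add_pow_rdistr[of "add_pow E (p ^ m) \<one>" \<one> p] by simp
    finally show ?case using Suc by simp
  qed simp
  have "(add_pow E (p) \<one>) [^] (2 * r) = \<zero>" using 0 pm[of "2 * r"] by (simp add: q_eq)
  moreover have "u [^] (m::nat) \<noteq> \<zero>" if "u \<in> carrier E" "u \<noteq> \<zero>" for u m
    using that by (induction m) (auto simp: integral_iff)
  ultimately show ?thesis by (metis add.nat_pow_closed one_closed)
qed

lemma frob_add: "a \<in> carrier E \<Longrightarrow> b \<in> carrier E \<Longrightarrow>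
    (a \<oplus> b) [^] (p ^ m) = a [^] (p ^ m) \<oplus> b [^] (p ^ m)"
  using freshman_dream[OF p char_p] .

text \<open>Deduced from additivity instead of the parity of \<open>p ^ m\<close>, so that
  characteristic 2 is no special case.\<close>

lemma frob_uminus: assumes "a \<in> carrier E" shows "(\<ominus> a) [^] (p ^ m) = \<ominus> (a [^] (p ^ m))"
proof -
  have pm: "0 < p ^ m" using p_gt_1 by simp
  have "(\<ominus> a) [^] (p ^ m) \<oplus> a [^] (p ^ m) = \<zero>"
    using frob_add[of "\<ominus> a" a m] assms pm by (simp add: l_neg nat_pow_zero)
  then show ?thesis using assms by (simp add: minus_equality)
qed

lemma frob_minus: "a \<in> carrier E \<Longrightarrow> b \<in> carrier E \<Longrightarrow>
    (a \<ominus> b) [^] (p ^ m) = a [^] (p ^ m) \<ominus> b [^] (p ^ m)"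
  by (simp add: minus_eq frob_add frob_uminus)

end

section \<open>Weights and leading monomials\<close>

text \<open>Exponent lists run from x_n down to x_1. The parameters stay free because the
  multiplicative encoder reads the lists in the opposite direction, which exchanges \<open>a\<close>
  and \<open>b\<close> by \<open>wt_rev\<close>.\<close>

fun wt :: "nat \<Rightarrow> nat \<Rightarrow> nat list \<Rightarrow> nat" where
  "wt a b [] = 0"
| "wt a b (d # ds) = d * b ^ length ds + a * wt a b ds"

text \<open>The last entry is unbounded: it belongs to the variable that no relation allows to
  reduce further, x_1 in the usual reading and x_n in the reversed one.\<close>

fun digits_below :: "nat \<Rightarrow> nat list \<Rightarrow> bool" where
  "digits_below a (d # e # es) \<longleftrightarrow> d < a \<and> digits_below a (e # es)"
| "digits_below a _ \<longleftrightarrow> True"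

lemma wt_add: "length ds = length es \<Longrightarrow> wt a b (map2 (+) ds es) = wt a b ds + wt a b es"
  by (induction ds es rule: list_induct2) (auto simp: algebra_simps)

text \<open>All terms but the first are multiples of \<open>a\<close>, and \<open>b\<close> is
  invertible modulo \<open>a\<close>; so the weight modulo \<open>a\<close> determines the first
  digit.\<close>

lemma wt_inj:
  assumes "coprime a b" "length ds = length es" "digits_below a ds" "digits_below a es"
    and "wt a b ds = wt a b es"
  shows "ds = es"
  using assms(2-5)
proof (induction ds es rule: list_induct2)
  case Nil
  then show ?case by simp
next
  case (Cons d ds e es)
  show ?case
  proof (cases ds)
    case Nil
    then show ?thesis using Cons by simp
  next
    case (Cons d' ds')
    then obtain e' es' where es: "es = e' # es'" using Cons.hyps by (cases es) auto
    have lt: "d < a" "e < a" and db: "digits_below a ds" "digits_below a es"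
      using Cons.prems es Cons by auto
    have eq: "d * b ^ length es + a * wt a b ds = e * b ^ length es + a * wt a b es"
      using Cons.prems Cons.hyps by simp
    have "(d * b ^ length es + a * wt a b ds) mod a = (e * b ^ length es + a * wt a b es) mod a"
      using eq by simp
    then have "[d * b ^ length es = e * b ^ length es] (mod a)" by (simp add: cong_def)
    moreover have "coprime (b ^ length es) a" using assms(1) by (simp add: coprime_commute)
    ultimately have "[d = e] (mod a)" by (simp add: cong_mult_rcancel_nat)
    then have "d = e" using lt by (simp add: cong_def)
    moreover have "wt a b ds = wt a b es" using eq \<open>d = e\<close> lt by simp
    ultimately show ?thesis using Cons.IH db by simp
  qed
qed

text \<open>Carrying: \<open>a\<close> units of one exponent weigh as much as \<open>b\<close> units
  of the next.\<close>

lemma wt_normalize: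
  assumes "0 < a"
  shows "\<exists>es. length es = length ds \<and> digits_below a es \<and> wt a b es = wt a b ds"
proof (induction "length ds" arbitrary: ds)
  case 0
  then show ?case by (intro exI[of _ "[]"]) auto
next
  case (Suc k)
  then obtain d ds' where ds: "ds = d # ds'" and k: "length ds' = k" by (metis length_Suc_conv)
  show ?case
  proof (cases ds')
    case Nil
    then show ?thesis using ds by (intro exI[of _ ds]) auto
  next
    case (Cons e es)
    have "\<exists>es'. length es' = length ((e + d div a * b) # es) \<and> digits_below a es' \<and>
        wt a b es' = wt a b ((e + d div a * b) # es)"
      using k Cons by (intro Suc.hyps) auto
    then obtain es' where es': "length es' = Suc (length es)" "digits_below a es'"
      "wt a b es' = wt a b ((e + d div a * b) # es)" by auto
    have "digits_below a ((d mod a) # es')" using es' assms by (cases es') auto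
    moreover have "wt a b ((d mod a) # es') = wt a b ds"
    proof -
      have *: "(a * t + u) * (b * B) + a * (e * B + a * w) = u * (b * B) + a * ((e + t * b) * B + a * w)"
        for t u B w :: nat by (simp add: algebra_simps)
      have "wt a b ds = (a * (d div a) + d mod a) * (b * b ^ length es) + a * (e * b ^ length es + a * wt a b es)"
        by (simp add: ds Cons)
      then show ?thesis unfolding * using es' by simp
    qed
    ultimately show ?thesis using es' ds Cons by (intro exI[of _ "(d mod a) # es'"]) auto
  qed
qed

lemma wt_rev: "wt b a (rev ds) = wt a b ds"
proof -
  have snoc: "wt b a (ds @ [d]) = a * wt b a ds + d * b ^ length ds" for ds d
    by (induction ds) (auto simp: algebra_simps)
  show ?thesis by (induction ds) (auto simp: snoc)
qed

lemma wt_last_le: "ds \<noteq> [] \<Longrightarrow> last ds * a ^ (length ds - 1) \<le> wt a b ds"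
proof (induction ds)
  case (Cons d ds)
  show ?case
  proof (cases "ds = []")
    case False
    then have "last ds * a ^ (length ds - 1) * a \<le> wt a b ds * a" using Cons by simp
    moreover have "a ^ length ds = a ^ (length ds - 1) * a"
      using False by (metis One_nat_def Suc_pred length_greater_0_conv power_Suc2)
    ultimately show ?thesis using False by (simp add: ac_simps trans_le_add1)
  qed simp
qed simp

text \<open>Powers of \<open>Suc a\<close> are 1 modulo \<open>a\<close>, so taking s mod a as the
  first exponent leaves a multiple of \<open>a\<close> for the remaining ones. The result is used
  twice: it bounds remainders in \<open>Pol_division\<close>, and it supplies monomials of
  consecutive weights for a uniformiser at infinity.\<close>

lemma wt_cofinite:
  assumes "0 < a"
  shows "\<exists>g. \<forall>s\<ge>g. \<exists>ds. length ds = Suc n \<and> wt a (Suc a) ds = s"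
proof (induction n)
  case 0
  show ?case by (rule exI[of _ 0]) (auto intro!: exI[of _ "[_]"])
next
  case (Suc n)
  then obtain g where g: "\<And>s. s \<ge> g \<Longrightarrow> \<exists>ds. length ds = Suc n \<and> wt a (Suc a) ds = s" by blast
  show ?case
  proof (rule exI, intro allI impI)
    fix s assume s: "s \<ge> a * g + a * Suc a ^ Suc n"
    define d where "d = s mod a"
    have "d < a" using assms by (simp add: d_def)
    then have dle: "d * Suc a ^ Suc n \<le> a * Suc a ^ Suc n" by simp
    have "[s = d * Suc a ^ Suc n] (mod a)"
    proof -
      have "[Suc a ^ Suc n = 1 ^ Suc n] (mod a)"
        by (rule cong_pow) (simp add: cong_def mod_Suc)
      then have "[d * Suc a ^ Suc n = d * 1] (mod a)" by (intro cong_mult) auto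
      then show ?thesis by (simp add: d_def cong_def)
    qed
    then have "a dvd s - d * Suc a ^ Suc n"
      using cong_altdef_nat[of "d * Suc a ^ Suc n" s a] s dle by linarith
    then obtain k where k: "s - d * Suc a ^ Suc n = a * k" by blast
    then have sk: "s = d * Suc a ^ Suc n + a * k" using s dle by linarith
    have "a * g \<le> a * k" using s dle k by linarith
    then have "g \<le> k" using assms by simp
    then obtain ds where "length ds = Suc n" "wt a (Suc a) ds = k" using g by blast
    then show "\<exists>ds. length ds = Suc (Suc n) \<and> wt a (Suc a) ds = s"
      using sk by (intro exI[of _ "d # ds"]) auto
  qed
qed

section \<open>Polynomial functions on the points of the tower, filtered by weight\<close>

fun tmon :: "('a, 'b) ring_scheme \<Rightarrow> nat list \<Rightarrow> 'a list \<Rightarrow> 'a" where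
  "tmon E (d # ds) (y # ys) = y [^]\<^bsub>E\<^esub> d \<otimes>\<^bsub>E\<^esub> tmon E ds ys"
| "tmon E _ _ = \<one>\<^bsub>E\<^esub>"

fun herm :: "('a, 'b) ring_scheme \<Rightarrow> nat \<Rightarrow> 'a list \<Rightarrow> bool" where
  "herm E \<kappa> (y # z # zs) \<longleftrightarrow>
     y [^]\<^bsub>E\<^esub> \<kappa> \<oplus>\<^bsub>E\<^esub> y = z [^]\<^bsub>E\<^esub> Suc \<kappa> \<and> herm E \<kappa> (z # zs)"
| "herm E \<kappa> _ \<longleftrightarrow> True"

context const_field begin

abbreviation W where "W \<equiv> wt \<kappa> (Suc \<kappa>)"

text \<open>Coordinates range over E and not only over K, so the generic point \<open>xs\<close> is
  a member on the same footing as the rational points.\<close>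

definition Pts :: "nat \<Rightarrow> 'a list set" where
  "Pts n = {v. length v = n \<and> set v \<subseteq> carrier E \<and> herm E \<kappa> v}"

lemma Pts_Cons: "y # ys \<in> Pts (Suc n) \<Longrightarrow> y \<in> carrier E \<and> ys \<in> Pts n"
  by (cases ys) (auto simp: Pts_def)

lemma Pts_Suc: "v \<in> Pts (Suc n) \<Longrightarrow> \<exists>y ys. v = y # ys \<and> y \<in> carrier E \<and> ys \<in> Pts n"
  using Pts_Cons by (cases v) (auto simp: Pts_def)

text \<open>The coordinate ring appears as functions, considered only through their values on
  \<open>Pts n\<close>, and no normal form is stored. The bound \<open>m\<close> is strict:
  \<open>Pol n 0\<close> consists of the functions that vanish on all points, and the bound
  belonging to pole order at most l is \<open>Suc l\<close>.\<close>

inductive_set Pol :: "nat \<Rightarrow> nat \<Rightarrow> ('a list \<Rightarrow> 'a) set" for n m where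
  zero: "(\<And>v. v \<in> Pts n \<Longrightarrow> F v = \<zero>) \<Longrightarrow> F \<in> Pol n m"
| step: "\<lbrakk>c \<in> K; length ds = n; W ds < m; G \<in> Pol n m;
    \<And>v. v \<in> Pts n \<Longrightarrow> F v = c \<otimes> tmon E ds v \<oplus> G v\<rbrakk> \<Longrightarrow> F \<in> Pol n m"

lemma tmon_closed: "set v \<subseteq> carrier E \<Longrightarrow> tmon E ds v \<in> carrier E"
proof (induction ds arbitrary: v)
  case (Cons d ds)
  then show ?case by (cases v) auto
qed simp

lemma tmon_carr [simp]: "v \<in> Pts n \<Longrightarrow> tmon E ds v \<in> carrier E"
  by (auto simp: Pts_def intro!: tmon_closed)

lemma tmon_K: "set v \<subseteq> K \<Longrightarrow> tmon E ds v \<in> K"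
proof (induction ds arbitrary: v)
  case (Cons d ds)
  then show ?case by (cases v) auto
qed simp

lemma tmon_mult: "length ds = length es \<Longrightarrow> set v \<subseteq> carrier E \<Longrightarrow>
    tmon E (map2 (+) ds es) v = tmon E ds v \<otimes> tmon E es v"
proof (induction ds es arbitrary: v rule: list_induct2)
  case (Cons d ds e es)
  show ?case
  proof (cases v)
    case v: (Cons y ys)
    then have c: "y \<in> carrier E" "tmon E ds ys \<in> carrier E" "tmon E es ys \<in> carrier E"
      "y [^] d \<in> carrier E" "y [^] e \<in> carrier E"
      using Cons.prems by (auto intro: tmon_closed)
    have "tmon E (map2 (+) ds es) ys = tmon E ds ys \<otimes> tmon E es ys"
      using Cons.IH[of ys] Cons.prems v by simp
    then show ?thesis using v c by (simp add: nat_pow_mult[symmetric] m_ac)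
  qed simp
qed simp

lemma Pol_closed: "F \<in> Pol n m \<Longrightarrow> v \<in> Pts n \<Longrightarrow> F v \<in> carrier E"
  by (induction rule: Pol.induct) auto

lemma Pol_K: "F \<in> Pol n m \<Longrightarrow> v \<in> Pts n \<Longrightarrow> set v \<subseteq> K \<Longrightarrow> F v \<in> K"
  by (induction rule: Pol.induct) (auto simp: tmon_K)

lemma Pol_le: "F \<in> Pol n m \<Longrightarrow> m \<le> m' \<Longrightarrow> F \<in> Pol n m'"
  by (induction rule: Pol.induct) (auto intro: Pol.zero Pol.step)

lemma Pol_cong:
  assumes "F \<in> Pol n m" "\<And>v. v \<in> Pts n \<Longrightarrow> G v = F v"
  shows "G \<in> Pol n m"
  using assms(1)
proof cases
  case zero
  then show ?thesis using assms(2) by (intro Pol.zero) auto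
next
  case (step c ds H)
  show ?thesis by (rule Pol.step[OF step(1-4)]) (simp add: assms(2) step(5))
qed

lemma Pol_add: "F \<in> Pol n m \<Longrightarrow> G \<in> Pol n m \<Longrightarrow> (\<lambda>v. F v \<oplus> G v) \<in> Pol n m"
proof (induction rule: Pol.induct)
  case (zero F)
  then show ?case by (intro Pol_cong[OF zero(2)]) (simp add: Pol_closed)
next
  case (step c ds H F)
  show ?case
    by (rule Pol.step[OF step(1-3) step.IH[OF step.prems]])
      (use step in \<open>simp add: a_assoc Pol_closed\<close>)
qed

lemma Pol_smult: "F \<in> Pol n m \<Longrightarrow> c \<in> K \<Longrightarrow> (\<lambda>v. c \<otimes> F v) \<in> Pol n m"
proof (induction rule: Pol.induct)
  case (zero F)
  then show ?case by (intro Pol.zero) simp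
next
  case (step d ds H F)
  show ?case
    by (rule Pol.step[OF _ step(2,3) step.IH[OF step.prems], of "c \<otimes> d"])
      (use step in \<open>simp_all add: r_distr m_assoc Pol_closed\<close>)
qed

lemma Pol_uminus: "F \<in> Pol n m \<Longrightarrow> (\<lambda>v. \<ominus> F v) \<in> Pol n m"
  by (rule Pol_cong[OF Pol_smult[of F n m "\<ominus> \<one>"]]) (auto simp: Pol_closed l_minus)

lemma Pol_minus: "F \<in> Pol n m \<Longrightarrow> G \<in> Pol n m \<Longrightarrow> (\<lambda>v. F v \<ominus> G v) \<in> Pol n m"
  unfolding minus_eq by (intro Pol_add Pol_uminus)

lemma Pol_zero [simp]: "(\<lambda>v. \<zero>) \<in> Pol n m"
  by (rule Pol.zero) simp

lemma Pol_monom: "c \<in> K \<Longrightarrow> length ds = n \<Longrightarrow> W ds < m \<Longrightarrow> (\<lambda>v. c \<otimes> tmon E ds v) \<in> Pol n m"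
  by (rule Pol.step[OF _ _ _ Pol_zero]) auto

lemma Pol_mono: "length ds = n \<Longrightarrow> W ds < m \<Longrightarrow> tmon E ds \<in> Pol n m"
  by (rule Pol.step[OF _ _ _ Pol_zero, of \<one>]) auto

lemma Pol_mono_mult: "F \<in> Pol n m \<Longrightarrow> length ds = n \<Longrightarrow> (\<lambda>v. tmon E ds v \<otimes> F v) \<in> Pol n (W ds + m)"
proof (induction rule: Pol.induct)
  case (zero F)
  then show ?case by (intro Pol.zero) simp
next
  case (step c es H F)
  show ?case
  proof (rule Pol.step[OF step(1) _ _ step.IH[OF step.prems]])
    show "length (map2 (+) ds es) = n" "W (map2 (+) ds es) < W ds + m"
      using step by (auto simp: wt_add)
    fix v assume v: "v \<in> Pts n"
    have c: "c \<in> carrier E" "tmon E ds v \<in> carrier E" "tmon E es v \<in> carrier E" "H v \<in> carrier E"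
      using step v by (auto simp: Pol_closed)
    have "tmon E (map2 (+) ds es) v = tmon E ds v \<otimes> tmon E es v"
      using step v by (intro tmon_mult) (auto simp: Pts_def)
    then show "tmon E ds v \<otimes> F v = c \<otimes> tmon E (map2 (+) ds es) v \<oplus> tmon E ds v \<otimes> H v"
      using step v c by (simp add: r_distr m_ac)
  qed
qed

text \<open>Both bounds being strict, one unit is to spare: weights at most m plus weights below m'
  stay below m + m'.\<close>

lemma Pol_mult: "F \<in> Pol n (Suc m) \<Longrightarrow> G \<in> Pol n m' \<Longrightarrow> (\<lambda>v. F v \<otimes> G v) \<in> Pol n (m + m')"
proof (induction rule: Pol.induct)
  case (zero F)
  then show ?case by (intro Pol.zero) (simp add: Pol_closed)
next
  case (step c ds H F)
  have "(\<lambda>v. c \<otimes> (tmon E ds v \<otimes> G v)) \<in> Pol n (m + m')"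
    using step by (intro Pol_smult Pol_le[OF Pol_mono_mult]) auto
  from Pol_add[OF this step.IH[OF step.prems]]
  show ?case
    by (rule Pol_cong) (use step in \<open>simp add: l_distr m_assoc Pol_closed\<close>)
qed

lemma Pol_lift:
  "F \<in> Pol n m \<Longrightarrow> (\<lambda>v. hd v [^] d \<otimes> F (tl v)) \<in> Pol (Suc n) (d * Suc \<kappa> ^ n + \<kappa> * m)"
proof (induction rule: Pol.induct)
  case (zero F)
  show ?case
    by (rule Pol.zero) (use zero in \<open>auto dest!: Pts_Suc\<close>)
next
  case (step c ds H F)
  show ?case
  proof (rule Pol.step[OF step(1) _ _ step.IH])
    show "length (d # ds) = Suc n" "W (d # ds) < d * Suc \<kappa> ^ n + \<kappa> * m"
      using step kappa_gt_1 by auto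
    fix v assume "v \<in> Pts (Suc n)"
    then obtain y ys where v: "v = y # ys" "y \<in> carrier E" "ys \<in> Pts n" using Pts_Suc by blast
    have "c \<in> carrier E" "tmon E ds ys \<in> carrier E" "H ys \<in> carrier E" "y [^] d \<in> carrier E"
      using step v by (auto simp: Pol_closed)
    then show "hd v [^] d \<otimes> F (tl v) = c \<otimes> tmon E (d # ds) v \<oplus> hd v [^] d \<otimes> H (tl v)"
      using step v by (simp add: r_distr m_ac)
  qed
qed

text \<open>The relation replaces y^\<kappa> by z^(\<kappa>+1), which has the same weight, minus y,
  which has a smaller one. Reduction to a normal form thus alters a monomial only by terms of lower
  weight; the inner induction is on the exponent of the first variable.\<close>

lemma tmon_reduce:
  "length ds = n \<Longrightarrow> \<exists>es. length es = n \<and> digits_below \<kappa> es \<and> W es = W ds \<and>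
     (\<lambda>v. tmon E ds v \<ominus> tmon E es v) \<in> Pol n (W ds)"
proof (induction n arbitrary: ds)
  case 0
  then show ?case by (intro exI[of _ "[]"]) (auto intro!: Pol.zero simp: minus_eq r_neg)
next
  case (Suc n)
  show ?case
  proof (cases n)
    case 0
    then show ?thesis using Suc.prems by (intro exI[of _ ds]) (cases ds; auto intro!: Pol.zero simp: minus_eq r_neg)
  next
    case (Suc n')
    obtain d e es where ds: "ds = d # e # es" and len: "length es = n'"
      using Suc.prems Suc by (metis length_Suc_conv)
    have "\<exists>fs. length fs = Suc n \<and> digits_below \<kappa> fs \<and> W fs = W (d # e # es) \<and>
      (\<lambda>v. tmon E (d # e # es) v \<ominus> tmon E fs v) \<in> Pol (Suc n) (W (d # e # es))" for d e
    proof (induction d arbitrary: e rule: less_induct)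
      case (less d)
      let ?ds = "d # e # es"
      show ?case
      proof (cases "d < \<kappa>")
        case True
        obtain fs where fs: "length fs = n" "digits_below \<kappa> fs" "W fs = W (e # es)"
          "(\<lambda>v. tmon E (e # es) v \<ominus> tmon E fs v) \<in> Pol n (W (e # es))"
          using Suc.IH[of "e # es"] len Suc by auto
        have "(\<lambda>v. hd v [^] d \<otimes> (tmon E (e # es) (tl v) \<ominus> tmon E fs (tl v))) \<in> Pol (Suc n) (W ?ds)"
          by (rule Pol_le[OF Pol_lift[OF fs(4)]]) (simp add: len Suc)
        then have "(\<lambda>v. tmon E ?ds v \<ominus> tmon E (d # fs) v) \<in> Pol (Suc n) (W ?ds)"
        proof (rule Pol_cong)
          fix v assume "v \<in> Pts (Suc n)"
          then obtain y ys where v: "v = y # ys" "y \<in> carrier E" "ys \<in> Pts n" using Pts_Suc by blast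
          have cl: "y [^] d \<in> carrier E" "tmon E (e # es) ys \<in> carrier E" "tmon E fs ys \<in> carrier E"
            using v tmon_carr by blast+
          have "tmon E ?ds v = y [^] d \<otimes> tmon E (e # es) ys" "tmon E (d # fs) v = y [^] d \<otimes> tmon E fs ys"
            unfolding v by (rule tmon.simps)+
          then show "tmon E ?ds v \<ominus> tmon E (d # fs) v = hd v [^] d \<otimes> (tmon E (e # es) (tl v) \<ominus> tmon E fs (tl v))"
            unfolding v(1) list.sel using cl by algebra
        qed
        moreover have "digits_below \<kappa> (d # fs)" using fs True by (cases fs) auto
        ultimately show ?thesis using fs len Suc by (intro exI[of _ "d # fs"]) auto
      next
        case False
        let ?ds1 = "(d - \<kappa>) # (e + Suc \<kappa>) # es" and ?ds2 = "(d - \<kappa> + 1) # e # es"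
        have w1: "W ?ds1 = W ?ds"
        proof -
          obtain k where k: "d = \<kappa> + k" using False by (metis le_iff_add not_less)
          show ?thesis by (simp add: k algebra_simps)
        qed
        have w2: "W ?ds2 < W ?ds"
        proof -
          have "d - \<kappa> + 1 < d" using False kappa_gt_1 by linarith
          then have "(d - \<kappa> + 1) * Suc \<kappa> ^ length (e # es) < d * Suc \<kappa> ^ length (e # es)"
            by (intro mult_strict_right_mono) auto
          then show ?thesis by (simp only: wt.simps add_less_cancel_right)
        qed
        have eq: "tmon E ?ds v = tmon E ?ds1 v \<ominus> tmon E ?ds2 v" if v: "v \<in> Pts (Suc n)" for v
        proof -
          obtain y z zs where eqv: "v = y # z # zs" using v Suc by (auto simp: Pts_def length_Suc_conv)
          have c: "y \<in> carrier E" "z \<in> carrier E" "tmon E es zs \<in> carrier E"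
            and h: "y [^] \<kappa> \<oplus> y = z [^] Suc \<kappa>"
            using v eqv by (auto simp: Pts_def intro!: tmon_closed)
          have yk: "y [^] \<kappa> = z [^] Suc \<kappa> \<ominus> y"
            using h c by (metis add.inv_closed a_assoc minus_eq nat_pow_closed r_neg r_zero)
          have "y [^] d = y [^] (d - \<kappa>) \<otimes> y [^] \<kappa>" using c False by (simp add: nat_pow_mult)
          then have 1: "tmon E ?ds v = (y [^] (d - \<kappa>) \<otimes> (z [^] Suc \<kappa> \<ominus> y)) \<otimes> (z [^] e \<otimes> tmon E es zs)"
            by (simp add: eqv yk)
          have 2: "tmon E ?ds1 v = y [^] (d - \<kappa>) \<otimes> ((z [^] e \<otimes> z [^] Suc \<kappa>) \<otimes> tmon E es zs)"
            using c nat_pow_mult[of z e "Suc \<kappa>"] by (simp add: eqv del: nat_pow_Suc)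
          have 3: "tmon E ?ds2 v = (y [^] (d - \<kappa>) \<otimes> y) \<otimes> (z [^] e \<otimes> tmon E es zs)"
            using c by (simp add: eqv)
          have c': "y [^] (d - \<kappa>) \<in> carrier E" "z [^] Suc \<kappa> \<in> carrier E" "z [^] e \<in> carrier E"
            using c by auto
          show ?thesis unfolding 1 2 3 using c(1,3) c' by algebra
        qed
        obtain fs where fs: "length fs = Suc n" "digits_below \<kappa> fs" "W fs = W ?ds1"
          "(\<lambda>v. tmon E ?ds1 v \<ominus> tmon E fs v) \<in> Pol (Suc n) (W ?ds1)"
          using less.IH[of "d - \<kappa>" "e + Suc \<kappa>"] False kappa_gt_1 by auto
        have "(\<lambda>v. (tmon E ?ds1 v \<ominus> tmon E fs v) \<ominus> tmon E ?ds2 v) \<in> Pol (Suc n) (W ?ds)"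
          using Pol_minus[OF fs(4)[unfolded w1] Pol_mono[OF _ w2]] len Suc by simp
        then have "(\<lambda>v. tmon E ?ds v \<ominus> tmon E fs v) \<in> Pol (Suc n) (W ?ds)"
        proof (rule Pol_cong)
          fix v assume v: "v \<in> Pts (Suc n)"
          have "tmon E ?ds1 v \<in> carrier E" "tmon E ?ds2 v \<in> carrier E" "tmon E fs v \<in> carrier E"
            using v by (auto simp del: tmon.simps)
          then show "tmon E ?ds v \<ominus> tmon E fs v = (tmon E ?ds1 v \<ominus> tmon E fs v) \<ominus> tmon E ?ds2 v"
            unfolding eq[OF v] by algebra
        qed
        then show ?thesis using fs w1 by metis
      qed
    qed
    then show ?thesis unfolding ds by blast
  qed
qed

text \<open>Both monomials reduce to the normal form of their weight, which is unique by
  \<open>wt_inj\<close>.\<close>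

lemma tmon_same_weight:
  assumes "length ds = n" "length es = n" "W ds = W es"
  shows "(\<lambda>v. tmon E ds v \<ominus> tmon E es v) \<in> Pol n (W ds)"
proof -
  obtain ds' where d: "length ds' = n" "digits_below \<kappa> ds'" "W ds' = W ds"
     "(\<lambda>v. tmon E ds v \<ominus> tmon E ds' v) \<in> Pol n (W ds)" using tmon_reduce assms by blast
  obtain es' where e: "length es' = n" "digits_below \<kappa> es'" "W es' = W es"
     "(\<lambda>v. tmon E es v \<ominus> tmon E es' v) \<in> Pol n (W es)" using tmon_reduce assms by blast
  have "ds' = es'" using d e assms by (intro wt_inj[of \<kappa> "Suc \<kappa>"]) auto
  then have "(\<lambda>v. (tmon E ds v \<ominus> tmon E ds' v) \<ominus> (tmon E es v \<ominus> tmon E ds' v)) \<in> Pol n (W ds)"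
    using d e assms Pol_minus[OF d(4), of "\<lambda>v. tmon E es v \<ominus> tmon E ds' v"] by simp
  then show ?thesis
  proof (rule Pol_cong)
    fix v assume v: "v \<in> Pts n"
    have "tmon E ds v \<in> carrier E" "tmon E es v \<in> carrier E" "tmon E ds' v \<in> carrier E" using v by auto
    then show "tmon E ds v \<ominus> tmon E es v = tmon E ds v \<ominus> tmon E ds' v \<ominus> (tmon E es v \<ominus> tmon E ds' v)"
      by algebra
  qed
qed

text \<open>Some monomial of weight \<open>s\<close> is asked for; by \<open>lead_any\<close> each
  of them will do. That a function has at most one leading weight, and that zero has none, cannot be
  said yet: this comes with \<open>lead_nonzero\<close> and
  \<open>lead_weight_unique\<close>.\<close>

definition lead :: "nat \<Rightarrow> ('a list \<Rightarrow> 'a) \<Rightarrow> nat \<Rightarrow> 'a \<Rightarrow> bool" where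
  "lead n F s c \<longleftrightarrow> c \<in> K \<and> c \<noteq> \<zero> \<and>
     (\<exists>ds. length ds = n \<and> W ds = s \<and> (\<lambda>v. F v \<ominus> c \<otimes> tmon E ds v) \<in> Pol n s \<and>
        (\<forall>v\<in>Pts n. F v \<in> carrier E))"

lemma lead_any:
  assumes "lead n F s c" "length es = n" "W es = s"
  shows "(\<lambda>v. F v \<ominus> c \<otimes> tmon E es v) \<in> Pol n s"
proof -
  obtain ds where ds: "length ds = n" "W ds = s" "(\<lambda>v. F v \<ominus> c \<otimes> tmon E ds v) \<in> Pol n s"
    and F: "\<forall>v\<in>Pts n. F v \<in> carrier E" and c: "c \<in> K"
    using assms(1) unfolding lead_def by blast
  have "(\<lambda>v. c \<otimes> (tmon E ds v \<ominus> tmon E es v)) \<in> Pol n s"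
    using tmon_same_weight[of ds n es] ds assms c by (intro Pol_smult) auto
  from Pol_add[OF ds(3) this] show ?thesis
  proof (rule Pol_cong)
    fix v assume v: "v \<in> Pts n"
    have "tmon E ds v \<in> carrier E" "tmon E es v \<in> carrier E" "F v \<in> carrier E" "c \<in> carrier E"
      using v F c by auto
    then show "F v \<ominus> c \<otimes> tmon E es v = (F v \<ominus> c \<otimes> tmon E ds v) \<oplus> c \<otimes> (tmon E ds v \<ominus> tmon E es v)"
      by algebra
  qed
qed

lemma lead_Pol: assumes "lead n F s c" shows "F \<in> Pol n (Suc s)"
proof -
  obtain ds where ds: "length ds = n" "W ds = s" "(\<lambda>v. F v \<ominus> c \<otimes> tmon E ds v) \<in> Pol n s"
    and F: "\<forall>v\<in>Pts n. F v \<in> carrier E" and c: "c \<in> K"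
    using assms unfolding lead_def by blast
  have "(\<lambda>v. (F v \<ominus> c \<otimes> tmon E ds v) \<oplus> c \<otimes> tmon E ds v) \<in> Pol n (Suc s)"
    using ds c by (intro Pol_add Pol_monom Pol_le[OF ds(3)]) auto
  then show ?thesis
  proof (rule Pol_cong)
    fix v assume v: "v \<in> Pts n"
    have "tmon E ds v \<in> carrier E" "F v \<in> carrier E" "c \<in> carrier E" using v F c by auto
    then show "F v = (F v \<ominus> c \<otimes> tmon E ds v) \<oplus> c \<otimes> tmon E ds v" by algebra
  qed
qed

lemma lead_cong:
  assumes "lead n F s c" "\<And>v. v \<in> Pts n \<Longrightarrow> G v = F v"
  shows "lead n G s c"
proof -
  obtain ds where ds: "length ds = n" "W ds = s" "(\<lambda>v. F v \<ominus> c \<otimes> tmon E ds v) \<in> Pol n s"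
    and F: "\<forall>v\<in>Pts n. F v \<in> carrier E" and c: "c \<in> K" "c \<noteq> \<zero>"
    using assms unfolding lead_def by blast
  have "(\<lambda>v. G v \<ominus> c \<otimes> tmon E ds v) \<in> Pol n s"
    by (rule Pol_cong[OF ds(3)]) (simp add: assms(2))
  then show ?thesis unfolding lead_def using ds F c assms(2) by auto
qed

lemma lead_tmon:
  assumes "length ds = n"
  shows "lead n (tmon E ds) (W ds) \<one>"
proof -
  have "(\<lambda>v. tmon E ds v \<ominus> \<one> \<otimes> tmon E ds v) \<in> Pol n (W ds)"
    by (rule Pol.zero) (simp add: minus_eq r_neg)
  then show ?thesis unfolding lead_def using assms by auto
qed

lemma lead_smult:
  assumes "lead n F s c" "d \<in> K" "d \<noteq> \<zero>"
  shows "lead n (\<lambda>v. d \<otimes> F v) s (d \<otimes> c)"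
proof -
  obtain ds where ds: "length ds = n" "W ds = s" "(\<lambda>v. F v \<ominus> c \<otimes> tmon E ds v) \<in> Pol n s"
    and F: "\<forall>v\<in>Pts n. F v \<in> carrier E" and c: "c \<in> K" "c \<noteq> \<zero>"
    using assms unfolding lead_def by blast
  have "(\<lambda>v. d \<otimes> F v \<ominus> (d \<otimes> c) \<otimes> tmon E ds v) \<in> Pol n s"
  proof (rule Pol_cong[OF Pol_smult[OF ds(3) assms(2)]])
    fix v assume v: "v \<in> Pts n"
    have "tmon E ds v \<in> carrier E" "F v \<in> carrier E" "c \<in> carrier E" "d \<in> carrier E"
      using v F c assms by auto
    then show "d \<otimes> F v \<ominus> (d \<otimes> c) \<otimes> tmon E ds v = d \<otimes> (F v \<ominus> c \<otimes> tmon E ds v)" by algebra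
  qed
  then show ?thesis unfolding lead_def using ds F c assms by (auto simp: integral_iff)
qed

lemma lead_add_lower:
  assumes "lead n F s c" "G \<in> Pol n s"
  shows "lead n (\<lambda>v. F v \<oplus> G v) s c"
proof -
  obtain ds where ds: "length ds = n" "W ds = s" "(\<lambda>v. F v \<ominus> c \<otimes> tmon E ds v) \<in> Pol n s"
    and F: "\<forall>v\<in>Pts n. F v \<in> carrier E" and c: "c \<in> K" "c \<noteq> \<zero>"
    using assms unfolding lead_def by blast
  have "(\<lambda>v. (F v \<oplus> G v) \<ominus> c \<otimes> tmon E ds v) \<in> Pol n s"
  proof (rule Pol_cong[OF Pol_add[OF ds(3) assms(2)]])
    fix v assume v: "v \<in> Pts n"
    have "tmon E ds v \<in> carrier E" "F v \<in> carrier E" "c \<in> carrier E" "G v \<in> carrier E"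
      using v F c assms by (auto simp: Pol_closed)
    then show "(F v \<oplus> G v) \<ominus> c \<otimes> tmon E ds v = (F v \<ominus> c \<otimes> tmon E ds v) \<oplus> G v" by algebra
  qed
  then show ?thesis unfolding lead_def using ds F c Pol_closed[OF assms(2)] by auto
qed

lemma lead_mult:
  assumes "lead n F s c" "lead n G t d"
  shows "lead n (\<lambda>v. F v \<otimes> G v) (s + t) (c \<otimes> d)"
proof -
  obtain ds where ds: "length ds = n" "W ds = s" "(\<lambda>v. F v \<ominus> c \<otimes> tmon E ds v) \<in> Pol n s"
    and F: "\<forall>v\<in>Pts n. F v \<in> carrier E" and c: "c \<in> K" "c \<noteq> \<zero>"
    using assms unfolding lead_def by blast
  obtain es where es: "length es = n" "W es = t" "(\<lambda>v. G v \<ominus> d \<otimes> tmon E es v) \<in> Pol n t"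
    and G: "\<forall>v\<in>Pts n. G v \<in> carrier E" and d: "d \<in> K" "d \<noteq> \<zero>"
    using assms unfolding lead_def by blast
  have A: "(\<lambda>v. G v \<otimes> (F v \<ominus> c \<otimes> tmon E ds v)) \<in> Pol n (s + t)"
    using Pol_mult[OF lead_Pol[OF assms(2)] ds(3)] by (simp add: add.commute)
  have B: "(\<lambda>v. c \<otimes> (tmon E ds v \<otimes> (G v \<ominus> d \<otimes> tmon E es v))) \<in> Pol n (s + t)"
    using Pol_smult[OF Pol_mono_mult[OF es(3) ds(1)] c(1)] ds by simp
  have "(\<lambda>v. F v \<otimes> G v \<ominus> (c \<otimes> d) \<otimes> tmon E (map2 (+) ds es) v) \<in> Pol n (s + t)"
  proof (rule Pol_cong[OF Pol_add[OF A B]])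
    fix v assume v: "v \<in> Pts n"
    have cl: "tmon E ds v \<in> carrier E" "tmon E es v \<in> carrier E" "F v \<in> carrier E" "G v \<in> carrier E"
      "c \<in> carrier E" "d \<in> carrier E"
      using v F G c d by auto
    have "tmon E (map2 (+) ds es) v = tmon E ds v \<otimes> tmon E es v"
      using ds es v by (intro tmon_mult) (auto simp: Pts_def)
    then show "F v \<otimes> G v \<ominus> (c \<otimes> d) \<otimes> tmon E (map2 (+) ds es) v
      = G v \<otimes> (F v \<ominus> c \<otimes> tmon E ds v) \<oplus> c \<otimes> (tmon E ds v \<otimes> (G v \<ominus> d \<otimes> tmon E es v))"
      using cl by algebra
  qed
  moreover have "length (map2 (+) ds es) = n" "W (map2 (+) ds es) = s + t"
    using ds es by (auto simp: wt_add)
  ultimately show ?thesis unfolding lead_def using F G c d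
    by (intro conjI exI[of _ "map2 (+) ds es"]) (auto simp: integral_iff)
qed

text \<open>All terms of weight \<open>m\<close> can be moved onto one monomial by
  \<open>lead_any\<close>. Their coefficients then add up, and the alternative records whether the
  sum is zero.\<close>

lemma Pol_top:
  "F \<in> Pol n (Suc m) \<Longrightarrow> F \<in> Pol n m \<or> (\<exists>c. lead n F m c)"
proof (induction rule: Pol.induct)
  case (zero F)
  then show ?case by (auto intro: Pol.zero)
next
  case (step c ds G F)
  have Fc: "v \<in> Pts n \<Longrightarrow> F v \<in> carrier E" for v using step by (simp add: Pol_closed)
  consider "W ds < m" | "W ds = m" using step by linarith
  then show ?case
  proof cases
    case 1
    have mon: "(\<lambda>v. c \<otimes> tmon E ds v) \<in> Pol n m" using step 1 by (intro Pol_monom)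
    from step.IH show ?thesis
    proof
      assume "G \<in> Pol n m"
      from Pol_add[OF mon this] have "F \<in> Pol n m" by (rule Pol_cong) (use step in auto)
      then show ?thesis ..
    next
      assume "\<exists>c. lead n G m c"
      then obtain d where "lead n G m d" by blast
      from lead_add_lower[OF this mon] have "lead n F m d"
        by (rule lead_cong) (use step in \<open>auto simp: a_comm Pol_closed\<close>)
      then show ?thesis by blast
    qed
  next
    case 2
    have mon: "lead n (\<lambda>v. c \<otimes> tmon E ds v) m c" if "c \<noteq> \<zero>"
      using lead_smult[OF lead_tmon[OF step(2)] step(1) that] 2 step by simp
    from step.IH show ?thesis
    proof
      assume G: "G \<in> Pol n m"
      show ?thesis
      proof (cases "c = \<zero>")
        case True
        have "F \<in> Pol n m" by (rule Pol_cong[OF G]) (use step True in \<open>simp add: Pol_closed\<close>)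
        then show ?thesis ..
      next
        case False
        have "lead n F m c"
          by (rule lead_cong[OF lead_add_lower[OF mon[OF False] G]]) (use step in auto)
        then show ?thesis by blast
      qed
    next
      assume "\<exists>c. lead n G m c"
      then obtain d where L: "lead n G m d" by blast
      have d: "d \<in> K" using L by (simp add: lead_def)
      have low: "(\<lambda>v. G v \<ominus> d \<otimes> tmon E ds v) \<in> Pol n m" using lead_any[OF L step(2)] 2 by simp
      have eq: "F v = (c \<oplus> d) \<otimes> tmon E ds v \<oplus> (G v \<ominus> d \<otimes> tmon E ds v)" if v: "v \<in> Pts n" for v
      proof -
        have "c \<in> carrier E" "d \<in> carrier E" "tmon E ds v \<in> carrier E" "G v \<in> carrier E"
          using step v d by (auto simp: Pol_closed)
        then show ?thesis unfolding step(5)[OF v] by algebra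
      qed
      show ?thesis
      proof (cases "c \<oplus> d = \<zero>")
        case True
        have "F \<in> Pol n m" by (rule Pol_cong[OF low]) (use True eq Pol_closed[OF low] in simp)
        then show ?thesis ..
      next
        case False
        have "lead n (\<lambda>v. (c \<oplus> d) \<otimes> tmon E ds v) m (c \<oplus> d)"
          using lead_smult[OF lead_tmon[OF step(2)] _ False] 2 step d by simp
        from lead_add_lower[OF this low] have "lead n F m (c \<oplus> d)"
          by (rule lead_cong) (use eq in auto)
        then show ?thesis by blast
      qed
    qed
  qed
qed

lemma Pol_0: "F \<in> Pol n 0 \<Longrightarrow> v \<in> Pts n \<Longrightarrow> F v = \<zero>"
  by (erule Pol.cases) auto

lemma Pol_cases:
  "F \<in> Pol n m \<Longrightarrow> (\<forall>v\<in>Pts n. F v = \<zero>) \<or> (\<exists>s<m. \<exists>c. lead n F s c)"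
proof (induction m)
  case 0
  then show ?case using Pol_0 by blast
next
  case (Suc m)
  then show ?case using Pol_top[OF Suc.prems] less_SucI by blast
qed

end

section \<open>The coordinate ring of the Hermitian tower\<close>

context const_field begin

lemma inv_nz:
  assumes "a \<in> carrier E" "a \<noteq> \<zero>"
  shows "inv a \<in> carrier E" "a \<otimes> inv a = \<one>" "inv a \<otimes> a = \<one>" "inv a \<noteq> \<zero>"
proof -
  have u: "a \<in> Units E" using assms field_Units by simp
  then show 1: "inv a \<in> carrier E" "a \<otimes> inv a = \<one>" "inv a \<otimes> a = \<one>" by auto
  show "inv a \<noteq> \<zero>" using 1(2) assms by auto
qed

lemma lead_diff:
  assumes "lead n F s c" "lead n G s c"
  shows "(\<lambda>v. F v \<ominus> G v) \<in> Pol n s"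
proof -
  obtain ds where ds: "length ds = n" "W ds = s" "(\<lambda>v. F v \<ominus> c \<otimes> tmon E ds v) \<in> Pol n s"
    and F: "\<forall>v\<in>Pts n. F v \<in> carrier E" and c: "c \<in> K"
    using assms unfolding lead_def by blast
  have G: "\<forall>v\<in>Pts n. G v \<in> carrier E" using assms unfolding lead_def by blast
  show ?thesis
  proof (rule Pol_cong[OF Pol_minus[OF ds(3) lead_any[OF assms(2) ds(1,2)]]])
    fix v assume v: "v \<in> Pts n"
    have "tmon E ds v \<in> carrier E" "F v \<in> carrier E" "G v \<in> carrier E" "c \<in> carrier E"
      using v F G c by auto
    then show "F v \<ominus> G v = (F v \<ominus> c \<otimes> tmon E ds v) \<ominus> (G v \<ominus> c \<otimes> tmon E ds v)" by algebra
  qed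
qed

text \<open>Division by leading terms. A leading weight can be cancelled as soon as it exceeds that
  of \<open>F\<close> by the weight of some monomial, hence always from a fixed bound on. What
  matters is that \<open>B\<close> does not depend on \<open>G\<close>.\<close>

lemma Pol_division:
  assumes F: "lead n F s c" and n: "0 < n"
  shows "\<exists>B. \<forall>m. \<forall>G\<in>Pol n m. \<exists>H m' G'. H \<in> Pol n m' \<and> G' \<in> Pol n B \<and>
      (\<forall>v\<in>Pts n. G v = H v \<otimes> F v \<oplus> G' v)"
proof -
  obtain g where g: "\<And>s. s \<ge> g \<Longrightarrow> \<exists>ds. length ds = n \<and> W ds = s"
    using wt_cofinite[of \<kappa> "n - 1"] kappa_gt_1 n by auto
  have c: "c \<in> K" "c \<noteq> \<zero>" and Fc: "\<And>v. v \<in> Pts n \<Longrightarrow> F v \<in> carrier E"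
    using F unfolding lead_def by auto
  have "\<exists>H m' G'. H \<in> Pol n m' \<and> G' \<in> Pol n (g + s) \<and>
      (\<forall>v\<in>Pts n. G v = H v \<otimes> F v \<oplus> G' v)" if "G \<in> Pol n m" for G m
    using that
  proof (induction m arbitrary: G)
    case 0
    then show ?case
      by (intro exI[of _ "\<lambda>_. \<zero>"] exI[of _ 0] exI[of _ G] conjI)
        (auto simp: Fc Pol_closed intro: Pol_le)
  next
    case (Suc m)
    show ?case
    proof (cases "g + s \<ge> Suc m")
      case True
      then show ?thesis
        using Suc.prems by (intro exI[of _ "\<lambda>_. \<zero>"] exI[of _ 0] exI[of _ G] conjI)
          (auto simp: Fc Pol_closed intro: Pol_le)
    next
      case False
      from Pol_top[OF Suc.prems] show ?thesis
      proof
        assume "G \<in> Pol n m"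
        then show ?thesis by (rule Suc.IH)
      next
        assume "\<exists>d. lead n G m d"
        then obtain d where d: "lead n G m d" by blast
        then have dK: "d \<in> K" "d \<noteq> \<zero>" unfolding lead_def by auto
        \<comment> \<open>In this branch m - s is at least \<open>g\<close>, so a monomial of that
          weight exists; multiplied by \<open>F\<close> it has leading weight
          \<open>m\<close>.\<close>
        obtain ds where ds: "length ds = n" "W ds = m - s" using g[of "m - s"] False
          by (meson add_le_imp_le_diff not_less_eq_eq)
        let ?e = "d \<otimes> inv c"
        have e: "?e \<in> K" "?e \<noteq> \<zero>"
          using dK c inv_nz[of c] by (auto simp: integral_iff)
        define M where "M v = ?e \<otimes> (tmon E ds v \<otimes> F v)" for v
        have "lead n M m (?e \<otimes> (\<one> \<otimes> c))"
          using lead_smult[OF lead_mult[OF lead_tmon[OF ds(1)] F] e] ds False by (simp add: M_def[abs_def])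
        also have "?e \<otimes> (\<one> \<otimes> c) = d"
          using c dK by (simp add: m_assoc inv_nz)
        finally have "(\<lambda>v. G v \<ominus> M v) \<in> Pol n m" by (rule lead_diff[OF d])
        from Suc.IH[OF this] obtain H m' G' where H: "H \<in> Pol n m'" "G' \<in> Pol n (g + s)"
          "\<And>v. v \<in> Pts n \<Longrightarrow> G v \<ominus> M v = H v \<otimes> F v \<oplus> G' v" by blast
        have "(\<lambda>v. H v \<oplus> ?e \<otimes> tmon E ds v) \<in> Pol n (max m' (Suc m))"
          using H e ds by (intro Pol_add Pol_monom Pol_le[OF H(1)]) auto
        moreover have "G v = (H v \<oplus> ?e \<otimes> tmon E ds v) \<otimes> F v \<oplus> G' v" if v: "v \<in> Pts n" for v
        proof -
          have cl: "G v \<in> carrier E" "tmon E ds v \<in> carrier E" "F v \<in> carrier E" "H v \<in> carrier E"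
            "G' v \<in> carrier E" "?e \<in> carrier E" "M v \<in> carrier E"
            using Fc v H e Suc.prems by (auto simp: Pol_closed M_def)
          have "G v = (G v \<ominus> M v) \<oplus> M v" using cl by algebra
          also have "\<dots> = (H v \<otimes> F v \<oplus> G' v) \<oplus> M v" by (simp add: H(3)[OF v])
          also have "\<dots> = (H v \<oplus> ?e \<otimes> tmon E ds v) \<otimes> F v \<oplus> G' v"
            unfolding M_def using cl(2-6) by algebra
          finally show ?thesis .
        qed
        ultimately show ?thesis using H(2) by blast
      qed
    qed
  qed
  then show ?thesis by blast
qed

text \<open>By \<open>Pol_top\<close> each unit of weight enlarges the space by at most one
  dimension over the finite field K.\<close>

lemma finite_Pol_values: "v \<in> Pts n \<Longrightarrow> finite ((\<lambda>F. F v) ` Pol n m)"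
proof (induction m)
  case 0
  then have "(\<lambda>F. F v) ` Pol n 0 \<subseteq> {\<zero>}" using Pol_0 by auto
  then show ?case by (rule finite_subset) simp
next
  case (Suc m)
  let ?V = "(\<lambda>F. F v) ` Pol n m"
  show ?case
  proof (cases "\<exists>ds. length ds = n \<and> W ds = m")
    case True
    then obtain ds where ds: "length ds = n" "W ds = m" by blast
    have "(\<lambda>F. F v) ` Pol n (Suc m) \<subseteq> ?V \<union> (\<lambda>(c, u). c \<otimes> tmon E ds v \<oplus> u) ` (K \<times> ?V)"
    proof
      fix u assume "u \<in> (\<lambda>F. F v) ` Pol n (Suc m)"
      then obtain F where F: "F \<in> Pol n (Suc m)" "u = F v" by blast
      from Pol_top[OF F(1)] show "u \<in> ?V \<union> (\<lambda>(c, u). c \<otimes> tmon E ds v \<oplus> u) ` (K \<times> ?V)"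
      proof
        assume "\<exists>c. lead n F m c"
        then obtain c where c: "lead n F m c" by blast
        then have cK: "c \<in> K" by (simp add: lead_def)
        have "(\<lambda>v. F v \<ominus> c \<otimes> tmon E ds v) \<in> Pol n m" by (rule lead_any[OF c ds])
        then have "F v \<ominus> c \<otimes> tmon E ds v \<in> ?V" by (rule rev_image_eqI) simp
        moreover have "F v = c \<otimes> tmon E ds v \<oplus> (F v \<ominus> c \<otimes> tmon E ds v)"
        proof -
          have "F v \<in> carrier E" "tmon E ds v \<in> carrier E" "c \<in> carrier E"
            using F Suc.prems cK by (auto simp: Pol_closed)
          then show ?thesis by algebra
        qed
        ultimately show ?thesis using cK F(2) by (auto intro!: rev_image_eqI[of "(c, F v \<ominus> c \<otimes> tmon E ds v)"])
      qed (use F in auto)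
    qed
    then show ?thesis
      by (rule finite_subset) (use Suc finite_K in auto)
  next
    case False
    have "Pol n (Suc m) \<subseteq> Pol n m"
    proof
      fix F assume "F \<in> Pol n (Suc m)"
      then show "F \<in> Pol n m" using Pol_top[of F n m] False unfolding lead_def by blast
    qed
    then show ?thesis using Suc by (meson finite_subset image_mono)
  qed
qed

lemma tmon_single: "i < length v \<Longrightarrow> set v \<subseteq> carrier E \<Longrightarrow>
   tmon E ((replicate (length v) 0)[i := k]) v = v ! i [^] k"
proof (induction v arbitrary: i)
  case (Cons y v)
  have 0: "tmon E (replicate (length v) 0) v = \<one>" if "set v \<subseteq> carrier E" for v
    using that by (induction v) auto
  show ?case
  proof (cases i)
    case 0
    then show ?thesis using Cons.prems \<open>\<And>v. set v \<subseteq> carrier E \<Longrightarrow> tmon E (replicate (length v) 0) v = \<one>\<close>[of v] by simp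
  next
    case (Suc j)
    then show ?thesis using Cons by (auto simp: subset_iff)
  qed
qed simp

lemma tmon_zero: "set v \<subseteq> carrier E \<Longrightarrow> tmon E (replicate (length v) 0) v = \<one>"
  by (induction v) auto

end

locale hermitian = const_field E K p r \<kappa> q for E (structure) and K p r \<kappa> q +
  fixes n :: nat and xs :: "'a list"
  assumes n: "0 < n" and xs: "xs \<in> Pts n" and trans: "transcendental K (last xs)"
    and gen: "generate_field E (K \<union> set xs) = carrier E"
begin

definition "x1 = last xs"

lemma xs_carr: "set xs \<subseteq> carrier E" and xs_len: "length xs = n" and xs_herm: "herm E \<kappa> xs"
  using xs by (auto simp: Pts_def)

lemma xs_ne: "xs \<noteq> []" using xs_len n by auto

lemma x1_in: "x1 \<in> set xs" unfolding x1_def using xs_ne by simp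
lemma x1_carr [simp]: "x1 \<in> carrier E" using x1_in xs_carr by blast

lemma x1_pow_inj: assumes "x1 [^] (i::nat) = x1 [^] (j::nat)" shows "i = j"
proof -
  have inj: "inj_on (\<lambda>P. eval P x1) (carrier (K[X]))"
    using trans unfolding transcendental_def x1_def .
  have carr: "monom \<one> k \<in> carrier (K[X])" for k
    using monom_is_polynomial[OF K_subring, of \<one> k] by (simp add: univ_poly_carrier[symmetric])
  have ev: "eval (monom \<one> k) x1 = x1 [^] k" for k
    using eval_monom[of \<one> x1 k] by simp
  have "monom \<one> i = monom \<one> j" using inj_onD[OF inj _ carr carr, of i j] assms ev by simp
  then have "length (monom \<one> i) = length (monom \<one> j)" by simp
  then show ?thesis by (simp add: monom_def)
qed

definition R where "R = (\<Union>m. (\<lambda>F. F xs) ` Pol n m)"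

lemma R_I: "F \<in> Pol n m \<Longrightarrow> F xs \<in> R" unfolding R_def by blast
lemma R_E: "z \<in> R \<Longrightarrow> \<exists>F m. F \<in> Pol n m \<and> z = F xs" unfolding R_def by blast
lemma R_sub: "R \<subseteq> carrier E" using xs by (auto simp: R_def Pol_closed)
lemma R_carr [simp]: "z \<in> R \<Longrightarrow> z \<in> carrier E" using R_sub by blast

lemma R_tmon: "length ds = n \<Longrightarrow> tmon E ds xs \<in> R"
  by (rule R_I[OF Pol_mono[OF _ lessI]])

lemma R_add [simp]: assumes "a \<in> R" "b \<in> R" shows "a \<oplus> b \<in> R"
proof -
  obtain F m G m' where F: "F \<in> Pol n m" "a = F xs" "G \<in> Pol n m'" "b = G xs" using assms R_E by blast
  have "(\<lambda>v. F v \<oplus> G v) \<in> Pol n (max m m')" using F by (intro Pol_add) (auto intro: Pol_le)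
  from R_I[OF this] show ?thesis using F by simp
qed

lemma R_mult [simp]: assumes "a \<in> R" "b \<in> R" shows "a \<otimes> b \<in> R"
proof -
  obtain F m G m' where F: "F \<in> Pol n m" "a = F xs" "G \<in> Pol n m'" "b = G xs" using assms R_E by blast
  have "(\<lambda>v. F v \<otimes> G v) \<in> Pol n (m + m')" using F by (intro Pol_mult Pol_le[OF F(1)]) auto
  from R_I[OF this] show ?thesis using F by simp
qed

lemma R_K: assumes "c \<in> K" shows "c \<in> R"
proof -
  have "(\<lambda>v. c \<otimes> tmon E (replicate n 0) v) \<in> Pol n (Suc (W (replicate n 0)))"
    using assms by (intro Pol_monom) auto
  from R_I[OF this] show ?thesis using tmon_zero[OF xs_carr] xs_len assms by simp
qed

lemma R_one [simp]: "\<one> \<in> R" by (rule R_K) simp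
lemma R_zero [simp]: "\<zero> \<in> R" by (rule R_K) simp

lemma R_uminus [simp]: "a \<in> R \<Longrightarrow> \<ominus> a \<in> R"
  using R_mult[OF R_K[of "\<ominus> \<one>"], of a] by (simp add: l_minus)

lemma R_minus [simp]: "a \<in> R \<Longrightarrow> b \<in> R \<Longrightarrow> a \<ominus> b \<in> R" by (simp add: minus_eq)
lemma R_pow [simp]: "a \<in> R \<Longrightarrow> a [^] (k::nat) \<in> R" by (induction k) auto

lemma R_xs: "y \<in> set xs \<Longrightarrow> y \<in> R"
proof -
  assume "y \<in> set xs"
  then obtain i where i: "i < length xs" "y = xs ! i" by (auto simp: in_set_conv_nth)
  have "tmon E ((replicate n 0)[i := 1]) xs \<in> R" by (rule R_tmon) simp
  then show ?thesis using tmon_single[OF i(1) xs_carr, of 1] i xs_carr nth_mem[OF i(1)] xs_len by (auto simp: subset_iff)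
qed

lemma R_x1 [simp]: "x1 \<in> R" using R_xs x1_in by blast

definition D where "D s = x1 [^] (q ^ s) \<ominus> x1"

lemma D_R [simp]: "D s \<in> R" by (simp add: D_def)

lemma minus_eq_zero: "a \<in> carrier E \<Longrightarrow> b \<in> carrier E \<Longrightarrow> a \<ominus> b = \<zero> \<longleftrightarrow> a = b"
  by (metis a_minus_def minus_equality minus_minus r_neg a_inv_closed)

lemma D_nonzero: assumes "0 < s" shows "D s \<noteq> \<zero>"
proof
  assume "D s = \<zero>"
  then have "x1 [^] (q ^ s) = x1 [^] (1::nat)" by (simp add: D_def minus_eq_zero)
  then have "q ^ s = 1" using x1_pow_inj by blast
  then show False using q_gt_1 assms by auto
qed

lemma pow_eq_zero: "a \<in> carrier E \<Longrightarrow> a [^] (k::nat) = \<zero> \<Longrightarrow> a = \<zero>"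
  by (induction k) (auto simp: integral_iff)

lemma frob_q: "a \<in> carrier E \<Longrightarrow> b \<in> carrier E \<Longrightarrow> (a \<ominus> b) [^] (q ^ i) = a [^] (q ^ i) \<ominus> b [^] (q ^ i)"
  "a \<in> carrier E \<Longrightarrow> b \<in> carrier E \<Longrightarrow> (a \<oplus> b) [^] (q ^ i) = a [^] (q ^ i) \<oplus> b [^] (q ^ i)"
  using frob_minus[of a b "2 * r * i"] frob_add[of a b "2 * r * i"] by (simp_all add: q_eq power_mult)

lemma x1_pow_diff: assumes "i < j"
  shows "x1 [^] (q ^ j) \<ominus> x1 [^] (q ^ i) = D (j - i) [^] (q ^ i)"
proof -
  have "q ^ (j - i) * q ^ i = q ^ j" using assms by (simp add: power_add[symmetric])
  then show ?thesis by (simp add: D_def frob_q nat_pow_pow)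
qed

text \<open>Infinitely many powers x1^(q^k), but only finitely many remainders modulo
  \<open>F\<close>: two of the powers have the same remainder, so \<open>F\<close> divides their
  difference. By additivity of Frobenius the difference is a power of some
  \<open>D s\<close>.\<close>

lemma lead_divides:
  assumes "lead n F s c"
  shows "\<exists>i j w. i < j \<and> w \<in> R \<and> D (j - i) [^] (q ^ i) = F xs \<otimes> w"
proof -
  obtain B where B: "\<And>m G. G \<in> Pol n m \<Longrightarrow> \<exists>H m' G'. H \<in> Pol n m' \<and> G' \<in> Pol n B \<and>
      (\<forall>v\<in>Pts n. G v = H v \<otimes> F v \<oplus> G' v)" using Pol_division[OF assms n] by blast
  have Fc: "F xs \<in> R" by (rule R_I[OF lead_Pol[OF assms]])
  have ex: "\<exists>w u. w \<in> R \<and> u \<in> (\<lambda>F. F xs) ` Pol n B \<and> x1 [^] (q ^ k) = w \<otimes> F xs \<oplus> u" for k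
  proof -
    obtain G m where G: "G \<in> Pol n m" "x1 [^] (q ^ k) = G xs" using R_E[OF R_pow[OF R_x1]] by blast
    obtain H m' G' where H: "H \<in> Pol n m'" "G' \<in> Pol n B" "\<forall>v\<in>Pts n. G v = H v \<otimes> F v \<oplus> G' v"
      using B[OF G(1)] by blast
    then show ?thesis using G xs R_I[OF H(1)] by auto
  qed
  then obtain w u where wu: "\<And>k. w k \<in> R" "\<And>k. u k \<in> (\<lambda>F. F xs) ` Pol n B"
    "\<And>k. x1 [^] (q ^ k) = w k \<otimes> F xs \<oplus> u k" by metis
  have uR: "u k \<in> R" for k using wu(2)[of k] R_I by auto
  have "\<not> inj u"
    using finite_Pol_values[OF xs, of B] wu(2) by (metis finite_subset finite_imageD image_subsetI infinite_UNIV_nat)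
  then obtain i j where ij: "i < j" "u i = u j" unfolding inj_def by (metis linorder_neqE_nat)
  have "x1 [^] (q ^ j) \<ominus> x1 [^] (q ^ i) = F xs \<otimes> (w j \<ominus> w i)"
  proof -
    have "F xs \<in> carrier E" "w j \<in> carrier E" "w i \<in> carrier E" "u j \<in> carrier E"
      using Fc wu uR by auto
    then show ?thesis unfolding wu(3) ij(2) by algebra
  qed
  then show ?thesis using x1_pow_diff[OF ij(1)] wu(1) ij(1) by (intro exI[of _ i] exI[of _ j] exI[of _ "w j \<ominus> w i"]) auto
qed

text \<open>The transcendence of \<open>x1\<close> enters here, through \<open>D_nonzero\<close>.
  The lemma does the work of the irreducibility of the tower equations.\<close>

lemma lead_nonzero: assumes "lead n F s c" shows "F xs \<noteq> \<zero>"
proof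
  assume 0: "F xs = \<zero>"
  obtain i j w where "i < j" "w \<in> R" "D (j - i) [^] (q ^ i) = F xs \<otimes> w" using lead_divides[OF assms] by blast
  then have "D (j - i) = \<zero>" using 0 pow_eq_zero[of "D (j - i)" "q ^ i"] by simp
  then show False using D_nonzero \<open>i < j\<close> by simp
qed

text \<open>Relations at the generic point specialise to every point. This is what makes the value
  of an element of \<open>R\<close> at a rational point well defined.\<close>

lemma Pol_vanish: "F \<in> Pol n m \<Longrightarrow> F xs = \<zero> \<Longrightarrow> v \<in> Pts n \<Longrightarrow> F v = \<zero>"
  using Pol_cases[of F n m] lead_nonzero by blast

lemma Pol_nonzero_lead: "F \<in> Pol n m \<Longrightarrow> F xs \<noteq> \<zero> \<Longrightarrow> \<exists>s<m. \<exists>c. lead n F s c"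
  using Pol_cases[of F n m] xs by blast

text \<open>Every nonzero element of \<open>R\<close> has its zeros among those of a single
  \<open>D s\<close>, which therefore serves as a common denominator.\<close>

lemma R_divides:
  assumes "z \<in> R" "z \<noteq> \<zero>"
  shows "\<exists>s>0. \<exists>l. \<exists>w\<in>R. D s [^] (l::nat) = z \<otimes> w"
proof -
  obtain F m where F: "F \<in> Pol n m" "z = F xs" using R_E assms by blast
  obtain s c where "lead n F s c" using Pol_nonzero_lead F assms by blast
  from lead_divides[OF this] obtain i j w where "i < j" "w \<in> R" "D (j - i) [^] (q ^ i) = z \<otimes> w"
    using F by blast
  then show ?thesis by (intro exI[of _ "j - i"]) auto
qed

lemma fraction:
  assumes "z \<in> carrier E"
  shows "\<exists>a\<in>R. \<exists>b\<in>R. b \<noteq> \<zero> \<and> z \<otimes> b = a"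
proof -
  have "z \<in> generate_field E (K \<union> set xs)" using assms gen by simp
  then show ?thesis
  proof induction
    case one
    then show ?case by (intro bexI[of _ \<one>]) auto
  next
    case (incl h)
    then have "h \<in> R" using R_K R_xs by blast
    then show ?case by (intro bexI[of _ h] bexI[of _ \<one>]) auto
  next
    case (a_inv h)
    then obtain a b where ab: "a \<in> R" "b \<in> R" "b \<noteq> \<zero>" "h \<otimes> b = a" by blast
    have "h \<in> carrier E" using a_inv gen by simp
    then have "(\<ominus> h) \<otimes> b = \<ominus> a" using ab by (simp add: l_minus)
    then show ?case using ab by (intro bexI[of _ "\<ominus> a"] bexI[of _ b]) auto
  next
    case (m_inv h)
    then obtain a b where ab: "a \<in> R" "b \<in> R" "b \<noteq> \<zero>" "h \<otimes> b = a" by blast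
    have h: "h \<in> carrier E" "h \<noteq> \<zero>" using m_inv gen by auto
    have "a \<noteq> \<zero>" using ab h by (auto simp: integral_iff)
    moreover have "inv h \<otimes> a = b" 
      using ab h inv_nz[of h] m_assoc[of "inv h" h b] by simp
    ultimately show ?case using ab by (intro bexI[of _ b] bexI[of _ a]) auto
  next
    case (eng_add h1 h2)
    then obtain a b a' b' where ab: "a \<in> R" "b \<in> R" "b \<noteq> \<zero>" "h1 \<otimes> b = a"
      "a' \<in> R" "b' \<in> R" "b' \<noteq> \<zero>" "h2 \<otimes> b' = a'" by blast
    have h: "h1 \<in> carrier E" "h2 \<in> carrier E" using eng_add gen by auto
    have "b \<in> carrier E" "b' \<in> carrier E" using ab by auto
    then have "(h1 \<oplus> h2) \<otimes> (b \<otimes> b') = (h1 \<otimes> b) \<otimes> b' \<oplus> (h2 \<otimes> b') \<otimes> b" using h by algebra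
    then show ?case using ab by (intro bexI[of _ "a \<otimes> b' \<oplus> a' \<otimes> b"] bexI[of _ "b \<otimes> b'"]) (auto simp: integral_iff)
  next
    case (eng_mult h1 h2)
    then obtain a b a' b' where ab: "a \<in> R" "b \<in> R" "b \<noteq> \<zero>" "h1 \<otimes> b = a"
      "a' \<in> R" "b' \<in> R" "b' \<noteq> \<zero>" "h2 \<otimes> b' = a'" by blast
    have h: "h1 \<in> carrier E" "h2 \<in> carrier E" using eng_mult gen by auto
    have "b \<in> carrier E" "b' \<in> carrier E" using ab by auto
    then have "(h1 \<otimes> h2) \<otimes> (b \<otimes> b') = (h1 \<otimes> b) \<otimes> (h2 \<otimes> b')" using h by algebra
    then show ?case using ab by (intro bexI[of _ "a \<otimes> a'"] bexI[of _ "b \<otimes> b'"]) (auto simp: integral_iff)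
  qed
qed

section \<open>Congruences modulo \<open>D s\<close> and the Frobenius map on
  \<open>R\<close>\<close>

definition cong_D :: "nat \<Rightarrow> 'a \<Rightarrow> 'a \<Rightarrow> bool" where
  "cong_D s a b \<longleftrightarrow> a \<in> R \<and> b \<in> R \<and> (\<exists>w\<in>R. a \<ominus> b = D s \<otimes> w)"

lemma cong_refl [simp]: "a \<in> R \<Longrightarrow> cong_D s a a"
  unfolding cong_D_def by (auto intro!: bexI[of _ \<zero>] simp: minus_eq r_neg)

lemma cong_add: assumes "cong_D s a b" "cong_D s a' b'" shows "cong_D s (a \<oplus> a') (b \<oplus> b')"
proof -
  obtain w w' where w: "w \<in> R" "a \<ominus> b = D s \<otimes> w" "w' \<in> R" "a' \<ominus> b' = D s \<otimes> w'"
    and R: "a \<in> R" "b \<in> R" "a' \<in> R" "b' \<in> R" using assms unfolding cong_D_def by blast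
  have c: "a \<in> carrier E" "b \<in> carrier E" "a' \<in> carrier E" "b' \<in> carrier E" "w \<in> carrier E" "w' \<in> carrier E"
    "D s \<in> carrier E" using w R by auto
  have "(a \<oplus> a') \<ominus> (b \<oplus> b') = (a \<ominus> b) \<oplus> (a' \<ominus> b')" using c by algebra
  also have "\<dots> = D s \<otimes> (w \<oplus> w')" unfolding w using c by algebra
  finally show ?thesis unfolding cong_D_def using w R by auto
qed

lemma cong_mult: assumes "cong_D s a b" "cong_D s a' b'" shows "cong_D s (a \<otimes> a') (b \<otimes> b')"
proof -
  obtain w w' where w: "w \<in> R" "a \<ominus> b = D s \<otimes> w" "w' \<in> R" "a' \<ominus> b' = D s \<otimes> w'"
    and R: "a \<in> R" "b \<in> R" "a' \<in> R" "b' \<in> R" using assms unfolding cong_D_def by blast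
  have c: "a \<in> carrier E" "b \<in> carrier E" "a' \<in> carrier E" "b' \<in> carrier E" "w \<in> carrier E" "w' \<in> carrier E"
    "D s \<in> carrier E" using w R by auto
  have "(a \<otimes> a') \<ominus> (b \<otimes> b') = (a \<ominus> b) \<otimes> a' \<oplus> b \<otimes> (a' \<ominus> b')" using c by algebra
  also have "\<dots> = D s \<otimes> (w \<otimes> a' \<oplus> b \<otimes> w')" unfolding w using c by algebra
  finally show ?thesis unfolding cong_D_def using w R by auto
qed

lemma cong_trans: assumes "cong_D s a b" "cong_D s b c" shows "cong_D s a c"
proof -
  obtain w w' where w: "w \<in> R" "a \<ominus> b = D s \<otimes> w" "w' \<in> R" "b \<ominus> c = D s \<otimes> w'"
    and R: "a \<in> R" "b \<in> R" "c \<in> R" using assms unfolding cong_D_def by blast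
  have c: "a \<in> carrier E" "b \<in> carrier E" "c \<in> carrier E" "w \<in> carrier E" "w' \<in> carrier E"
    "D s \<in> carrier E" using w R by auto
  have "a \<ominus> c = (a \<ominus> b) \<oplus> (b \<ominus> c)" using c by algebra
  also have "\<dots> = D s \<otimes> (w \<oplus> w')" unfolding w using c by algebra
  finally show ?thesis unfolding cong_D_def using w R by auto
qed

lemma cong_pow: "cong_D s a b \<Longrightarrow> cong_D s (a [^] (k::nat)) (b [^] k)"
  by (induction k) (auto intro: cong_mult)

lemma cong_uminus: "cong_D s a b \<Longrightarrow> cong_D s (\<ominus> a) (\<ominus> b)"
  using cong_mult[OF cong_refl[of "\<ominus> \<one>" s], of a b] by (auto simp: l_minus cong_D_def)

lemma cong_pow_iter: "cong_D s (y [^] (Q::nat)) y \<Longrightarrow> cong_D s (y [^] (Q ^ k)) y"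
proof (induction k)
  case 0
  then have "y \<in> R" by (simp add: cong_D_def)
  then show ?case by simp
next
  case (Suc k)
  have y: "y \<in> carrier E" using Suc.prems by (auto simp: cong_D_def)
  have "cong_D s ((y [^] (Q ^ k)) [^] Q) (y [^] Q)" using Suc by (intro cong_pow) auto
  then have "cong_D s (y [^] (Q ^ Suc k)) (y [^] Q)" using y by (simp add: nat_pow_pow mult.commute)
  then show ?case using Suc.prems cong_trans by blast
qed

text \<open>Let Q = q^t. The defect \<delta> = y^Q - y satisfies \<delta>^\<kappa> + \<delta> = 0
  modulo \<open>D s\<close>, because z^Q is congruent to z. Hence \<delta>^\<kappa> is -\<delta>,
  and \<delta> is fixed by the power q and so by Q. Each further power Q adds \<delta> once more:
  y^(Q^k) is y + k \<delta>, and k = p removes the defect.\<close>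

lemma frobenius_tower_step:
  assumes y: "y \<in> R" and z: "z \<in> R" and rel: "y [^] \<kappa> \<oplus> y = z [^] Suc \<kappa>"
    and cz: "cong_D s (z [^] (q ^ t)) z"
  shows "cong_D s (y [^] (q ^ (t * p))) y"
proof -
  define Q where "Q = q ^ t"
  define \<delta> where "\<delta> = y [^] Q \<ominus> y"
  have \<delta>: "\<delta> \<in> R" using y by (simp add: \<delta>_def)
  have c: "y \<in> carrier E" "z \<in> carrier E" "\<delta> \<in> carrier E" "y [^] Q \<in> carrier E"
    "y [^] \<kappa> \<in> carrier E" using y z \<delta> by auto
  have k: "(a \<ominus> b) [^] \<kappa> = a [^] \<kappa> \<ominus> b [^] \<kappa>" if "a \<in> carrier E" "b \<in> carrier E" for a b
    using frob_minus[OF that, of r] by (simp add: \<kappa>)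
  have "\<delta> [^] \<kappa> \<oplus> \<delta> = (z [^] Q) [^] Suc \<kappa> \<ominus> z [^] Suc \<kappa>"
  proof -
    have cc: "(y [^] Q) [^] \<kappa> \<in> carrier E" using c by simp
    have "\<delta> [^] \<kappa> \<oplus> \<delta> = ((y [^] Q) [^] \<kappa> \<ominus> y [^] \<kappa>) \<oplus> (y [^] Q \<ominus> y)"
      using c by (simp add: \<delta>_def k)
    also have "\<dots> = ((y [^] Q) [^] \<kappa> \<oplus> y [^] Q) \<ominus> (y [^] \<kappa> \<oplus> y)" using c cc by algebra
    also have "(y [^] Q) [^] \<kappa> \<oplus> y [^] Q = (y [^] \<kappa> \<oplus> y) [^] Q"
      using c by (simp add: Q_def frob_q nat_pow_pow mult.commute)
    also have "\<dots> = (z [^] Q) [^] Suc \<kappa>"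
      unfolding rel using c by (simp only: nat_pow_pow mult.commute)
    finally show ?thesis unfolding rel .
  qed
  moreover have "cong_D s ((z [^] Q) [^] Suc \<kappa>) (z [^] Suc \<kappa>)"
    using cz unfolding Q_def by (rule cong_pow)
  ultimately obtain w where w: "w \<in> R" "\<delta> [^] \<kappa> \<oplus> \<delta> = D s \<otimes> w" unfolding cong_D_def by auto
  have 1: "cong_D s (\<delta> [^] \<kappa>) (\<ominus> \<delta>)"
    unfolding cong_D_def using w \<delta> by (auto simp: minus_eq)
  have "cong_D s ((\<delta> [^] \<kappa>) [^] \<kappa>) ((\<ominus> \<delta>) [^] \<kappa>)" by (rule cong_pow[OF 1])
  then have "cong_D s (\<delta> [^] q) (\<ominus> (\<delta> [^] \<kappa>))"
    using c frob_uminus[of \<delta> r] by (simp add: nat_pow_pow q power2_eq_square \<kappa>)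
  moreover have "cong_D s (\<ominus> (\<delta> [^] \<kappa>)) \<delta>" using cong_uminus[OF 1] c by simp
  ultimately have "cong_D s (\<delta> [^] q) \<delta>" by (rule cong_trans)
  then have \<delta>Q: "cong_D s (\<delta> [^] Q) \<delta>" unfolding Q_def by (rule cong_pow_iter)
  define e where "e k = add_pow E k \<one>" for k :: nat
  have eK: "e k \<in> K" for k by (induction k) (auto simp: e_def)
  have eR: "e k \<in> R" for k using eK R_K by blast
  have main: "cong_D s (y [^] (Q ^ k)) (y \<oplus> e k \<otimes> \<delta>)" for k
  proof (induction k)
    case 0
    then show ?case using y \<delta> by (simp add: e_def)
  next
    case (Suc k)
    have ec: "e k \<in> carrier E" using eR by simp
    have "cong_D s ((y [^] (Q ^ k)) [^] Q) ((y \<oplus> e k \<otimes> \<delta>) [^] Q)" by (rule cong_pow[OF Suc.IH])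
    moreover have "(y [^] (Q ^ k)) [^] Q = y [^] (Q ^ Suc k)"
      using c by (simp add: nat_pow_pow mult.commute)
    moreover have "(y \<oplus> e k \<otimes> \<delta>) [^] Q = y [^] Q \<oplus> e k \<otimes> \<delta> [^] Q"
      using c ec eK[of k] by (simp add: Q_def frob_q nat_pow_distrib K_pow_qm)
    ultimately have 2: "cong_D s (y [^] (Q ^ Suc k)) (y [^] Q \<oplus> e k \<otimes> \<delta> [^] Q)" by simp
    have "cong_D s (y [^] Q \<oplus> e k \<otimes> \<delta> [^] Q) (y [^] Q \<oplus> e k \<otimes> \<delta>)"
      using y eR by (intro cong_add cong_mult \<delta>Q cong_refl) auto
    moreover have "y [^] Q \<oplus> e k \<otimes> \<delta> = y \<oplus> e (Suc k) \<otimes> \<delta>"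
    proof -
      have "e (Suc k) = e k \<oplus> \<one>" by (simp add: e_def)
      moreover have "y [^] Q = y \<oplus> \<delta>" unfolding \<delta>_def using c(1,4) by algebra
      ultimately show ?thesis using c(1,3) ec by (simp add: l_distr a_ac)
    qed
    ultimately show ?case using 2 cong_trans by simp
  qed
  have "e p = \<zero>" using char_p by (simp add: e_def)
  then show ?thesis using main[of p] c by (simp add: Q_def power_mult)
qed

text \<open>For x_1 the exponent t = s works by the definition of \<open>D s\<close>, and each level
  of the tower costs a factor p. An exponent common to all coordinates then works for all of
  \<open>R\<close>, since the power q^t is additive and multiplicative and fixes K.\<close>

lemma frobenius_R: assumes "0 < s" shows "\<exists>t>0. \<forall>z\<in>R. cong_D s (z [^] (q ^ t)) z"
proof -
  have *: "\<exists>t>0. \<forall>y\<in>set ys. cong_D s (y [^] (q ^ t)) y"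
    if "ys \<noteq> []" "herm E \<kappa> ys" "set ys \<subseteq> R" "last ys = x1" for ys
    using that
  proof (induction ys)
    case (Cons y ys)
    show ?case
    proof (cases ys)
      case Nil
      then have "cong_D s (y [^] (q ^ s)) y"
        using Cons.prems unfolding cong_D_def by (auto intro!: bexI[of _ \<one>] simp: D_def)
      then show ?thesis using Nil assms by auto
    next
      case (Cons z zs)
      obtain t where t: "t > 0" "\<forall>y\<in>set ys. cong_D s (y [^] (q ^ t)) y"
        using Cons.IH Cons.prems Cons by auto
      have "cong_D s (y [^] (q ^ (t * p))) y"
        by (rule frobenius_tower_step[of y z]) (use Cons.prems Cons t in auto)
      moreover have "cong_D s (u [^] (q ^ (t * p))) u" if "u \<in> set ys" for u
        using cong_pow_iter[of s u "q ^ t" p] t that by (simp add: power_mult)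
      ultimately show ?thesis using t p_gt_1 by (intro exI[of _ "t * p"]) auto
    qed
  qed simp
  obtain t where t: "t > 0" "\<forall>y\<in>set xs. cong_D s (y [^] (q ^ t)) y"
    using *[OF xs_ne xs_herm subsetI[OF R_xs] x1_def[symmetric]] by auto
  have mon: "cong_D s (tmon E ds ys [^] (q ^ t)) (tmon E ds ys)" if "set ys \<subseteq> set xs" for ds ys
    using that
  proof (induction ds arbitrary: ys)
    case (Cons d ds)
    show ?case
    proof (cases ys)
      case (Cons y zs)
      have y: "y \<in> carrier E" and z: "tmon E ds zs \<in> carrier E"
        using Cons.prems Cons xs_carr by (auto intro!: tmon_closed)
      have "cong_D s ((y [^] (q ^ t)) [^] d \<otimes> tmon E ds zs [^] (q ^ t)) (y [^] d \<otimes> tmon E ds zs)"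
        using Cons.prems Cons t by (intro cong_mult cong_pow Cons.IH) auto
      then show ?thesis using y z by (simp add: Cons nat_pow_distrib nat_pow_pow mult.commute)
    qed simp
  qed simp
  have "cong_D s (F xs [^] (q ^ t)) (F xs)" if "F \<in> Pol n m" for F m
    using that
  proof induction
    case (zero F)
    then show ?case using xs q_gt_1 by (simp add: nat_pow_zero)
  next
    case (step c ds G F)
    have cl: "c \<in> carrier E" "tmon E ds xs \<in> carrier E" "G xs \<in> carrier E"
      using step xs by (auto simp: Pol_closed)
    have "cong_D s (c \<otimes> tmon E ds xs [^] (q ^ t) \<oplus> G xs [^] (q ^ t)) (c \<otimes> tmon E ds xs \<oplus> G xs)"
      using step by (intro cong_add cong_mult mon cong_refl R_K) auto
    then show ?case
      using step(5)[OF xs] cl step(1) by (simp add: frob_q nat_pow_distrib K_pow_qm)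
  qed
  then show ?thesis using t(1) R_E by blast
qed

end

section \<open>Discrete valuation rings and places\<close>

context const_field begin

declare pow_nat [simp del]

section \<open>Integer powers and inverses in E\<close>

lemma mult_group: "comm_group (units_of E)"
  by (rule units_comm_group)

lemma units_carrier: "carrier (units_of E) = carrier E - {\<zero>}"
  using field_Units by (simp add: units_of_carrier)

lemma ipow_mult_of: assumes "a \<in> carrier E" "a \<noteq> \<zero>"
  shows "a [^]\<^bsub>units_of E\<^esub> (m::int) = a [^] m"
proof -
  have a: "a \<in> Units E" using assms field_Units by simp
  then have "a [^] (k::nat) \<in> Units E" for k by (induction k) auto
  then show ?thesis using a by (simp add: int_pow_def2 units_of_pow units_of_inv)
qed

lemma ipow_closed [simp]: "a \<in> carrier E \<Longrightarrow> a \<noteq> \<zero> \<Longrightarrow> a [^] (m::int) \<in> carrier E"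
  and ipow_nonzero: "a \<in> carrier E \<Longrightarrow> a \<noteq> \<zero> \<Longrightarrow> a [^] (m::int) \<noteq> \<zero>"
proof -
  interpret G: comm_group "units_of E" by (rule mult_group)
  show "a \<in> carrier E \<Longrightarrow> a \<noteq> \<zero> \<Longrightarrow> a [^] (m::int) \<in> carrier E"
    "a \<in> carrier E \<Longrightarrow> a \<noteq> \<zero> \<Longrightarrow> a [^] (m::int) \<noteq> \<zero>"
    using G.int_pow_closed[of a m] by (auto simp: ipow_mult_of units_carrier)
qed

lemma ipow_add: "a \<in> carrier E \<Longrightarrow> a \<noteq> \<zero> \<Longrightarrow> a [^] (m + k::int) = a [^] m \<otimes> a [^] k"
proof -
  interpret G: comm_group "units_of E" by (rule mult_group)
  assume "a \<in> carrier E" "a \<noteq> \<zero>"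
  then show ?thesis using G.int_pow_mult[of a m k] by (simp add: ipow_mult_of units_carrier units_of_mult)
qed

lemma ipow_distrib: "a \<in> carrier E \<Longrightarrow> a \<noteq> \<zero> \<Longrightarrow> b \<in> carrier E \<Longrightarrow> b \<noteq> \<zero> \<Longrightarrow>
    (a \<otimes> b) [^] (m::int) = a [^] m \<otimes> b [^] m"
proof -
  interpret G: comm_group "units_of E" by (rule mult_group)
  assume "a \<in> carrier E" "a \<noteq> \<zero>" "b \<in> carrier E" "b \<noteq> \<zero>"
  then show ?thesis using G.int_pow_distrib[of a b m] by (simp add: ipow_mult_of integral_iff units_carrier units_of_mult)
qed

lemma inv_mult:
  assumes "a \<in> carrier E" "a \<noteq> \<zero>" "b \<in> carrier E" "b \<noteq> \<zero>"
  shows "inv (a \<otimes> b) = inv a \<otimes> inv b"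
proof (rule comm_inv_char)
  note i = inv_nz[OF assms(1,2)] inv_nz[OF assms(3,4)]
  have "a \<otimes> b \<otimes> (inv a \<otimes> inv b) = (a \<otimes> inv a) \<otimes> (b \<otimes> inv b)"
    using assms i(1,5) by algebra
  then show "a \<otimes> b \<otimes> (inv a \<otimes> inv b) = \<one>" by (simp add: i)
qed (use assms inv_nz in auto)

lemma inv_inv': "a \<in> carrier E \<Longrightarrow> a \<noteq> \<zero> \<Longrightarrow> inv (inv a) = a"
  using Units_inv_inv field_Units by auto

lemma ipow_minus: assumes "a \<in> carrier E" "a \<noteq> \<zero>" shows "a [^] (- m::int) = inv (a [^] m)"
proof -
  have "a [^] (m + - m) = a [^] m \<otimes> a [^] (- m)" by (rule ipow_add[OF assms])
  then show ?thesis using assms comm_inv_char[of "a [^] m" "a [^] (- m)"] by simp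
qed

section \<open>Valuation rings and their maximal ideals\<close>

definition vunits :: "'a set \<Rightarrow> 'a set" where
  "vunits V = {u \<in> V. u \<noteq> \<zero> \<and> inv u \<in> V}"

definition nonunits :: "'a set \<Rightarrow> 'a set" where
  "nonunits V = {u \<in> V. u = \<zero> \<or> inv u \<notin> V}"

lemma vunits_iff: "u \<in> V \<Longrightarrow> u \<in> vunits V \<longleftrightarrow> u \<notin> nonunits V"
  by (auto simp: vunits_def nonunits_def)

lemma subring_sub: "subring V E \<Longrightarrow> a \<in> V \<Longrightarrow> a \<in> carrier E"
  using subringE(1) by blast

lemma vunits_mult: assumes "subring V E" "u \<in> vunits V" "v \<in> vunits V" shows "u \<otimes> v \<in> vunits V"
  using assms subringE(6)[OF assms(1)] subring_sub[OF assms(1)]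
  by (auto simp: vunits_def integral_iff inv_mult)

lemma vunits_inv: "subring V E \<Longrightarrow> u \<in> vunits V \<Longrightarrow> inv u \<in> vunits V"
  using subring_sub[of V] by (auto simp: vunits_def inv_inv' inv_nz)

lemma vunits_one: "subring V E \<Longrightarrow> \<one> \<in> vunits V"
  using subringE(3)[of V E] by (auto simp: vunits_def)

lemma vunits_pow: "subring V E \<Longrightarrow> u \<in> vunits V \<Longrightarrow> u [^] (k::nat) \<in> vunits V"
  by (induction k) (auto intro: vunits_mult vunits_one)

lemma vunits_ipow: "subring V E \<Longrightarrow> u \<in> vunits V \<Longrightarrow> u [^] (k::int) \<in> vunits V"
  by (simp add: int_pow_def2 vunits_pow vunits_inv)

lemma vunits_factor:
  assumes V: "subring V E" and "a \<in> V" "b \<in> V" "a \<otimes> b \<in> vunits V"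
  shows "a \<in> vunits V"
proof -
  have c: "a \<in> carrier E" "b \<in> carrier E" "a \<noteq> \<zero>" "b \<noteq> \<zero>"
    using assms subring_sub[OF V] by (auto simp: vunits_def)
  have "inv a = b \<otimes> inv (a \<otimes> b)"
    using c by (intro comm_inv_char) (auto simp: inv_nz integral_iff m_assoc[symmetric])
  then show ?thesis using assms c subringE(6)[OF V] by (auto simp: vunits_def)
qed

lemma vunits_K: assumes "subring V E" "K \<subseteq> V" "c \<in> K" "c \<noteq> \<zero>" shows "c \<in> vunits V"
  using assms by (auto simp: vunits_def)

lemma subring_pow: "subring V E \<Longrightarrow> a \<in> V \<Longrightarrow> a [^] (k::nat) \<in> V"
  using subringE(3,6)[of V E] by (induction k) auto

lemma Units_subring: assumes "subring V E" shows "Units (E\<lparr>carrier := V\<rparr>) = vunits V"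
proof -
  show ?thesis
  proof
    show "Units (E\<lparr>carrier := V\<rparr>) \<subseteq> vunits V"
    proof
      fix u assume "u \<in> Units (E\<lparr>carrier := V\<rparr>)"
      then obtain w where u: "u \<in> V" "w \<in> V" "w \<otimes> u = \<one>" unfolding Units_def by auto
      have "u \<in> carrier E" "w \<in> carrier E" "u \<noteq> \<zero>" using u subring_sub[OF assms] by auto
      then show "u \<in> vunits V" using u comm_inv_char[of u w] by (simp add: vunits_def m_comm)
    qed
    show "vunits V \<subseteq> Units (E\<lparr>carrier := V\<rparr>)"
    proof
      fix u assume "u \<in> vunits V"
      then have u: "u \<in> V" "u \<noteq> \<zero>" "inv u \<in> V" "u \<in> carrier E"
        using subring_sub[OF assms] by (auto simp: vunits_def)
      then show "u \<in> Units (E\<lparr>carrier := V\<rparr>)"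
        unfolding Units_def using inv_nz[of u] by (auto intro!: bexI[of _ "inv u"])
    qed
  qed
qed

lemma valuation_ringD:
  assumes "valuation_ring K E V"
  shows "subring V E" "K \<subseteq> V" "V \<noteq> carrier E" "V \<subseteq> carrier E"
    "\<And>z. z \<in> carrier E \<Longrightarrow> z \<noteq> \<zero> \<Longrightarrow> z \<in> V \<or> inv z \<in> V"
  using assms unfolding valuation_ring_def by auto

lemma nonunits_mult: assumes "subring V E" "a \<in> nonunits V" "b \<in> V" shows "a \<otimes> b \<in> nonunits V"
proof -
  have "a \<in> V" "a \<notin> vunits V" using assms vunits_iff by (auto simp: nonunits_def vunits_def)
  then show ?thesis using vunits_factor[OF assms(1) _ assms(3)] vunits_iff[of "a \<otimes> b" V]
      subringE(6)[OF assms(1) _ assms(3)] by blast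
qed

text \<open>One of the quotients b/a and a/b lies in V, and the sum is a or b times an element of
  V.\<close>

lemma nonunits_add:
  assumes V: "valuation_ring K E V" and a: "a \<in> nonunits V" and b: "b \<in> nonunits V"
  shows "a \<oplus> b \<in> nonunits V"
proof -
  note V' = valuation_ringD[OF V]
  have c: "a \<in> V" "b \<in> V" "a \<in> carrier E" "b \<in> carrier E"
    using a b V'(4) by (auto simp: nonunits_def)
  have *: "a \<oplus> b \<in> nonunits V" if "a \<in> nonunits V" "b \<in> V" "a \<in> carrier E" "b \<in> carrier E"
    "a \<noteq> \<zero>" "b \<otimes> inv a \<in> V" for a b
  proof -
    have "b = a \<otimes> (b \<otimes> inv a)" using that m_lcomm[of a b "inv a"] by (simp add: inv_nz)
    then have "a \<oplus> b = a \<otimes> (\<one> \<oplus> b \<otimes> inv a)" using that by (simp add: r_distr inv_nz)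
    then show ?thesis using that nonunits_mult[OF V'(1)] subringE(3,7)[OF V'(1)] by simp
  qed
  show ?thesis
  proof (cases "a = \<zero> \<or> b = \<zero>")
    case True
    then show ?thesis using a b c by auto
  next
    case False
    then have z: "b \<otimes> inv a \<in> carrier E" "b \<otimes> inv a \<noteq> \<zero>" using c by (auto simp: inv_nz integral_iff)
    have i: "inv (b \<otimes> inv a) = a \<otimes> inv b"
      using c False by (simp add: inv_mult inv_nz inv_inv' m_comm)
    from V'(5)[OF z] show ?thesis
    proof
      assume "b \<otimes> inv a \<in> V"
      then show ?thesis using *[of a b] a c False by blast
    next
      assume "inv (b \<otimes> inv a) \<in> V"
      then have "b \<oplus> a \<in> nonunits V" using *[of b a] b c False i by simp
      then show ?thesis using c by (simp add: a_comm)
    qed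
  qed
qed

lemma nonunits_uminus:
  assumes "valuation_ring K E V" "a \<in> nonunits V" shows "\<ominus> a \<in> nonunits V"
proof -
  note V' = valuation_ringD[OF assms(1)]
  have "a \<otimes> (\<ominus> \<one>) \<in> nonunits V"
    using nonunits_mult[OF V'(1) assms(2)] subringE(3,5)[OF V'(1)] by blast
  moreover have "a \<in> carrier E" using assms V'(4) by (auto simp: nonunits_def)
  ultimately show ?thesis by (simp add: r_minus)
qed

lemma vunits_add_nonunits:
  assumes V: "valuation_ring K E V" and "u \<in> vunits V" "a \<in> nonunits V"
  shows "u \<oplus> a \<in> vunits V"
proof (rule ccontr)
  note V' = valuation_ringD[OF assms(1)]
  have c: "u \<in> V" "a \<in> V" "u \<in> carrier E" "a \<in> carrier E"
    using assms V'(4) by (auto simp: nonunits_def vunits_def)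
  assume "u \<oplus> a \<notin> vunits V"
  then have "u \<oplus> a \<in> nonunits V" using vunits_iff c subringE(7)[OF V'(1)] by blast
  then have "(u \<oplus> a) \<oplus> (\<ominus> a) \<in> nonunits V" using nonunits_add nonunits_uminus V assms(3) by blast
  moreover have "(u \<oplus> a) \<oplus> (\<ominus> a) = u" using c(3,4) by algebra
  ultimately show False using assms(2) vunits_iff c by auto
qed

lemma nonunits_maximal:
  assumes V: "valuation_ring K E V"
  shows "maximalideal (nonunits V) (E\<lparr>carrier := V\<rparr>)"
proof -
  note V' = valuation_ringD[OF assms(1)]
  let ?V = "E\<lparr>carrier := V\<rparr>"
  interpret V: domain ?V by (rule subring_is_domain[OF V'(1)])
  have Z: "\<zero> \<in> nonunits V" using subringE(2)[OF V'(1)] by (simp add: nonunits_def)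
  have minus: "\<ominus>\<^bsub>?V\<^esub> a = \<ominus> a" if "a \<in> V" for a
    using that V'(4) subringE(5)[OF V'(1)] by (intro V.minus_equality) (auto simp: l_neg)
  have "subgroup (nonunits V) (add_monoid ?V)"
    by (rule V.add.subgroupI) (use Z nonunits_add[OF V] nonunits_uminus[OF V] minus in
        \<open>auto simp: nonunits_def[of V] simp flip: a_inv_def\<close>)
  then have "ideal (nonunits V) ?V"
    by (intro idealI V.ring_axioms) (use nonunits_mult[OF V'(1)] V'(4) m_comm in
      \<open>auto simp: nonunits_def subset_iff\<close>)
  then show ?thesis
  proof (rule maximalidealI)
    have "\<one> \<notin> nonunits V" using subringE(3)[OF V'(1)] by (simp add: nonunits_def)
    then show "carrier ?V \<noteq> nonunits V" using subringE(3)[OF V'(1)] by auto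
    fix J assume J: "ideal J ?V" "nonunits V \<subseteq> J" "J \<subseteq> carrier ?V"
    interpret J: ideal J ?V by fact
    show "J = nonunits V \<or> J = carrier ?V"
    proof (rule disjCI)
      assume "J \<noteq> carrier ?V"
      have "u \<notin> vunits V" if "u \<in> J" for u
      proof
        assume u: "u \<in> vunits V"
        then have "u \<otimes> inv u \<in> J" using J.I_r_closed[OF that, of "inv u"] by (simp add: vunits_def)
        moreover have "u \<otimes> inv u = \<one>" using u V'(4) by (auto simp: vunits_def inv_nz)
        ultimately show False using J.one_imp_carrier \<open>J \<noteq> carrier ?V\<close> by simp
      qed
      then have "J \<subseteq> nonunits V" using J(3) vunits_iff[of _ V] by (simp add: subset_iff)
      then show "J = nonunits V" using J(2) by blast
    qed
  qed
qed

text \<open>A proper ideal contains no units, so the set of nonunits, being an ideal itself, is the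
  only maximal one.\<close>

lemma is_place_of_iff:
  "is_place_of K E V P \<longleftrightarrow> valuation_ring K E V \<and> P = nonunits V"
proof
  assume L: "is_place_of K E V P"
  then have V: "valuation_ring K E V" and P: "maximalideal P (E\<lparr>carrier := V\<rparr>)"
    unfolding is_place_of_def by auto
  note V' = valuation_ringD[OF V]
  interpret P: maximalideal P "E\<lparr>carrier := V\<rparr>" by (rule P)
  have sub: "P \<subseteq> V" using P.a_subset by simp
  have "u \<notin> vunits V" if "u \<in> P" for u
  proof
    assume u: "u \<in> vunits V"
    then have "u \<otimes> inv u \<in> P" using P.I_r_closed[OF that, of "inv u"] by (simp add: vunits_def)
    moreover have "u \<otimes> inv u = \<one>" using u V'(4) by (auto simp: vunits_def inv_nz)
    ultimately show False using P.one_imp_carrier P.I_notcarr by simp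
  qed
  then have "P \<subseteq> nonunits V" using sub vunits_iff by blast
  moreover have "\<one> \<notin> nonunits V" using subringE(3)[OF V'(1)] by (simp add: nonunits_def)
  then have "nonunits V \<noteq> V" using subringE(3)[OF V'(1)] by blast
  ultimately have "P = nonunits V"
    using P.I_maximal[of "nonunits V"] maximalideal.axioms(1)[OF nonunits_maximal[OF V]]
    by (auto simp: nonunits_def)
  then show "valuation_ring K E V \<and> P = nonunits V" using V by blast
next
  assume "valuation_ring K E V \<and> P = nonunits V"
  then show "is_place_of K E V P" using nonunits_maximal unfolding is_place_of_def by blast
qed

text \<open>The place determines its ring, which is what the definite description in
  \<open>place_ring\<close> relies on.\<close>

lemma valuation_ring_of_nonunits:
  assumes "valuation_ring K E V"
  shows "V = {z \<in> carrier E. z = \<zero> \<or> inv z \<notin> nonunits V}"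
proof -
  note V' = valuation_ringD[OF assms]
  have "z \<in> V" if "z \<in> carrier E" "z \<noteq> \<zero>" "inv z \<notin> nonunits V" for z
    using V'(5)[OF that(1,2)] that by (auto simp: nonunits_def inv_inv' inv_nz)
  moreover have "inv z \<notin> nonunits V" if "z \<in> V" "z \<noteq> \<zero>" for z
    using that V'(4) by (auto simp: nonunits_def inv_inv' inv_nz subset_iff)
  ultimately show ?thesis using V'(4) subringE(2)[OF V'(1)] by auto
qed

lemma nonunits_inj:
  "valuation_ring K E V \<Longrightarrow> valuation_ring K E V' \<Longrightarrow> nonunits V = nonunits V' \<Longrightarrow> V = V'"
  using valuation_ring_of_nonunits by metis

lemma place_iff: "place K E P \<longleftrightarrow> (\<exists>V. valuation_ring K E V \<and> P = nonunits V)"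
  by (simp add: place_def is_place_of_iff)

lemma place_ring_nonunits:
  assumes "valuation_ring K E V" shows "place_ring K E (nonunits V) = E\<lparr>carrier := V\<rparr>"
proof -
  have "(THE V'. is_place_of K E V' (nonunits V)) = V"
    using assms nonunits_inj by (intro the_equality) (auto simp: is_place_of_iff)
  then show ?thesis by (simp add: place_ring_def)
qed

text \<open>Discreteness is stated as a factorisation of every nonzero element of E. That V is a
  valuation ring is then a consequence, \<open>dvr_valuation_ring\<close>; this suits the
  localisations of \<open>R\<close>, for which it is not known beforehand.\<close>

definition dvr :: "'a set \<Rightarrow> 'a \<Rightarrow> bool" where
  "dvr V t \<longleftrightarrow> subring V E \<and> K \<subseteq> V \<and> t \<in> V \<and> t \<noteq> \<zero> \<and> inv t \<notin> V \<and>
     (\<forall>z\<in>carrier E - {\<zero>}. \<exists>m::int. \<exists>u\<in>vunits V. z = t [^] m \<otimes> u)"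

lemma dvrD:
  assumes "dvr V t"
  shows "subring V E" "K \<subseteq> V" "t \<in> V" "t \<noteq> \<zero>" "inv t \<notin> V" "t \<in> carrier E" "t \<in> nonunits V"
    "\<And>z. z \<in> carrier E \<Longrightarrow> z \<noteq> \<zero> \<Longrightarrow> \<exists>m::int. \<exists>u\<in>vunits V. z = t [^] m \<otimes> u"
  using assms subring_sub[of V t] unfolding dvr_def nonunits_def by auto

lemma dvr_mem:
  assumes V: "dvr V t" and u: "u \<in> vunits V"
  shows "t [^] (m::int) \<otimes> u \<in> V \<longleftrightarrow> m \<ge> 0" "t [^] (m::int) \<otimes> u \<in> nonunits V \<longleftrightarrow> m > 0"
proof -
  note V' = dvrD[OF V]
  have uc: "u \<in> carrier E" "u \<noteq> \<zero>" "u \<in> V" "inv u \<in> V" using u subring_sub[OF V'(1)] by (auto simp: vunits_def)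
  have nn: "t [^] m \<otimes> v \<in> V" if "m \<ge> 0" "v \<in> V" for m :: int and v
    using that subring_pow[OF V'(1,3)] subringE(6)[OF V'(1)] by (simp add: int_pow_def2)
  have pos: "t [^] m \<otimes> u \<in> nonunits V" if "m > 0" for m :: int
  proof -
    have "t [^] m \<otimes> u = t \<otimes> (t [^] (m - 1) \<otimes> u)"
      using ipow_add[OF V'(6,4), of 1 "m - 1"] V' uc by (simp add: m_assoc int_pow_def2[of _ _ 1])
    then show ?thesis using nonunits_mult[OF V'(1,7)] nn[of "m - 1"] that uc by simp
  qed
  have neg: "t [^] m \<otimes> u \<notin> V" if "m < 0" for m :: int
  proof
    assume "t [^] m \<otimes> u \<in> V"
    then have "(t [^] m \<otimes> u) \<otimes> (t [^] (- m - 1) \<otimes> inv u) \<in> V"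
      using nn[of "- m - 1" "inv u"] that uc by (intro subringE(6)[OF V'(1), of "t [^] m \<otimes> u"]) simp_all
    also have "(t [^] m \<otimes> u) \<otimes> (t [^] (- m - 1) \<otimes> inv u) = (t [^] m \<otimes> t [^] (- m - 1)) \<otimes> (u \<otimes> inv u)"
      using V'(4,6) uc(1) inv_nz(1)[OF uc(1,2)] by (simp add: m_ac)
    also have "\<dots> = t [^] (-1 :: int)"
      using V' uc ipow_add[OF V'(6,4), of m "- m - 1"] by (simp add: inv_nz)
    also have "\<dots> = inv t" using V' by (simp add: int_pow_def2)
    finally show False using V' by simp
  qed
  show "t [^] m \<otimes> u \<in> V \<longleftrightarrow> m \<ge> 0" using nn[OF _ uc(3), of m] neg[of m] by (meson not_le)
  have "u \<notin> nonunits V" using u vunits_iff uc by blast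
  then have "t [^] (0::int) \<otimes> u \<notin> nonunits V" using uc by simp
  then show "t [^] m \<otimes> u \<in> nonunits V \<longleftrightarrow> m > 0"
    using pos[of m] neg[of m] unfolding nonunits_def
    by (cases "m > 0"; cases "m = 0") (simp_all add: nonunits_def)
qed

lemma dvr_unique:
  assumes V: "dvr V t" and u: "u \<in> vunits V" "u' \<in> vunits V"
    and eq: "t [^] (m::int) \<otimes> u = t [^] (m'::int) \<otimes> u'"
  shows "m = m'"
proof -
  note V' = dvrD[OF V]
  have *: "m' \<le> m" if "u \<in> vunits V" "u' \<in> vunits V" "t [^] (m::int) \<otimes> u = t [^] (m'::int) \<otimes> u'" for u u' m m'
  proof -
    have uc: "u \<in> carrier E" "u \<noteq> \<zero>" "u' \<in> carrier E" using that subring_sub[OF V'(1)] by (auto simp: vunits_def)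
    have "t [^] (m - m') \<otimes> u = t [^] (- m') \<otimes> (t [^] m \<otimes> u)"
      using ipow_add[OF V'(6,4), of "- m'" m] V' uc by (simp add: m_assoc)
    also have "\<dots> = t [^] (0::int) \<otimes> u'"
      using ipow_add[OF V'(6,4), of "- m'" m'] V' uc that(3) by (simp add: m_assoc[symmetric])
    finally have "t [^] (m - m') \<otimes> u \<in> V" using that(2) uc by (simp add: vunits_def)
    then show ?thesis using dvr_mem(1)[OF V that(1)] by simp
  qed
  show ?thesis using *[OF u eq] *[OF u(2,1) eq[symmetric]] by simp
qed

lemma dvr_valuation_ring: assumes "dvr V t" shows "valuation_ring K E V"
proof -
  note V' = dvrD[OF assms]
  have "z \<in> V \<or> inv z \<in> V" if z: "z \<in> carrier E" "z \<noteq> \<zero>" for z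
  proof -
    obtain m :: int and u where u: "u \<in> vunits V" "z = t [^] m \<otimes> u" using V'(8)[OF z] by blast
    have uc: "u \<in> carrier E" "u \<noteq> \<zero>" using u subring_sub[OF V'(1)] by (auto simp: vunits_def)
    have "inv z = t [^] (- m) \<otimes> inv u"
      using V' uc by (simp add: u(2) inv_mult ipow_minus ipow_nonzero)
    then show ?thesis
      using dvr_mem(1)[OF assms u(1), of m] dvr_mem(1)[OF assms vunits_inv[OF V'(1) u(1)], of "- m"] u by force
  qed
  moreover have "t \<notin> K" using V' K_inv[of t] by blast
  moreover have "inv t \<in> carrier E" using V' inv_nz by blast
  ultimately show ?thesis unfolding valuation_ring_def using V' subringE(1)[OF V'(1)] by blast
qed

text \<open>\<open>place_val\<close> admits every generator of the place as prime element. Two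
  generators divide each other, so they differ by a unit and give the same exponent.\<close>

lemma dvr_place_val:
  assumes V: "dvr V t" and u: "u \<in> vunits V"
  shows "place_val K E (nonunits V) (t [^] (m::int) \<otimes> u) = m"
proof -
  note V' = dvrD[OF V]
  have vr: "valuation_ring K E V" by (rule dvr_valuation_ring[OF V])
  let ?V = "E\<lparr>carrier := V\<rparr>"
  have PI: "PIdl\<^bsub>?V\<^esub> a = {x \<otimes> a | x. x \<in> V}" for a by (simp add: cgenideal_def)
  have gen_t: "nonunits V = PIdl\<^bsub>?V\<^esub> t"
  proof
    show "PIdl\<^bsub>?V\<^esub> t \<subseteq> nonunits V"
      using nonunits_mult[OF V'(1,7)] V' subring_sub[OF V'(1)] m_comm by (auto simp: PI)
    show "nonunits V \<subseteq> PIdl\<^bsub>?V\<^esub> t"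
    proof
      fix z assume z: "z \<in> nonunits V"
      show "z \<in> PIdl\<^bsub>?V\<^esub> t"
      proof (cases "z = \<zero>")
        case True
        then show ?thesis using subringE(2)[OF V'(1)] V' by (auto simp: PI intro!: exI[of _ \<zero>])
      next
        case False
        have zc: "z \<in> carrier E" using z subring_sub[OF V'(1)] by (auto simp: nonunits_def)
        obtain k :: int and v where v: "v \<in> vunits V" "z = t [^] k \<otimes> v" using V'(8)[OF zc False] by blast
        have vc: "v \<in> carrier E" using v subring_sub[OF V'(1)] by (auto simp: vunits_def)
        have "k > 0" using dvr_mem(2)[OF V v(1)] z v by blast
        then have "t [^] (k - 1) \<otimes> v \<in> V" using dvr_mem(1)[OF V v(1)] by simp
        moreover have "z = (t [^] (k - 1) \<otimes> v) \<otimes> t"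
          using ipow_add[OF V'(6,4), of "k - 1" 1] V' vc v by (simp add: m_ac int_pow_def2[of _ _ 1])
        ultimately show ?thesis by (auto simp: PI)
      qed
    qed
  qed
  show ?thesis unfolding place_val_def place_ring_nonunits[OF vr] Units_subring[OF V'(1)]
  proof (rule the_equality)
    show "\<exists>t'\<in>nonunits V. \<exists>u'\<in>vunits V. nonunits V = PIdl\<^bsub>?V\<^esub> t' \<and> t [^] m \<otimes> u = t' [^] m \<otimes> u'"
      using V'(7) u gen_t by blast
  next
    fix m' :: int assume "\<exists>t'\<in>nonunits V. \<exists>u'\<in>vunits V. nonunits V = PIdl\<^bsub>?V\<^esub> t' \<and> t [^] m \<otimes> u = t' [^] m' \<otimes> u'"
    then obtain t' u' where t': "t' \<in> nonunits V" "u' \<in> vunits V" "nonunits V = PIdl\<^bsub>?V\<^esub> t'"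
      and eq: "t [^] m \<otimes> u = t' [^] m' \<otimes> u'" by blast
    obtain x where x: "x \<in> V" "t = x \<otimes> t'" using V'(7) t'(3) unfolding PI by blast
    obtain y where y: "y \<in> V" "t' = y \<otimes> t" using t'(1) gen_t unfolding PI by blast
    have c: "x \<in> carrier E" "y \<in> carrier E" "t \<in> carrier E" using x y V' subring_sub[OF V'(1)] by auto
    have "t \<otimes> (x \<otimes> y) = t \<otimes> \<one>" using x(2) c unfolding y(2) by (simp add: m_ac)
    then have "x \<otimes> y = \<one>" using m_lcancel[of t "x \<otimes> y" \<one>] c V' by simp
    then have yu: "y \<in> vunits V"
      using vunits_factor[OF V'(1) y(1) x(1)] vunits_one[OF V'(1)] c by (simp add: m_comm)
    have uc: "u' \<in> carrier E" "y \<noteq> \<zero>" using t' yu subring_sub[OF V'(1)] by (auto simp: vunits_def)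
    have "t' [^] m' = y [^] m' \<otimes> t [^] m'"
      using c uc V'(4) ipow_distrib[of y t m'] unfolding y(2) by simp
    then have "t' [^] m' \<otimes> u' = t [^] m' \<otimes> (y [^] m' \<otimes> u')"
      using c uc V'(4) by (simp add: m_ac)
    then show "m' = m"
      using dvr_unique[OF V u vunits_mult[OF V'(1) vunits_ipow[OF V'(1) yu] t'(2)], of m m'] eq by simp
  qed
qed

lemma dvr_val_nonneg:
  assumes V: "dvr V t" and z: "z \<in> carrier E" "z \<noteq> \<zero>"
  shows "place_val K E (nonunits V) z \<ge> 0 \<longleftrightarrow> z \<in> V"
proof -
  obtain m :: int and u where u: "u \<in> vunits V" "z = t [^] m \<otimes> u" using dvrD(8)[OF V z] by blast
  show ?thesis unfolding u(2) dvr_place_val[OF V u(1)] dvr_mem(1)[OF V u(1)] ..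
qed

text \<open>The hypothesis makes K map onto the residue field, and a field has dimension one over
  itself.\<close>

lemma rational_placeI:
  assumes V: "valuation_ring K E V" and res: "\<And>z. z \<in> V \<Longrightarrow> \<exists>a\<in>K. z \<ominus> a \<in> nonunits V"
  shows "rational_place K E (nonunits V)"
proof -
  note V' = valuation_ringD[OF V]
  let ?V = "E\<lparr>carrier := V\<rparr>" and ?P = "nonunits V"
  interpret V: domain ?V by (rule subring_is_domain[OF V'(1)])
  interpret P: maximalideal ?P ?V by (rule nonunits_maximal[OF V])
  interpret Q: field "?V Quot ?P" by (rule P.quotient_is_field) (rule V.is_cring)
  have minus: "\<ominus>\<^bsub>?V\<^esub> a = \<ominus> a" if "a \<in> V" for a
    using that V'(4) subringE(5)[OF V'(1)] by (intro V.minus_equality) (auto simp: l_neg)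
  have carr: "carrier (?V Quot ?P) = (\<lambda>a. ?P +>\<^bsub>?V\<^esub> a) ` V"
    by (auto simp: FactRing_def A_RCOSETS_def')
  have "(\<lambda>a. ?P +>\<^bsub>?V\<^esub> a) ` K = carrier (?V Quot ?P)"
  proof
    show "(\<lambda>a. ?P +>\<^bsub>?V\<^esub> a) ` K \<subseteq> carrier (?V Quot ?P)"
      using V'(2) by (auto simp: carr)
    show "carrier (?V Quot ?P) \<subseteq> (\<lambda>a. ?P +>\<^bsub>?V\<^esub> a) ` K"
    proof
      fix y assume "y \<in> carrier (?V Quot ?P)"
      then obtain z where z: "z \<in> V" "y = ?P +>\<^bsub>?V\<^esub> z" by (auto simp: carr)
      obtain a where a: "a \<in> K" "z \<ominus> a \<in> ?P" using res[OF z(1)] by blast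
      have "z \<ominus>\<^bsub>?V\<^esub> a \<in> ?P" using a V'(2) minus[of a] by (auto simp: a_minus_def)
      then have "?P +>\<^bsub>?V\<^esub> z = ?P +>\<^bsub>?V\<^esub> a"
        using V.quotient_eq_iff_same_a_r_cos[OF P.is_ideal, of z a] z a V'(2) by auto
      then show "y \<in> (\<lambda>a. ?P +>\<^bsub>?V\<^esub> a) ` K" using z a by auto
    qed
  qed
  moreover have "Q.dimension 1 (carrier (?V Quot ?P)) (carrier (?V Quot ?P))"
    by (rule Q.dimension_one[OF Q.carrier_is_subfield])
  ultimately show ?thesis
    unfolding rational_place_def place_ring_nonunits[OF V] place_iff using V by auto
qed

end

section \<open>The place at infinity\<close>

lemma wt_zero: "wt a b (replicate k 0) = 0"
  by (induction k) auto

context hermitian begin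

lemma ipow_cancel:
  assumes "a \<in> carrier E" "a \<noteq> \<zero>" "z \<in> carrier E"
  shows "a [^] (- k::int) \<otimes> (a [^] k \<otimes> z) = z"
proof -
  have "a [^] (- k) \<otimes> a [^] k = \<one>" using ipow_add[OF assms(1,2), of "- k" k] by simp
  then show ?thesis using assms m_assoc[of "a [^] (- k)" "a [^] k" z] by simp
qed

text \<open>The number \<open>k\<close> is the pole order at infinity, that is, minus the valuation:
  weight of a numerator minus weight of a denominator. Being a relation, it lets existence and
  independence of the fraction be treated separately in \<open>wrel_ex\<close> and
  \<open>wrel_unique\<close>.\<close>

definition wrel :: "'a \<Rightarrow> int \<Rightarrow> bool" where
  "wrel z k \<longleftrightarrow> z \<in> carrier E \<and> (\<exists>F G s s' c c'. lead n F s c \<and> lead n G s' c' \<and>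
      z \<otimes> G xs = F xs \<and> k = int s - int s')"

lemma lead_carr: "lead n F s c \<Longrightarrow> F xs \<in> carrier E"
  using xs unfolding lead_def by blast

text \<open>If a function with leading weight s belonged to \<open>Pol n s\<close>, subtracting it
  from itself would leave a zero function that still has a leading term, against
  \<open>lead_nonzero\<close>.\<close>

lemma lead_weight_unique:
  assumes "lead n F s c" "lead n F s' c'" shows "s = s'"
proof -
  have no: "\<not> F \<in> Pol n s" if L: "lead n F s c" for F s c
  proof
    assume F: "F \<in> Pol n s"
    have "lead n (\<lambda>v. F v \<oplus> (\<ominus> F v)) s c" by (rule lead_add_lower[OF L Pol_uminus[OF F]])
    then have "F xs \<oplus> (\<ominus> F xs) \<noteq> \<zero>" by (rule lead_nonzero)
    then show False using lead_carr[OF L] by (simp add: r_neg)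
  qed
  have *: "\<not> s < s'" if "lead n F s c" "lead n F s' c'" for s s' c c'
    using no[OF that(2)] lead_Pol[OF that(1)] Pol_le[of F n "Suc s" s'] by auto
  show ?thesis using *[OF assms] *[OF assms(2,1)] by simp
qed

text \<open>By \<open>Pol_vanish\<close> equality at \<open>xs\<close> is equality on all points, so
  the leading weight is attached to the element of E and not to the function representing
  it.\<close>

lemma lead_eq_transfer:
  assumes "lead n F s c" "lead n G s' c'" "F xs = G xs" shows "s = s'"
proof -
  have "(\<lambda>v. F v \<ominus> G v) \<in> Pol n (max (Suc s) (Suc s'))"
    using lead_Pol[OF assms(1)] lead_Pol[OF assms(2)] by (intro Pol_minus) (auto elim: Pol_le)
  then have "F v \<ominus> G v = \<zero>" if "v \<in> Pts n" for v
    using Pol_vanish[of "\<lambda>v. F v \<ominus> G v" _ v] assms that lead_carr by (simp add: minus_eq r_neg)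
  then have "F v = G v" if "v \<in> Pts n" for v
    using assms that minus_eq_zero unfolding lead_def by auto
  then have "lead n F s' c'" by (intro lead_cong[OF assms(2)])
  then show ?thesis using lead_weight_unique assms(1) by blast
qed

lemma wrel_unique: assumes "wrel z k" "wrel z k'" shows "k = k'"
proof -
  obtain F G s s' c c' where 1: "lead n F s c" "lead n G s' c'" "z \<otimes> G xs = F xs" "k = int s - int s'"
    and z: "z \<in> carrier E" using assms unfolding wrel_def by blast
  obtain F' G' t t' d d' where 2: "lead n F' t d" "lead n G' t' d'" "z \<otimes> G' xs = F' xs" "k' = int t - int t'"
    using assms unfolding wrel_def by blast
  have c: "G xs \<in> carrier E" "G' xs \<in> carrier E" using 1 2 lead_carr by auto
  have "F xs \<otimes> G' xs = F' xs \<otimes> G xs" unfolding 1(3)[symmetric] 2(3)[symmetric] using c z by algebra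
  then have "s + t' = t + s'" using lead_eq_transfer[OF lead_mult[OF 1(1) 2(2)] lead_mult[OF 2(1) 1(2)]] by simp
  then show ?thesis using 1 2 by simp
qed

lemma wrel_nonzero: "wrel z k \<Longrightarrow> z \<in> carrier E \<and> z \<noteq> \<zero>"
  unfolding wrel_def using lead_nonzero lead_carr by fastforce

lemma lead_one: "lead n (tmon E (replicate n 0)) 0 \<one>" "tmon E (replicate n 0) xs = \<one>"
  using lead_tmon[of "replicate n 0"] tmon_zero[OF xs_carr] xs_len by (simp_all add: wt_zero)

lemma wrel_lead: assumes "lead n F s c" shows "wrel (F xs) (int s)"
proof -
  have "F xs \<otimes> tmon E (replicate n 0) xs = F xs" using lead_one(2) lead_carr[OF assms] by simp
  moreover have "int s = int s - int 0" by simp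
  ultimately show ?thesis unfolding wrel_def using assms lead_one(1) lead_carr[OF assms] by blast
qed

lemma wrel_ex: assumes "z \<in> carrier E" "z \<noteq> \<zero>" shows "\<exists>k. wrel z k"
proof -
  obtain a b where ab: "a \<in> R" "b \<in> R" "b \<noteq> \<zero>" "z \<otimes> b = a" using fraction[OF assms(1)] by blast
  obtain F m G m' where F: "F \<in> Pol n m" "a = F xs" "G \<in> Pol n m'" "b = G xs" using R_E ab by meson
  have "a \<noteq> \<zero>" using ab assms by (auto simp: integral_iff)
  then obtain s c t d where "lead n F s c" "lead n G t d" using Pol_nonzero_lead F ab by meson
  then show ?thesis unfolding wrel_def using F ab assms by blast
qed

lemma wrel_mult: assumes "wrel z k" "wrel z' k'" shows "wrel (z \<otimes> z') (k + k')"
proof -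
  obtain F G s s' c c' where 1: "lead n F s c" "lead n G s' c'" "z \<otimes> G xs = F xs" "k = int s - int s'"
    and z: "z \<in> carrier E" using assms unfolding wrel_def by blast
  obtain F' G' t t' d d' where 2: "lead n F' t d" "lead n G' t' d'" "z' \<otimes> G' xs = F' xs" "k' = int t - int t'"
    and z': "z' \<in> carrier E" using assms unfolding wrel_def by blast
  have c: "G xs \<in> carrier E" "G' xs \<in> carrier E" using 1 2 lead_carr by auto
  have "z \<otimes> z' \<otimes> (G xs \<otimes> G' xs) = F xs \<otimes> F' xs" unfolding 1(3)[symmetric] 2(3)[symmetric] using c z z' by algebra
  then show ?thesis unfolding wrel_def using z z' lead_mult[OF 1(1) 2(1)] lead_mult[OF 1(2) 2(2)] 1(4) 2(4)
    by (intro conjI exI[of _ "\<lambda>v. F v \<otimes> F' v"] exI[of _ "\<lambda>v. G v \<otimes> G' v"] exI[of _ "s + t"] exI[of _ "s' + t'"]) auto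
qed

lemma wrel_inv: assumes "wrel z k" shows "wrel (inv z) (- k)"
proof -
  obtain F G s s' c c' where 1: "lead n F s c" "lead n G s' c'" "z \<otimes> G xs = F xs" "k = int s - int s'"
    and z: "z \<in> carrier E" using assms unfolding wrel_def by blast
  have z0: "z \<noteq> \<zero>" using wrel_nonzero assms by blast
  have "inv z \<otimes> F xs = G xs" using 1(3) z z0 inv_nz[OF z z0] m_assoc[of "inv z" z "G xs"] lead_carr[OF 1(2)] by simp
  then show ?thesis unfolding wrel_def using 1 inv_nz[OF z z0]
    by (intro conjI exI[of _ G] exI[of _ F] exI[of _ s'] exI[of _ s]) auto
qed

lemma wrel_one: "wrel \<one> 0"
  using wrel_lead[OF lead_one(1)] lead_one(2) by simp

lemma wrel_ipow: assumes "wrel z k" shows "wrel (z [^] (m::int)) (m * k)"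
proof -
  have nat: "wrel (z [^] j) (int j * k)" for j :: nat
  proof (induction j)
    case (Suc j)
    from wrel_mult[OF Suc assms] show ?case by (simp add: algebra_simps)
  qed (simp add: wrel_one)
  show ?thesis
  proof (cases "m \<ge> 0")
    case True
    then show ?thesis using nat[of "nat m"] by (simp add: int_pow_def2)
  next
    case False
    then show ?thesis using wrel_inv[OF nat[of "nat (- m)"]] by (simp add: int_pow_def2)
  qed
qed

lemma wrel_add:
  assumes "wrel z k" "wrel z' k'" "z \<oplus> z' \<noteq> \<zero>"
  shows "\<exists>j \<le> max k k'. wrel (z \<oplus> z') j"
proof -
  obtain F G s s' c c' where 1: "lead n F s c" "lead n G s' c'" "z \<otimes> G xs = F xs" "k = int s - int s'"
    and z: "z \<in> carrier E" using assms unfolding wrel_def by blast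
  obtain F' G' t t' d d' where 2: "lead n F' t d" "lead n G' t' d'" "z' \<otimes> G' xs = F' xs" "k' = int t - int t'"
    and z': "z' \<in> carrier E" using assms unfolding wrel_def by blast
  have c: "G xs \<in> carrier E" "G' xs \<in> carrier E" using 1 2 lead_carr by auto
  define H where "H v = F v \<otimes> G' v \<oplus> F' v \<otimes> G v" for v
  have H: "(z \<oplus> z') \<otimes> (G xs \<otimes> G' xs) = H xs"
    unfolding H_def 1(3)[symmetric] 2(3)[symmetric] using c z z' by algebra
  have "H \<in> Pol n (Suc (max (s + t') (t + s')))" unfolding H_def
    by (intro Pol_add Pol_le[OF lead_Pol[OF lead_mult[OF 1(1) 2(2)]]] Pol_le[OF lead_Pol[OF lead_mult[OF 2(1) 1(2)]]]) auto
  moreover have "H xs \<noteq> \<zero>" unfolding H[symmetric] using assms(3) c z z' lead_nonzero[OF 1(2)] lead_nonzero[OF 2(2)]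
    by (simp add: integral_iff)
  ultimately obtain s0 c0 where s0: "s0 < Suc (max (s + t') (t + s'))" "lead n H s0 c0" using Pol_nonzero_lead by blast
  have "wrel (z \<oplus> z') (int s0 - int (s' + t'))"
    unfolding wrel_def using z z' H s0(2) lead_mult[OF 1(2) 2(2)]
    by (intro conjI exI[of _ H] exI[of _ "\<lambda>v. G v \<otimes> G' v"] exI[of _ s0] exI[of _ "s' + t'"]) auto
  then show ?thesis using s0(1) 1(4) 2(4) by (intro exI[of _ "int s0 - int (s' + t')"]) auto
qed

lemma wrel_uminus: assumes "wrel z k" shows "wrel (\<ominus> z) k"
proof -
  have "wrel (\<ominus> \<one>) 0"
  proof -
    have "lead n (\<lambda>v. (\<ominus> \<one>) \<otimes> tmon E (replicate n 0) v) 0 (\<ominus> \<one> \<otimes> \<one>)"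
      using minus_eq_zero[of \<zero> \<one>] by (intro lead_smult[OF lead_one(1)]) (auto simp: minus_eq)
    then have "wrel ((\<ominus> \<one>) \<otimes> tmon E (replicate n 0) xs) (int 0)" by (rule wrel_lead)
    then show ?thesis using lead_one(2) by simp
  qed
  from wrel_mult[OF this assms] show ?thesis using wrel_nonzero[OF assms] by (simp add: l_minus)
qed

definition Vinf where "Vinf = {z \<in> carrier E. z = \<zero> \<or> (\<exists>k\<le>0. wrel z k)}"
definition "Pinf = nonunits Vinf"

lemma Vinf_subring: "subring Vinf E"
proof (rule subringI)
  show "Vinf \<subseteq> carrier E" by (auto simp: Vinf_def)
  show "\<one> \<in> Vinf" using wrel_one by (auto simp: Vinf_def)
  show "\<ominus> h \<in> Vinf" if "h \<in> Vinf" for h using that wrel_uminus by (auto simp: Vinf_def)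
  show "h1 \<otimes> h2 \<in> Vinf" if h: "h1 \<in> Vinf" "h2 \<in> Vinf" for h1 h2
  proof (cases "h1 = \<zero> \<or> h2 = \<zero>")
    case False
    then obtain k k' where "k \<le> 0" "wrel h1 k" "k' \<le> 0" "wrel h2 k'" using h by (auto simp: Vinf_def)
    then show ?thesis using wrel_mult[of h1 k h2 k'] that by (auto simp: Vinf_def intro!: exI[of _ "k + k'"])
  qed (use h in \<open>auto simp: Vinf_def\<close>)
  show "h1 \<oplus> h2 \<in> Vinf" if h: "h1 \<in> Vinf" "h2 \<in> Vinf" for h1 h2
  proof (cases "h1 = \<zero> \<or> h2 = \<zero> \<or> h1 \<oplus> h2 = \<zero>")
    case False
    then obtain k k' where k: "k \<le> 0" "wrel h1 k" "k' \<le> 0" "wrel h2 k'" using h by (auto simp: Vinf_def)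
    then obtain j where "j \<le> max k k'" "wrel (h1 \<oplus> h2) j" using wrel_add False by blast
    then show ?thesis using h k by (auto simp: Vinf_def intro!: exI[of _ j])
  qed (use h in \<open>auto simp: Vinf_def\<close>)
qed

lemma Vinf_iff: "wrel z k \<Longrightarrow> z \<in> Vinf \<longleftrightarrow> k \<le> 0"
  using wrel_unique wrel_nonzero unfolding Vinf_def by blast

lemma Vinf_units: assumes "wrel z 0" shows "z \<in> vunits Vinf"
  using assms wrel_inv[OF assms] wrel_nonzero[OF assms] Vinf_iff by (auto simp: vunits_def)

lemma Vinf_nonunits: assumes "wrel z k" shows "z \<in> nonunits Vinf \<longleftrightarrow> k < 0"
  using Vinf_iff[OF assms] Vinf_iff[OF wrel_inv[OF assms]] wrel_nonzero[OF assms] by (auto simp: nonunits_def)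

lemma Vinf_dvr: "\<exists>t. wrel t (-1) \<and> dvr Vinf t"
proof -
  obtain g where g: "\<And>s. s \<ge> g \<Longrightarrow> \<exists>ds. length ds = n \<and> W ds = s"
    using wt_cofinite[of \<kappa> "n - 1"] kappa_gt_1 n by auto
  \<comment> \<open>The quotient of monomials of consecutive weights has pole order -1 and is the
    uniformiser sought.\<close>
  obtain ds es where ds: "length ds = n" "W ds = g" "length es = n" "W es = Suc g"
    using g[of g] g[of "Suc g"] by auto
  define t where "t = tmon E ds xs \<otimes> inv (tmon E es xs)"
  have t: "wrel t (-1)"
    using wrel_mult[OF wrel_lead[OF lead_tmon[OF ds(1)]] wrel_inv[OF wrel_lead[OF lead_tmon[OF ds(3)]]]] ds
    by (simp add: t_def)
  have t0: "t \<in> carrier E" "t \<noteq> \<zero>" using wrel_nonzero[OF t] by auto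
  have "\<exists>m::int. \<exists>u\<in>vunits Vinf. z = t [^] m \<otimes> u" if z: "z \<in> carrier E" "z \<noteq> \<zero>" for z
  proof -
    obtain k where k: "wrel z k" using wrel_ex[OF z] by blast
    have "wrel (t [^] k \<otimes> z) (k * (-1) + k)" by (rule wrel_mult[OF wrel_ipow[OF t] k])
    then have "t [^] k \<otimes> z \<in> vunits Vinf" by (intro Vinf_units) simp
    moreover have "z = t [^] (- k) \<otimes> (t [^] k \<otimes> z)"
      using ipow_cancel[OF t0 z(1)] by simp
    ultimately show ?thesis by blast
  qed
  moreover have "K \<subseteq> Vinf"
  proof
    fix c assume c: "c \<in> K"
    show "c \<in> Vinf"
    proof (cases "c = \<zero>")
      case False
      have "lead n (\<lambda>v. c \<otimes> tmon E (replicate n 0) v) 0 (c \<otimes> \<one>)"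
        by (rule lead_smult[OF lead_one(1) c False])
      from wrel_lead[OF this] show ?thesis using lead_one(2) c Vinf_iff by simp
    qed (simp add: Vinf_def)
  qed
  ultimately have "dvr Vinf t"
    unfolding dvr_def using Vinf_subring t0 Vinf_iff[OF t] Vinf_iff[OF wrel_inv[OF t]] by simp
  then show ?thesis using t by blast
qed

lemma Vinf_valuation: "valuation_ring K E Vinf"
  using Vinf_dvr dvr_valuation_ring by blast

lemma Pinf_val: assumes "wrel z k" shows "place_val K E Pinf z = - k"
proof -
  obtain t where t: "wrel t (-1)" "dvr Vinf t" using Vinf_dvr by blast
  have z: "z \<in> carrier E" "z \<noteq> \<zero>" using wrel_nonzero[OF assms] by auto
  have t0: "t \<in> carrier E" "t \<noteq> \<zero>" using wrel_nonzero[OF t(1)] by auto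
  have "wrel (t [^] k \<otimes> z) (k * (-1) + k)" by (rule wrel_mult[OF wrel_ipow[OF t(1)] assms])
  then have "t [^] k \<otimes> z \<in> vunits Vinf" by (intro Vinf_units) simp
  from dvr_place_val[OF t(2) this, of "- k"]
  show ?thesis using ipow_cancel[OF t0 z(1)] by (simp add: Pinf_def)
qed

lemma x1_notin_Vinf: "x1 \<notin> Vinf"
proof -
  let ?ds = "(replicate n (0::nat))[n - 1 := 1]"
  have ds: "length ?ds = n" by simp
  have "tmon E ?ds xs = xs ! (n - 1) [^] (1::nat)"
    using tmon_single[of "n - 1" xs 1] xs_len xs_carr n by simp
  then have "tmon E ?ds xs = x1" using xs_ne xs_len x1_def x1_carr by (simp add: last_conv_nth)
  then have w: "wrel x1 (int (W ?ds))" using wrel_lead[OF lead_tmon[OF ds]] by simp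
  have "last ?ds * \<kappa> ^ (length ?ds - 1) \<le> W ?ds" by (rule wt_last_le) (use n in auto)
  moreover have "last ?ds = 1" using n by (simp add: last_conv_nth)
  ultimately have "0 < W ?ds" using kappa_gt_1 by (metis ds gr0I le_zero_eq mult_1 not_one_less_zero power_not_zero)
  then show ?thesis using Vinf_iff[OF w] by simp
qed

text \<open>For pole order 0 the residue is the quotient of the leading coefficients: subtracting it
  cancels the leading terms of numerator and denominator against each other.\<close>

lemma Vinf_residue: assumes "z \<in> Vinf" shows "\<exists>a\<in>K. z \<ominus> a \<in> nonunits Vinf"
proof -
  note V' = valuation_ringD[OF Vinf_valuation]
  have zero: "\<zero> \<in> nonunits Vinf" by (simp add: nonunits_def Vinf_def)
  show ?thesis
  proof (cases "z = \<zero>")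
    case True
    then show ?thesis using zero by (intro bexI[of _ \<zero>]) (auto simp: minus_eq)
  next
    case False
    have zc: "z \<in> carrier E" using assms by (simp add: Vinf_def)
    obtain k where k: "wrel z k" "k \<le> 0" using assms False by (auto simp: Vinf_def)
    show ?thesis
    proof (cases "k = 0")
      case False
      then have "z \<in> nonunits Vinf" using Vinf_nonunits[OF k(1)] k by simp
      then show ?thesis using zc by (intro bexI[of _ \<zero>]) (auto simp: minus_eq)
    next
      case True
      then obtain F G s c c' where 1: "lead n F s c" "lead n G s c'" "z \<otimes> G xs = F xs"
        using k(1) unfolding wrel_def by auto
      have cK: "c \<in> K" "c \<noteq> \<zero>" "c' \<in> K" "c' \<noteq> \<zero>" using 1 unfolding lead_def by auto
      let ?a = "c \<otimes> inv c'"
      have a: "?a \<in> K" "?a \<noteq> \<zero>" using cK inv_nz[of c'] by (auto simp: integral_iff)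
      have "?a \<otimes> c' = c" using cK inv_nz[of c'] by (simp add: m_assoc)
      then have "lead n (\<lambda>v. ?a \<otimes> G v) s c" using lead_smult[OF 1(2) a] by simp
      from lead_diff[OF 1(1) this] have P: "(\<lambda>v. F v \<ominus> ?a \<otimes> G v) \<in> Pol n s" .
      have Gc: "G xs \<in> carrier E" using 1 lead_carr by blast
      have eq: "(z \<ominus> ?a) \<otimes> G xs = F xs \<ominus> ?a \<otimes> G xs"
        unfolding 1(3)[symmetric] using zc a(1) Gc K_carr[OF a(1)] by algebra
      have "z \<ominus> ?a \<in> nonunits Vinf"
      proof (cases "z \<ominus> ?a = \<zero>")
        case True
        then show ?thesis using zero by simp
      next
        case False
        then have "F xs \<ominus> ?a \<otimes> G xs \<noteq> \<zero>"
          unfolding eq[symmetric] using zc a Gc lead_nonzero[OF 1(2)] by (simp add: integral_iff)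
        then obtain s0 d where "s0 < s" "lead n (\<lambda>v. F v \<ominus> ?a \<otimes> G v) s0 d"
          using Pol_nonzero_lead[OF P] by blast
        then have "wrel (z \<ominus> ?a) (int s0 - int s)" unfolding wrel_def using 1(2) eq zc a
          by (intro conjI exI[of _ "\<lambda>v. F v \<ominus> ?a \<otimes> G v"] exI[of _ G] exI[of _ s0] exI[of _ s]) auto
        then show ?thesis using Vinf_nonunits \<open>s0 < s\<close> by simp
      qed
      then show ?thesis using a by blast
    qed
  qed
qed

lemma Pinf_rational: "rational_place K E Pinf"
  unfolding Pinf_def by (rule rational_placeI[OF Vinf_valuation Vinf_residue])

text \<open>Together with \<open>nonunits_root\<close> this allows monomials to be compared after
  raising them to a power, which is how their poles will be expressed through
  \<open>x1\<close>.\<close>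

lemma vunits_root:
  assumes V: "valuation_ring K E V" and a: "a \<in> carrier E" "a [^] h \<in> vunits V" and h: "0 < (h::nat)"
  shows "a \<in> vunits V"
proof -
  note V' = valuation_ringD[OF V]
  have a0: "a \<noteq> \<zero>" using a h by (auto simp: vunits_def nat_pow_zero)
  have *: "a \<in> V" if "a \<in> carrier E" "a \<noteq> \<zero>" "a [^] h \<in> vunits V" for a
  proof (rule ccontr)
    assume na: "a \<notin> V"
    then have i: "inv a \<in> V" using V'(5) that by blast
    then have "inv a \<in> nonunits V" using na that by (simp add: nonunits_def inv_inv')
    then have "inv a [^] h \<in> nonunits V"
    proof -
      obtain k where k: "h = Suc k" using h by (cases h) auto
      have "inv a \<otimes> inv a [^] k \<in> nonunits V"
        by (rule nonunits_mult[OF V'(1) \<open>inv a \<in> nonunits V\<close> subring_pow[OF V'(1) i]])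
      then show ?thesis using that inv_nz[of a] by (simp add: k m_comm)
    qed
    from nonunits_mult[OF V'(1) this, of "a [^] h"] have "inv a [^] h \<otimes> a [^] h \<in> nonunits V"
      using that by (simp add: vunits_def)
    moreover have "inv a [^] h \<otimes> a [^] h = \<one>"
      using that inv_nz[of a] nat_pow_distrib[of "inv a" a h] by simp
    ultimately show False using subringE(3)[OF V'(1)] by (simp add: nonunits_def)
  qed
  have "inv (a [^] h) = inv a [^] h"
    using a a0 inv_nz[of a] nat_pow_distrib[of a "inv a" h] by (intro comm_inv_char) auto
  then have "inv a [^] h \<in> vunits V" using vunits_inv[OF V'(1) a(2)] by simp
  then show ?thesis using *[OF a(1) a0 a(2)] *[of "inv a"] a0 a inv_nz[of a] by (simp add: vunits_def)
qed

lemma nonunits_root: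
  assumes V: "valuation_ring K E V" and a: "a \<in> carrier E" "a [^] h \<in> nonunits V" and h: "0 < (h::nat)"
  shows "a \<in> nonunits V"
proof (cases "a = \<zero>")
  case True
  then show ?thesis using subringE(2)[OF valuation_ringD(1)[OF V]] by (simp add: nonunits_def)
next
  case False
  note V' = valuation_ringD[OF V]
  have "a \<in> V"
  proof (rule ccontr)
    assume na: "a \<notin> V"
    then have i: "inv a \<in> V" using V'(5) a False by blast
    have "a [^] h \<otimes> inv a [^] h \<in> nonunits V" by (rule nonunits_mult[OF V'(1) a(2) subring_pow[OF V'(1) i]])
    moreover have "a [^] h \<otimes> inv a [^] h = \<one>"
      using a False inv_nz[of a] nat_pow_distrib[of a "inv a" h] by simp
    ultimately show False using subringE(3)[OF V'(1)] by (simp add: nonunits_def)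
  qed
  moreover have "a \<notin> vunits V"
    using vunits_pow[OF V'(1), of a h] vunits_iff[of "a [^] h" V] a(2) by (auto simp: nonunits_def)
  ultimately show ?thesis using vunits_iff by blast
qed

definition assoc_in :: "'a set \<Rightarrow> 'a \<Rightarrow> 'a \<Rightarrow> bool" where
  "assoc_in V a b \<longleftrightarrow> (\<exists>u\<in>vunits V. a = b \<otimes> u)"

lemma assoc_refl: "subring V E \<Longrightarrow> a \<in> carrier E \<Longrightarrow> assoc_in V a a"
  unfolding assoc_in_def using vunits_one by (intro bexI[of _ \<one>]) auto

lemma vunits_carr: "subring V E \<Longrightarrow> u \<in> vunits V \<Longrightarrow> u \<in> carrier E"
  using subring_sub by (auto simp: vunits_def)

lemma assoc_mult:
  assumes V: "subring V E" and "assoc_in V a b" "assoc_in V a' b'" "b \<in> carrier E" "b' \<in> carrier E"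
  shows "assoc_in V (a \<otimes> a') (b \<otimes> b')"
proof -
  obtain u u' where u: "u \<in> vunits V" "u' \<in> vunits V" "a = b \<otimes> u" "a' = b' \<otimes> u'"
    using assms unfolding assoc_in_def by blast
  have "u \<in> carrier E" "u' \<in> carrier E" using u vunits_carr[OF V] by auto
  then have "a \<otimes> a' = (b \<otimes> b') \<otimes> (u \<otimes> u')" unfolding u(3,4) using assms(4,5) by algebra
  then show ?thesis unfolding assoc_in_def using u vunits_mult[OF V] by blast
qed

lemma assoc_trans:
  assumes V: "subring V E" and "assoc_in V a b" "assoc_in V b c" "c \<in> carrier E"
  shows "assoc_in V a c"
proof -
  obtain u u' where u: "u \<in> vunits V" "u' \<in> vunits V" "a = b \<otimes> u" "b = c \<otimes> u'"
    using assms unfolding assoc_in_def by blast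
  have "u \<in> carrier E" "u' \<in> carrier E" using u vunits_carr[OF V] by auto
  then have "a = c \<otimes> (u' \<otimes> u)" unfolding u(3,4) using assms(4) by algebra
  then show ?thesis unfolding assoc_in_def using u vunits_mult[OF V] by blast
qed

lemma assoc_pow:
  assumes V: "subring V E" and "assoc_in V a b" "b \<in> carrier E"
  shows "assoc_in V (a [^] (k::nat)) (b [^] k)"
  by (induction k) (use assms assoc_mult[OF V] assoc_refl[OF V] in auto)

text \<open>At a pole of z the term y^\<kappa> dominates y: the factor 1 + y^(1-\<kappa>) is a unit
  because y has a pole as well and \<kappa> is at least 2. In the proof \<open>k\<close> is \<kappa>
  - 2.\<close>

lemma tower_pole:
  assumes V: "valuation_ring K E V" and c: "y \<in> carrier E" "z \<in> carrier E"
    and rel: "y [^] \<kappa> \<oplus> y = z [^] Suc \<kappa>" and z: "z \<notin> V"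
  shows "y \<notin> V" "assoc_in V (y [^] \<kappa>) (z [^] Suc \<kappa>)"
proof -
  note V' = valuation_ringD[OF V]
  have z0: "z \<noteq> \<zero>" using z subringE(2)[OF V'(1)] by blast
  have iz: "inv z \<in> V" using V'(5) c z z0 by blast
  show yV: "y \<notin> V"
  proof
    assume "y \<in> V"
    then have "z [^] Suc \<kappa> \<in> V" using rel[symmetric] subringE(7)[OF V'(1)] subring_pow[OF V'(1)] by simp
    then have "z [^] Suc \<kappa> \<otimes> inv z [^] \<kappa> \<in> V" using iz subringE(6)[OF V'(1)] subring_pow[OF V'(1)] by blast
    moreover have "z [^] Suc \<kappa> \<otimes> inv z [^] \<kappa> = z \<otimes> (z [^] \<kappa> \<otimes> inv z [^] \<kappa>)"
      using c inv_nz[OF c(2) z0] by (simp add: m_ac)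
    moreover have "z [^] \<kappa> \<otimes> inv z [^] \<kappa> = \<one>"
      using c z0 inv_nz[of z] nat_pow_distrib[of z "inv z" \<kappa>] by simp
    ultimately show False using z c by simp
  qed
  have y0: "y \<noteq> \<zero>" using yV subringE(2)[OF V'(1)] by blast
  have iy: "inv y \<in> V" "inv y \<in> carrier E" using V'(5) c yV y0 inv_nz[OF c(1) y0] by auto
  then have iyN: "inv y \<in> nonunits V" using yV y0 c by (simp add: nonunits_def inv_inv')
  obtain k where k: "\<kappa> = Suc (Suc k)" using kappa_gt_1 by (metis One_nat_def less_iff_Suc_add add_Suc_right add_Suc plus_nat.add_0)
  have "inv y \<otimes> inv y [^] k \<in> nonunits V" by (rule nonunits_mult[OF V'(1) iyN subring_pow[OF V'(1) iy(1)]])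
  then have u: "\<one> \<oplus> inv y \<otimes> inv y [^] k \<in> vunits V"
    by (rule vunits_add_nonunits[OF V vunits_one[OF V'(1)]])
  have "y [^] \<kappa> \<otimes> (inv y \<otimes> inv y [^] k) = y"
  proof -
    have "y [^] \<kappa> \<otimes> (inv y \<otimes> inv y [^] k) = y \<otimes> ((y \<otimes> inv y) \<otimes> (y [^] k \<otimes> inv y [^] k))"
      using c iy(2) by (simp add: k m_ac)
    also have "y [^] k \<otimes> inv y [^] k = \<one>"
      using c y0 inv_nz[of y] nat_pow_distrib[of y "inv y" k] by simp
    finally show ?thesis using c y0 inv_nz[of y] by simp
  qed
  then have eq: "z [^] Suc \<kappa> = y [^] \<kappa> \<otimes> (\<one> \<oplus> inv y \<otimes> inv y [^] k)"
    unfolding rel[symmetric] using c iy(2) by (simp add: r_distr)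
  have "y [^] \<kappa> = z [^] Suc \<kappa> \<otimes> inv (\<one> \<oplus> inv y \<otimes> inv y [^] k)"
    unfolding eq using vunits_carr[OF V'(1) u] u inv_nz[of "\<one> \<oplus> inv y \<otimes> inv y [^] k"] c
    by (simp add: m_assoc vunits_def)
  then show "assoc_in V (y [^] \<kappa>) (z [^] Suc \<kappa>)"
    unfolding assoc_in_def using vunits_inv[OF V'(1) u] by blast
qed

end

section \<open>The remaining places and the Riemann--Roch spaces\<close>

context hermitian begin

text \<open>Climbing i steps from x_1, the power \<kappa>^i of the coordinate is the power
  (\<kappa>+1)^i of \<open>x1\<close> up to units. The exponent \<kappa>^(length - 1) clears the
  denominators of all coordinates at once and turns a monomial into \<open>x1\<close> to the power
  of its weight; this is the origin of the weights.\<close>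

lemma tmon_pole_aux:
  assumes V: "valuation_ring K E V" and x1V: "x1 \<notin> V"
    and "ys \<noteq> []" "herm E \<kappa> ys" "set ys \<subseteq> carrier E" "last ys = x1"
  shows "hd ys \<notin> V \<and> assoc_in V (hd ys [^] (\<kappa> ^ (length ys - 1))) (x1 [^] (Suc \<kappa> ^ (length ys - 1))) \<and>
    (\<forall>ds. length ds = length ys \<longrightarrow> assoc_in V (tmon E ds ys [^] (\<kappa> ^ (length ys - 1))) (x1 [^] W ds))"
  using assms(3-6)
proof (induction ys)
  case (Cons y ys)
  note V' = valuation_ringD[OF V]
  show ?case
  proof (cases ys)
    case Nil
    have "assoc_in V (tmon E ds (y # ys)) (x1 [^] W ds)" if "length ds = length (y # ys)" for ds
      using that Nil Cons.prems assoc_refl[OF V'(1)] by (cases ds) auto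
    then show ?thesis using Nil Cons.prems x1V assoc_refl[OF V'(1) x1_carr] tmon_closed[of "[x1]"] by simp
  next
    case (Cons z zs)
    define k where "k = length zs"
    have c: "y \<in> carrier E" "z \<in> carrier E" and ysc: "set ys \<subseteq> carrier E"
      and rel: "y [^] \<kappa> \<oplus> y = z [^] Suc \<kappa>"
      using Cons.prems Cons by auto
    have IH: "z \<notin> V" "assoc_in V (z [^] (\<kappa> ^ k)) (x1 [^] (Suc \<kappa> ^ k))"
      "\<And>ds. length ds = Suc k \<Longrightarrow> assoc_in V (tmon E ds ys [^] (\<kappa> ^ k)) (x1 [^] W ds)"
      using Cons.IH Cons.prems Cons by (auto simp: k_def)
    note tp = tower_pole[OF V c rel IH(1)]
    have "assoc_in V ((y [^] \<kappa>) [^] (\<kappa> ^ k)) ((z [^] Suc \<kappa>) [^] (\<kappa> ^ k))"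
      using c by (intro assoc_pow[OF V'(1) tp(2)]) auto
    moreover have "assoc_in V ((z [^] (\<kappa> ^ k)) [^] Suc \<kappa>) ((x1 [^] (Suc \<kappa> ^ k)) [^] Suc \<kappa>)"
      by (intro assoc_pow[OF V'(1) IH(2)]) auto
    ultimately have "assoc_in V (y [^] (\<kappa> ^ Suc k)) (x1 [^] (Suc \<kappa> ^ Suc k))"
      using c assoc_trans[OF V'(1)] by (simp only: nat_pow_pow x1_carr) (metis mult.commute nat_pow_closed power_Suc x1_carr)
    note hd = this
    have "assoc_in V (tmon E ds (y # ys) [^] (\<kappa> ^ Suc k)) (x1 [^] W ds)"
      if len: "length ds = length (y # ys)" for ds
    proof -
      obtain d ds' where ds: "ds = d # ds'" "length ds' = Suc k" using len Cons by (cases ds) (auto simp: k_def)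
      have tc: "tmon E ds' ys \<in> carrier E" using ysc by (rule tmon_closed)
      have A: "assoc_in V ((y [^] (\<kappa> ^ Suc k)) [^] d) ((x1 [^] (Suc \<kappa> ^ Suc k)) [^] d)"
        by (intro assoc_pow[OF V'(1) hd]) auto
      have B: "assoc_in V ((tmon E ds' ys [^] (\<kappa> ^ k)) [^] \<kappa>) ((x1 [^] W ds') [^] \<kappa>)"
        by (intro assoc_pow[OF V'(1) IH(3)] ds) auto
      have "tmon E ds (y # ys) [^] (\<kappa> ^ Suc k) = (y [^] d) [^] (\<kappa> ^ Suc k) \<otimes> tmon E ds' ys [^] (\<kappa> ^ Suc k)"
        using c tc by (simp add: ds nat_pow_distrib del: power_Suc)
      also have "(y [^] d) [^] (\<kappa> ^ Suc k) = (y [^] (\<kappa> ^ Suc k)) [^] d"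
        using c by (simp only: nat_pow_pow mult.commute)
      also have "tmon E ds' ys [^] (\<kappa> ^ Suc k) = (tmon E ds' ys [^] (\<kappa> ^ k)) [^] \<kappa>"
        using tc by (simp only: nat_pow_pow power_Suc mult.commute)
      finally have L: "tmon E ds (y # ys) [^] (\<kappa> ^ Suc k) =
        (y [^] (\<kappa> ^ Suc k)) [^] d \<otimes> (tmon E ds' ys [^] (\<kappa> ^ k)) [^] \<kappa>" .
      have "x1 [^] W ds = x1 [^] (Suc \<kappa> ^ Suc k * d) \<otimes> x1 [^] (W ds' * \<kappa>)"
        by (simp add: ds nat_pow_mult mult.commute)
      then have R: "x1 [^] W ds = (x1 [^] (Suc \<kappa> ^ Suc k)) [^] d \<otimes> (x1 [^] W ds') [^] \<kappa>"
        by (simp only: nat_pow_pow x1_carr)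
      show ?thesis unfolding L R by (intro assoc_mult[OF V'(1) A B]) auto
    qed
    then show ?thesis using hd tp Cons by (simp add: k_def)
  qed
qed simp

lemma tmon_pole:
  assumes "valuation_ring K E V" "x1 \<notin> V" "length ds = n"
  shows "assoc_in V (tmon E ds xs [^] (\<kappa> ^ (n - 1))) (x1 [^] W ds)"
  using tmon_pole_aux[OF assms(1,2) xs_ne xs_herm xs_carr x1_def[symmetric]] assms(3) xs_len by auto

lemma tmon_xs_nz: "length ds = n \<Longrightarrow> tmon E ds xs \<in> carrier E \<and> tmon E ds xs \<noteq> \<zero>"
  using lead_nonzero[OF lead_tmon] xs_carr tmon_closed by blast

text \<open>With h = \<kappa>^(n-1), the power h of the quotient is a unit times a power of the
  inverse of \<open>x1\<close>, with the difference of the weights as exponent. The root lemmas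
  carry this back to the quotient itself.\<close>

lemma tmon_ratio:
  assumes V: "valuation_ring K E V" "x1 \<notin> V" and ds: "length ds = n" "length es = n" and le: "W ds \<le> W es"
  shows "tmon E ds xs \<otimes> inv (tmon E es xs) \<in> (if W ds = W es then vunits V else nonunits V)"
proof -
  note V' = valuation_ringD[OF V(1)]
  define h where "h = \<kappa> ^ (n - 1)"
  have h: "0 < h" using kappa_gt_1 by (simp add: h_def)
  define a where "a = tmon E ds xs" define b where "b = tmon E es xs"
  have c: "a \<in> carrier E" "b \<in> carrier E" "a \<noteq> \<zero>" "b \<noteq> \<zero>" using tmon_xs_nz ds by (auto simp: a_def b_def)
  obtain u where u: "u \<in> vunits V" "a [^] h = x1 [^] W ds \<otimes> u"
    using tmon_pole[OF V ds(1)] unfolding assoc_in_def a_def h_def by blast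
  obtain v where v: "v \<in> vunits V" "b [^] h = x1 [^] W es \<otimes> v"
    using tmon_pole[OF V ds(2)] unfolding assoc_in_def b_def h_def by blast
  have uc: "u \<in> carrier E" "v \<in> carrier E" "v \<noteq> \<zero>" "u \<noteq> \<zero>"
    using u v vunits_carr[OF V'(1)] by (auto simp: vunits_def)
  have x10: "x1 \<noteq> \<zero>" using V(2) subringE(2)[OF V'(1)] by metis
  have ix: "inv x1 \<in> V" using V'(5)[OF x1_carr x10] V(2) by blast
  then have ixN: "inv x1 \<in> nonunits V" using V(2) x10 by (simp add: nonunits_def inv_inv')
  note ixc = inv_nz[OF x1_carr x10]
  let ?m = "W es - W ds"
  have iv: "inv v \<in> carrier E" using inv_nz uc by blast
  have "b [^] h = a [^] h \<otimes> (x1 [^] ?m \<otimes> (v \<otimes> inv u))"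
  proof -
    have "b [^] h = (x1 [^] W ds \<otimes> x1 [^] ?m) \<otimes> v" using le v by (simp add: nat_pow_mult)
    also have "\<dots> = (x1 [^] W ds \<otimes> u) \<otimes> (x1 [^] ?m \<otimes> (v \<otimes> inv u))"
    proof -
      have "(x1 [^] W ds \<otimes> u) \<otimes> (x1 [^] ?m \<otimes> (v \<otimes> inv u)) = ((x1 [^] W ds \<otimes> x1 [^] ?m) \<otimes> v) \<otimes> (u \<otimes> inv u)"
        using uc(1,2) inv_nz(1)[OF uc(1,4)] nat_pow_closed[OF x1_carr, of "W ds"] nat_pow_closed[OF x1_carr, of ?m]
        by algebra
      then show ?thesis using uc inv_nz(2)[OF uc(1,4)] by simp
    qed
    finally show ?thesis by (simp add: u)
  qed
  define e where "e = inv x1 [^] ?m \<otimes> (u \<otimes> inv v)"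
  have ec: "e \<in> carrier E" using uc iv ixc by (simp add: e_def)
  have "(a \<otimes> inv b) [^] h \<otimes> b [^] h = e \<otimes> b [^] h"
  proof -
    have "(a \<otimes> inv b) [^] h \<otimes> b [^] h = a [^] h"
    proof -
      have "(a \<otimes> inv b) [^] h \<otimes> b [^] h = ((a \<otimes> inv b) \<otimes> b) [^] h"
        using c inv_nz[of b] by (intro nat_pow_distrib[symmetric]) auto
      moreover have "(a \<otimes> inv b) \<otimes> b = a" using c inv_nz[of b] by (simp add: m_assoc)
      ultimately show ?thesis by simp
    qed
    moreover have "e \<otimes> b [^] h = a [^] h"
    proof -
      have "e \<otimes> b [^] h = (inv x1 [^] ?m \<otimes> x1 [^] ?m) \<otimes> (inv v \<otimes> v) \<otimes> (x1 [^] W ds \<otimes> u)"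
      proof -
        have "b [^] h = (x1 [^] W ds \<otimes> x1 [^] ?m) \<otimes> v" using le v by (simp add: nat_pow_mult)
        then show ?thesis unfolding e_def
          using uc(1,2) iv nat_pow_closed[OF ixc(1), of ?m] nat_pow_closed[OF x1_carr, of "W ds"] nat_pow_closed[OF x1_carr, of ?m]
          by algebra
      qed
      also have "inv x1 [^] ?m \<otimes> x1 [^] ?m = \<one>" using ixc nat_pow_distrib[of "inv x1" x1 ?m] by simp
      finally show ?thesis using uc inv_nz[of v] u by simp
    qed
    ultimately show ?thesis by simp
  qed
  moreover have "b [^] h \<noteq> \<zero>" using pow_eq_zero c by blast
  ultimately have eq: "(a \<otimes> inv b) [^] h = e"
    using m_rcancel[of "b [^] h" "(a \<otimes> inv b) [^] h" e] c ec inv_nz[of b] by simp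
  have uv: "u \<otimes> inv v \<in> vunits V" by (intro vunits_mult[OF V'(1)] u vunits_inv[OF V'(1)] v)
  have ab: "a \<otimes> inv b \<in> carrier E" using c inv_nz[of b] by simp
  show ?thesis
  proof (cases "W ds = W es")
    case True
    then have "(a \<otimes> inv b) [^] h \<in> vunits V" unfolding eq e_def using uv uc iv by simp
    then show ?thesis using vunits_root[OF V(1) ab _ h] True by (simp add: a_def b_def)
  next
    case False
    then obtain m where m: "?m = Suc m" using le by (metis Suc_diff_Suc le_neq_implies_less)
    have "inv x1 \<otimes> (inv x1 [^] m \<otimes> (u \<otimes> inv v)) \<in> nonunits V"
      using uv subringE(6)[OF V'(1) subring_pow[OF V'(1) ix]]
      by (intro nonunits_mult[OF V'(1) ixN]) (simp add: vunits_def)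
    also have "inv x1 \<otimes> (inv x1 [^] m \<otimes> (u \<otimes> inv v)) = e"
      unfolding e_def m using ixc uc iv by (simp add: m_ac)
    finally have "(a \<otimes> inv b) [^] h \<in> nonunits V" unfolding eq .
    then show ?thesis using nonunits_root[OF V(1) ab _ h] False by (simp add: a_def b_def)
  qed
qed

lemma Pol_pole:
  assumes V: "valuation_ring K E V" "x1 \<notin> V" and es: "length es = n"
  shows "F \<in> Pol n (W es) \<Longrightarrow> F xs \<otimes> inv (tmon E es xs) \<in> nonunits V"
proof (induction rule: Pol.induct)
  case (zero F)
  note V' = valuation_ringD[OF V(1)]
  show ?case using zero[OF xs] subringE(2)[OF V'(1)] tmon_xs_nz[OF es] inv_nz[of "tmon E es xs"] by (simp add: nonunits_def)
next
  case (step c ds G F)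
  note V' = valuation_ringD[OF V(1)]
  let ?b = "inv (tmon E es xs)"
  have 0: "tmon E ds xs \<otimes> ?b \<in> nonunits V" using tmon_ratio[OF V step(2) es] step(3) by simp
  then have 1: "(tmon E ds xs \<otimes> ?b) \<otimes> c \<in> nonunits V"
    using step(1) V'(2) by (intro nonunits_mult[OF V'(1) 0]) auto
  have "c \<in> carrier E" "tmon E ds xs \<in> carrier E" "G xs \<in> carrier E" "?b \<in> carrier E"
    using step xs tmon_xs_nz[OF es] inv_nz[of "tmon E es xs"] by (auto simp: Pol_closed)
  then have "F xs \<otimes> ?b = (tmon E ds xs \<otimes> ?b) \<otimes> c \<oplus> G xs \<otimes> ?b"
    unfolding step(5)[OF xs] by algebra
  then show ?case using nonunits_add[OF V(1) 1 step.IH] by simp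
qed

lemma lead_pole:
  assumes V: "valuation_ring K E V" "x1 \<notin> V" and L: "lead n F (W es) c" and es: "length es = n"
  shows "F xs \<otimes> inv (tmon E es xs) \<in> vunits V"
proof -
  note V' = valuation_ringD[OF V(1)]
  have c: "c \<in> K" "c \<noteq> \<zero>" using L unfolding lead_def by auto
  define b where "b = tmon E es xs"
  have b: "b \<in> carrier E" "b \<noteq> \<zero>" using tmon_xs_nz[OF es] by (auto simp: b_def)
  note ib = inv_nz[OF b]
  have N: "(F xs \<ominus> c \<otimes> b) \<otimes> inv b \<in> nonunits V"
    using Pol_pole[OF V es lead_any[OF L es refl]] by (simp add: b_def)
  have cl: "c \<in> carrier E" "F xs \<in> carrier E" using c lead_carr[OF L] by auto
  have "F xs \<otimes> inv b = c \<otimes> (b \<otimes> inv b) \<oplus> (F xs \<ominus> c \<otimes> b) \<otimes> inv b"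
    using cl b(1) ib(1) by algebra
  also have "c \<otimes> (b \<otimes> inv b) = c" using ib cl by simp
  finally show ?thesis
    using vunits_add_nonunits[OF V(1) vunits_K[OF V'(1,2) c] N] by (simp add: b_def)
qed

text \<open>Such a V compares monomials by weight, and by \<open>lead_pole\<close> a function
  differs from its leading monomial by a unit of V. Membership of a fraction in V is then decided by
  the two leading weights, just as for \<open>Vinf\<close>.\<close>

lemma valuation_ring_at_infinity:
  assumes V: "valuation_ring K E V" "x1 \<notin> V"
  shows "V = Vinf"
proof -
  note V' = valuation_ringD[OF V(1)]
  have *: "z \<in> (if k = 0 then vunits V else nonunits V)" if w: "wrel z k" "k \<le> 0" for z k
  proof -
    obtain F G s s' c c' where 1: "lead n F s c" "lead n G s' c'" "z \<otimes> G xs = F xs" "k = int s - int s'"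
      and z: "z \<in> carrier E" using w unfolding wrel_def by blast
    obtain ds where ds: "length ds = n" "W ds = s" using 1 unfolding lead_def by blast
    obtain es where es: "length es = n" "W es = s'" using 1 unfolding lead_def by blast
    define a where "a = tmon E ds xs" define b where "b = tmon E es xs"
    have c: "a \<in> carrier E" "b \<in> carrier E" "a \<noteq> \<zero>" "b \<noteq> \<zero>" "F xs \<in> carrier E" "G xs \<in> carrier E" "F xs \<noteq> \<zero>" "G xs \<noteq> \<zero>"
      using tmon_xs_nz ds es lead_carr 1 lead_nonzero by (auto simp: a_def b_def)
    have A: "F xs \<otimes> inv a \<in> vunits V" using lead_pole[OF V _ ds(1)] 1 ds by (simp add: a_def)
    have B: "G xs \<otimes> inv b \<in> vunits V" using lead_pole[OF V _ es(1)] 1 es by (simp add: b_def)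
    have C: "a \<otimes> inv b \<in> (if k = 0 then vunits V else nonunits V)"
      using tmon_ratio[OF V ds(1) es(1)] 1 w ds es by (auto simp: a_def b_def)
    note i = inv_nz[OF c(1,3)] inv_nz[OF c(2,4)] inv_nz[OF c(6,8)]
    have "z = F xs \<otimes> inv (G xs)" using 1(3)[symmetric] z c i by (simp add: m_assoc)
    also have "\<dots> = (a \<otimes> inv b) \<otimes> ((F xs \<otimes> inv a) \<otimes> inv (G xs \<otimes> inv b))"
    proof -
      have "(a \<otimes> inv b) \<otimes> ((F xs \<otimes> inv a) \<otimes> inv (G xs \<otimes> inv b))
        = (a \<otimes> inv b) \<otimes> ((F xs \<otimes> inv a) \<otimes> (inv (G xs) \<otimes> b))"
        using c i by (simp add: inv_mult inv_inv')
      also have "\<dots> = (F xs \<otimes> inv (G xs)) \<otimes> (a \<otimes> inv a) \<otimes> (b \<otimes> inv b)"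
        using c(1,2,5) i(1,5,9) by algebra
      finally show ?thesis using c i by simp
    qed
    finally have z: "z = (a \<otimes> inv b) \<otimes> ((F xs \<otimes> inv a) \<otimes> inv (G xs \<otimes> inv b))" .
    have u: "(F xs \<otimes> inv a) \<otimes> inv (G xs \<otimes> inv b) \<in> vunits V"
      by (intro vunits_mult[OF V'(1) A] vunits_inv[OF V'(1) B])
    show ?thesis
    proof (cases "k = 0")
      case True
      then show ?thesis using C vunits_mult[OF V'(1) _ u] z by simp
    next
      case False
      then show ?thesis using C nonunits_mult[OF V'(1), of "a \<otimes> inv b"] u z by (simp add: vunits_def)
    qed
  qed
  have sub: "z \<in> V" if "wrel z k" "k \<le> 0" for z k
    using *[OF that] by (auto simp: vunits_def nonunits_def split: if_splits)
  show ?thesis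
  proof
    show "Vinf \<subseteq> V" using sub subringE(2)[OF V'(1)] by (auto simp: Vinf_def)
    show "V \<subseteq> Vinf"
    proof
      fix z assume z: "z \<in> V"
      show "z \<in> Vinf"
      proof (rule ccontr)
        assume nz: "z \<notin> Vinf"
        then have z0: "z \<in> carrier E" "z \<noteq> \<zero>" using z V'(4) by (auto simp: Vinf_def)
        obtain k where k: "wrel z k" using wrel_ex[OF z0] by blast
        then have "k > 0" using nz Vinf_iff by force
        then have "inv z \<in> nonunits V" using *[OF wrel_inv[OF k]] by simp
        then show False using z z0 by (simp add: nonunits_def inv_inv' inv_nz)
      qed
    qed
  qed
qed

text \<open>A common frame for the valuation rings that contain \<open>x1\<close> and for the
  localisations of \<open>R\<close>: a nonunit from \<open>R\<close> behaves as if it lay in the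
  radical of A. One argument then shows that both kinds are discrete.\<close>

definition loc_units :: "'a set \<Rightarrow> bool" where
  "loc_units A \<longleftrightarrow> subring A E \<and> R \<subseteq> A \<and> (\<forall>a\<in>R. a \<notin> vunits A \<longrightarrow> (\<forall>b\<in>R. \<one> \<ominus> a \<otimes> b \<in> vunits A))"

text \<open>By \<open>frobenius_R\<close> the product of a and 1 - a^(q^t - 1) is a multiple of
  \<open>D s\<close>, and the second factor is a unit of A since a is not.\<close>

lemma local_step:
  assumes A: "loc_units A" and s: "0 < s"
    and a: "a \<in> R" "a \<notin> vunits A"
  shows "\<exists>w\<in>R. \<exists>u\<in>vunits A. a = D s \<otimes> w \<otimes> u"
proof -
  have sA: "subring A E" using A by (simp add: loc_units_def)
  obtain t where t: "t > 0" "\<And>z. z \<in> R \<Longrightarrow> cong_D s (z [^] (q ^ t)) z" using frobenius_R[OF s] by blast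
  obtain w where w: "w \<in> R" "a [^] (q ^ t) \<ominus> a = D s \<otimes> w" using t(2)[OF a(1)] unfolding cong_D_def by blast
  have "1 < q ^ t" using one_less_power[OF q_gt_1 t(1)] .
  then obtain k where k: "q ^ t = Suc (Suc k)" using le_Suc_ex[of 2 "q ^ t"] by auto
  define e where "e = \<one> \<ominus> a \<otimes> a [^] k"
  have e: "e \<in> vunits A" using A a by (simp add: loc_units_def e_def)
  have ec: "e \<in> carrier E" "e \<noteq> \<zero>" using e vunits_carr[OF sA] by (auto simp: vunits_def)
  have c: "a \<in> carrier E" "a [^] k \<in> carrier E" "w \<in> carrier E" "D s \<in> carrier E" using a w by auto
  have "D s \<otimes> w = a [^] k \<otimes> a \<otimes> a \<ominus> a" using w(2) k by simp
  moreover have "a \<otimes> e = \<ominus> (a [^] k \<otimes> a \<otimes> a \<ominus> a)" unfolding e_def using c(1,2) by algebra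
  ultimately have "a \<otimes> e = D s \<otimes> (\<ominus> w)" using c by (simp only: r_minus)
  then have "a = D s \<otimes> (\<ominus> w) \<otimes> inv e"
    using c ec inv_nz[OF ec] m_assoc[of a e "inv e"] by simp
  then show ?thesis using w vunits_inv[OF sA e] by (intro bexI[of _ "\<ominus> w"] bexI[of _ "inv e"]) auto
qed

text \<open>Repeating \<open>local_step\<close> either ends with a power of \<open>D s\<close> times
  a unit or shows that a is divisible by every power of \<open>D s\<close>. The second case is
  impossible. Indeed a divides some power D s'^l, where \<open>D s'\<close> is again a nonunit, and
  \<open>local_step\<close> applied to \<open>D s\<close> itself shows that \<open>D s'\<close>
  divides \<open>D s\<close>. So D s'^(l+1) would divide D s'^l.\<close>

lemma loc_units_dvr:
  assumes A: "loc_units A" and s: "0 < s" "D s \<notin> vunits A"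
  shows "dvr A (D s)"
proof -
  have sA: "subring A E" and RA: "R \<subseteq> A" using A by (auto simp: loc_units_def)
  have D0: "D s \<in> carrier E" "D s \<noteq> \<zero>" using D_nonzero s by auto
  have iter: "(\<exists>m::nat. \<exists>u\<in>vunits A. a = D s [^] m \<otimes> u) \<or> (\<exists>w\<in>R. \<exists>u\<in>vunits A. a = D s [^] k \<otimes> w \<otimes> u)"
    if a: "a \<in> R" for a and k :: nat
  proof (induction k)
    case 0
    show ?case using a vunits_one[OF sA] by (intro disjI2 bexI[of _ a] bexI[of _ \<one>]) auto
  next
    case (Suc k)
    then show ?case
    proof
      assume "\<exists>w\<in>R. \<exists>u\<in>vunits A. a = D s [^] k \<otimes> w \<otimes> u"
      then obtain w u where w: "w \<in> R" "u \<in> vunits A" "a = D s [^] k \<otimes> w \<otimes> u" by blast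
      have uc: "u \<in> carrier E" using w vunits_carr[OF sA] by blast
      show ?case
      proof (cases "w \<in> vunits A")
        case True
        then have "a = D s [^] k \<otimes> (w \<otimes> u)" using w uc D0 by (simp add: m_assoc)
        then show ?thesis using vunits_mult[OF sA True w(2)] by blast
      next
        case False
        obtain w' u' where w': "w' \<in> R" "u' \<in> vunits A" "w = D s \<otimes> w' \<otimes> u'"
          using local_step[OF A s(1) w(1) False] by blast
        have u'c: "u' \<in> carrier E" using w' vunits_carr[OF sA] by blast
        have "a = D s [^] Suc k \<otimes> w' \<otimes> (u' \<otimes> u)"
          using w(3) w' uc u'c D0 by (simp add: m_ac)
        then show ?thesis using vunits_mult[OF sA w'(2) w(2)] w'(1) by blast
      qed
    qed blast
  qed
  have nat: "\<exists>m::nat. \<exists>u\<in>vunits A. a = D s [^] m \<otimes> u" if a: "a \<in> R" "a \<noteq> \<zero>" for a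
  proof (rule ccontr)
    assume no: "\<not> (\<exists>m::nat. \<exists>u\<in>vunits A. a = D s [^] m \<otimes> u)"
    obtain s' l w' where s': "s' > 0" "w' \<in> R" "D s' [^] (l::nat) = a \<otimes> w'" using R_divides[OF a] by blast
    obtain w u where w: "w \<in> R" "u \<in> vunits A" "a = D s [^] Suc l \<otimes> w \<otimes> u" using iter[OF a(1), of "Suc l"] no by blast
    have uc: "u \<in> carrier E" "u \<in> A" using w vunits_carr[OF sA] by (auto simp: vunits_def)
    have "D s' \<notin> vunits A"
    proof
      assume "D s' \<in> vunits A"
      then have "a \<otimes> w' \<in> vunits A" using vunits_pow[OF sA] s'(3) by metis
      then have "a \<in> vunits A" using vunits_factor[OF sA] a s' RA by blast
      moreover have "a = D s [^] (0::nat) \<otimes> a" using a by simp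
      ultimately show False using no by blast
    qed
    note ns' = this
    obtain v u' where v: "v \<in> R" "u' \<in> vunits A" "D s = D s' \<otimes> v \<otimes> u'"
      using local_step[OF A s'(1) D_R s(2)] by blast
    define e where "e = v \<otimes> u'"
    have u'c: "u' \<in> carrier E" "u' \<in> A" using v vunits_carr[OF sA] by (auto simp: vunits_def)
    have eA: "e \<in> A" "e \<in> carrier E" using v u'c RA subringE(6)[OF sA] by (auto simp: e_def)
    have De: "D s = D s' \<otimes> e" using v u'c by (simp add: e_def m_assoc)
    define f where "f = e [^] Suc l \<otimes> w \<otimes> u \<otimes> w'"
    have fA: "f \<in> A" unfolding f_def using w s' RA uc eA by (intro subringE(6)[OF sA] subring_pow[OF sA]) auto
    have fc: "f \<in> carrier E" using fA subring_sub[OF sA] by blast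
    have D'0: "D s' \<in> carrier E" "D s' \<noteq> \<zero>" using D_nonzero s' by auto
    have "D s' [^] l = D s' [^] Suc l \<otimes> f"
    proof -
      have "D s [^] Suc l = D s' [^] Suc l \<otimes> e [^] Suc l" unfolding De using D'0 eA by (intro nat_pow_distrib) auto
      moreover have "e [^] Suc l \<in> carrier E" "D s' [^] Suc l \<in> carrier E" "w \<in> carrier E" "w' \<in> carrier E"
        using nat_pow_closed[OF eA(2)] nat_pow_closed[OF D'0(1)] R_carr[OF w(1)] R_carr[OF s'(2)] by blast+
      ultimately show ?thesis unfolding s'(3) w(3) f_def using uc by (simp add: m_assoc del: nat_pow_Suc)
    qed
    then have "D s' [^] l \<otimes> \<one> = D s' [^] l \<otimes> (D s' \<otimes> f)" using D'0 fc by (simp add: m_assoc)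
    moreover have "D s' [^] l \<noteq> \<zero>" using pow_eq_zero D'0 by blast
    ultimately have "\<one> = D s' \<otimes> f" using m_lcancel[of "D s' [^] l" \<one> "D s' \<otimes> f"] D'0 fc by simp
    then have "D s' \<in> vunits A" using vunits_factor[OF sA subsetD[OF RA D_R] fA, of s'] vunits_one[OF sA] by simp
    then show False using ns' by blast
  qed
  have "\<exists>m::int. \<exists>u\<in>vunits A. z = D s [^] m \<otimes> u" if z: "z \<in> carrier E" "z \<noteq> \<zero>" for z
  proof -
    obtain a b where ab: "a \<in> R" "b \<in> R" "b \<noteq> \<zero>" "z \<otimes> b = a" using fraction[OF z(1)] by blast
    have "a \<noteq> \<zero>" using ab z by (auto simp: integral_iff)
    then obtain m u where m: "u \<in> vunits A" "a = D s [^] (m::nat) \<otimes> u" using nat ab by blast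
    obtain m' u' where m': "u' \<in> vunits A" "b = D s [^] (m'::nat) \<otimes> u'" using nat ab by blast
    have uc: "u \<in> carrier E" "u' \<in> carrier E" "u' \<noteq> \<zero>" using m m' vunits_carr[OF sA] by (auto simp: vunits_def)
    note i = inv_nz[OF uc(2,3)]
    have "(D s [^] (int m - int m') \<otimes> (u \<otimes> inv u')) \<otimes> b
        = (D s [^] (int m - int m') \<otimes> D s [^] int m') \<otimes> u \<otimes> (u' \<otimes> inv u')"
      unfolding m'(2) int_pow_int using D0 uc i(1) by (simp add: m_ac)
    also have "\<dots> = a" unfolding m(2) using ipow_add[OF D0, of "int m - int m'" "int m'"] D0 uc i by (simp add: int_pow_int)
    finally have "(D s [^] (int m - int m') \<otimes> (u \<otimes> inv u')) \<otimes> b = z \<otimes> b" by (simp add: ab)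
    then have "z = D s [^] (int m - int m') \<otimes> (u \<otimes> inv u')"
      using m_rcancel[of b z "D s [^] (int m - int m') \<otimes> (u \<otimes> inv u')"] ab z D0 uc i by simp
    then show ?thesis using vunits_mult[OF sA m(1) vunits_inv[OF sA m'(1)]] by blast
  qed
  then show ?thesis unfolding dvr_def using sA RA R_K D0 s(2) subsetD[OF RA D_R, of s] by (auto simp: vunits_def)
qed

text \<open>The coordinates are integral over K[x_1]. If y had a pole while z has none, multiplying
  the relation by y^(1-\<kappa>) would put y + y^(2-\<kappa>) into V; the second term lies in V
  since \<kappa> is at least 2, so y would lie there too.\<close>

lemma R_sub_valuation:
  assumes V: "valuation_ring K E V" and x1V: "x1 \<in> V" shows "R \<subseteq> V"
proof -
  note V' = valuation_ringD[OF V]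
  have *: "set ys \<subseteq> V" if "ys \<noteq> []" "herm E \<kappa> ys" "set ys \<subseteq> carrier E" "last ys = x1" for ys
    using that
  proof (induction ys)
    case (Cons y ys)
    show ?case
    proof (cases ys)
      case (Cons z zs)
      have IH: "set ys \<subseteq> V" using Cons.IH Cons.prems Cons by auto
      have rel: "y [^] \<kappa> \<oplus> y = z [^] Suc \<kappa>" and yc: "y \<in> carrier E" using Cons.prems Cons by auto
      have "y \<in> V"
      proof (rule ccontr)
        assume yV: "y \<notin> V"
        then have y0: "y \<noteq> \<zero>" using subringE(2)[OF V'(1)] by blast
        note i = inv_nz[OF yc y0]
        have iy: "inv y \<in> V" using V'(5)[OF yc y0] yV by blast
        then have iN: "inv y \<in> nonunits V" using yV yc y0 by (simp add: nonunits_def inv_inv')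
        obtain k where k: "\<kappa> = Suc (Suc k)" using kappa_gt_1 by (metis One_nat_def less_iff_Suc_add add_Suc_right add_Suc plus_nat.add_0)
        have zV: "z [^] Suc \<kappa> \<in> V" using IH Cons by (intro subring_pow[OF V'(1)]) auto
        have p1: "inv y [^] Suc k \<otimes> y [^] Suc k = \<one>"
          using nat_pow_distrib[OF i(1) yc, of "Suc k"] unfolding i(3) nat_pow_one by (rule sym)
        have "(y [^] \<kappa> \<oplus> y) \<otimes> inv y [^] Suc k = y \<oplus> inv y [^] k"
        proof -
          have "(y [^] \<kappa> \<oplus> y) \<otimes> inv y [^] Suc k = (inv y [^] Suc k \<otimes> y [^] Suc k) \<otimes> y \<oplus> inv y [^] k \<otimes> (inv y \<otimes> y)"
            using yc i(1) nat_pow_closed[OF i(1), of k] nat_pow_closed[OF yc, of k]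
            unfolding k nat_pow_Suc by algebra
          then show ?thesis unfolding p1 i(3) using l_one[OF yc] r_one[OF nat_pow_closed[OF i(1), of k]] by metis
        qed
        moreover have "(y [^] \<kappa> \<oplus> y) \<otimes> inv y [^] Suc k \<in> V" unfolding rel
          by (rule subringE(6)[OF V'(1) zV subring_pow[OF V'(1) iy]])
        ultimately have "y \<oplus> inv y [^] k \<in> V" by simp
        then have "(y \<oplus> inv y [^] k) \<oplus> (\<ominus> (inv y [^] k)) \<in> V"
          using subringE(5,7)[OF V'(1)] subring_pow[OF V'(1) iy] by blast
        moreover have "(y \<oplus> inv y [^] k) \<oplus> (\<ominus> (inv y [^] k)) = y"
          using yc i(1) nat_pow_closed[OF i(1), of k] by algebra
        ultimately show False using yV by simp
      qed
      then show ?thesis using IH Cons by auto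
    qed (use Cons.prems x1V in auto)
  qed simp
  have xsV: "set xs \<subseteq> V" by (rule *[OF xs_ne xs_herm xs_carr x1_def[symmetric]])
  have mon: "tmon E ds ys \<in> V" if "set ys \<subseteq> V" for ds ys
    using that
  proof (induction ds arbitrary: ys)
    case (Cons d ds)
    then show ?case using subringE(3)[OF V'(1)] by (cases ys) (auto intro!: subringE(6)[OF V'(1)] subring_pow[OF V'(1)])
  qed (use subringE(3)[OF V'(1)] in simp)
  have "F xs \<in> V" if "F \<in> Pol n m" for F m
    using that
  proof induction
    case (zero F)
    then show ?case using xs subringE(2)[OF V'(1)] by simp
  next
    case (step c ds G F)
    have "c \<otimes> tmon E ds xs \<oplus> G xs \<in> V"
      using step V'(2) by (intro subringE(7)[OF V'(1)] subringE(6)[OF V'(1)] mon xsV) auto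
    then show ?case using step(5)[OF xs] by simp
  qed
  then show ?thesis using R_E by blast
qed

lemma finite_place_dvr:
  assumes V: "valuation_ring K E V" and x1V: "x1 \<in> V" shows "\<exists>t. dvr V t"
proof -
  note V' = valuation_ringD[OF V]
  have RV: "R \<subseteq> V" by (rule R_sub_valuation[OF assms])
  have L: "loc_units V" unfolding loc_units_def
  proof (intro conjI ballI impI V'(1) RV)
    fix a b assume a: "a \<in> R" "a \<notin> vunits V" and b: "b \<in> R"
    have "a \<otimes> b \<in> nonunits V" using nonunits_mult[OF V'(1), of a b] vunits_iff[of a V] a b RV by blast
    then show "\<one> \<ominus> a \<otimes> b \<in> vunits V" unfolding minus_eq
      using vunits_add_nonunits[OF V vunits_one[OF V'(1)] nonunits_uminus[OF V]] by blast
  qed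
  \<comment> \<open>Some \<open>D s\<close> has to be a nonunit. An element outside V is a fraction
    whose denominator b is a nonunit, and b divides a power of some \<open>D s\<close> by
    \<open>R_divides\<close>.\<close>
  obtain z where z: "z \<in> carrier E" "z \<notin> V" using V'(3,4) by blast
  obtain a b where ab: "a \<in> R" "b \<in> R" "b \<noteq> \<zero>" "z \<otimes> b = a" using fraction[OF z(1)] by blast
  have bc: "b \<in> carrier E" using ab by simp
  have "b \<notin> vunits V"
  proof
    assume "b \<in> vunits V"
    then have "a \<otimes> inv b \<in> V" using ab RV subringE(6)[OF V'(1)] by (auto simp: vunits_def)
    moreover have "a \<otimes> inv b = z" 
      using z(1) bc inv_nz[OF bc ab(3)] unfolding ab(4)[symmetric] by (simp add: m_assoc)
    ultimately show False using z by simp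
  qed
  obtain s l w where s: "s > 0" "w \<in> R" "D s [^] (l::nat) = b \<otimes> w" using R_divides[OF ab(2,3)] by blast
  have "D s \<notin> vunits V"
  proof
    assume "D s \<in> vunits V"
    then have "b \<otimes> w \<in> vunits V" using vunits_pow[OF V'(1)] s(3) by metis
    then show False using vunits_factor[OF V'(1)] ab s RV \<open>b \<notin> vunits V\<close> by blast
  qed
  then show ?thesis using loc_units_dvr[OF L s(1)] by blast
qed

lemma place_dvr: assumes "valuation_ring K E V" shows "\<exists>t. dvr V t"
  using valuation_ring_at_infinity[OF assms] finite_place_dvr[OF assms] Vinf_dvr by blast

section \<open>Maximal ideals of \<open>R\<close> and localisation\<close>

definition maxid :: "'a set \<Rightarrow> bool" where
  "maxid M \<longleftrightarrow> M \<subseteq> R \<and> \<zero> \<in> M \<and> \<one> \<notin> M \<and> (\<forall>a\<in>M. \<forall>b\<in>M. a \<oplus> b \<in> M) \<and>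
     (\<forall>a\<in>M. \<forall>b\<in>R. a \<otimes> b \<in> M) \<and> (\<forall>a\<in>R - M. \<exists>b\<in>R. \<one> \<ominus> a \<otimes> b \<in> M)"

lemma maxidD:
  assumes "maxid M"
  shows "M \<subseteq> R" "\<zero> \<in> M" "\<one> \<notin> M" "\<And>a b. a \<in> M \<Longrightarrow> b \<in> M \<Longrightarrow> a \<oplus> b \<in> M"
    "\<And>a b. a \<in> M \<Longrightarrow> b \<in> R \<Longrightarrow> a \<otimes> b \<in> M" "\<And>a. a \<in> R \<Longrightarrow> a \<notin> M \<Longrightarrow> \<exists>b\<in>R. \<one> \<ominus> a \<otimes> b \<in> M"
  using assms unfolding maxid_def by auto

lemma maxid_prime:
  assumes "maxid M" "a \<in> R" "a \<notin> M" "b \<in> R" "b \<notin> M" shows "a \<otimes> b \<notin> M"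
proof
  note M = maxidD[OF assms(1)]
  assume ab: "a \<otimes> b \<in> M"
  obtain c where c: "c \<in> R" "\<one> \<ominus> a \<otimes> c \<in> M" using M(6) assms by blast
  have "(\<one> \<ominus> a \<otimes> c) \<otimes> b \<oplus> (a \<otimes> b) \<otimes> c \<in> M" using M(4,5) c ab assms by blast
  moreover have "(\<one> \<ominus> a \<otimes> c) \<otimes> b \<oplus> (a \<otimes> b) \<otimes> c = b"
    using R_carr[OF c(1)] R_carr[OF assms(2)] R_carr[OF assms(4)] by algebra
  ultimately show False using assms by simp
qed

definition Vloc :: "'a set \<Rightarrow> 'a set" where
  "Vloc M = {z \<in> carrier E. \<exists>a\<in>R. \<exists>b\<in>R - M. z \<otimes> b = a}"

lemma Vloc_I: "z \<in> carrier E \<Longrightarrow> b \<in> R \<Longrightarrow> b \<notin> M \<Longrightarrow> z \<otimes> b \<in> R \<Longrightarrow> z \<in> Vloc M"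
  unfolding Vloc_def by blast

lemma R_sub_Vloc: "maxid M \<Longrightarrow> R \<subseteq> Vloc M"
  by (auto intro!: Vloc_I[of _ \<one>] dest: maxidD(3))

lemma Vloc_subring: assumes M: "maxid M" shows "subring (Vloc M) E"
proof (rule subringI)
  show "Vloc M \<subseteq> carrier E" by (auto simp: Vloc_def)
  show "\<one> \<in> Vloc M" using R_sub_Vloc[OF M] by auto
  show "\<ominus> h \<in> Vloc M" if h0: "h \<in> Vloc M" for h
  proof -
    obtain a b where ab: "a \<in> R" "b \<in> R" "b \<notin> M" "h \<otimes> b = a" and h: "h \<in> carrier E" using h0 unfolding Vloc_def by blast
    then have "(\<ominus> h) \<otimes> b = \<ominus> a" by (simp add: l_minus)
    then show ?thesis using ab h by (intro Vloc_I[of _ b]) auto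
  qed
  fix h h' assume "h \<in> Vloc M" "h' \<in> Vloc M"
  then obtain a b a' b' where ab: "a \<in> R" "b \<in> R" "b \<notin> M" "h \<otimes> b = a" and h: "h \<in> carrier E" "h' \<in> carrier E"
    and ab': "a' \<in> R" "b' \<in> R" "b' \<notin> M" "h' \<otimes> b' = a'" unfolding Vloc_def by blast
  have bb: "b \<otimes> b' \<in> R" "b \<otimes> b' \<notin> M" using maxid_prime[OF M] ab ab' by auto
  have c: "b \<in> carrier E" "b' \<in> carrier E" using ab ab' by auto
  have "(h \<otimes> h') \<otimes> (b \<otimes> b') = (h \<otimes> b) \<otimes> (h' \<otimes> b')" using c h by algebra
  then show "h \<otimes> h' \<in> Vloc M" using h ab ab' by (intro Vloc_I[OF _ bb]) auto
  have "(h \<oplus> h') \<otimes> (b \<otimes> b') = (h \<otimes> b) \<otimes> b' \<oplus> (h' \<otimes> b') \<otimes> b" using c h by algebra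
  then show "h \<oplus> h' \<in> Vloc M" using h ab ab' by (intro Vloc_I[OF _ bb]) auto
qed

lemma Vloc_units: assumes M: "maxid M" and a: "a \<in> R" shows "a \<in> vunits (Vloc M) \<longleftrightarrow> a \<notin> M"
proof
  note M' = maxidD[OF M]
  assume L: "a \<in> vunits (Vloc M)"
  show "a \<notin> M"
  proof
    assume aM: "a \<in> M"
    obtain c b where cb: "c \<in> R" "b \<in> R" "b \<notin> M" "inv a \<otimes> b = c" using L unfolding vunits_def Vloc_def by blast
    have a0: "a \<noteq> \<zero>" using L by (simp add: vunits_def)
    have ac: "a \<in> carrier E" using a by simp
    have "a \<otimes> c = b" using cb inv_nz[OF ac a0] ac m_assoc[of a "inv a" b] by simp
    then show False using M'(5)[OF aM cb(1)] cb by simp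
  qed
next
  assume na: "a \<notin> M"
  have a0: "a \<noteq> \<zero>" using na maxidD(2)[OF M] by blast
  have ac: "a \<in> carrier E" using a by simp
  have "inv a \<in> Vloc M" using inv_nz[OF ac a0] a na by (intro Vloc_I[of _ a]) auto
  then show "a \<in> vunits (Vloc M)" using a0 a R_sub_Vloc[OF M] by (auto simp: vunits_def)
qed

text \<open>Being a valuation ring is part of the outcome: only the local behaviour in
  \<open>loc_units\<close> is checked, namely that 1 - ab avoids M whenever a lies in M.\<close>

lemma Vloc_dvr: assumes M: "maxid M" and s: "0 < s" "D s \<in> M" shows "dvr (Vloc M) (D s)"
proof (rule loc_units_dvr)
  note M' = maxidD[OF M]
  show "loc_units (Vloc M)" unfolding loc_units_def
  proof (intro conjI ballI impI Vloc_subring[OF M] R_sub_Vloc[OF M])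
    fix a b assume a: "a \<in> R" "a \<notin> vunits (Vloc M)" and b: "b \<in> R"
    then have aM: "a \<otimes> b \<in> M" using Vloc_units[OF M] M'(5) by blast
    have "\<one> \<ominus> a \<otimes> b \<notin> M"
    proof
      assume "\<one> \<ominus> a \<otimes> b \<in> M"
      then have "(\<one> \<ominus> a \<otimes> b) \<oplus> a \<otimes> b \<in> M" using M'(4) aM by blast
      moreover have "(\<one> \<ominus> a \<otimes> b) \<oplus> a \<otimes> b = \<one>" using R_carr[OF a(1)] R_carr[OF b] by algebra
      ultimately show False using M' by simp
    qed
    then show "\<one> \<ominus> a \<otimes> b \<in> vunits (Vloc M)" using Vloc_units[OF M] a b by simp
  qed
qed (use s Vloc_units[OF M] in auto)

lemma Vloc_nonunits: "maxid M \<Longrightarrow> a \<in> M \<Longrightarrow> a \<in> nonunits (Vloc M)"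
  using Vloc_units[of M a] vunits_iff[of a "Vloc M"] maxidD(1)[of M] R_sub_Vloc[of M] by blast

lemma Vloc_ne_Vinf: "maxid M \<Longrightarrow> Vloc M \<noteq> Vinf"
  using R_sub_Vloc[of M] x1_notin_Vinf R_x1 by blast

text \<open>Zorn's lemma on the proper ideals above I. An element a without inverse modulo the
  maximal M would make M + aR a strictly larger proper ideal.\<close>

lemma maxid_exists:
  assumes I: "I \<subseteq> R" "\<zero> \<in> I" "\<one> \<notin> I" "\<And>a b. a \<in> I \<Longrightarrow> b \<in> I \<Longrightarrow> a \<oplus> b \<in> I"
    "\<And>a b. a \<in> I \<Longrightarrow> b \<in> R \<Longrightarrow> a \<otimes> b \<in> I"
  shows "\<exists>M. maxid M \<and> I \<subseteq> M"
proof -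
  define \<A> where "\<A> = {J. I \<subseteq> J \<and> J \<subseteq> R \<and> \<one> \<notin> J \<and> (\<forall>a\<in>J. \<forall>b\<in>J. a \<oplus> b \<in> J) \<and> (\<forall>a\<in>J. \<forall>b\<in>R. a \<otimes> b \<in> J)}"
  have IA: "I \<in> \<A>" using I by (simp add: \<A>_def)
  have "\<exists>M\<in>\<A>. \<forall>J\<in>\<A>. M \<subseteq> J \<longrightarrow> J = M"
  proof (rule subset_Zorn_nonempty)
    show "\<A> \<noteq> {}" using IA by blast
    fix \<C> assume C: "\<C> \<noteq> {}" "subset.chain \<A> \<C>"
    have CA: "\<And>J. J \<in> \<C> \<Longrightarrow> J \<in> \<A>" and tot: "\<And>J J'. J \<in> \<C> \<Longrightarrow> J' \<in> \<C> \<Longrightarrow> J \<subseteq> J' \<or> J' \<subseteq> J"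
      using C(2) unfolding subset.chain_def by auto
    have "a \<oplus> b \<in> \<Union>\<C>" if ab: "a \<in> \<Union>\<C>" "b \<in> \<Union>\<C>" for a b
    proof -
      obtain J J' where J: "J \<in> \<C>" "a \<in> J" "J' \<in> \<C>" "b \<in> J'" using ab by blast
      then obtain L where "L \<in> \<C>" "a \<in> L" "b \<in> L" using tot[of J J'] by blast
      then show ?thesis using CA[of L] unfolding \<A>_def by blast
    qed
    moreover have "a \<otimes> b \<in> \<Union>\<C>" if "a \<in> \<Union>\<C>" "b \<in> R" for a b
      using that CA unfolding \<A>_def by blast
    moreover have "I \<subseteq> \<Union>\<C>" "\<Union>\<C> \<subseteq> R" "\<one> \<notin> \<Union>\<C>" using C(1) CA unfolding \<A>_def by blast+
    ultimately show "\<Union>\<C> \<in> \<A>" unfolding \<A>_def by blast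
  qed
  then obtain M where M: "M \<in> \<A>" and max: "\<And>J. J \<in> \<A> \<Longrightarrow> M \<subseteq> J \<Longrightarrow> J = M" by blast
  have M': "I \<subseteq> M" "M \<subseteq> R" "\<one> \<notin> M" "\<And>a b. a \<in> M \<Longrightarrow> b \<in> M \<Longrightarrow> a \<oplus> b \<in> M" "\<And>a b. a \<in> M \<Longrightarrow> b \<in> R \<Longrightarrow> a \<otimes> b \<in> M"
    using M unfolding \<A>_def by auto
  have "\<exists>b\<in>R. \<one> \<ominus> a \<otimes> b \<in> M" if a: "a \<in> R" "a \<notin> M" for a
  proof (rule ccontr)
    assume no: "\<not> (\<exists>b\<in>R. \<one> \<ominus> a \<otimes> b \<in> M)"
    define J where "J = {m \<oplus> a \<otimes> b | m b. m \<in> M \<and> b \<in> R}"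
    have JI: "m \<oplus> a \<otimes> b \<in> J" if "m \<in> M" "b \<in> R" for m b using that by (auto simp: J_def)
    have "J \<in> \<A>" unfolding \<A>_def
    proof (intro CollectI conjI ballI)
      have MJ: "M \<subseteq> J"
      proof
        fix m assume m: "m \<in> M"
        then have "m \<oplus> a \<otimes> \<zero> = m" using a M' by auto
        then show "m \<in> J" using JI[OF m R_zero] by simp
      qed
      then show "I \<subseteq> J" using M' by blast
      show "J \<subseteq> R" using M' a by (auto simp: J_def)
      show "\<one> \<notin> J"
      proof
        assume "\<one> \<in> J"
        then obtain m b where mb: "m \<in> M" "b \<in> R" "\<one> = m \<oplus> a \<otimes> b" by (auto simp: J_def)
        have c: "m \<in> carrier E" "a \<in> carrier E" "b \<in> carrier E" using mb a M' by auto
        have "\<one> \<ominus> a \<otimes> b = m" unfolding mb(3) using c by algebra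
        then show False using no mb by blast
      qed
      fix u v assume u: "u \<in> J"
      then obtain m b where mb: "m \<in> M" "b \<in> R" "u = m \<oplus> a \<otimes> b" by (auto simp: J_def)
      have c: "m \<in> carrier E" "a \<in> carrier E" "b \<in> carrier E" using mb a M' by auto
      { assume "v \<in> J"
        then obtain m' b' where mb': "m' \<in> M" "b' \<in> R" "v = m' \<oplus> a \<otimes> b'" by (auto simp: J_def)
        have c': "m' \<in> carrier E" "b' \<in> carrier E" using mb' M' by auto
        have "u \<oplus> v = (m \<oplus> m') \<oplus> a \<otimes> (b \<oplus> b')" unfolding mb(3) mb'(3) using c c' by algebra
        then show "u \<oplus> v \<in> J" using JI M' mb mb' by simp }
      { assume v: "v \<in> R"
        then have "v \<in> carrier E" by simp
        then have "u \<otimes> v = (m \<otimes> v) \<oplus> a \<otimes> (b \<otimes> v)" unfolding mb(3) using c by algebra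
        then show "u \<otimes> v \<in> J" using JI M' mb v by simp }
    qed
    moreover have "M \<subseteq> J"
    proof
      fix m assume m: "m \<in> M"
      then have "m \<oplus> a \<otimes> \<zero> = m" using a M' by auto
      then show "m \<in> J" using JI[OF m R_zero] by simp
    qed
    ultimately have "J = M" by (rule max)
    moreover have "\<zero> \<oplus> a \<otimes> \<one> \<in> J" using I(2) M' by (intro JI) auto
    ultimately show False using a by simp
  qed
  then have "maxid M" unfolding maxid_def using M' I(2) by blast
  then show ?thesis using M' by blast
qed

text \<open>The hard inclusion has to show that z without poles outside P_inf lies in
  \<open>R\<close>. Some power of \<open>D s\<close> times z does; if the least such power were not
  the zeroth, a maximal ideal containing the denominators that are still missing would give a place
  at which z has a pole.\<close>

theorem RR_space: "one_point_RR_space K E Pinf l = (\<lambda>F. F xs) ` Pol n (Suc l)"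
proof
  show "(\<lambda>F. F xs) ` Pol n (Suc l) \<subseteq> one_point_RR_space K E Pinf l"
  proof
    fix z assume "z \<in> (\<lambda>F. F xs) ` Pol n (Suc l)"
    then obtain F where F: "F \<in> Pol n (Suc l)" "z = F xs" by blast
    have zR: "z \<in> R" using F R_I by blast
    show "z \<in> one_point_RR_space K E Pinf l"
    proof (cases "z = \<zero>")
      case False
      have "place_val K E P z + (if P = Pinf then int l else 0) \<ge> 0" if "place K E P" for P
      proof -
        obtain V where V: "valuation_ring K E V" "P = nonunits V" using \<open>place K E P\<close> place_iff by blast
        show ?thesis
        proof (cases "P = Pinf")
          case True
          obtain s c where s: "s < Suc l" "lead n F s c" using Pol_nonzero_lead[OF F(1)] F False by blast
          show ?thesis using Pinf_val[OF wrel_lead[OF s(2)]] s(1) True F by simp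
        next
          case False
          then have "x1 \<in> V" using valuation_ring_at_infinity V unfolding Pinf_def by blast
          then have "z \<in> V" using R_sub_valuation V zR by blast
          moreover obtain t where "dvr V t" using place_dvr V by blast
          ultimately show ?thesis using dvr_val_nonneg[of V t z] \<open>z \<noteq> \<zero>\<close> zR V False by simp
        qed
      qed
      then show ?thesis using zR False unfolding one_point_RR_space_def by simp
    qed (simp add: one_point_RR_space_def)
  qed
next
  show "one_point_RR_space K E Pinf l \<subseteq> (\<lambda>F. F xs) ` Pol n (Suc l)"
  proof
    fix z assume zL: "z \<in> one_point_RR_space K E Pinf l"
    show "z \<in> (\<lambda>F. F xs) ` Pol n (Suc l)"
    proof (cases "z = \<zero>")
      case True
      then show ?thesis by (auto intro!: rev_image_eqI[OF Pol_zero])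
    next
      case False
      then have z: "z \<in> carrier E" "z \<noteq> \<zero>"
        and val: "\<And>P. place K E P \<Longrightarrow> place_val K E P z + (if P = Pinf then int l else 0) \<ge> 0"
        using zL unfolding one_point_RR_space_def by auto
      obtain a b where ab: "a \<in> R" "b \<in> R" "b \<noteq> \<zero>" "z \<otimes> b = a" using fraction[OF z(1)] by blast
      obtain s l' w where s: "s > 0" "w \<in> R" "D s [^] (l'::nat) = b \<otimes> w" using R_divides[OF ab(2,3)] by blast
      have Dc: "D s \<in> carrier E" "D s \<noteq> \<zero>" using D_nonzero s by auto
      have "z \<otimes> D s [^] l' = a \<otimes> w" unfolding s(3) ab(4)[symmetric] using z(1) R_carr[OF ab(2)] R_carr[OF s(2)] by (simp add: m_assoc)
      then have ex: "z \<otimes> D s [^] l' \<in> R" using ab s by simp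
      define k where "k = (LEAST k. z \<otimes> D s [^] (k::nat) \<in> R)"
      have kR: "z \<otimes> D s [^] k \<in> R" unfolding k_def using ex by (rule LeastI)
      have "k = 0"
      proof (rule ccontr)
        assume "k \<noteq> 0"
        then obtain k' where k': "k = Suc k'" by (cases k) auto
        have nR: "z \<otimes> D s [^] k' \<notin> R" using not_less_Least[of k' "\<lambda>k. z \<otimes> D s [^] k \<in> R"] k' by (simp add: k_def)
        define r where "r = z \<otimes> D s [^] k"
        have rR: "r \<in> R" using kR by (simp add: r_def)
        have rc: "r \<in> carrier E" using rR by simp
        \<comment> \<open>The ideal of denominators of r / D s. Minimality of \<open>k\<close> keeps
          1 out of it, and \<open>D s\<close> belongs to it.\<close>
        define I where "I = {a \<in> R. \<exists>w\<in>R. a \<otimes> r = D s \<otimes> w}"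
        have "\<exists>M. maxid M \<and> I \<subseteq> M"
        proof (rule maxid_exists)
          show "I \<subseteq> R" by (auto simp: I_def)
          show "\<zero> \<in> I" using rc Dc by (auto simp: I_def intro!: bexI[of _ \<zero>])
          show "\<one> \<notin> I"
          proof
            assume "\<one> \<in> I"
            then obtain w where w: "w \<in> R" "r = D s \<otimes> w" using rc by (auto simp: I_def)
            have "D s \<otimes> (z \<otimes> D s [^] k') = D s \<otimes> w"
              using w(2) z Dc unfolding r_def k' by (simp add: m_ac)
            then have "z \<otimes> D s [^] k' = w" using m_lcancel[of "D s"] Dc z w by simp
            then show False using nR w by simp
          qed
          fix a b assume a: "a \<in> I"
          then obtain w where w: "a \<in> R" "w \<in> R" "a \<otimes> r = D s \<otimes> w" by (auto simp: I_def)
          have c: "a \<in> carrier E" "w \<in> carrier E" using w by auto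
          { assume "b \<in> I"
            then obtain w' where w': "b \<in> R" "w' \<in> R" "b \<otimes> r = D s \<otimes> w'" by (auto simp: I_def)
            have c': "b \<in> carrier E" "w' \<in> carrier E" using w' by auto
            have "(a \<oplus> b) \<otimes> r = a \<otimes> r \<oplus> b \<otimes> r" using c c' rc by algebra
            also have "\<dots> = D s \<otimes> (w \<oplus> w')" unfolding w(3) w'(3) using c c' Dc(1) by algebra
            finally show "a \<oplus> b \<in> I" using w w' by (auto simp: I_def) }
          { assume b: "b \<in> R"
            then have bc: "b \<in> carrier E" by simp
            have "(a \<otimes> b) \<otimes> r = (a \<otimes> r) \<otimes> b" using c bc rc by algebra
            also have "\<dots> = D s \<otimes> (w \<otimes> b)" unfolding w(3) using c bc Dc(1) by algebra
            finally show "a \<otimes> b \<in> I" using w b by (auto simp: I_def) }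
        qed
        then obtain M where M: "maxid M" "I \<subseteq> M" by blast
        note M' = maxidD[OF M(1)]
        have DM: "D s \<in> M" using M(2) rR by (auto simp: I_def)
        obtain t where t: "t > 0" "\<And>z. z \<in> R \<Longrightarrow> cong_D s (z [^] (q ^ t)) z" using frobenius_R[OF s(1)] by blast
        have "1 < q ^ t" using one_less_power[OF q_gt_1 t(1)] .
        then obtain j where j: "q ^ t = Suc (Suc j)" using le_Suc_ex[of 2 "q ^ t"] by auto
        obtain w where w: "w \<in> R" "r [^] (q ^ t) \<ominus> r = D s \<otimes> w" using t(2)[OF rR] unfolding cong_D_def by blast
        \<comment> \<open>Here \<open>Suc j\<close> is q^t - 1, so this element times r is r^(q^t) -
          r, a multiple of \<open>D s\<close>. It makes r invertible modulo any maximal ideal above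
          I.\<close>
        have "r [^] Suc j \<ominus> \<one> \<in> I"
        proof -
          have rj: "r [^] Suc j \<in> carrier E" using rc by simp
          have "(r [^] Suc j \<ominus> \<one>) \<otimes> r = r [^] Suc j \<otimes> r \<ominus> r" using rc rj by algebra
          also have "\<dots> = D s \<otimes> w" using w(2) by (simp add: j)
          finally show ?thesis using rR w(1) by (auto simp: I_def)
        qed
        then have 1: "r [^] Suc j \<ominus> \<one> \<in> M" using M by blast
        have rM: "r \<notin> M"
        proof
          assume rM: "r \<in> M"
          then have "r \<otimes> r [^] j \<in> M" using M'(5) rR by simp
          then have "r [^] Suc j \<in> M" using rc by (simp add: m_comm)
          moreover have "(r [^] Suc j \<ominus> \<one>) \<otimes> (\<ominus> \<one>) \<in> M" using M'(5)[OF 1] by simp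
          ultimately have "r [^] Suc j \<oplus> (r [^] Suc j \<ominus> \<one>) \<otimes> (\<ominus> \<one>) \<in> M" using M'(4) by blast
          moreover have "r [^] Suc j \<oplus> (r [^] Suc j \<ominus> \<one>) \<otimes> (\<ominus> \<one>) = \<one>"
            using nat_pow_closed[OF rc, of "Suc j"] by algebra
          ultimately show False using M' by simp
        qed
        let ?V = "Vloc M"
        have dv: "dvr ?V (D s)" by (rule Vloc_dvr[OF M(1) s(1) DM])
        have vr: "valuation_ring K E ?V" by (rule dvr_valuation_ring[OF dv])
        have "nonunits ?V \<noteq> Pinf" unfolding Pinf_def using nonunits_inj[OF vr Vinf_valuation] Vloc_ne_Vinf[OF M(1)] by blast
        then have "place_val K E (nonunits ?V) z \<ge> 0" using val[of "nonunits ?V"] vr place_iff by auto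
        then have zV: "z \<in> ?V" using dvr_val_nonneg[OF dv z] by simp
        \<comment> \<open>Since z is regular at this place, r = z D s^k with positive k lies in the
          maximal ideal of \<open>Vloc M\<close>, although \<open>rM\<close> makes it a unit
          there.\<close>
        have "D s \<otimes> (z \<otimes> D s [^] k') \<in> nonunits ?V"
          using nonunits_mult[OF dvrD(1)[OF dv] dvrD(7)[OF dv]] zV subringE(6)[OF dvrD(1)[OF dv]]
            subring_pow[OF dvrD(1)[OF dv] dvrD(3)[OF dv]] by blast
        also have "D s \<otimes> (z \<otimes> D s [^] k') = r" using z Dc unfolding r_def k' by (simp add: m_ac)
        finally show False using Vloc_units[OF M(1) rR] rM vunits_iff[of r ?V] by (auto simp: nonunits_def vunits_def)
      qed
      then have zR: "z \<in> R" using kR z by simp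
      obtain F m where F: "F \<in> Pol n m" "z = F xs" using R_E[OF zR] by blast
      obtain t c where t: "lead n F t c" using Pol_nonzero_lead[OF F(1)] F z by blast
      have "place K E Pinf" using Vinf_valuation place_iff Pinf_def by blast
      then have "t \<le> l" using val[of Pinf] Pinf_val[OF wrel_lead[OF t]] F by simp
      then have "F \<in> Pol n (Suc l)" using lead_Pol[OF t] Pol_le by auto
      then show ?thesis using F by blast
    qed
  qed
qed

end

section \<open>Evaluation at rational points\<close>

context hermitian begin

section \<open>Rational points of the tower as rational places\<close>

definition Mpt :: "'a list \<Rightarrow> 'a set" where
  "Mpt a = {z. \<exists>F m. F \<in> Pol n m \<and> z = F xs \<and> F a = \<zero>}"

definition Ppt :: "'a list \<Rightarrow> 'a set" where
  "Ppt a = nonunits (Vloc (Mpt a))"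

context
  fixes a assumes a: "a \<in> Pts n" "set a \<subseteq> K"
begin

text \<open>Evaluation at \<open>a\<close> is well defined on \<open>R\<close>: two functions that
  agree at \<open>xs\<close> also agree at \<open>a\<close>, by \<open>Pol_vanish\<close>.\<close>

lemma Mpt_iff: assumes "F \<in> Pol n m" shows "F xs \<in> Mpt a \<longleftrightarrow> F a = \<zero>"
proof
  assume "F xs \<in> Mpt a"
  then obtain G m' where G: "G \<in> Pol n m'" "F xs = G xs" "G a = \<zero>" unfolding Mpt_def by blast
  have "(\<lambda>v. F v \<ominus> G v) \<in> Pol n (max m m')" using assms G by (intro Pol_minus) (auto elim: Pol_le)
  moreover have "F xs \<ominus> G xs = \<zero>" using G xs by (simp add: Pol_closed minus_eq r_neg)
  ultimately have "F a \<ominus> G a = \<zero>" using Pol_vanish a by blast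
  then show "F a = \<zero>" using minus_eq_zero[of "F a" "G a"] G assms a by (simp add: Pol_closed)
qed (use assms in \<open>auto simp: Mpt_def\<close>)

lemma Pol_const: "c \<in> K \<Longrightarrow> (\<lambda>v. c) \<in> Pol n 1"
proof (rule Pol.step[of c "replicate n 0" _ _ "\<lambda>_. \<zero>"])
  fix v assume v: "v \<in> Pts n" and c: "c \<in> K"
  then have "tmon E (replicate n 0) v = \<one>" using tmon_zero[of v] by (auto simp: Pts_def)
  then show "c = c \<otimes> tmon E (replicate n 0) v \<oplus> \<zero>" using c by simp
qed (auto simp: wt_zero)

lemma Mpt_maxid: "maxid (Mpt a)"
  unfolding maxid_def
proof (intro conjI ballI)
  show "Mpt a \<subseteq> R" using R_I by (auto simp: Mpt_def)
  show "\<zero> \<in> Mpt a" using Mpt_iff[OF Pol_zero[of n 0]] by simp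
  show "\<one> \<notin> Mpt a" using Mpt_iff[OF Pol_const[of \<one>]] by simp
  fix z assume z: "z \<in> Mpt a"
  then obtain F m where F: "F \<in> Pol n m" "z = F xs" "F a = \<zero>" unfolding Mpt_def by blast
  { fix y assume "y \<in> Mpt a"
    then obtain G m' where G: "G \<in> Pol n m'" "y = G xs" "G a = \<zero>" unfolding Mpt_def by blast
    have "(\<lambda>v. F v \<oplus> G v) \<in> Pol n (max m m')" using F G by (intro Pol_add) (auto elim: Pol_le)
    from Mpt_iff[OF this] show "z \<oplus> y \<in> Mpt a" using F G by simp }
  { fix y assume "y \<in> R"
    then obtain G m' where G: "G \<in> Pol n m'" "y = G xs" using R_E by blast
    have "(\<lambda>v. F v \<otimes> G v) \<in> Pol n (m + m')" using F G by (intro Pol_mult) (auto elim: Pol_le)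
    from Mpt_iff[OF this] show "z \<otimes> y \<in> Mpt a" using F G a by (simp add: Pol_closed) }
next
  fix z assume z: "z \<in> R - Mpt a"
  then obtain F m where F: "F \<in> Pol n m" "z = F xs" using R_E by blast
  have Fa: "F a \<noteq> \<zero>" "F a \<in> K" using z F Mpt_iff Pol_K a by auto
  let ?c = "inv (F a)"
  have c: "?c \<in> K" using Fa by simp
  have "(\<lambda>v. \<one> \<ominus> ?c \<otimes> F v) \<in> Pol n (max 1 m)"
    using F c Pol_const[of \<one>] by (intro Pol_minus Pol_smult) (auto elim: Pol_le)
  from Mpt_iff[OF this] have "\<one> \<ominus> ?c \<otimes> z \<in> Mpt a"
    using F Fa inv_nz[of "F a"] by (simp add: minus_eq r_neg)
  moreover have "?c \<otimes> z = z \<otimes> ?c" using z c by (simp add: m_comm)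
  ultimately show "\<exists>b\<in>R. \<one> \<ominus> z \<otimes> b \<in> Mpt a" using R_K[OF c] by auto
qed

lemma coord_Pol: "i < n \<Longrightarrow> \<exists>F m. F \<in> Pol n m \<and> (\<forall>v\<in>Pts n. F v = v ! i)"
  using tmon_single[of i _ 1] Pol_mono[of "(replicate n 0)[i := 1]" n, OF _ lessI]
  by (auto simp: Pts_def subset_iff intro!: exI[of _ "tmon E ((replicate n 0)[i := 1])"])

text \<open>The x_1-coordinate of a rational point is fixed by the power q. So \<open>D 1\<close>
  vanishes at all rational points and is a uniformiser common to all of them.\<close>

lemma D_Mpt: "D 1 \<in> Mpt a"
proof -
  obtain F m where F: "F \<in> Pol n m" "\<forall>v\<in>Pts n. F v = v ! (n - 1)" using coord_Pol[of "n - 1"] n by auto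
  have last: "v ! (n - 1) = last v" if "v \<in> Pts n" for v
    using that n by (auto simp: Pts_def last_conv_nth)
  have pow: "\<exists>m. (\<lambda>v. F v [^] k) \<in> Pol n m" for k :: nat
  proof (induction k)
    case 0
    then show ?case using Pol_const[of \<one>] by (auto intro!: exI[of _ 1])
  next
    case (Suc k)
    then obtain m' where m': "(\<lambda>v. F v [^] k) \<in> Pol n m'" by blast
    have "(\<lambda>v. F v [^] k \<otimes> F v) \<in> Pol n (m' + m)" using m' F by (intro Pol_mult) (auto elim: Pol_le)
    then show ?case by auto
  qed
  obtain m' where "(\<lambda>v. F v [^] q) \<in> Pol n m'" using pow by blast
  then have "(\<lambda>v. F v [^] q \<ominus> F v) \<in> Pol n (max m' m)" using F by (intro Pol_minus) (auto elim: Pol_le)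
  from Mpt_iff[OF this] have "F xs [^] q \<ominus> F xs \<in> Mpt a \<longleftrightarrow> F a [^] q \<ominus> F a = \<zero>" .
  moreover have "F xs = x1" using F(2) xs last by (simp add: x1_def)
  moreover have "F a \<in> K" using F(1) Pol_K a by blast
  ultimately show ?thesis by (simp add: D_def K_pow_q minus_eq r_neg)
qed

lemma Vpt_dvr: "dvr (Vloc (Mpt a)) (D 1)"
  by (rule Vloc_dvr[OF Mpt_maxid _ D_Mpt]) simp

lemma Vpt_valuation: "valuation_ring K E (Vloc (Mpt a))"
  by (rule dvr_valuation_ring[OF Vpt_dvr])

lemma Ppt_rational: "rational_place K E (Ppt a)"
  unfolding Ppt_def
proof (rule rational_placeI[OF Vpt_valuation])
  fix z assume "z \<in> Vloc (Mpt a)"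
  then obtain u b where ub: "u \<in> R" "b \<in> R" "b \<notin> Mpt a" "z \<otimes> b = u" and z: "z \<in> carrier E" unfolding Vloc_def by blast
  obtain F m where F: "F \<in> Pol n m" "u = F xs" using ub R_E by blast
  obtain G m' where G: "G \<in> Pol n m'" "b = G xs" using ub R_E by blast
  have FG: "F a \<in> K" "G a \<in> K" "G a \<noteq> \<zero>" using F G Pol_K a ub Mpt_iff by auto
  \<comment> \<open>The quotient of the values at \<open>a\<close> is the residue of z; the
    denominator is nonzero since b lies outside the ideal.\<close>
  let ?c = "F a \<otimes> inv (G a)"
  have c: "?c \<in> K" using FG by simp
  have ca: "?c \<otimes> G a = F a" using FG inv_nz[of "G a"] by (simp add: m_assoc)
  have P: "(\<lambda>v. F v \<ominus> ?c \<otimes> G v) \<in> Pol n (max m m')"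
    using F G c by (intro Pol_minus Pol_smult) (auto elim: Pol_le)
  have "F a \<ominus> ?c \<otimes> G a = \<zero>" unfolding ca using FG by (simp add: minus_eq r_neg)
  then have M: "u \<ominus> ?c \<otimes> b \<in> Mpt a" using Mpt_iff[OF P] F(2) G(2) by simp
  have bc: "b \<in> carrier E" "b \<noteq> \<zero>" using ub maxidD(2)[OF Mpt_maxid] by auto
  note ib = inv_nz[OF bc]
  have "inv b \<in> Vloc (Mpt a)" using Vloc_units[OF Mpt_maxid ub(2)] ub by (simp add: vunits_def)
  then have N: "(u \<ominus> ?c \<otimes> b) \<otimes> inv b \<in> nonunits (Vloc (Mpt a))"
    by (rule nonunits_mult[OF Vloc_subring[OF Mpt_maxid] Vloc_nonunits[OF Mpt_maxid M]])
  have "(u \<ominus> ?c \<otimes> b) \<otimes> inv b = (z \<ominus> ?c) \<otimes> (b \<otimes> inv b)"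
    unfolding ub(4)[symmetric] using z bc(1) ib(1) K_carr[OF c] by algebra
  then show "\<exists>c\<in>K. z \<ominus> c \<in> nonunits (Vloc (Mpt a))" using N c z ib by (intro bexI[of _ ?c]) auto
qed

lemma Ppt_value: assumes F: "F \<in> Pol n m" shows "place_value K E (Ppt a) (F xs) = F a"
  unfolding place_value_def
proof (rule the_equality)
  have Fa: "F a \<in> K" using F Pol_K a by blast
  have "(\<lambda>v. F v \<ominus> F a) \<in> Pol n (max m 1)" using F Pol_const[OF Fa] by (intro Pol_minus) (auto elim: Pol_le)
  from Mpt_iff[OF this] have "F xs \<ominus> F a \<in> Mpt a" using Fa by (simp add: minus_eq r_neg)
  then have N: "F xs \<ominus> F a \<in> Ppt a" unfolding Ppt_def by (rule Vloc_nonunits[OF Mpt_maxid])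
  then show "F a \<in> K \<and> F xs \<ominus> F a \<in> Ppt a" using Fa by blast
  fix c assume c: "c \<in> K \<and> F xs \<ominus> c \<in> Ppt a"
  have "(F xs \<ominus> c) \<oplus> (\<ominus> (F xs \<ominus> F a)) \<in> Ppt a"
    using c N nonunits_add[OF Vpt_valuation] nonunits_uminus[OF Vpt_valuation] unfolding Ppt_def by blast
  moreover have "(F xs \<ominus> c) \<oplus> (\<ominus> (F xs \<ominus> F a)) = F a \<ominus> c"
    using F xs c Fa Pol_closed[OF F xs] K_carr[of c] K_carr[OF Fa] by algebra
  ultimately have N': "F a \<ominus> c \<in> nonunits (Vloc (Mpt a))" by (simp add: Ppt_def)
  have "F a \<ominus> c = \<zero>"
  proof (rule ccontr)
    assume nz: "F a \<ominus> c \<noteq> \<zero>"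
    note V' = valuation_ringD[OF Vpt_valuation]
    have "F a \<ominus> c \<in> vunits (Vloc (Mpt a))" using vunits_K[OF V'(1,2) _ nz] c Fa by simp
    then show False using N' vunits_iff by (auto simp: nonunits_def vunits_def)
  qed
  then show "c = F a" using minus_eq_zero[of "F a" c] c Fa by simp
qed

lemma Ppt_ne_Pinf: "Ppt a \<noteq> Pinf"
  using nonunits_inj[OF Vpt_valuation Vinf_valuation] Vloc_ne_Vinf[OF Mpt_maxid] by (auto simp: Ppt_def Pinf_def)

end

lemma Ppt_inj:
  assumes "a \<in> Pts n" "set a \<subseteq> K" "b \<in> Pts n" "set b \<subseteq> K" "Ppt a = Ppt b" shows "a = b"
proof (rule nth_equalityI)
  show len: "length a = length b" using assms by (auto simp: Pts_def)
  fix i assume i: "i < length a"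
  then have "i < n" using assms by (auto simp: Pts_def)
  then obtain F m where F: "F \<in> Pol n m" "\<forall>v\<in>Pts n. F v = v ! i" using coord_Pol[OF assms(1,2)] by blast
  show "a ! i = b ! i"
    using Ppt_value[OF assms(1,2) F(1)] Ppt_value[OF assms(3,4) F(1)] assms F(2) by simp
qed

text \<open>Decreasing order puts a new weight at the head of the list, which matches the recursion
  of \<open>independent\<close> and \<open>Span\<close>.\<close>

definition wlist :: "nat \<Rightarrow> nat list" where
  "wlist m = filter (\<lambda>s. \<exists>ds. length ds = n \<and> W ds = s) (rev [0..<m])"

lemma wlist_Suc: "wlist (Suc m) = (if \<exists>ds. length ds = n \<and> W ds = m then m # wlist m else wlist m)"
  by (simp add: wlist_def)

lemma set_wlist: "set (wlist m) = {s. s < m \<and> (\<exists>ds. length ds = n \<and> W ds = s)}"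
  by (auto simp: wlist_def)

text \<open>Echelon form. The element added at weight \<open>m\<close> lies outside the previous
  span because all nonzero elements there have smaller leading weight, and by \<open>Pol_top\<close>
  the space grows by one dimension only.\<close>

lemma wlist_basis:
  assumes f: "\<And>s. s \<in> set (wlist m) \<Longrightarrow> \<exists>c. lead n (f s) s c"
  shows "independent K (map (\<lambda>s. f s xs) (wlist m)) \<and>
    Span K (map (\<lambda>s. f s xs) (wlist m)) = (\<lambda>F. F xs) ` Pol n m"
  using f
proof (induction m)
  case 0
  have "(\<lambda>F. F xs) ` Pol n 0 = {\<zero>}" using Pol_0 xs Pol_zero[of n 0] by (auto intro!: rev_image_eqI[OF Pol_zero])
  then show ?case by (simp add: wlist_def)
next
  case (Suc m)
  show ?case
  proof (cases "\<exists>ds. length ds = n \<and> W ds = m")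
    case False
    have "Pol n (Suc m) \<subseteq> Pol n m"
    proof
      fix F assume "F \<in> Pol n (Suc m)"
      then show "F \<in> Pol n m" using Pol_top[of F n m] False unfolding lead_def by blast
    qed
    moreover have "Pol n m \<subseteq> Pol n (Suc m)" by (auto elim: Pol_le)
    ultimately have "Pol n (Suc m) = Pol n m" by blast
    moreover have "wlist (Suc m) = wlist m" using False by (auto simp: wlist_Suc)
    ultimately show ?thesis using Suc by simp
  next
    case True
    then have wl: "wlist (Suc m) = m # wlist m" by (auto simp: wlist_Suc)
    obtain c where c: "lead n (f m) m c" using Suc.prems[of m] wl by auto
    have cK: "c \<in> K" "c \<noteq> \<zero>" using c unfolding lead_def by auto
    have IH: "independent K (map (\<lambda>s. f s xs) (wlist m))"
      "Span K (map (\<lambda>s. f s xs) (wlist m)) = (\<lambda>F. F xs) ` Pol n m"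
      using Suc wl by auto
    have notin: "f m xs \<notin> (\<lambda>F. F xs) ` Pol n m"
    proof
      assume "f m xs \<in> (\<lambda>F. F xs) ` Pol n m"
      then obtain F where F: "F \<in> Pol n m" "f m xs = F xs" by blast
      then obtain s d where "s < m" "lead n F s d" using Pol_nonzero_lead lead_nonzero[OF c] by metis
      then show False using lead_eq_transfer[OF c, of F s d] F by simp
    qed
    have "line_extension K (f m xs) ((\<lambda>F. F xs) ` Pol n m) = (\<lambda>F. F xs) ` Pol n (Suc m)"
    proof
      show "line_extension K (f m xs) ((\<lambda>F. F xs) ` Pol n m) \<subseteq> (\<lambda>F. F xs) ` Pol n (Suc m)"
      proof
        fix u assume "u \<in> line_extension K (f m xs) ((\<lambda>F. F xs) ` Pol n m)"
        then obtain k F where k: "k \<in> K" "F \<in> Pol n m" "u = k \<otimes> f m xs \<oplus> F xs"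
          unfolding line_extension_mem_iff by blast
        then have "(\<lambda>v. k \<otimes> f m v \<oplus> F v) \<in> Pol n (Suc m)"
          using lead_Pol[OF c] by (intro Pol_add Pol_smult) (auto elim: Pol_le)
        then show "u \<in> (\<lambda>F. F xs) ` Pol n (Suc m)" using k by (intro rev_image_eqI) auto
      qed
      show "(\<lambda>F. F xs) ` Pol n (Suc m) \<subseteq> line_extension K (f m xs) ((\<lambda>F. F xs) ` Pol n m)"
      proof
        fix u assume "u \<in> (\<lambda>F. F xs) ` Pol n (Suc m)"
        then obtain F where F: "F \<in> Pol n (Suc m)" "u = F xs" by blast
        from Pol_top[OF F(1)] show "u \<in> line_extension K (f m xs) ((\<lambda>F. F xs) ` Pol n m)"
        proof
          assume "F \<in> Pol n m"
          then have "u = \<zero> \<otimes> f m xs \<oplus> F xs" using lead_carr[OF c] F xs by (simp add: Pol_closed)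
          then show ?thesis unfolding line_extension_mem_iff using \<open>F \<in> Pol n m\<close> by (intro bexI[of _ \<zero>] bexI[of _ "F xs"]) auto
        next
          assume "\<exists>d. lead n F m d"
          then obtain d where d: "lead n F m d" by blast
          have dK: "d \<in> K" "d \<noteq> \<zero>" using d unfolding lead_def by auto
          let ?k = "d \<otimes> inv c"
          have k: "?k \<in> K" "?k \<noteq> \<zero>" using dK cK inv_nz[of c] by (auto simp: integral_iff)
          have "?k \<otimes> c = d" using dK cK inv_nz[of c] by (simp add: m_assoc)
          then have "lead n (\<lambda>v. ?k \<otimes> f m v) m d" using lead_smult[OF c k] by simp
          then have P: "(\<lambda>v. F v \<ominus> ?k \<otimes> f m v) \<in> Pol n m" by (rule lead_diff[OF d])
          have "u = ?k \<otimes> f m xs \<oplus> (F xs \<ominus> ?k \<otimes> f m xs)"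
            unfolding F(2) using lead_carr[OF c] lead_carr[OF d] K_carr[OF k(1)] by algebra
          moreover have "F xs \<ominus> ?k \<otimes> f m xs \<in> (\<lambda>F. F xs) ` Pol n m" by (rule rev_image_eqI[OF P]) simp
          ultimately show ?thesis unfolding line_extension_mem_iff using k by blast
        qed
      qed
    qed
    then show ?thesis using IH notin wl li_Cons[OF lead_carr[OF c], of K "map (\<lambda>s. f s xs) (wlist m)"] by simp
  qed
qed

lemma combine_Pol:
  assumes "set cs \<subseteq> K" "\<And>s. s \<in> set ws \<Longrightarrow> f s \<in> Pol n m"
  shows "(\<lambda>v. combine cs (map (\<lambda>s. f s v) ws)) \<in> Pol n m"
  using assms
proof (induction cs arbitrary: ws)
  case (Cons c cs)
  show ?case
  proof (cases ws)
    case (Cons w ws')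
    then show ?thesis using Cons.prems Cons.IH[of ws'] by (auto intro!: Pol_add Pol_smult)
  qed simp
qed simp

lemma one_point_basis_wlist:
  assumes "\<And>s. s \<in> set (wlist (Suc l)) \<Longrightarrow> \<exists>c. lead n (f s) s c"
  shows "one_point_basis K E Pinf l (map (\<lambda>s. f s xs) (wlist (Suc l)))"
  unfolding one_point_basis_def RR_space using wlist_basis[OF assms] by blast

lemma encoder_eq:
  assumes f: "\<And>s. s \<in> set (wlist (Suc l)) \<Longrightarrow> \<exists>c. lead n (f s) s c"
    and pts: "set pts \<subseteq> {a \<in> Pts n. set a \<subseteq> K}" and cs: "set cs \<subseteq> K"
  shows "one_point_encoder K E (map Ppt pts) (map (\<lambda>s. f s xs) (wlist (Suc l))) cs =
    map (\<lambda>a. combine cs (map (\<lambda>s. f s a) (wlist (Suc l)))) pts"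
proof -
  have fP: "f s \<in> Pol n (Suc l)" if "s \<in> set (wlist (Suc l))" for s
    using f[OF that] lead_Pol[of n "f s" s] that Pol_le[of "f s" n "Suc s" "Suc l"] by (auto simp: set_wlist)
  have "place_value K E (Ppt a) (combine cs (map (\<lambda>s. f s xs) (wlist (Suc l)))) =
      combine cs (map (\<lambda>s. f s a) (wlist (Suc l)))" if "a \<in> set pts" for a
    using Ppt_value[where a = a and F = "\<lambda>v. combine cs (map (\<lambda>s. f s v) (wlist (Suc l)))", OF _ _ combine_Pol[OF cs fP]]
      that pts by auto
  then show ?thesis unfolding one_point_encoder_def ag_codeword_def by simp
qed

lemma one_point_places_pts:
  assumes "distinct pts" "set pts \<subseteq> {a \<in> Pts n. set a \<subseteq> K}"
  shows "one_point_places K E Pinf (map Ppt pts)"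
proof -
  have "inj_on Ppt (set pts)" using assms(2) Ppt_inj by (intro inj_onI) blast
  moreover have "Ppt a \<noteq> Pinf" "rational_place K E (Ppt a)" if "a \<in> set pts" for a
    using Ppt_ne_Pinf[where a = a] Ppt_rational[where a = a] assms(2) that by auto
  ultimately show ?thesis unfolding one_point_places_def
    using assms(1) Pinf_rational by (fastforce simp: distinct_map)
qed

end

section \<open>Straight-line computations and fast transforms\<close>

lemma slp_run_append:
  "slp_run R (p @ p') mem = (case slp_run R p mem of None \<Rightarrow> None | Some m \<Rightarrow> slp_run R p' m)"
  by (induction p arbitrary: mem) (auto split: option.splits)

lemma slp_cost_append: "slp_cost (p @ p') = slp_cost p + slp_cost p'"
  by (simp add: slp_cost_def)

context const_field begin

text \<open>Straight-line computation without addresses: \<open>G\<close> is a set of functions of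
  the input that \<open>t\<close> operations make available from \<open>F\<close>. Constants are
  free, as \<open>Load\<close> is; \<open>weaken\<close> forgets values, and \<open>eq_on\<close>
  renames a function that has the same values on the admissible inputs.\<close>

inductive reach :: "'i set \<Rightarrow> ('i \<Rightarrow> 'a) set \<Rightarrow> nat \<Rightarrow> ('i \<Rightarrow> 'a) set \<Rightarrow> bool" for Dom F where
  base: "reach Dom F 0 F"
| const: "reach Dom F t G \<Longrightarrow> c \<in> K \<Longrightarrow> reach Dom F t (insert (\<lambda>_. c) G)"
| add: "reach Dom F t G \<Longrightarrow> f \<in> G \<Longrightarrow> g \<in> G \<Longrightarrow> reach Dom F (Suc t) (insert (\<lambda>x. f x \<oplus> g x) G)"
| mul: "reach Dom F t G \<Longrightarrow> f \<in> G \<Longrightarrow> g \<in> G \<Longrightarrow> reach Dom F (Suc t) (insert (\<lambda>x. f x \<otimes> g x) G)"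
| weaken: "reach Dom F t G \<Longrightarrow> H \<subseteq> G \<Longrightarrow> t \<le> u \<Longrightarrow> reach Dom F u H"
| eq_on: "reach Dom F t G \<Longrightarrow> g \<in> G \<Longrightarrow> (\<And>x. x \<in> Dom \<Longrightarrow> f x = g x) \<Longrightarrow> reach Dom F t (insert f G)"

lemma reach_trans: "reach Dom G s H \<Longrightarrow> reach Dom F t G \<Longrightarrow> reach Dom F (t + s) H"
proof (induction rule: reach.induct)
  case base
  then show ?case by simp
next
  case (const s H c)
  show ?case by (rule reach.const[OF const.IH[OF const.prems] const.hyps(2)])
next
  case (add s H f g)
  show ?case using reach.add[OF add.IH[OF add.prems] add.hyps(2,3)] by simp
next
  case (mul s H f g)
  show ?case using reach.mul[OF mul.IH[OF mul.prems] mul.hyps(2,3)] by simp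
next
  case (weaken s H H' u)
  show ?case by (rule reach.weaken[OF weaken.IH[OF weaken.prems] weaken.hyps(2)]) (use weaken in simp)
next
  case (eq_on s H g f)
  show ?case by (rule reach.eq_on[OF eq_on.IH[OF eq_on.prems] eq_on.hyps(2,3)])
qed

lemma reach_Un: "reach Dom F t G \<Longrightarrow> reach Dom (F \<union> A) t (G \<union> A)"
proof (induction rule: reach.induct)
  case base
  show ?case by (rule reach.base)
next
  case (const t G c)
  show ?case using reach.const[OF const.IH const.hyps(2)] by simp
next
  case (add t G f g)
  then show ?case using reach.add[OF add.IH, of f g] by simp
next
  case (mul t G f g)
  then show ?case using reach.mul[OF mul.IH, of f g] by simp
next
  case (weaken s H H' u)
  show ?case by (rule reach.weaken[OF weaken.IH _ weaken.hyps(3)]) (use weaken.hyps in blast)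
next
  case (eq_on t G g f)
  have "reach Dom (F \<union> A) t (insert f (G \<union> A))"
    by (rule reach.eq_on[OF eq_on.IH, of g]) (use eq_on.hyps in auto)
  then show ?case by simp
qed

lemma reach_subset: "H \<subseteq> F \<Longrightarrow> reach Dom F 0 H"
  by (rule reach.weaken[OF reach.base]) auto

lemma reach_both:
  assumes "reach Dom F t G" "reach Dom F s H" shows "reach Dom F (t + s) (G \<union> H)"
proof -
  have "reach Dom F t (G \<union> F)" using reach_Un[OF assms(1), of F] by simp
  moreover have "reach Dom (G \<union> F) s (G \<union> H)" using reach_Un[OF assms(2), of G] by (simp add: Un_commute)
  ultimately show ?thesis by (rule reach_trans[rotated])
qed

lemma reach_UN:
  assumes "finite J" "\<And>j. j \<in> J \<Longrightarrow> reach Dom F \<tau> (G j)"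
  shows "reach Dom F (card J * \<tau>) (\<Union>j\<in>J. G j)"
  using assms
proof (induction J)
  case empty
  then show ?case by (simp add: reach_subset)
next
  case (insert j J)
  have "reach Dom F (\<tau> + card J * \<tau>) (G j \<union> (\<Union>j\<in>J. G j))"
    using insert by (intro reach_both) auto
  then show ?case using insert by simp
qed

text \<open>One multiplication and one addition for each term, the first addition being to the
  constant zero.\<close>

lemma reach_lincomb:
  assumes "\<And>i. i < r' \<Longrightarrow> g i \<in> F" "\<And>i. i < r' \<Longrightarrow> m i \<in> K" "\<And>i x. i < r' \<Longrightarrow> x \<in> Dom \<Longrightarrow> g i x \<in> K"
  shows "reach Dom F (2 * r') {\<lambda>x. \<Oplus>i\<in>{..<r'::nat}. g i x \<otimes> m i}"
  using assms
proof (induction r')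
  case 0
  have "reach Dom F 0 (insert (\<lambda>_. \<zero>) F)" by (rule reach.const[OF reach.base]) simp
  then show ?case by (rule reach.weaken) auto
next
  case (Suc k)
  let ?S = "\<lambda>x. \<Oplus>i\<in>{..<k}. g i x \<otimes> m i"
  have 1: "reach Dom F (2 * k) ({?S} \<union> F)"
    using reach_Un[of Dom F "2 * k" "{?S}" F] Suc by simp
  have 2: "reach Dom F (2 * k) (insert (\<lambda>_. m k) ({?S} \<union> F))"
    by (rule reach.const[OF 1]) (use Suc in auto)
  have 3: "reach Dom F (Suc (2 * k)) (insert (\<lambda>x. g k x \<otimes> m k) (insert (\<lambda>_. m k) ({?S} \<union> F)))"
    by (rule reach.mul[OF 2]) (use Suc in auto)
  have 4: "reach Dom F (Suc (Suc (2 * k))) (insert (\<lambda>x. ?S x \<oplus> g k x \<otimes> m k) (insert (\<lambda>x. g k x \<otimes> m k) (insert (\<lambda>_. m k) ({?S} \<union> F))))"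
    by (rule reach.add[OF 3]) auto
  have "reach Dom F (Suc (Suc (2 * k))) (insert (\<lambda>x. \<Oplus>i\<in>{..<Suc k}. g i x \<otimes> m i) (insert (\<lambda>x. ?S x \<oplus> g k x \<otimes> m k) (insert (\<lambda>x. g k x \<otimes> m k) (insert (\<lambda>_. m k) ({?S} \<union> F)))))"
  proof (rule reach.eq_on[OF 4])
    fix x assume x: "x \<in> Dom"
    have cl: "g i x \<otimes> m i \<in> carrier E" if "i < Suc k" for i using Suc.prems that x by simp
    have "(\<Oplus>i\<in>{..<Suc k}. g i x \<otimes> m i) = g k x \<otimes> m k \<oplus> ?S x"
      unfolding lessThan_Suc using cl by (subst finsum_insert) auto
    moreover have "?S x \<in> carrier E" using cl by (intro finsum_closed) auto
    ultimately show "(\<Oplus>i\<in>{..<Suc k}. g i x \<otimes> m i) = ?S x \<oplus> g k x \<otimes> m k"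
      using cl[of k] by (simp add: a_comm)
  qed simp
  then show ?case by (rule reach.weaken) auto
qed

lemma reach_add_cong:
  assumes "finite H" "reach Dom F t G" "\<And>f. f \<in> H \<Longrightarrow> \<exists>g\<in>G. \<forall>x\<in>Dom. f x = g x"
  shows "reach Dom F t (G \<union> H)"
  using assms(1,3)
proof (induction H)
  case empty
  then show ?case using assms(2) by simp
next
  case (insert f H)
  then obtain g where "g \<in> G" "\<forall>x\<in>Dom. f x = g x" by blast
  then have "reach Dom F t (insert f (G \<union> H))"
    using insert by (intro reach.eq_on[of Dom F t "G \<union> H" g]) auto
  then show ?case by simp
qed

lemma reach_cong_image:
  assumes "reach Dom F t (f ` Y)" "finite Y" "\<And>y x. y \<in> Y \<Longrightarrow> x \<in> Dom \<Longrightarrow> f' y x = f y x"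
  shows "reach Dom F t (f' ` Y)"
  by (rule reach.weaken[OF reach_add_cong[OF _ assms(1), of "f' ` Y"]]) (use assms in auto)

section \<open>Mixed-radix transforms\<close>

lemma finsum_mod_reindex:
  assumes "\<And>d. d < M * k \<Longrightarrow> G d \<in> carrier E"
  shows "(\<Oplus>d\<in>{..<M * k}. G d) = (\<Oplus>d\<in>{..<M::nat}. \<Oplus>e\<in>{..<k::nat}. G (d + e * M))"
  using assms
proof (induction k)
  case 0
  then show ?case by simp
next
  case (Suc k)
  have lt: "d + e * M < M * Suc k" if "d < M" "e < Suc k" for d e
  proof -
    have "M * e \<le> M * k" using that by (intro mult_le_mono2) simp
    then have "d + M * e < M + M * k" using that by linarith
    then show ?thesis by (simp add: mult.commute)
  qed
  have "(\<Oplus>d\<in>{..<M * Suc k}. G d) = (\<Oplus>d\<in>{..<M * k} \<union> {M * k..<M * k + M}. G d)"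
    by (rule arg_cong[where f = "finsum E G"]) auto
  also have "\<dots> = (\<Oplus>d\<in>{..<M * k}. G d) \<oplus> (\<Oplus>d\<in>{M * k..<M * k + M}. G d)"
    using Suc.prems by (intro finsum_Un_disjoint) auto
  also have "(\<Oplus>d\<in>{M * k..<M * k + M}. G d) = (\<Oplus>d\<in>(\<lambda>d. d + k * M) ` {..<M}. G d)"
    by (rule arg_cong[where f = "finsum E G"])
      (simp only: lessThan_atLeast0 image_add_atLeastLessThan' add_0 mult.commute add.commute)
  also have "\<dots> = (\<Oplus>d\<in>{..<M}. G (d + k * M))"
    using Suc.prems by (subst finsum_reindex) (auto simp: inj_on_def mult.commute)
  also have "(\<Oplus>d\<in>{..<M * k}. G d) = (\<Oplus>d\<in>{..<M}. \<Oplus>e\<in>{..<k}. G (d + e * M))"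
    using Suc.prems by (intro Suc.IH) simp
  also have "\<dots> \<oplus> (\<Oplus>d\<in>{..<M}. G (d + k * M)) = (\<Oplus>d\<in>{..<M}. (\<Oplus>e\<in>{..<k}. G (d + e * M)) \<oplus> G (d + k * M))"
    using Suc.prems lt by (intro finsum_addf[symmetric]) (auto intro!: finsum_closed)
  also have "\<dots> = (\<Oplus>d\<in>{..<M}. \<Oplus>e\<in>{..<Suc k}. G (d + e * M))"
  proof (rule finsum_cong')
    fix d assume d: "d \<in> {..<M}"
    have cl: "\<And>e. e < Suc k \<Longrightarrow> G (d + e * M) \<in> carrier E" using Suc.prems lt d by simp
    then show "(\<Oplus>e\<in>{..<k}. G (d + e * M)) \<oplus> G (d + k * M) = (\<Oplus>e\<in>{..<Suc k}. G (d + e * M))"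
      unfolding lessThan_Suc by (subst finsum_insert) (auto simp: a_comm intro!: finsum_closed)
  qed (use Suc.prems lt in \<open>auto intro!: finsum_closed\<close>)
  finally show ?case .
qed

text \<open>The index \<open>d\<close> is written in the mixed radix system given by
  \<open>rad\<close>, and its digits are the exponents of the functions \<phi> j. Powers of y, with
  partial products of the radices as exponents, give y^d (\<open>fft_basis_power\<close>);
  polynomials vanishing on a chain of subgroups give a polynomial of degree d
  (\<open>monic_fft_basis\<close>).\<close>

fun fft_basis :: "(nat \<Rightarrow> nat) \<Rightarrow> (nat \<Rightarrow> 'a \<Rightarrow> 'a) \<Rightarrow> nat \<Rightarrow> nat \<Rightarrow> 'a \<Rightarrow> 'a" where
  "fft_basis rad \<phi> 0 d y = \<one>"
| "fft_basis rad \<phi> (Suc j) d y =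
     fft_basis rad \<phi> j (d mod prod rad {..<j}) y \<otimes> \<phi> j y [^] (d div prod rad {..<j})"

text \<open>The tree of splittings along which a transform descends; at its leaves at most one point
  is left. Parts may be empty or overlap, so \<open>rad j\<close> is merely an upper bound for their
  number.\<close>

fun fft_class :: "(nat \<Rightarrow> nat) \<Rightarrow> (nat \<Rightarrow> 'a \<Rightarrow> 'a) \<Rightarrow> nat \<Rightarrow> 'a set \<Rightarrow> bool" where
  "fft_class rad \<phi> 0 Y \<longleftrightarrow> (\<exists>y. Y \<subseteq> {y})"
| "fft_class rad \<phi> (Suc j) Y \<longleftrightarrow> (\<exists>Ys. Y = (\<Union>k<rad j. Ys k) \<and>
     (\<forall>k<rad j. fft_class rad \<phi> j (Ys k) \<and> (\<exists>\<sigma>\<in>K. \<forall>y\<in>Ys k. \<phi> j y = \<sigma>)))"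

lemma fft_class_finite: "fft_class rad \<phi> j Y \<Longrightarrow> finite Y"
proof (induction j arbitrary: Y)
  case 0
  then show ?case by (auto intro: finite_subset)
next
  case (Suc j)
  then show ?case by auto
qed

lemma K_finsum: "finite I \<Longrightarrow> (\<And>i. i \<in> I \<Longrightarrow> f i \<in> K) \<Longrightarrow> (\<Oplus>i\<in>I. f i) \<in> K"
  by (induction I rule: finite_induct) (auto simp: Pi_def)

lemma fft_basis_K: "fft_class rad \<phi> j Y \<Longrightarrow> y \<in> Y \<Longrightarrow> fft_basis rad \<phi> j d y \<in> K"
proof (induction j arbitrary: Y d)
  case (Suc j)
  then obtain Ys k where "k < rad j" "y \<in> Ys k" "fft_class rad \<phi> j (Ys k)" "\<exists>\<sigma>\<in>K. \<forall>y\<in>Ys k. \<phi> j y = \<sigma>"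
    by auto
  then show ?case using Suc.IH[of "Ys k"] by auto
qed simp

text \<open>On a part where \<phi> m is a constant \<sigma>, the powers of \<sigma> are absorbed
  into the coefficients, and a transform with M instead of M rad m coefficients remains. Absorbing
  costs 2 rad m operations for each of M coefficients and each of rad m parts, hence at most 2 B M
  rad m at each of the m levels.\<close>

theorem fft_reach:
  assumes "fft_class rad \<phi> m Y" and "\<And>j. j < m \<Longrightarrow> 0 < rad j \<and> rad j \<le> B"
    and "\<And>d. d < prod rad {..<m} \<Longrightarrow> g d \<in> F"
    and "\<And>d x. d < prod rad {..<m} \<Longrightarrow> x \<in> Dom \<Longrightarrow> g d x \<in> K"
  shows "reach Dom F (2 * B * m * prod rad {..<m})
    ((\<lambda>y x. \<Oplus>d\<in>{..<prod rad {..<m}}. g d x \<otimes> fft_basis rad \<phi> m d y) ` Y)"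
  using assms
proof (induction m arbitrary: Y g F)
  case 0
  then obtain y where y: "Y \<subseteq> {y}" by auto
  have "reach Dom F 0 (insert (\<lambda>x. \<Oplus>d\<in>{..<1::nat}. g d x \<otimes> \<one>) F)"
  proof (rule reach.eq_on[OF reach.base])
    show "g 0 \<in> F" using 0 by simp
    fix x assume "x \<in> Dom"
    then have "g 0 x \<in> carrier E" using 0 by simp
    moreover have "{..<1::nat} = {0}" by auto
    ultimately show "(\<Oplus>d\<in>{..<1::nat}. g d x \<otimes> \<one>) = g 0 x" by simp
  qed
  then show ?case by (rule reach.weaken) auto
next
  case (Suc m)
  define M where "M = prod rad {..<m}"
  have MS: "prod rad {..<Suc m} = M * rad m" by (simp add: M_def lessThan_Suc mult.commute)
  have M0: "0 < M" unfolding M_def using Suc.prems(2) by (intro prod_pos) auto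
  obtain Ys where Ys: "Y = (\<Union>k<rad m. Ys k)"
    "\<And>k. k < rad m \<Longrightarrow> fft_class rad \<phi> m (Ys k)"
    "\<And>k. k < rad m \<Longrightarrow> \<exists>\<sigma>\<in>K. \<forall>y\<in>Ys k. \<phi> m y = \<sigma>" using Suc.prems(1) by auto
  then obtain \<sigma> where \<sigma>: "\<And>k. k < rad m \<Longrightarrow> \<sigma> k \<in> K" "\<And>k y. k < rad m \<Longrightarrow> y \<in> Ys k \<Longrightarrow> \<phi> m y = \<sigma> k"
    by metis
  let ?out = "\<lambda>y x. \<Oplus>d\<in>{..<M * rad m}. g d x \<otimes> fft_basis rad \<phi> (Suc m) d y"
  have lt: "d + e * M < M * rad m" if "d < M" "e < rad m" for d e
  proof -
    have "Suc e * M \<le> rad m * M" using that by (intro mult_le_mono1) simp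
    then show ?thesis using that by (simp add: mult.commute)
  qed
  have one: "reach Dom F (M * (2 * rad m) + 2 * B * m * M) (?out ` Ys k)" if k: "k < rad m" for k
  proof -
    define h where "h d x = (\<Oplus>e\<in>{..<rad m}. g (d + e * M) x \<otimes> \<sigma> k [^] e)" for d x
    have hK: "h d x \<in> K" if "d < M" "x \<in> Dom" for d x
      unfolding h_def
    proof (rule K_finsum)
      fix e assume "e \<in> {..<rad m}"
      then show "g (d + e * M) x \<otimes> \<sigma> k [^] e \<in> K"
        using Suc.prems(4)[of "d + e * M" x] lt that \<sigma>(1)[OF k] unfolding MS by simp
    qed simp
    have "reach Dom F (card {..<M} * (2 * rad m)) (\<Union>d\<in>{..<M}. {h d})"
    proof (rule reach_UN)
      fix d assume d: "d \<in> {..<M}"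
      show "reach Dom F (2 * rad m) {h d}" unfolding h_def[abs_def]
        using d lt Suc.prems(3,4) \<sigma>(1)[OF k] unfolding MS by (intro reach_lincomb) auto
    qed simp
    then have 1: "reach Dom F (M * (2 * rad m)) (h ` {..<M})" by (simp add: UNION_singleton_eq_range)
    have 2: "reach Dom (h ` {..<M}) (2 * B * m * M)
      ((\<lambda>y x. \<Oplus>d\<in>{..<M}. h d x \<otimes> fft_basis rad \<phi> m d y) ` Ys k)"
      unfolding M_def
      by (rule Suc.IH[OF Ys(2)[OF k]]) (use Suc.prems(2) hK in \<open>auto simp: M_def[symmetric]\<close>)
    have 3: "reach Dom F (M * (2 * rad m) + 2 * B * m * M)
      ((\<lambda>y x. \<Oplus>d\<in>{..<M}. h d x \<otimes> fft_basis rad \<phi> m d y) ` Ys k)"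
      by (rule reach_trans[OF 2 1])
    have eq: "?out y x = (\<Oplus>d\<in>{..<M}. h d x \<otimes> fft_basis rad \<phi> m d y)" if y: "y \<in> Ys k" and x: "x \<in> Dom" for y x
    proof -
      have bK: "fft_basis rad \<phi> m d y \<in> K" for d by (rule fft_basis_K[OF Ys(2)[OF k] y])
      have gK: "d < M * rad m \<Longrightarrow> g d x \<in> K" for d using Suc.prems(4) x unfolding MS by blast
      have \<phi>y: "\<phi> m y = \<sigma> k" by (rule \<sigma>(2)[OF k y])
      have "?out y x = (\<Oplus>d\<in>{..<M}. \<Oplus>e\<in>{..<rad m}. g (d + e * M) x \<otimes> fft_basis rad \<phi> (Suc m) (d + e * M) y)"
        using gK bK \<sigma>(1)[OF k] \<phi>y by (intro finsum_mod_reindex) auto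
      also have "\<dots> = (\<Oplus>d\<in>{..<M}. h d x \<otimes> fft_basis rad \<phi> m d y)"
      proof (rule finsum_cong')
        fix d assume d: "d \<in> {..<M}"
        have "(\<Oplus>e\<in>{..<rad m}. g (d + e * M) x \<otimes> fft_basis rad \<phi> (Suc m) (d + e * M) y)
          = (\<Oplus>e\<in>{..<rad m}. (g (d + e * M) x \<otimes> \<sigma> k [^] e) \<otimes> fft_basis rad \<phi> m d y)"
        proof (rule finsum_cong')
          fix e assume e: "e \<in> {..<rad m}"
          have "g (d + e * M) x \<in> carrier E" "\<sigma> k [^] e \<in> carrier E" "fft_basis rad \<phi> m d y \<in> carrier E"
            using gK lt d e bK \<sigma>(1)[OF k] by auto
          moreover have "(d + e * M) mod M = d" "(d + e * M) div M = e" using d M0 by auto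
          ultimately show "g (d + e * M) x \<otimes> fft_basis rad \<phi> (Suc m) (d + e * M) y
            = (g (d + e * M) x \<otimes> \<sigma> k [^] e) \<otimes> fft_basis rad \<phi> m d y"
            by (simp add: M_def[symmetric] \<phi>y m_ac)
        qed (use gK lt d bK \<sigma>(1)[OF k] in auto)
        also have "\<dots> = h d x \<otimes> fft_basis rad \<phi> m d y"
          unfolding h_def using gK lt d bK \<sigma>(1)[OF k] by (intro finsum_ldistr[symmetric]) auto
        finally show "(\<Oplus>e\<in>{..<rad m}. g (d + e * M) x \<otimes> fft_basis rad \<phi> (Suc m) (d + e * M) y)
          = h d x \<otimes> fft_basis rad \<phi> m d y" .
      qed (use hK x bK in auto)
      finally show ?thesis .
    qed
    show ?thesis by (rule reach_cong_image[OF 3 fft_class_finite[OF Ys(2)[OF k]] eq])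
  qed
  have R: "reach Dom F (card {..<rad m} * (M * (2 * rad m) + 2 * B * m * M)) (\<Union>k\<in>{..<rad m}. ?out ` Ys k)"
    by (rule reach_UN) (use one in auto)
  have le: "card {..<rad m} * (M * (2 * rad m) + 2 * B * m * M) \<le> 2 * B * Suc m * (M * rad m)"
  proof -
    have "rad m \<le> B" using Suc.prems(2) by blast
    then have "rad m * M * (2 * rad m) \<le> rad m * M * (2 * B)" by (intro mult_le_mono2) simp
    then show ?thesis by (simp add: algebra_simps)
  qed
  have im: "?out ` Y = (\<Union>k\<in>{..<rad m}. ?out ` Ys k)" unfolding Ys(1) by blast
  show ?case unfolding MS im by (rule reach.weaken[OF R order_refl le])
qed

text \<open>The level of an entry is the length of the list behind it, so the last entry has level
  0. Levels are evaluated in increasing order, from the end of the list to its head.\<close>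

fun level_eval :: "(nat \<Rightarrow> nat \<Rightarrow> 'a \<Rightarrow> 'a) \<Rightarrow> nat list \<Rightarrow> 'a list \<Rightarrow> 'a" where
  "level_eval b (d # ds) (y # ys) = b (length ds) d y \<otimes> level_eval b ds ys"
| "level_eval b _ _ = \<one>"

fun box :: "(nat \<Rightarrow> nat) \<Rightarrow> nat \<Rightarrow> nat list set" where
  "box Dm 0 = {[]}"
| "box Dm (Suc v) = (\<lambda>(d, ds). d # ds) ` ({..<Dm v} \<times> box Dm v)"

text \<open>Exponents for the \<open>k\<close> levels from \<open>v\<close> upwards, built at the
  end of the list so that a list from \<open>box Dm v\<close> can be appended.\<close>

fun upper_box :: "(nat \<Rightarrow> nat) \<Rightarrow> nat \<Rightarrow> nat \<Rightarrow> nat list set" where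
  "upper_box Dm v 0 = {[]}"
| "upper_box Dm v (Suc k) = (\<lambda>(es, d). es @ [d]) ` (upper_box Dm (Suc v) k \<times> {..<Dm v})"

lemma finite_box: "finite (box Dm v)" by (induction v) auto

lemma box_length: "ds \<in> box Dm v \<Longrightarrow> length ds = v" by (induction v arbitrary: ds) auto

lemma upper_box_finite_card: "finite (upper_box Dm v k) \<and> card (upper_box Dm v k) \<le> prod Dm {v..<v + k}"
proof (induction k arbitrary: v)
  case (Suc k)
  have "card (upper_box Dm v (Suc k)) \<le> card (upper_box Dm (Suc v) k \<times> {..<Dm v})"
    unfolding upper_box.simps by (rule card_image_le) (use Suc in auto)
  also have "\<dots> \<le> prod Dm {Suc v..<Suc v + k} * Dm v"
    using Suc[of "Suc v"] by (simp add: card_cartesian_product)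
  also have "\<dots> = prod Dm {v..<v + Suc k}"
  proof -
    have "{v..<v + Suc k} = insert v {Suc v..<Suc v + k}" by auto
    then show ?thesis by (simp add: mult.commute)
  qed
  finally show ?case using Suc[of "Suc v"] by simp
qed simp

lemma upper_box_append: "es \<in> upper_box Dm v k \<Longrightarrow> ds \<in> box Dm v \<Longrightarrow> es @ ds \<in> box Dm (v + k)"
proof (induction k arbitrary: v es ds)
  case (Suc k)
  then obtain es' d where es: "es = es' @ [d]" "es' \<in> upper_box Dm (Suc v) k" "d < Dm v" by auto
  have "es' @ (d # ds) \<in> box Dm (Suc v + k)" using Suc.prems es by (intro Suc.IH) auto
  then show ?case by (simp add: es)
qed simp

lemma level_eval_K:
  assumes A0: "A 0 = {[]}"
    and Acl: "\<And>v Y. v < n \<Longrightarrow> Y \<in> A (Suc v) \<Longrightarrow> \<exists>y ys. Y = y # ys \<and> ys \<in> A v \<and> length ys = v"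
    and bK: "\<And>v d y ys. v < n \<Longrightarrow> d < Dm v \<Longrightarrow> y # ys \<in> A (Suc v) \<Longrightarrow> b v d y \<in> K"
  shows "v \<le> n \<Longrightarrow> ys \<in> A v \<Longrightarrow> ds \<in> box Dm v \<Longrightarrow> level_eval b ds ys \<in> K"
proof (induction v arbitrary: ys ds)
  case (Suc v)
  obtain y ys' where Y: "ys = y # ys'" "ys' \<in> A v" using Acl[of v ys] Suc.prems by auto
  obtain d ds' where ds: "ds = d # ds'" "d < Dm v" "ds' \<in> box Dm v" using Suc.prems by auto
  have "b v d y \<in> K" using bK[of v d y ys'] Suc.prems Y ds by simp
  then show ?case using Suc.IH[OF _ Y(2) ds(3)] Suc.prems Y ds box_length[OF ds(3)] by simp
qed (auto simp: A0)

text \<open>One variable at a time. After v levels the values held are the partial sums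
  \<open>S v es ys\<close>, one for every point \<open>ys\<close> of \<open>A v\<close> and every
  list \<open>es\<close> of exponents of the levels still open. Level v runs one univariate
  transform for each point of \<open>A v\<close> and each choice of the exponents above v, which
  explains the summands of the cost.\<close>

theorem tower_reach:
  assumes A0: "A 0 = {[]}" and Afin: "\<And>v. v \<le> n \<Longrightarrow> finite (A v)"
    and Acl: "\<And>v Y. v < n \<Longrightarrow> Y \<in> A (Suc v) \<Longrightarrow> \<exists>y ys. Y = y # ys \<and> ys \<in> A v \<and> length ys = v"
    and bK: "\<And>v d y ys. v < n \<Longrightarrow> d < Dm v \<Longrightarrow> y # ys \<in> A (Suc v) \<Longrightarrow> b v d y \<in> K"
    and c: "\<And>ds. ds \<in> box Dm n \<Longrightarrow> c ds \<in> F" "\<And>ds x. ds \<in> box Dm n \<Longrightarrow> x \<in> Dom \<Longrightarrow> c ds x \<in> K"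
    and step: "\<And>v ys G (g :: nat \<Rightarrow> 'i \<Rightarrow> 'a). v < n \<Longrightarrow> ys \<in> A v \<Longrightarrow> (\<And>d. d < Dm v \<Longrightarrow> g d \<in> G) \<Longrightarrow>
      (\<And>d x. d < Dm v \<Longrightarrow> x \<in> Dom \<Longrightarrow> g d x \<in> K) \<Longrightarrow>
      reach Dom G (\<tau> v) ((\<lambda>y x. \<Oplus>d\<in>{..<Dm v}. g d x \<otimes> b v d y) ` {y. y # ys \<in> A (Suc v)})"
  shows "reach Dom F (\<Sum>v<n. card (A v) * prod Dm {Suc v..<n} * \<tau> v)
    ((\<lambda>ys x. \<Oplus>ds\<in>box Dm n. c ds x \<otimes> level_eval b ds ys) ` A n)"
proof -
  define S where "S v es ys x = (\<Oplus>ds\<in>box Dm v. c (es @ ds) x \<otimes> level_eval b ds ys)" for v es ys x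
  have evK: "level_eval b ds ys \<in> K" if "v \<le> n" "ys \<in> A v" "ds \<in> box Dm v" for v ys ds
    by (rule level_eval_K[where A = A and n = n and Dm = Dm, OF A0 _ _ that]) (use Acl bK in blast)+
  have cK: "c (es @ ds) x \<in> K" if "v \<le> n" "es \<in> upper_box Dm v (n - v)" "ds \<in> box Dm v" "x \<in> Dom" for v es ds x
    using upper_box_append[OF that(2,3)] c(2) that by simp
  have SK: "S v es ys x \<in> K" if "v \<le> n" "es \<in> upper_box Dm v (n - v)" "ys \<in> A v" "x \<in> Dom" for v es ys x
    unfolding S_def by (rule K_finsum[OF finite_box]) (use that evK cK in simp)
  have S_Suc: "S (Suc v) es (y # ys) x = (\<Oplus>d\<in>{..<Dm v}. S v (es @ [d]) ys x \<otimes> b v d y)"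
    if v: "v < n" and es: "es \<in> upper_box Dm (Suc v) (n - Suc v)" and Y: "y # ys \<in> A (Suc v)" "ys \<in> A v" and x: "x \<in> Dom"
    for v es y ys x
  proof -
    have nv: "n - v = Suc (n - Suc v)" using v by simp
    have esd: "es @ [d] \<in> upper_box Dm v (n - v)" if "d < Dm v" for d using es that unfolding nv by auto
    have bc: "b v d y \<in> carrier E" if "d < Dm v" for d using bK[OF v that Y(1)] by simp
    have tm: "c (es @ d # ds) x \<in> carrier E" "level_eval b ds ys \<in> carrier E" if "d < Dm v" "ds \<in> box Dm v" for d ds
      using cK[OF _ esd[OF that(1)] that(2) x] evK[OF _ Y(2) that(2)] v by auto
    have "S (Suc v) es (y # ys) x = (\<Oplus>ds\<in>(\<Union>d\<in>{..<Dm v}. (\<lambda>ds. d # ds) ` box Dm v). c (es @ ds) x \<otimes> level_eval b ds (y # ys))"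
      unfolding S_def by (rule arg_cong[where f = "finsum E _"]) auto
    also have "\<dots> = (\<Oplus>d\<in>{..<Dm v}. \<Oplus>ds\<in>(\<lambda>ds. d # ds) ` box Dm v. c (es @ ds) x \<otimes> level_eval b ds (y # ys))"
      using tm bc box_length by (intro add.finprod_UN_disjoint) (auto simp: finite_box pairwise_def disjnt_def)
    also have "\<dots> = (\<Oplus>d\<in>{..<Dm v}. S v (es @ [d]) ys x \<otimes> b v d y)"
    proof (rule finsum_cong')
      fix d assume d: "d \<in> {..<Dm v}"
      have "(\<Oplus>ds\<in>(\<lambda>ds. d # ds) ` box Dm v. c (es @ ds) x \<otimes> level_eval b ds (y # ys))
        = (\<Oplus>ds\<in>box Dm v. c (es @ d # ds) x \<otimes> level_eval b (d # ds) (y # ys))"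
        using tm[of d] bc[of d] d box_length by (subst finsum_reindex) (auto simp: inj_on_def)
      also have "\<dots> = (\<Oplus>ds\<in>box Dm v. (c (es @ d # ds) x \<otimes> level_eval b ds ys) \<otimes> b v d y)"
        using tm[of d] bc[of d] d box_length by (intro finsum_cong') (auto simp: m_ac)
      also have "\<dots> = S v (es @ [d]) ys x \<otimes> b v d y"
        unfolding S_def using tm[of d] bc[of d] d by (subst finsum_ldistr) (auto simp: finite_box)
      finally show "(\<Oplus>ds\<in>(\<lambda>ds. d # ds) ` box Dm v. c (es @ ds) x \<otimes> level_eval b ds (y # ys))
        = S v (es @ [d]) ys x \<otimes> b v d y" .
    qed (use SK[of v _ ys x] esd v Y x bc in auto)
    finally show ?thesis .
  qed
  have main: "reach Dom F (\<Sum>u<v. card (A u) * prod Dm {Suc u..<n} * \<tau> u)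
      (\<Union>es\<in>upper_box Dm v (n - v). S v es ` A v)" if "v \<le> n" for v
    using that
  proof (induction v)
    case 0
    \<comment> \<open>At level 0 the partial sums are the coefficients themselves, up to the empty
      product 1.\<close>
    define H where "H = (\<Union>es\<in>upper_box Dm 0 n. S 0 es ` A 0)"
    have "reach Dom F 0 (F \<union> H)"
    proof (rule reach_add_cong[OF _ reach.base])
      show "finite H" using upper_box_finite_card by (simp add: H_def A0)
      fix f assume "f \<in> H"
      then obtain es where es: "es \<in> upper_box Dm 0 n" "f = S 0 es []" by (auto simp: H_def A0)
      have "es \<in> box Dm n" using upper_box_append[OF es(1), of "[]"] by simp
      then show "\<exists>g\<in>F. \<forall>x\<in>Dom. f x = g x" using c es(2) by (intro bexI[of _ "c es"]) (auto simp: S_def)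
    qed
    then show ?case by (rule reach.weaken) (auto simp: H_def)
  next
    case (Suc v)
    then have v: "v < n" by simp
    have nv: "n - v = Suc (n - Suc v)" using v by simp
    let ?G = "\<Union>es\<in>upper_box Dm v (n - v). S v es ` A v"
    have one: "reach Dom ?G (\<tau> v) ((\<lambda>y. S (Suc v) es (y # ys)) ` {y. y # ys \<in> A (Suc v)})"
      if es: "es \<in> upper_box Dm (Suc v) (n - Suc v)" and ys: "ys \<in> A v" for es ys
    proof -
      have esd: "es @ [d] \<in> upper_box Dm v (n - v)" if "d < Dm v" for d using es that unfolding nv by auto
      have R: "reach Dom ?G (\<tau> v) ((\<lambda>y x. \<Oplus>d\<in>{..<Dm v}. S v (es @ [d]) ys x \<otimes> b v d y) ` {y. y # ys \<in> A (Suc v)})"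
        using esd ys SK[of v] v by (intro step) auto
      have "finite ((\<lambda>y. y # ys) ` {y. y # ys \<in> A (Suc v)})"
        by (rule finite_subset[OF _ Afin[of "Suc v"]]) (use v in auto)
      then have fin: "finite {y. y # ys \<in> A (Suc v)}" by (rule finite_imageD) (auto simp: inj_on_def)
      show ?thesis
        by (rule reach_cong_image[OF R fin]) (use S_Suc[OF v es] ys in auto)
    qed
    let ?J = "upper_box Dm (Suc v) (n - Suc v) \<times> A v"
    have fJ: "finite ?J" using upper_box_finite_card Afin v by auto
    have "reach Dom ?G (card ?J * \<tau> v) (\<Union>j\<in>?J. (\<lambda>y. S (Suc v) (fst j) (y # snd j)) ` {y. y # snd j \<in> A (Suc v)})"
      by (rule reach_UN[OF fJ]) (use one in auto)
    from reach_trans[OF this Suc.IH]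
    have R: "reach Dom F ((\<Sum>u<v. card (A u) * prod Dm {Suc u..<n} * \<tau> u) + card ?J * \<tau> v)
      (\<Union>j\<in>?J. (\<lambda>y. S (Suc v) (fst j) (y # snd j)) ` {y. y # snd j \<in> A (Suc v)})" using v by simp
    show ?case
    proof (rule reach.weaken[OF R])
      have "card (upper_box Dm (Suc v) (n - Suc v)) \<le> prod Dm {Suc v..<n}"
        using upper_box_finite_card[of Dm "Suc v" "n - Suc v"] v by simp
      then have "card ?J * \<tau> v \<le> card (A v) * prod Dm {Suc v..<n} * \<tau> v"
        by (simp add: card_cartesian_product mult.commute)
      then show "(\<Sum>u<v. card (A u) * prod Dm {Suc u..<n} * \<tau> u) + card ?J * \<tau> v
        \<le> (\<Sum>u<Suc v. card (A u) * prod Dm {Suc u..<n} * \<tau> u)" by simp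
      show "(\<Union>es\<in>upper_box Dm (Suc v) (n - Suc v). S (Suc v) es ` A (Suc v))
        \<subseteq> (\<Union>j\<in>?J. (\<lambda>y. S (Suc v) (fst j) (y # snd j)) ` {y. y # snd j \<in> A (Suc v)})"
      proof
        fix f assume "f \<in> (\<Union>es\<in>upper_box Dm (Suc v) (n - Suc v). S (Suc v) es ` A (Suc v))"
        then obtain es Y where es: "es \<in> upper_box Dm (Suc v) (n - Suc v)" "Y \<in> A (Suc v)" "f = S (Suc v) es Y" by blast
        then obtain y ys where "Y = y # ys" "ys \<in> A v" using Acl v by blast
        then show "f \<in> (\<Union>j\<in>?J. (\<lambda>y. S (Suc v) (fst j) (y # snd j)) ` {y. y # snd j \<in> A (Suc v)})"
          using es by (intro UN_I[of "(es, ys)"]) auto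
      qed
    qed
  qed
  have "S n [] = (\<lambda>ys x. \<Oplus>ds\<in>box Dm n. c ds x \<otimes> level_eval b ds ys)" by (simp add: S_def fun_eq_iff)
  then show ?thesis using main[of n] by simp
qed

text \<open>The output addresses of a program must not depend on the input. The invariant therefore
  provides, for each available function, one address that is valid for all inputs;
  \<open>weaken\<close> and \<open>eq_on\<close> emit no instruction.\<close>

theorem reach_slp:
  fixes k :: nat
  defines "Dom \<equiv> {cs. set cs \<subseteq> K \<and> length cs = k}"
  assumes "reach Dom ((\<lambda>i cs. cs ! i) ` {..<k}) t G"
  shows "\<exists>prog memf. (\<Union>ins \<in> set prog. set_slp_instr ins) \<subseteq> K \<and> slp_cost prog \<le> t \<and>
    (\<forall>cs\<in>Dom. slp_run E prog cs = Some (memf cs) \<and> length (memf cs) = k + length prog) \<and>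
    (\<forall>g\<in>G. \<exists>i<k + length prog. \<forall>cs\<in>Dom. memf cs ! i = g cs)"
  using assms(2)
proof (induction rule: reach.induct)
  case base
  show ?case
    by (rule exI[of _ "[]"], rule exI[of _ "\<lambda>cs. cs"]) (auto simp: Dom_def slp_cost_def)
next
  case (const t G c)
  then obtain prog memf where P: "(\<Union>ins \<in> set prog. set_slp_instr ins) \<subseteq> K" "slp_cost prog \<le> t"
    "\<And>cs. cs \<in> Dom \<Longrightarrow> slp_run E prog cs = Some (memf cs) \<and> length (memf cs) = k + length prog"
    "\<And>g. g \<in> G \<Longrightarrow> \<exists>i<k + length prog. \<forall>cs\<in>Dom. memf cs ! i = g cs" by blast
  show ?case
  proof (intro exI[of _ "prog @ [Load c]"] exI[of _ "\<lambda>cs. memf cs @ [c]"] conjI ballI)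
    fix g assume "g \<in> insert (\<lambda>_. c) G"
    then show "\<exists>i<k + length (prog @ [Load c]). \<forall>cs\<in>Dom. (memf cs @ [c]) ! i = g cs"
    proof
      assume "g = (\<lambda>_. c)"
      then show ?thesis using P(3) by (intro exI[of _ "k + length prog"]) (auto simp: nth_append)
    next
      assume "g \<in> G"
      then obtain i where "i < k + length prog" "\<forall>cs\<in>Dom. memf cs ! i = g cs" using P(4) by blast
      then show ?thesis using P(3) by (intro exI[of _ i]) (auto simp: nth_append)
    qed
  qed (use P const in \<open>auto simp: slp_run_append slp_cost_append slp_cost_def\<close>)
next
  case (add t G f g)
  then obtain prog memf where P: "(\<Union>ins \<in> set prog. set_slp_instr ins) \<subseteq> K" "slp_cost prog \<le> t"
    "\<And>cs. cs \<in> Dom \<Longrightarrow> slp_run E prog cs = Some (memf cs) \<and> length (memf cs) = k + length prog"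
    "\<And>g. g \<in> G \<Longrightarrow> \<exists>i<k + length prog. \<forall>cs\<in>Dom. memf cs ! i = g cs" by blast
  obtain i where i: "i < k + length prog" "\<And>cs. cs \<in> Dom \<Longrightarrow> memf cs ! i = f cs" using P(4) add.hyps by blast
  obtain j where j: "j < k + length prog" "\<And>cs. cs \<in> Dom \<Longrightarrow> memf cs ! j = g cs" using P(4) add.hyps by blast
  show ?case
  proof (intro exI[of _ "prog @ [Add i j]"] exI[of _ "\<lambda>cs. memf cs @ [f cs \<oplus> g cs]"] conjI ballI)
    fix h assume "h \<in> insert (\<lambda>x. f x \<oplus> g x) G"
    then show "\<exists>a<k + length (prog @ [Add i j]). \<forall>cs\<in>Dom. (memf cs @ [f cs \<oplus> g cs]) ! a = h cs"
    proof
      assume "h = (\<lambda>x. f x \<oplus> g x)"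
      then show ?thesis using P(3) by (intro exI[of _ "k + length prog"]) (auto simp: nth_append)
    next
      assume "h \<in> G"
      then obtain i where "i < k + length prog" "\<forall>cs\<in>Dom. memf cs ! i = h cs" using P(4) by blast
      then show ?thesis using P(3) by (intro exI[of _ i]) (auto simp: nth_append)
    qed
  qed (use P i j in \<open>auto simp: slp_run_append slp_cost_append slp_cost_def\<close>)
next
  case (mul t G f g)
  then obtain prog memf where P: "(\<Union>ins \<in> set prog. set_slp_instr ins) \<subseteq> K" "slp_cost prog \<le> t"
    "\<And>cs. cs \<in> Dom \<Longrightarrow> slp_run E prog cs = Some (memf cs) \<and> length (memf cs) = k + length prog"
    "\<And>g. g \<in> G \<Longrightarrow> \<exists>i<k + length prog. \<forall>cs\<in>Dom. memf cs ! i = g cs" by blast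
  obtain i where i: "i < k + length prog" "\<And>cs. cs \<in> Dom \<Longrightarrow> memf cs ! i = f cs" using P(4) mul.hyps by blast
  obtain j where j: "j < k + length prog" "\<And>cs. cs \<in> Dom \<Longrightarrow> memf cs ! j = g cs" using P(4) mul.hyps by blast
  show ?case
  proof (intro exI[of _ "prog @ [Mul i j]"] exI[of _ "\<lambda>cs. memf cs @ [f cs \<otimes> g cs]"] conjI ballI)
    fix h assume "h \<in> insert (\<lambda>x. f x \<otimes> g x) G"
    then show "\<exists>a<k + length (prog @ [Mul i j]). \<forall>cs\<in>Dom. (memf cs @ [f cs \<otimes> g cs]) ! a = h cs"
    proof
      assume "h = (\<lambda>x. f x \<otimes> g x)"
      then show ?thesis using P(3) by (intro exI[of _ "k + length prog"]) (auto simp: nth_append)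
    next
      assume "h \<in> G"
      then obtain i where "i < k + length prog" "\<forall>cs\<in>Dom. memf cs ! i = h cs" using P(4) by blast
      then show ?thesis using P(3) by (intro exI[of _ i]) (auto simp: nth_append)
    qed
  qed (use P i j in \<open>auto simp: slp_run_append slp_cost_append slp_cost_def\<close>)
next
  case (weaken t G H u)
  then obtain prog memf where P: "(\<Union>ins \<in> set prog. set_slp_instr ins) \<subseteq> K" "slp_cost prog \<le> t"
    "\<forall>cs\<in>Dom. slp_run E prog cs = Some (memf cs) \<and> length (memf cs) = k + length prog"
    "\<forall>g\<in>G. \<exists>i<k + length prog. \<forall>cs\<in>Dom. memf cs ! i = g cs" by blast
  have "\<forall>g\<in>H. \<exists>i<k + length prog. \<forall>cs\<in>Dom. memf cs ! i = g cs" using P(4) weaken.hyps(2) by blast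
  moreover have "slp_cost prog \<le> u" using P(2) weaken.hyps(3) by simp
  ultimately show ?case using P(1,3) by blast
next
  case (eq_on t G g f)
  then obtain prog memf where P: "(\<Union>ins \<in> set prog. set_slp_instr ins) \<subseteq> K" "slp_cost prog \<le> t"
    "\<forall>cs\<in>Dom. slp_run E prog cs = Some (memf cs) \<and> length (memf cs) = k + length prog"
    "\<And>g. g \<in> G \<Longrightarrow> \<exists>i<k + length prog. \<forall>cs\<in>Dom. memf cs ! i = g cs" by blast
  have "\<exists>i<k + length prog. \<forall>cs\<in>Dom. memf cs ! i = h cs" if "h \<in> insert f G" for h
    using that P(4)[of g] P(4)[of h] eq_on.hyps by auto
  then show ?case using P(1-3) by blast
qed

theorem reach_encodable:
  assumes "one_point_basis K E Pinf l bs"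
    and "reach {cs. set cs \<subseteq> K \<and> length cs = length bs} ((\<lambda>i cs. cs ! i) ` {..<length bs}) t G"
    and "\<And>P. P \<in> set Ps \<Longrightarrow> \<exists>g\<in>G. \<forall>cs. set cs \<subseteq> K \<and> length cs = length bs \<longrightarrow>
        place_value K E P (combine cs bs) = g cs"
    and "real t \<le> T"
  shows "encodable_within K E Pinf Ps l T"
proof -
  obtain prog memf where P: "(\<Union>ins \<in> set prog. set_slp_instr ins) \<subseteq> K" "slp_cost prog \<le> t"
    "\<And>cs. set cs \<subseteq> K \<Longrightarrow> length cs = length bs \<Longrightarrow>
      slp_run E prog cs = Some (memf cs) \<and> length (memf cs) = length bs + length prog"
    "\<And>g. g \<in> G \<Longrightarrow> \<exists>i<length bs + length prog. \<forall>cs. set cs \<subseteq> K \<and> length cs = length bs \<longrightarrow> memf cs ! i = g cs"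
    using reach_slp[OF assms(2)] unfolding Ball_def mem_Collect_eq by blast
  have "\<exists>i<length bs + length prog. \<forall>cs. set cs \<subseteq> K \<and> length cs = length bs \<longrightarrow>
      memf cs ! i = place_value K E P (combine cs bs)" if "P \<in> set Ps" for P
    using assms(3)[OF that] P(4) by metis
  then obtain ad where ad: "\<And>P. P \<in> set Ps \<Longrightarrow> ad P < length bs + length prog"
    "\<And>P cs. P \<in> set Ps \<Longrightarrow> set cs \<subseteq> K \<Longrightarrow> length cs = length bs \<Longrightarrow> memf cs ! ad P = place_value K E P (combine cs bs)"
    by metis
  have "slp_computes K E prog (map ad Ps) (length bs) (one_point_encoder K E Ps bs)"
    unfolding slp_computes_def one_point_encoder_def ag_codeword_def
    using P(1,3) ad by auto
  then show ?thesis unfolding encodable_within_def using assms(1,4) P(2)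
    by (intro exI[of _ bs] exI[of _ prog] exI[of _ "map ad Ps"]) auto
qed

end

section \<open>Rational points and subgroup chains\<close>

context const_field begin

section \<open>Trace, norm and the sizes of their fibres\<close>

lemma fixed_card: "card {u \<in> K. u [^] \<kappa> = u} \<le> \<kappa>"
proof -
  have "{u \<in> K. u [^] \<kappa> = u} \<subseteq> insert \<zero> {u \<in> K. u [^] (\<kappa> - 1) = \<one>}"
  proof
    fix u assume u: "u \<in> {u \<in> K. u [^] \<kappa> = u}"
    have "u [^] (\<kappa> - 1) = \<one>" if "u \<noteq> \<zero>"
    proof -
      have uc: "u \<in> carrier E" "u \<in> K" using u by auto
      have "u \<otimes> u [^] (\<kappa> - 1) = u [^] Suc (\<kappa> - 1)" using uc by (simp add: m_comm)
      also have "\<dots> = u \<otimes> \<one>" using u kappa_gt_1 uc by simp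
      finally show ?thesis using m_lcancel[of u "u [^] (\<kappa> - 1)" \<one>] uc that by simp
    qed
    then show "u \<in> insert \<zero> {u \<in> K. u [^] (\<kappa> - 1) = \<one>}" using u by auto
  qed
  then have "card {u \<in> K. u [^] \<kappa> = u} \<le> card (insert \<zero> {u \<in> K. u [^] (\<kappa> - 1) = \<one>})"
    using finite_K by (intro card_mono) auto
  also have "\<dots> \<le> Suc (card {u \<in> K. u [^] (\<kappa> - 1) = \<one>})" by (rule card_insert_le_m1) simp_all
  also have "\<dots> \<le> Suc (\<kappa> - 1)" using K_roots_of_unity[of "\<kappa> - 1"] kappa_gt_1 by simp
  finally show ?thesis using kappa_gt_1 by simp
qed

text \<open>Dividing by one nonzero root maps the others into the roots of unity; for \<gamma> = 0
  the only root is zero.\<close>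

lemma roots_card:
  assumes "0 < k" "\<gamma> \<in> K" shows "card {y \<in> K. y [^] (k::nat) = \<gamma>} \<le> k"
proof (cases "\<exists>y0\<in>K. y0 [^] k = \<gamma> \<and> y0 \<noteq> \<zero>")
  case False
  then have "{y \<in> K. y [^] k = \<gamma>} \<subseteq> {\<zero>}" by auto
  then have "card {y \<in> K. y [^] k = \<gamma>} \<le> card {\<zero>}" by (intro card_mono) auto
  then show ?thesis using assms(1) by simp
next
  case True
  then obtain y0 where y0: "y0 \<in> K" "y0 [^] k = \<gamma>" "y0 \<noteq> \<zero>" by blast
  note i = inv_nz[OF K_carr[OF y0(1)] y0(3)]
  have "card {y \<in> K. y [^] k = \<gamma>} \<le> card {u \<in> K. u [^] k = \<one>}"
  proof (rule card_inj_on_le[of "\<lambda>y. y \<otimes> inv y0"])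
    show "inj_on (\<lambda>y. y \<otimes> inv y0) {y \<in> K. y [^] k = \<gamma>}"
      using i m_rcancel[of "inv y0"] by (auto simp: inj_on_def)
    show "(\<lambda>y. y \<otimes> inv y0) ` {y \<in> K. y [^] k = \<gamma>} \<subseteq> {u \<in> K. u [^] k = \<one>}"
    proof clarify
      fix y assume y: "y \<in> K" "\<gamma> = y [^] k"
      have "(y \<otimes> inv y0) [^] k = y0 [^] k \<otimes> inv y0 [^] k"
        using y y0 i by (simp add: nat_pow_distrib)
      also have "\<dots> = (y0 \<otimes> inv y0) [^] k" using y0 i by (intro nat_pow_distrib[symmetric]) auto
      finally show "y \<otimes> inv y0 \<in> K \<and> (y \<otimes> inv y0) [^] k = \<one>" using y y0 i by simp
    qed
  qed (use finite_K in simp)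
  then show ?thesis using K_roots_of_unity[OF assms(1)] by simp
qed

text \<open>The trace of K over its subfield with \<kappa> elements. The set \<open>Ktr\<close>
  below is that subfield, and by \<open>norm_Ktr\<close> the norms a^(\<kappa>+1) lie in it as
  well.\<close>

definition tr :: "'a \<Rightarrow> 'a" where "tr y = y [^] \<kappa> \<oplus> y"
definition Ktr :: "'a set" where "Ktr = {u \<in> K. u [^] \<kappa> = u}"

lemma frob_kappa_add: "a \<in> carrier E \<Longrightarrow> b \<in> carrier E \<Longrightarrow> (a \<oplus> b) [^] \<kappa> = a [^] \<kappa> \<oplus> b [^] \<kappa>"
  using frob_add[of a b r] by (simp add: \<kappa>)

lemma tr_K [simp]: "y \<in> K \<Longrightarrow> tr y \<in> K" by (simp add: tr_def)

lemma pow_kappa_kappa: "y \<in> K \<Longrightarrow> (y [^] \<kappa>) [^] \<kappa> = y"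
  using K_pow_q[of y] by (simp add: nat_pow_pow q power2_eq_square)

lemma tr_Ktr: "y \<in> K \<Longrightarrow> tr y \<in> Ktr"
  using frob_kappa_add[of "y [^] \<kappa>" y] by (simp add: Ktr_def tr_def pow_kappa_kappa a_comm)

lemma norm_Ktr: assumes "a \<in> K" shows "a [^] Suc \<kappa> \<in> Ktr"
proof -
  have "(a [^] Suc \<kappa>) [^] \<kappa> = (a [^] \<kappa>) [^] \<kappa> \<otimes> a [^] \<kappa>"
    using assms by (simp add: nat_pow_distrib)
  then show ?thesis using assms by (simp add: Ktr_def pow_kappa_kappa m_comm)
qed

lemma tr_add: "a \<in> K \<Longrightarrow> b \<in> K \<Longrightarrow> tr (a \<oplus> b) = tr a \<oplus> tr b"
  by (simp add: tr_def frob_kappa_add a_ac)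

lemma tr_zero: "tr \<zero> = \<zero>" using kappa_gt_1 by (simp add: tr_def nat_pow_zero)

lemma tr_uminus: "a \<in> K \<Longrightarrow> tr (\<ominus> a) = \<ominus> tr a"
  using tr_add[of "\<ominus> a" a] minus_equality[of "tr (\<ominus> a)" "tr a"] by (simp add: l_neg tr_zero)

definition ker :: "'a set" where "ker = {y \<in> K. tr y = \<zero>}"

text \<open>Elements of the kernel satisfy y^\<kappa> = -y, so quotients of two of them satisfy
  u^\<kappa> = u.\<close>

lemma ker_card_le: "card ker \<le> \<kappa>"
proof (cases "ker \<subseteq> {\<zero>}")
  case True
  then have "card ker \<le> card {\<zero>}" by (intro card_mono) auto
  then show ?thesis using kappa_gt_1 by simp
next
  case False
  then obtain y0 where y0: "y0 \<in> K" "tr y0 = \<zero>" "y0 \<noteq> \<zero>" by (auto simp: ker_def)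
  note i = inv_nz[OF K_carr[OF y0(1)] y0(3)]
  have neg: "y [^] \<kappa> = \<ominus> y" if "y \<in> K" "tr y = \<zero>" for y
    using that minus_equality[of "y [^] \<kappa>" y] by (simp add: tr_def)
  have "card ker \<le> card {u \<in> K. u [^] \<kappa> = u}"
  proof (rule card_inj_on_le[of "\<lambda>y. y \<otimes> inv y0"])
    show "inj_on (\<lambda>y. y \<otimes> inv y0) ker"
      using i m_rcancel[of "inv y0"] by (auto simp: inj_on_def ker_def)
    show "(\<lambda>y. y \<otimes> inv y0) ` ker \<subseteq> {u \<in> K. u [^] \<kappa> = u}"
    proof clarify
      fix y assume y: "y \<in> ker"
      then have yK: "y \<in> K" by (simp add: ker_def)
      have i0: "inv y0 [^] \<kappa> = \<ominus> (inv y0)"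
      proof -
        have "y0 [^] \<kappa> \<otimes> inv y0 [^] \<kappa> = \<one>" using y0 i nat_pow_distrib[of y0 "inv y0" \<kappa>] by simp
        then have "(\<ominus> y0) \<otimes> inv y0 [^] \<kappa> = \<one>" using neg y0 by simp
        moreover have "(\<ominus> y0) \<otimes> (\<ominus> (inv y0)) = \<one>" using y0 i by (simp add: l_minus r_minus)
        moreover have "\<ominus> y0 \<noteq> \<zero>" using y0 minus_minus[of y0] by force
        ultimately show ?thesis
          using m_lcancel[of "\<ominus> y0" "inv y0 [^] \<kappa>" "\<ominus> (inv y0)"] y0 i by simp
      qed
      have "(y \<otimes> inv y0) [^] \<kappa> = (\<ominus> y) \<otimes> (\<ominus> (inv y0))"
        using yK i neg[of y] y i0 by (simp add: nat_pow_distrib ker_def)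
      then show "y \<otimes> inv y0 \<in> K \<and> (y \<otimes> inv y0) [^] \<kappa> = y \<otimes> inv y0"
        using yK i y0 by (simp add: l_minus r_minus)
    qed
  qed (use finite_K in simp)
  then show ?thesis using fixed_card by simp
qed

definition coset :: "'a \<Rightarrow> 'a set \<Rightarrow> 'a set" where "coset y U = (\<lambda>w. y \<oplus> w) ` U"

definition add_sub :: "'a set \<Rightarrow> bool" where
  "add_sub U \<longleftrightarrow> U \<subseteq> K \<and> \<zero> \<in> U \<and> (\<forall>a\<in>U. \<forall>b\<in>U. a \<oplus> b \<in> U) \<and> (\<forall>a\<in>U. \<ominus> a \<in> U)"

lemma add_subD:
  assumes "add_sub U"
  shows "U \<subseteq> K" "\<zero> \<in> U" "\<And>a b. a \<in> U \<Longrightarrow> b \<in> U \<Longrightarrow> a \<oplus> b \<in> U" "\<And>a. a \<in> U \<Longrightarrow> \<ominus> a \<in> U"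
    "finite U" "\<And>a. a \<in> U \<Longrightarrow> a \<in> carrier E"
  using assms finite_subset[OF _ finite_K] unfolding add_sub_def by auto

lemma add_sub_ker: "add_sub ker"
  unfolding add_sub_def ker_def by (auto simp: tr_add tr_uminus tr_zero)

lemma add_sub_K: "add_sub K"
  unfolding add_sub_def by auto

lemma card_coset: assumes "add_sub U" "y \<in> K" shows "card (coset y U) = card U"
  unfolding coset_def by (rule card_image) (use add_subD(6)[OF assms(1)] assms(2) in \<open>auto simp: inj_on_def\<close>)

lemma coset_iff:
  assumes "add_sub U" "y \<in> K"
  shows "z \<in> coset y U \<longleftrightarrow> z \<in> K \<and> z \<ominus> y \<in> U"
proof
  assume "z \<in> coset y U"
  then obtain w where w: "w \<in> U" "z = y \<oplus> w" by (auto simp: coset_def)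
  have "w \<in> K" using w add_subD(1)[OF assms(1)] by blast
  moreover have "(y \<oplus> w) \<ominus> y = w" using K_carr[OF assms(2)] K_carr[OF \<open>w \<in> K\<close>] by algebra
  ultimately show "z \<in> K \<and> z \<ominus> y \<in> U" using w assms by simp
next
  assume z: "z \<in> K \<and> z \<ominus> y \<in> U"
  have "z = y \<oplus> (z \<ominus> y)" using K_carr[of z] z K_carr[OF assms(2)] by algebra
  then show "z \<in> coset y U" using z unfolding coset_def by blast
qed

lemma tr_fibre: assumes "y0 \<in> K" shows "{y \<in> K. tr y = tr y0} = coset y0 ker"
proof -
  have "tr (y \<ominus> y0) = \<zero> \<longleftrightarrow> tr y = tr y0" if "y \<in> K" for y
  proof -
    have c: "tr y \<in> carrier E" "tr y0 \<in> carrier E" using that assms by auto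
    have "tr (y \<ominus> y0) = tr y \<oplus> \<ominus> tr y0" using that assms tr_add[of y "\<ominus> y0"] tr_uminus by (simp add: minus_eq)
    then show ?thesis using c by (metis add.inv_closed minus_equality minus_minus r_neg)
  qed
  then show ?thesis using coset_iff[OF add_sub_ker assms] assms by (auto simp: ker_def)
qed

text \<open>At most \<kappa> fibres with at most \<kappa> points each have to exhaust the \<kappa>^2
  elements of K, so all of them are full. In particular every norm is a trace, and rational points
  always extend to the next level.\<close>

lemma tr_fibre_card: assumes "c \<in> Ktr" shows "card {y \<in> K. tr y = c} = \<kappa>"
proof -
  have finT: "finite Ktr" using finite_K by (simp add: Ktr_def)
  have le: "card {y \<in> K. tr y = c} \<le> \<kappa>" for c
  proof (cases "\<exists>y0\<in>K. tr y0 = c")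
    case True
    then obtain y0 where y0: "y0 \<in> K" "tr y0 = c" by blast
    then show ?thesis using tr_fibre[OF y0(1)] card_coset[OF add_sub_ker y0(1)] ker_card_le by simp
  next
    case False
    then have "{y \<in> K. tr y = c} = {}" by blast
    then show ?thesis by (simp only: card.empty)
  qed
  show ?thesis
  proof (rule ccontr)
    assume "card {y \<in> K. tr y = c} \<noteq> \<kappa>"
    then have lt: "card {y \<in> K. tr y = c} < \<kappa>" using le[of c] by simp
    have "K = (\<Union>c\<in>Ktr. {y \<in> K. tr y = c})" using tr_Ktr by auto
    then have "card K = card (\<Union>c\<in>Ktr. {y \<in> K. tr y = c})" by simp
    also have "\<dots> \<le> (\<Sum>c\<in>Ktr. card {y \<in> K. tr y = c})" using finT by (rule card_UN_le)
    also have "\<dots> < (\<Sum>c\<in>Ktr. \<kappa>)" using lt assms le by (intro sum_strict_mono_ex1[OF finT]) auto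
    also have "\<dots> \<le> \<kappa> * \<kappa>" using fixed_card by (simp add: Ktr_def)
    finally show False by (simp add: card_K q power2_eq_square)
  qed
qed

lemma ker_card: "card ker = \<kappa>"
  using tr_fibre_card[of \<zero>] kappa_gt_1 by (simp add: Ktr_def ker_def nat_pow_zero)

section \<open>The rational points of the tower\<close>

definition TP :: "nat \<Rightarrow> 'a list set" where
  "TP v = {a. length a = v \<and> set a \<subseteq> K \<and> herm E \<kappa> a}"

lemma TP_Pts: "TP v = {a \<in> Pts v. set a \<subseteq> K}"
  using K_sub by (auto simp: TP_def Pts_def)

lemma TP_0: "TP 0 = {[]}" by (auto simp: TP_def)

lemma TP_tl: "y # ys \<in> TP (Suc v) \<Longrightarrow> ys \<in> TP v \<and> y \<in> K"
  by (cases ys) (auto simp: TP_def)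

lemma TP_Suc: "TP (Suc v) = (\<Union>ys\<in>TP v. (\<lambda>y. y # ys) ` {y. y # ys \<in> TP (Suc v)})"
proof -
  have "a \<in> (\<Union>ys\<in>TP v. (\<lambda>y. y # ys) ` {y. y # ys \<in> TP (Suc v)})" if "a \<in> TP (Suc v)" for a
    using that TP_tl by (cases a) (auto simp: TP_def)
  then show ?thesis by auto
qed

lemma TP_first: "{y. [y] \<in> TP (Suc 0)} = K" by (auto simp: TP_def)

lemma TP_fibre: "z # zs \<in> TP (Suc v) \<Longrightarrow> {y. y # z # zs \<in> TP (Suc (Suc v))} = {y \<in> K. tr y = z [^] Suc \<kappa>}"
  by (auto simp: TP_def tr_def)

lemma TP_fibre_card: "ys \<in> TP (Suc v) \<Longrightarrow> card {y. y # ys \<in> TP (Suc (Suc v))} = \<kappa>"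
proof -
  assume ys: "ys \<in> TP (Suc v)"
  then obtain z zs where z: "ys = z # zs" by (cases ys) (auto simp: TP_def)
  then have "z \<in> K" using ys TP_tl by blast
  then show ?thesis using TP_fibre ys z tr_fibre_card[OF norm_Ktr] by simp
qed

lemma TP_finite: "finite (TP v)"
  by (rule finite_subset[OF _ finite_lists_length_eq[OF finite_K, of v]]) (auto simp: TP_def)

text \<open>There are \<kappa>^2 choices for x_1 and \<kappa> for each further coordinate.\<close>

lemma TP_card: "card (TP (Suc v)) = \<kappa> ^ (v + 2)"
proof (induction v)
  case 0
  have "TP (Suc 0) = (\<lambda>y. [y]) ` K" using TP_Suc[of 0] TP_0 TP_first by simp
  then show ?case by (simp add: card_image inj_on_def card_K q power2_eq_square)
next
  case (Suc v)
  define Fb where "Fb ys = {y. y # ys \<in> TP (Suc (Suc v))}" for ys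
  have "card (TP (Suc (Suc v))) = card (\<Union>ys\<in>TP (Suc v). (\<lambda>y. y # ys) ` Fb ys)"
    using arg_cong[OF TP_Suc[of "Suc v"], of card] unfolding Fb_def .
  also have "\<dots> = (\<Sum>ys\<in>TP (Suc v). card ((\<lambda>y. y # ys) ` Fb ys))"
  proof (rule card_UN_disjoint[OF TP_finite])
    show "\<forall>ys\<in>TP (Suc v). finite ((\<lambda>y. y # ys) ` Fb ys)"
      unfolding Fb_def by (intro ballI finite_subset[OF _ TP_finite[of "Suc (Suc v)"]]) auto
  qed auto
  also have "\<dots> = (\<Sum>ys\<in>TP (Suc v). \<kappa>)"
    by (rule sum.cong) (auto simp: card_image inj_on_def TP_fibre_card Fb_def)
  finally show ?case using Suc by simp
qed

section \<open>Evaluation sets that admit fast transforms\<close>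

lemma fft_class_empty: "fft_class rad \<phi> j {}"
proof (induction j)
  case (Suc j)
  then show ?case by (auto intro!: exI[of _ "\<lambda>_. {}"] bexI[of _ \<zero>])
qed simp

text \<open>A splitting into fewer than \<open>rad j\<close> parts is padded with empty
  ones.\<close>

lemma fft_class_Suc:
  assumes "finite \<Gamma>" "card \<Gamma> \<le> rad j" "Y = (\<Union>\<gamma>\<in>\<Gamma>. Z \<gamma>)"
    and "\<And>\<gamma>. \<gamma> \<in> \<Gamma> \<Longrightarrow> fft_class rad \<phi> j (Z \<gamma>)"
    and "\<And>\<gamma>. \<gamma> \<in> \<Gamma> \<Longrightarrow> \<exists>\<sigma>\<in>K. \<forall>y\<in>Z \<gamma>. \<phi> j y = \<sigma>"
  shows "fft_class rad \<phi> (Suc j) Y"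
proof -
  obtain e where e: "bij_betw e {0..<card \<Gamma>} \<Gamma>" using ex_bij_betw_nat_finite[OF assms(1)] by blast
  define Ys where "Ys k = (if k < card \<Gamma> then Z (e k) else {})" for k
  have eG: "k < card \<Gamma> \<Longrightarrow> e k \<in> \<Gamma>" for k using bij_betwE[OF e] by simp
  have "Y = (\<Union>k<rad j. Ys k)"
  proof
    show "Y \<subseteq> (\<Union>k<rad j. Ys k)"
    proof
      fix y assume "y \<in> Y"
      then obtain \<gamma> where g: "\<gamma> \<in> \<Gamma>" "y \<in> Z \<gamma>" using assms(3) by blast
      then obtain k where "k < card \<Gamma>" "e k = \<gamma>" using e unfolding bij_betw_def by force
      then show "y \<in> (\<Union>k<rad j. Ys k)" using g assms(2) by (auto simp: Ys_def intro!: bexI[of _ k])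
    qed
    show "(\<Union>k<rad j. Ys k) \<subseteq> Y" using eG assms(3) by (auto simp: Ys_def split: if_splits)
  qed
  moreover have "fft_class rad \<phi> j (Ys k) \<and> (\<exists>\<sigma>\<in>K. \<forall>y\<in>Ys k. \<phi> j y = \<sigma>)" for k
    using assms(4,5)[OF eG, of k] fft_class_empty K_closed(1)
    by (cases "k < card \<Gamma>") (auto simp: Ys_def simp del: K_closed(1))
  ultimately show ?thesis unfolding fft_class.simps by blast
qed

text \<open>Raising to the product of the first m radices sends the set into the roots of order
  \<open>rad m\<close> of \<gamma>, of which there are at most \<open>rad m\<close>. The value
  \<gamma> = 0 is included and yields the class of zero alone.\<close>

lemma fft_class_power:
  assumes "\<And>j. j < m \<Longrightarrow> 0 < rad j" and "\<gamma> \<in> K"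
  shows "fft_class rad (\<lambda>j y. y [^] prod rad {..<j}) m {y \<in> K. y [^] prod rad {..<m} = \<gamma>}"
  using assms
proof (induction m arbitrary: \<gamma>)
  case 0
  then show ?case by (auto intro!: exI[of _ \<gamma>])
next
  case (Suc m)
  let ?\<Gamma> = "{g \<in> K. g [^] rad m = \<gamma>}"
  show ?case
  proof (rule fft_class_Suc[of ?\<Gamma>])
    show "card ?\<Gamma> \<le> rad m" using Suc.prems by (intro roots_card) auto
    show "{y \<in> K. y [^] prod rad {..<Suc m} = \<gamma>} = (\<Union>g\<in>?\<Gamma>. {y \<in> K. y [^] prod rad {..<m} = g})"
      using K_pow by (auto simp: lessThan_Suc nat_pow_pow mult.commute)
  qed (use Suc finite_K in auto)
qed

lemma fft_basis_power:
  "y \<in> K \<Longrightarrow> d < prod rad {..<m} \<Longrightarrow> (\<And>j. j < m \<Longrightarrow> 0 < rad j) \<Longrightarrow>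
    fft_basis rad (\<lambda>j y. y [^] prod rad {..<j}) m d y = y [^] d"
proof (induction m arbitrary: d)
  case 0
  then show ?case by simp
next
  case (Suc m)
  have "0 < prod rad {..<m}" using Suc.prems(3) by (intro prod_pos) auto
  then show ?case using Suc by (simp add: nat_pow_pow nat_pow_mult)
qed

definition vanish :: "'a set \<Rightarrow> 'a \<Rightarrow> 'a" where "vanish U y = (\<Otimes>w\<in>U. y \<ominus> w)"

lemma vanish_K: assumes "finite U" "U \<subseteq> K" "y \<in> K" shows "vanish U y \<in> K"
  using assms(1,2) unfolding vanish_def
proof (induction U rule: finite_induct)
  case (insert w U)
  then have "(\<lambda>w. y \<ominus> w) \<in> U \<rightarrow> carrier E" using assms(3) by auto
  then show ?case using insert assms(3) by (simp add: subset_iff)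
qed simp

text \<open>Translation by an element of U permutes the factors of the product.\<close>

lemma vanish_coset:
  assumes U: "add_sub U" and y: "y \<in> K" and z: "z \<in> coset y U"
  shows "vanish U z = vanish U y"
proof -
  note U' = add_subD[OF U]
  obtain u where u: "u \<in> U" "z = y \<oplus> u" using z by (auto simp: coset_def)
  have uc: "u \<in> carrier E" "y \<in> carrier E" using U'(6) u y by auto
  have im: "(\<lambda>w. w \<ominus> u) ` U = U"
  proof
    show "(\<lambda>w. w \<ominus> u) ` U \<subseteq> U" using U' u by (auto simp: minus_eq)
    show "U \<subseteq> (\<lambda>w. w \<ominus> u) ` U"
    proof
      fix w assume w: "w \<in> U"
      have "w = (w \<oplus> u) \<ominus> u" using U'(6)[OF w] uc by algebra
      then show "w \<in> (\<lambda>w. w \<ominus> u) ` U" using U'(3)[OF w u(1)] by blast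
    qed
  qed
  have inj: "inj_on (\<lambda>w. w \<ominus> u) U"
  proof (rule inj_onI)
    fix v w assume vw: "v \<in> U" "w \<in> U" "v \<ominus> u = w \<ominus> u"
    have "v = (v \<ominus> u) \<oplus> u" using U'(6)[OF vw(1)] uc by algebra
    also have "\<dots> = w" unfolding vw(3) using U'(6)[OF vw(2)] uc by algebra
    finally show "v = w" .
  qed
  have "vanish U y = (\<Otimes>w\<in>(\<lambda>w. w \<ominus> u) ` U. y \<ominus> w)" by (simp add: vanish_def im)
  also have "\<dots> = (\<Otimes>w\<in>U. y \<ominus> (w \<ominus> u))"
    by (rule finprod_reindex[OF _ inj]) (use im U'(6) uc in auto)
  also have "\<dots> = vanish U z" unfolding vanish_def
  proof (rule finprod_cong')
    fix w assume w: "w \<in> U"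
    show "y \<ominus> (w \<ominus> u) = z \<ominus> w" unfolding u(2) using U'(6)[OF w] uc by algebra
  qed (use U'(6) u uc in auto)
  finally show ?thesis by simp
qed

text \<open>A coset of one member of the chain is a disjoint union of p cosets of the preceding
  member, and the polynomial vanishing on the latter is constant on each of them. Every radix is
  p.\<close>

lemma fft_class_coset:
  assumes W: "\<And>j. j \<le> m \<Longrightarrow> add_sub (Wc j) \<and> card (Wc j) = p ^ j" "\<And>j. j < m \<Longrightarrow> Wc j \<subseteq> Wc (Suc j)" and y: "y \<in> K"
  shows "fft_class (\<lambda>_. p) (\<lambda>j. vanish (Wc j)) m (coset y (Wc m))"
  using assms
proof (induction m arbitrary: y)
  case 0
  then have "card (coset y (Wc 0)) = 1" using card_coset by simp
  then show ?case by (auto simp: card_1_singleton_iff)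
next
  case (Suc m)
  have U: "add_sub (Wc m)" "card (Wc m) = p ^ m" and V: "add_sub (Wc (Suc m))" "card (Wc (Suc m)) = p ^ Suc m"
    and sub: "Wc m \<subseteq> Wc (Suc m)" using Suc.prems by auto
  note U' = add_subD[OF U(1)]
  let ?C = "coset y (Wc (Suc m))"
  let ?\<Gamma> = "(\<lambda>z. coset z (Wc m)) ` ?C"
  have CK: "?C \<subseteq> K" using coset_iff[OF V(1) Suc.prems(3)] by blast
  have finC: "finite ?C" using CK finite_K finite_subset by blast
  have self: "z \<in> coset z (Wc m)" if "z \<in> K" for z
    using coset_iff[OF U(1) that] that U'(2) by (simp add: minus_eq r_neg)
  have inC: "coset z (Wc m) \<subseteq> ?C" if z: "z \<in> ?C" for z
  proof
    fix u assume "u \<in> coset z (Wc m)"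
    then obtain w where w: "w \<in> Wc m" "u = z \<oplus> w" by (auto simp: coset_def)
    obtain v where v: "v \<in> Wc (Suc m)" "z = y \<oplus> v" using z by (auto simp: coset_def)
    have "u = y \<oplus> (v \<oplus> w)" using w v Suc.prems(3) U'(6) add_subD(6)[OF V(1)] by (simp add: a_assoc)
    moreover have "v \<oplus> w \<in> Wc (Suc m)" using add_subD(3)[OF V(1)] v w sub by blast
    ultimately show "u \<in> ?C" by (auto simp: coset_def)
  qed
  have un: "\<Union>?\<Gamma> = ?C" using self CK inC by blast
  have eq: "coset z (Wc m) = coset z' (Wc m)" if z: "z \<in> K" "z' \<in> K" "u \<in> coset z (Wc m)" "u \<in> coset z' (Wc m)" for z z' u
  proof -
    have *: "coset z (Wc m) \<subseteq> coset z' (Wc m)" if z: "z \<in> K" "z' \<in> K" "u \<in> coset z (Wc m)" "u \<in> coset z' (Wc m)" for z z' u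
    proof
      fix x assume x: "x \<in> coset z (Wc m)"
      have h: "x \<in> K" "x \<ominus> z \<in> Wc m" "u \<in> K" "u \<ominus> z \<in> Wc m" "u \<ominus> z' \<in> Wc m"
        using x z coset_iff[OF U(1)] by auto
      have "(x \<ominus> z) \<oplus> (\<ominus> (u \<ominus> z)) \<oplus> (u \<ominus> z') \<in> Wc m" by (intro U'(3,4) h)
      moreover have "(x \<ominus> z) \<oplus> (\<ominus> (u \<ominus> z)) \<oplus> (u \<ominus> z') = x \<ominus> z'"
        using K_carr[OF h(1)] K_carr[OF h(3)] K_carr[OF z(1)] K_carr[OF z(2)] by algebra
      ultimately show "x \<in> coset z' (Wc m)" using coset_iff[OF U(1) z(2)] h by simp
    qed
    show ?thesis using *[OF z] *[OF z(2,1,4,3)] by blast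
  qed
  have "p ^ m * card ?\<Gamma> = card (\<Union>?\<Gamma>)"
  proof (rule card_partition)
    show "finite ?\<Gamma>" "finite (\<Union>?\<Gamma>)" using finC un by auto
    show "card c = p ^ m" if "c \<in> ?\<Gamma>" for c using that CK card_coset[OF U(1)] U(2) by auto
    show "c \<inter> d = {}" if cd: "c \<in> ?\<Gamma>" "d \<in> ?\<Gamma>" "c \<noteq> d" for c d
    proof (rule ccontr)
      assume "c \<inter> d \<noteq> {}"
      then obtain u where "u \<in> c" "u \<in> d" by blast
      then show False using cd eq CK by blast
    qed
  qed
  also have "\<dots> = p ^ m * p" unfolding un using card_coset[OF V(1) Suc.prems(3)] V(2) by simp
  finally have cG: "card ?\<Gamma> = p" using p_gt_1 by simp
  show ?case
  proof (rule fft_class_Suc[of ?\<Gamma> _ _ _ "\<lambda>c. c"])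
    fix c assume "c \<in> ?\<Gamma>"
    then obtain z where z: "z \<in> K" "c = coset z (Wc m)" using CK by blast
    show "fft_class (\<lambda>_. p) (\<lambda>j. vanish (Wc j)) m c" unfolding z(2) using Suc.prems z(1) by (intro Suc.IH) auto
    show "\<exists>\<sigma>\<in>K. \<forall>y\<in>c. vanish (Wc m) y = \<sigma>"
      using vanish_coset[OF U(1) z(1)] vanish_K[OF U'(5,1) z(1)] z(2) by blast
  qed (use finC cG un in auto)
qed

text \<open>Sylow's theorem provides a subgroup of index p in a group of order p^(m+1); the chain is
  built downwards from U.\<close>

lemma subgroup_chain:
  assumes "add_sub U" "card U = p ^ m"
  shows "\<exists>Wc. Wc m = U \<and> (\<forall>j\<le>m. add_sub (Wc j) \<and> card (Wc j) = p ^ j) \<and> (\<forall>j<m. Wc j \<subseteq> Wc (Suc j))"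
  using assms
proof (induction m arbitrary: U)
  case 0
  then show ?case by (intro exI[of _ "\<lambda>_. U"]) auto
next
  case (Suc m)
  note U' = add_subD[OF Suc.prems(1)]
  let ?G = "add_monoid (E\<lparr>carrier := U\<rparr>)"
  have "group ?G"
  proof (rule groupI)
    fix x assume "x \<in> carrier ?G"
    then show "\<exists>y\<in>carrier ?G. y \<otimes>\<^bsub>?G\<^esub> x = \<one>\<^bsub>?G\<^esub>"
      using U' by (auto simp: l_neg intro!: bexI[of _ "\<ominus> x"])
  qed (use U' in \<open>auto simp: a_assoc\<close>)
  then interpret G: group ?G .
  obtain H where H: "subgroup H ?G" "card H = p ^ m"
    using sylow_thm[of p ?G m p] p G.is_group U'(5) Suc.prems(2) by (auto simp: order_def mult.commute)
  interpret H: subgroup H ?G by (rule H(1))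
  have HU: "H \<subseteq> U" using H.subset by simp
  have inv: "inv\<^bsub>?G\<^esub> a = \<ominus> a" if "a \<in> U" for a
    using that U' by (intro G.inv_equality) (auto simp: l_neg)
  have "add_sub H" unfolding add_sub_def
  proof (intro conjI ballI)
    show "H \<subseteq> K" using HU U' by blast
    show "\<zero> \<in> H" using H.one_closed by simp
    show "a \<oplus> b \<in> H" if "a \<in> H" "b \<in> H" for a b using H.m_closed[OF that] by simp
    show "\<ominus> a \<in> H" if a: "a \<in> H" for a
      using H.m_inv_closed[OF a] unfolding inv[OF subsetD[OF HU a]] .
  qed
  from Suc.IH[OF this H(2)] obtain Wc where Wc: "Wc m = H" "\<forall>j\<le>m. add_sub (Wc j) \<and> card (Wc j) = p ^ j"
    "\<forall>j<m. Wc j \<subseteq> Wc (Suc j)" by blast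
  show ?case
    by (rule exI[of _ "Wc(Suc m := U)"]) (use Wc HU Suc.prems in \<open>auto simp: less_Suc_eq le_Suc_eq\<close>)
qed

text \<open>Polynomial functions that split into linear factors over K, recorded with their degree.
  This class contains the polynomials vanishing on subgroups of K and is closed under the products
  and powers in \<open>fft_basis\<close>.\<close>

inductive monic :: "nat \<Rightarrow> ('a \<Rightarrow> 'a) \<Rightarrow> bool" where
  one: "monic 0 (\<lambda>_. \<one>)"
| linear: "c \<in> K \<Longrightarrow> monic 1 (\<lambda>y. y \<ominus> c)"
| mult: "monic d f \<Longrightarrow> monic e g \<Longrightarrow> monic (d + e) (\<lambda>y. f y \<otimes> g y)"
| eq_on: "monic d f \<Longrightarrow> (\<And>y. y \<in> carrier E \<Longrightarrow> g y = f y) \<Longrightarrow> monic d g"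

lemma monic_pow: "monic d f \<Longrightarrow> monic (d * k) (\<lambda>y. f y [^] (k::nat))"
proof (induction k)
  case 0
  show ?case using monic.one by simp
next
  case (Suc k)
  from monic.mult[OF Suc.IH[OF Suc.prems] Suc.prems] show ?case by (simp add: add.commute)
qed

lemma monic_vanish: "finite U \<Longrightarrow> U \<subseteq> K \<Longrightarrow> monic (card U) (vanish U)"
proof (induction U rule: finite_induct)
  case empty
  then show ?case using monic.one by (simp add: vanish_def[abs_def])
next
  case (insert w U)
  have "monic (1 + card U) (\<lambda>y. (y \<ominus> w) \<otimes> vanish U y)"
    using insert by (intro monic.mult monic.linear) auto
  then have "monic (1 + card U) (vanish (insert w U))"
  proof (rule monic.eq_on)
    fix y assume "y \<in> carrier E"
    then show "vanish (insert w U) y = (y \<ominus> w) \<otimes> vanish U y"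
      unfolding vanish_def using insert by (subst finprod_insert) (auto simp: subset_iff)
  qed
  then show ?case using insert by simp
qed

text \<open>The degree is d mod M + M (d div M) = d. From the product of all radices on,
  \<open>d\<close> has no representation by digits, hence the second alternative.\<close>

lemma monic_fft_basis:
  assumes "\<And>j. j < m \<Longrightarrow> monic (prod rad {..<j}) (\<phi> j)"
  shows "monic d (fft_basis rad \<phi> m d) \<or> d \<ge> prod rad {..<m}"
  using assms
proof (induction m arbitrary: d)
  case 0
  show ?case using monic.one by (cases d) (auto simp: fft_basis.simps(1)[abs_def])
next
  case (Suc m)
  let ?M = "prod rad {..<m}"
  show ?case
  proof (cases "d < prod rad {..<Suc m}")
    case True
    then have "?M > 0" by (metis gr0I lessThan_Suc mult_is_0 not_less_zero prod.insert finite_lessThan lessThan_iff less_irrefl)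
    then have "d mod ?M < ?M" by simp
    then have "monic (d mod ?M) (fft_basis rad \<phi> m (d mod ?M))"
      using Suc.IH[of "d mod ?M"] Suc.prems by force
    moreover have "monic (?M * (d div ?M)) (\<lambda>y. \<phi> m y [^] (d div ?M))"
      using Suc.prems by (intro monic_pow) auto
    ultimately have "monic (d mod ?M + ?M * (d div ?M)) (\<lambda>y. fft_basis rad \<phi> m (d mod ?M) y \<otimes> \<phi> m y [^] (d div ?M))"
      by (rule monic.mult)
    then show ?thesis by (simp add: fft_basis.simps(2)[abs_def])
  qed simp
qed

lemma lead_tl: assumes "lead n F s c" shows "lead (Suc n) (\<lambda>v. F (tl v)) (\<kappa> * s) c"
proof -
  obtain ds where ds: "length ds = n" "W ds = s" "(\<lambda>v. F v \<ominus> c \<otimes> tmon E ds v) \<in> Pol n s"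
    and F: "\<forall>v\<in>Pts n. F v \<in> carrier E" and c: "c \<in> K" "c \<noteq> \<zero>"
    using assms unfolding lead_def by blast
  have tl: "tl v \<in> Pts n" "v = hd v # tl v" "hd v \<in> carrier E" if "v \<in> Pts (Suc n)" for v using Pts_Suc[OF that] by auto
  have "(\<lambda>v. F (tl v) \<ominus> c \<otimes> tmon E (0 # ds) v) \<in> Pol (Suc n) (\<kappa> * s)"
  proof (rule Pol_cong[OF Pol_lift[OF ds(3), of 0, simplified]])
    fix v assume v: "v \<in> Pts (Suc n)"
    obtain y ys where Y: "v = y # ys" "y \<in> carrier E" "ys \<in> Pts n" using Pts_Suc[OF v] by blast
    have "tmon E (0 # ds) v = tmon E ds (tl v)" using Y tmon_carr by simp
    then show "F (tl v) \<ominus> c \<otimes> tmon E (0 # ds) v = \<one> \<otimes> (F (tl v) \<ominus> c \<otimes> tmon E ds (tl v))"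
      using F tl[OF v] c by simp
  qed
  then show ?thesis unfolding lead_def using c F ds tl by (intro conjI exI[of _ "0 # ds"]) auto
qed

lemma lead_hd: "monic d f \<Longrightarrow> lead (Suc n) (\<lambda>v. f (hd v)) (d * Suc \<kappa> ^ n) \<one>"
proof (induction rule: monic.induct)
  case one
  have "lead (Suc n) (tmon E (replicate (Suc n) 0)) 0 \<one>"
    using lead_tmon[of "replicate (Suc n) 0" "Suc n"] by (simp add: wt_zero del: replicate.simps)
  then show ?case
    unfolding mult_0
  proof (rule lead_cong)
    fix v assume "v \<in> Pts (Suc n)"
    then show "\<one> = tmon E (replicate (Suc n) 0) v"
      using tmon_zero[of v] by (simp add: Pts_def del: replicate.simps tmon.simps)
  qed
next
  case (linear c)
  have L: "lead (Suc n) (tmon E (1 # replicate n 0)) (Suc \<kappa> ^ n) \<one>"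
    using lead_tmon[of "1 # replicate n 0" "Suc n"] by (simp add: wt_zero)
  have "(\<lambda>v. (\<ominus> c) \<otimes> tmon E (replicate (Suc n) 0) v) \<in> Pol (Suc n) (Suc \<kappa> ^ n)"
    using linear by (intro Pol_monom) (auto simp: wt_zero)
  from lead_add_lower[OF L this] show ?case unfolding mult_1
  proof (rule lead_cong)
    fix v assume v: "v \<in> Pts (Suc n)"
    obtain y ys where Y: "v = y # ys" "y \<in> carrier E" "ys \<in> Pts n" using Pts_Suc[OF v] by blast
    have "tmon E (replicate n 0) ys = \<one>" using tmon_zero[of ys] Y(3) by (auto simp: Pts_def)
    then show "hd v \<ominus> c = tmon E (1 # replicate n 0) v \<oplus> (\<ominus> c) \<otimes> tmon E (replicate (Suc n) 0) v"
      using Y linear by (simp add: minus_eq)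
  qed
next
  case (mult d f e g)
  from lead_mult[OF mult.IH] show ?case by (simp add: add_mult_distrib)
next
  case (eq_on d f g)
  from eq_on.IH show ?case
  proof (rule lead_cong)
    fix v assume "v \<in> Pts (Suc n)"
    then have "hd v \<in> carrier E" using Pts_Suc by fastforce
    then show "g (hd v) = f (hd v)" by (rule eq_on.hyps)
  qed
qed

text \<open>The lower terms of the univariate factors do not affect the leading weight. Functions
  adapted to the additive transform may therefore replace the monomials with the same
  exponents.\<close>

lemma lead_level_eval:
  assumes "length ds = n" "\<And>i. i < n \<Longrightarrow> monic (ds ! i) (b (n - 1 - i) (ds ! i))"
  shows "lead n (level_eval b ds) (W ds) \<one>"
  using assms
proof (induction ds arbitrary: n)
  case Nil
  have "lead 0 (tmon E []) 0 \<one>" using lead_tmon[of "[]" 0] by simp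
  then show ?case using Nil by (simp, elim lead_cong) simp
next
  case (Cons d ds)
  then obtain m where n: "n = Suc m" "length ds = m" by auto
  have 1: "lead m (level_eval b ds) (W ds) \<one>"
  proof (rule Cons.IH[OF n(2)])
    fix i assume "i < m"
    then show "monic (ds ! i) (b (m - 1 - i) (ds ! i))" using Cons.prems(2)[of "Suc i"] n by simp
  qed
  have 2: "lead (Suc m) (\<lambda>v. b m d (hd v)) (d * Suc \<kappa> ^ m) \<one>"
    using Cons.prems(2)[of 0] n by (intro lead_hd) simp
  have "lead (Suc m) (\<lambda>v. b m d (hd v) \<otimes> level_eval b ds (tl v)) (d * Suc \<kappa> ^ m + \<kappa> * W ds) (\<one> \<otimes> \<one>)"
    by (rule lead_mult[OF 2 lead_tl[OF 1]])
  then have "lead (Suc m) (level_eval b (d # ds)) (d * Suc \<kappa> ^ m + \<kappa> * W ds) (\<one> \<otimes> \<one>)"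
    by (rule lead_cong) (use n in \<open>auto dest!: Pts_Suc\<close>)
  then show ?case using n by simp
qed

end

section \<open>Encoding in smooth characteristic\<close>

context const_field begin

text \<open>The message is extended by zero from the exponents of the basis to a full index set, the
  form in which \<open>tower_reach\<close> takes its coefficients.\<close>

lemma combine_finsum:
  assumes "finite I" "distinct rs" "set rs \<subseteq> I" "length cs = length rs" "set cs \<subseteq> K" "\<And>d. d \<in> I \<Longrightarrow> g d \<in> K"
  shows "combine cs (map g rs) =
    (\<Oplus>d\<in>I. (case map_of (zip rs cs) d of None \<Rightarrow> \<zero> | Some k \<Rightarrow> k) \<otimes> g d)"
  using assms(2-5)
proof (induction rs arbitrary: cs)
  case Nil
  have "(\<Oplus>d\<in>I. \<zero> \<otimes> g d) = (\<Oplus>d\<in>I. \<zero>)" using assms(6) by (intro finsum_cong') auto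
  then show ?case using Nil by simp
next
  case (Cons r' rs)
  obtain c cs' where cs: "cs = c # cs'" "length cs' = length rs" using Cons.prems by (cases cs) auto
  have cK: "c \<in> K" "set cs' \<subseteq> K" using Cons.prems cs by auto
  define F where "F d = (case map_of (zip rs cs') d of None \<Rightarrow> \<zero> | Some k \<Rightarrow> k) \<otimes> g d" for d
  define F' where "F' d = (case map_of (zip (r' # rs) cs) d of None \<Rightarrow> \<zero> | Some k \<Rightarrow> k) \<otimes> g d" for d
  have val: "k \<in> K" if "map_of (zip rs cs') d = Some k" for d k
    using that cK(2) by (meson in_mono map_of_SomeD set_zip_rightD)
  have Fc: "F d \<in> carrier E" if "d \<in> I" for d using val assms(6)[OF that] by (auto simp: F_def split: option.splits)
  have r: "r' \<in> I" "r' \<notin> set rs" using Cons.prems by auto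
  have "map_of (zip rs cs') r' = None" using r(2) cs(2) by (simp add: map_of_zip_is_None)
  then have Fr: "F r' = \<zero>" using assms(6)[OF r(1)] by (simp add: F_def)
  have F'r: "F' r' = c \<otimes> g r'" by (simp add: F'_def cs)
  have eq: "F' d = F d" if "d \<noteq> r'" for d using that by (simp add: F'_def F_def cs)
  have I: "I = insert r' (I - {r'})" using r by blast
  have "finsum E F I = F r' \<oplus> finsum E F (I - {r'})"
    by (subst I, rule finsum_insert) (use assms(1) Fc r in auto)
  then have 1: "finsum E F I = finsum E F (I - {r'})" using Fr Fc by (simp add: finsum_closed Pi_def)
  have "finsum E F' I = F' r' \<oplus> finsum E F' (I - {r'})"
    by (subst I, rule finsum_insert) (use assms(1) Fc r eq F'r cK assms(6)[OF r(1)] in auto)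
  also have "finsum E F' (I - {r'}) = finsum E F (I - {r'})"
    by (rule finsum_cong') (use eq Fc in auto)
  also have "\<dots> = combine cs' (map g rs)"
    using Cons.IH[of cs'] Cons.prems cs cK 1 by (simp add: F_def[abs_def])
  finally show ?case using F'r by (simp add: F'_def[abs_def] cs)
qed

lemma box_Cons: "d # ds \<in> box Dm (Suc v) \<longleftrightarrow> d < Dm v \<and> ds \<in> box Dm v"
  by auto

lemma digits_below_box:
  "ds \<noteq> [] \<Longrightarrow> digits_below a ds \<Longrightarrow> last ds < D0 \<Longrightarrow> ds \<in> box (\<lambda>v. if v = 0 then D0 else a) (length ds)"
proof (induction a ds rule: digits_below.induct)
  case (1 a d e es)
  then show ?case by (simp add: box_Cons del: box.simps(2))
qed (auto simp: image_iff)

end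

text \<open>The radices are the prime factors with multiplicity. Each is at least 2, so the number
  of levels is at most the binary logarithm.\<close>

lemma smooth_radices:
  assumes "0 < N" "\<forall>l\<in>prime_factors N. l \<le> (B::nat)"
  shows "\<exists>m rad. prod rad {..<m::nat} = (N::nat) \<and> (\<forall>j<m. 0 < rad j \<and> rad j \<le> B) \<and> 2 ^ m \<le> N"
  using assms
proof (induction N rule: less_induct)
  case (less N)
  show ?case
  proof (cases "N = 1")
    case True
    then show ?thesis by (intro exI[of _ 0]) auto
  next
    case False
    then obtain l where l: "Factorial_Ring.prime l" "l dvd N" using less.prems by (metis prime_factor_nat)
    then obtain N' where N: "N = l * N'" by blast
    have l2: "2 \<le> l" using l prime_ge_2_nat by blast
    have N': "0 < N'" "N' < N" using less.prems N l2 by auto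
    have "\<forall>l\<in>prime_factors N'. l \<le> B"
      using less.prems(2) dvd_prime_factors[of N N'] N less.prems(1) by auto
    then obtain m rad where m: "prod rad {..<m::nat} = N'" "\<forall>j<m. 0 < rad j \<and> rad j \<le> B" "2 ^ m \<le> N'"
      using less.IH[OF N'(2,1)] by blast
    have lB: "l \<le> B" using less.prems l by (auto simp: prime_factors_dvd)
    have "prod (rad(m := l)) {..<Suc m} = N" using m(1) N by (simp add: lessThan_Suc)
    moreover have "\<forall>j<Suc m. 0 < (rad(m := l)) j \<and> (rad(m := l)) j \<le> B" using m(2) lB l2 by (auto simp: less_Suc_eq)
    moreover have "2 ^ Suc m \<le> N" using mult_mono[OF l2 m(3)] N by simp
    ultimately show ?thesis by blast
  qed
qed

text \<open>Bernoulli: (1 - 1/(\<kappa>+1))^j is at least 1 - j/(\<kappa>+1), and j is at most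
  \<kappa>/2.\<close>

lemma Suc_pow_le:
  assumes "2 * n \<le> \<kappa>" "j \<le> n" "0 < (\<kappa>::nat)" shows "Suc \<kappa> ^ j \<le> 2 * \<kappa> ^ j"
proof -
  have "1 + real j * (- 1 / real (Suc \<kappa>)) \<le> (1 + (- 1 / real (Suc \<kappa>))) ^ j"
    by (rule Bernoulli_inequality) (simp add: field_simps)
  moreover have "1 + (- 1 / real (Suc \<kappa>)) = real \<kappa> / real (Suc \<kappa>)" by (simp add: field_simps)
  moreover have "1 / 2 \<le> 1 + real j * (- 1 / real (Suc \<kappa>))" using assms by (simp add: field_simps)
  ultimately have "1 / 2 \<le> (real \<kappa> / real (Suc \<kappa>)) ^ j" by (metis order_trans)
  then have "real (Suc \<kappa>) ^ j \<le> 2 * real \<kappa> ^ j" by (simp add: power_divide field_simps)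
  then have "real (Suc \<kappa> ^ j) \<le> real (2 * \<kappa> ^ j)" by (simp only: of_nat_power of_nat_mult of_nat_numeral)
  then show ?thesis by (simp only: of_nat_le_iff)
qed

context hermitian begin

text \<open>The part common to both encoders. The map \<open>t\<close> puts the coordinates of a
  rational point into the order of evaluation, and \<open>rp\<close> chooses one exponent list for
  each weight, hence one basis element.\<close>

theorem tower_encodable:
  fixes A :: "nat \<Rightarrow> 'a list set" and rp :: "nat \<Rightarrow> nat list"
  assumes A0: "A 0 = {[]}" and Afin: "\<And>v. v \<le> n \<Longrightarrow> finite (A v)"
    and Acl: "\<And>v Y. v < n \<Longrightarrow> Y \<in> A (Suc v) \<Longrightarrow> \<exists>y ys. Y = y # ys \<and> ys \<in> A v \<and> length ys = v"
    and bK: "\<And>v d y ys. v < n \<Longrightarrow> d < Dm v \<Longrightarrow> y # ys \<in> A (Suc v) \<Longrightarrow> b v d y \<in> K"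
    and step: "\<And>v ys G Dom (g :: nat \<Rightarrow> 'a list \<Rightarrow> 'a). v < n \<Longrightarrow> ys \<in> A v \<Longrightarrow> (\<And>d. d < Dm v \<Longrightarrow> g d \<in> G) \<Longrightarrow>
      (\<And>d x. d < Dm v \<Longrightarrow> x \<in> Dom \<Longrightarrow> g d x \<in> K) \<Longrightarrow>
      reach Dom G (\<tau> v) ((\<lambda>y x. \<Oplus>d\<in>{..<Dm v}. g d x \<otimes> b v d y) ` {y. y # ys \<in> A (Suc v)})"
    and t: "\<And>a. a \<in> TP n \<Longrightarrow> t a \<in> A n"
    and rp: "\<And>s. s \<in> set (wlist (Suc l)) \<Longrightarrow> rp s \<in> box Dm n" "inj_on rp (set (wlist (Suc l)))"
    and ld: "\<And>s. s \<in> set (wlist (Suc l)) \<Longrightarrow> \<exists>c. lead n (\<lambda>a. level_eval b (rp s) (t a)) s c"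
    and pts: "set pts \<subseteq> TP n"
    and cost: "real (\<Sum>v<n. card (A v) * prod Dm {Suc v..<n} * \<tau> v) \<le> T"
  shows "encodable_within K E Pinf (map Ppt pts) l T"
proof -
  define ws where "ws = wlist (Suc l)"
  define k where "k = length ws"
  define f where "f s a = level_eval b (rp s) (t a)" for s a
  define bs where "bs = map (\<lambda>s. f s xs) ws"
  define Dom where "Dom = {cs. set cs \<subseteq> K \<and> length cs = k}"
  define rs where "rs = map rp ws"
  have lk: "length bs = k" by (simp add: bs_def k_def)
  have ld': "\<exists>c. lead n (f s) s c" if "s \<in> set (wlist (Suc l))" for s using ld[OF that] by (simp add: f_def[abs_def])
  have dist: "distinct rs" using rp(2) by (simp add: rs_def distinct_map ws_def wlist_def)
  have rsB: "set rs \<subseteq> box Dm n" using rp(1) by (auto simp: rs_def ws_def)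
  define F0 :: "('a list \<Rightarrow> 'a) set" where "F0 = (\<lambda>i cs. cs ! i) ` {..<k}"
  \<comment> \<open>The zero function fills the positions of the box that carry no basis
    element.\<close>
  define F where "F = insert (\<lambda>_. \<zero>) F0"
  have F: "reach Dom F0 0 F" unfolding F_def by (rule reach.const[OF reach.base]) simp
  have "\<exists>i<k. rs ! i = ds" if "ds \<in> set rs" for ds
    using that unfolding in_set_conv_nth by (simp add: rs_def k_def)
  then obtain ix where ix: "\<And>ds. ds \<in> set rs \<Longrightarrow> ix ds < k \<and> rs ! ix ds = ds" by metis
  define c :: "nat list \<Rightarrow> 'a list \<Rightarrow> 'a"
    where "c ds = (if ds \<in> set rs then (\<lambda>cs. cs ! ix ds) else (\<lambda>_. \<zero>))" for ds
  have cF: "c ds \<in> F" for ds using ix by (auto simp: c_def F_def F0_def)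
  have cK: "c ds cs \<in> K" if "cs \<in> Dom" for ds cs
    using that ix[of ds] nth_mem[of "ix ds" cs] by (auto simp: c_def Dom_def)
  have cmap: "(case map_of (zip rs cs) ds of None \<Rightarrow> \<zero> | Some k \<Rightarrow> k) = c ds cs" if "cs \<in> Dom" for ds cs
  proof (cases "ds \<in> set rs")
    case True
    have "map_of (zip rs cs) (rs ! ix ds) = Some (cs ! ix ds)"
      using that ix[OF True] dist by (intro map_of_zip_nth) (auto simp: Dom_def rs_def k_def)
    then show ?thesis using True ix[OF True] by (simp add: c_def)
  next
    case False
    then have "map_of (zip rs cs) ds = None" using that by (simp add: map_of_zip_is_None Dom_def rs_def k_def)
    then show ?thesis using False by (simp add: c_def)
  qed
  let ?C = "\<Sum>v<n. card (A v) * prod Dm {Suc v..<n} * \<tau> v"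
  let ?G = "(\<lambda>ys x. \<Oplus>ds\<in>box Dm n. c ds x \<otimes> level_eval b ds ys) ` A n"
  have "reach Dom F ?C ?G"
    by (rule tower_reach[where A = A and Dm = Dm and b = b and \<tau> = \<tau> and n = n and c = c,
          OF A0 Afin Acl bK cF cK step])
  from reach_trans[OF this F] have R: "reach Dom F0 ?C ?G" by simp
  have evK: "level_eval b ds ys \<in> K" if "ys \<in> A n" "ds \<in> box Dm n" for ys ds
    by (rule level_eval_K[where A = A and n = n and Dm = Dm and b = b, OF A0 Acl bK order_refl that])
  show ?thesis
  proof (rule reach_encodable[OF _ _ _ cost])
    show "one_point_basis K E Pinf l bs" unfolding bs_def ws_def by (rule one_point_basis_wlist[OF ld'])
    show "reach {cs. set cs \<subseteq> K \<and> length cs = length bs} ((\<lambda>i cs. cs ! i) ` {..<length bs}) ?C ?G"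
      using R by (simp add: Dom_def F0_def lk)
    fix P assume "P \<in> set (map Ppt pts)"
    then obtain a where a: "a \<in> TP n" "P = Ppt a" using pts by auto
    have tA: "t a \<in> A n" by (rule t[OF a(1)])
    show "\<exists>g\<in>?G. \<forall>cs. set cs \<subseteq> K \<and> length cs = length bs \<longrightarrow> place_value K E P (combine cs bs) = g cs"
    proof (rule bexI[OF _ imageI[OF tA]], intro allI impI)
      fix cs assume cs: "set cs \<subseteq> K \<and> length cs = length bs"
      then have csD: "cs \<in> Dom" by (simp add: Dom_def lk)
      have "one_point_encoder K E (map Ppt [a]) bs cs = map (\<lambda>a. combine cs (map (\<lambda>s. f s a) ws)) [a]"
        unfolding bs_def ws_def by (rule encoder_eq[OF ld']) (use a(1) cs in \<open>auto simp: TP_Pts\<close>)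
      then have "place_value K E P (combine cs bs) = combine cs (map (\<lambda>ds. level_eval b ds (t a)) rs)"
        by (simp add: one_point_encoder_def ag_codeword_def a(2) f_def rs_def comp_def)
      also have "\<dots> = (\<Oplus>ds\<in>box Dm n. (case map_of (zip rs cs) ds of None \<Rightarrow> \<zero> | Some k \<Rightarrow> k) \<otimes> level_eval b ds (t a))"
        using cs dist rsB evK[OF tA] by (intro combine_finsum finite_box) (auto simp: rs_def lk k_def)
      also have "\<dots> = (\<Oplus>ds\<in>box Dm n. c ds cs \<otimes> level_eval b ds (t a))" by (simp only: cmap[OF csD])
      finally show "place_value K E P (combine cs bs) = (\<Oplus>ds\<in>box Dm n. c ds cs \<otimes> level_eval b ds (t a))" .
    qed
  qed
qed

text \<open>Each unit in the exponent of x_1 weighs \<kappa>^(n-1), and the weight stays below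
  \<kappa>^(n+1) = q \<kappa>^(n-1).\<close>

lemma wlist_normalize:
  assumes "s \<in> set (wlist (Suc l))" "l < \<kappa> ^ (n + 1)"
  shows "\<exists>ds. length ds = n \<and> wt \<kappa> (Suc \<kappa>) ds = s \<and> digits_below \<kappa> ds \<and> last ds < q"
proof -
  obtain es where es: "length es = n" "W es = s" and sl: "s \<le> l" using assms(1) by (auto simp: set_wlist)
  obtain ds where ds: "length ds = length es" "digits_below \<kappa> ds" "W ds = W es"
    using wt_normalize[of \<kappa> es "Suc \<kappa>"] kappa_gt_1 by auto
  have "last ds * \<kappa> ^ (n - 1) \<le> s" using wt_last_le[of ds \<kappa> "Suc \<kappa>"] ds es n by auto
  also have "s < \<kappa> ^ (n + 1)" using sl assms(2) by simp
  also have "\<kappa> ^ (n + 1) = q * \<kappa> ^ (n - 1)" using n by (simp add: q power_add[symmetric])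
  finally have "last ds < q" by simp
  then show ?thesis using ds es by auto
qed

text \<open>In the reversed reading each unit of the last exponent, that of x_n, weighs
  (\<kappa>+1)^(n-1). The sharper bound q - 1 holds because (\<kappa>^2 - 1)(\<kappa>+1) is at least
  \<kappa>^3, and the factor \<kappa>+1 is available since n is at least 2. It fits the number of
  coefficients to a transform of length q - 1.\<close>

lemma wlist_normalize':
  assumes "s \<in> set (wlist (Suc l))" "l < \<kappa> ^ (n + 1)" "2 \<le> n"
  shows "\<exists>ds. length ds = n \<and> wt (Suc \<kappa>) \<kappa> ds = s \<and> digits_below (Suc \<kappa>) ds \<and> last ds < q - 1"
proof -
  obtain es where es: "length es = n" "W es = s" and sl: "s \<le> l" using assms(1) by (auto simp: set_wlist)
  obtain ds where ds: "length ds = length (rev es)" "digits_below (Suc \<kappa>) ds" "wt (Suc \<kappa>) \<kappa> ds = wt (Suc \<kappa>) \<kappa> (rev es)"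
    using wt_normalize[of "Suc \<kappa>" "rev es" \<kappa>] by auto
  have wds: "wt (Suc \<kappa>) \<kappa> ds = s" using ds es by (simp add: wt_rev)
  have "last ds * Suc \<kappa> ^ (n - 1) \<le> s" using wt_last_le[of ds "Suc \<kappa>" \<kappa>] ds es n wds by auto
  then have up: "last ds * Suc \<kappa> ^ (n - 1) < \<kappa> ^ (n + 1)" using sl assms(2) by simp
  obtain j where j: "n = Suc (Suc j)" using assms(3) by (metis One_nat_def Suc_1 Suc_le_D Suc_le_mono)
  have "last ds < q - 1"
  proof (rule ccontr)
    assume "\<not> last ds < q - 1"
    then have ge: "\<kappa> * \<kappa> - 1 \<le> last ds" by (simp add: q power2_eq_square)
    obtain c where c: "\<kappa> = Suc (Suc c)" using kappa_gt_1 by (metis One_nat_def less_iff_Suc_add add_Suc_right add_Suc plus_nat.add_0)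
    have "\<kappa> ^ 3 \<le> (\<kappa> * \<kappa> - 1) * Suc \<kappa>" by (simp add: c power3_eq_cube algebra_simps)
    then have "\<kappa> ^ 3 * \<kappa> ^ j \<le> ((\<kappa> * \<kappa> - 1) * Suc \<kappa>) * Suc \<kappa> ^ j" by (intro mult_mono power_mono) auto
    also have "\<dots> = (\<kappa> * \<kappa> - 1) * Suc \<kappa> ^ (n - 1)" by (simp only: j mult.assoc power_Suc diff_Suc_1)
    also have "\<dots> \<le> last ds * Suc \<kappa> ^ (n - 1)" using ge by (rule mult_le_mono1)
    finally have "\<kappa> ^ (n + 1) \<le> last ds * Suc \<kappa> ^ (n - 1)" by (simp add: j power_add[symmetric] eval_nat_numeral mult.assoc)
    then show False using up by simp
  qed
  then show ?thesis using ds es wds by auto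
qed

text \<open>The most expensive level is that of x_1: its transform has 2r radices p and q
  coefficients and costs 4 p r q. It is run \<kappa>^(n-1) times, and every other level costs half
  as much in total.\<close>

theorem additive_encodable:
  assumes l: "l < \<kappa> ^ (n + 1)" and pts: "set pts \<subseteq> TP n"
  shows "encodable_within K E Pinf (map Ppt pts) l (real (n * (4 * p * r * \<kappa> ^ (n + 1))))"
proof -
  obtain W0 where W0: "W0 (2 * r) = K" "\<And>j. j \<le> 2 * r \<Longrightarrow> add_sub (W0 j) \<and> card (W0 j) = p ^ j" "\<And>j. j < 2 * r \<Longrightarrow> W0 j \<subseteq> W0 (Suc j)"
    using subgroup_chain[OF add_sub_K, of "2 * r"] card_K q_eq by auto
  obtain W1 where W1: "W1 r = ker" "\<And>j. j \<le> r \<Longrightarrow> add_sub (W1 j) \<and> card (W1 j) = p ^ j" "\<And>j. j < r \<Longrightarrow> W1 j \<subseteq> W1 (Suc j)"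
    using subgroup_chain[OF add_sub_ker, of r] ker_card \<kappa> by auto
  define Wc where "Wc v = (if v = 0 then W0 else W1)" for v :: nat
  define m where "m v = (if v = 0 then 2 * r else r)" for v :: nat
  define b where "b v = fft_basis (\<lambda>_. p) (\<lambda>j. vanish (Wc v j)) (m v)" for v
  define Dm where "Dm v = (if v = 0 then q else \<kappa>)" for v :: nat
  define \<tau> where "\<tau> v = 2 * p * m v * Dm v" for v
  have Wc: "j \<le> m v \<Longrightarrow> add_sub (Wc v j) \<and> card (Wc v j) = p ^ j" "j < m v \<Longrightarrow> Wc v j \<subseteq> Wc v (Suc j)" for v j
    using W0(2,3)[of j] W1(2,3)[of j] by (cases "v = 0"; simp add: Wc_def m_def)+
  have Dm: "prod (\<lambda>_. p) {..<m v} = Dm v" for v using q_eq \<kappa> by (simp add: m_def Dm_def)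
  have cls: "fft_class (\<lambda>_. p) (\<lambda>j. vanish (Wc v j)) (m v) {y. y # ys \<in> TP (Suc v)}" if ys: "ys \<in> TP v" for v ys
  proof (cases v)
    case 0
    have "{y. y # ys \<in> TP (Suc v)} = coset \<zero> (Wc v (m v))"
      using ys TP_first W0(1) by (simp add: 0 TP_0 Wc_def m_def coset_def)
    then show ?thesis using fft_class_coset[of "m v" "Wc v" \<zero>] Wc by simp
  next
    case (Suc u)
    obtain z zs where z: "ys = z # zs" using ys Suc by (cases ys) (auto simp: TP_def)
    have eq: "{y. y # ys \<in> TP (Suc v)} = {y \<in> K. tr y = z [^] Suc \<kappa>}" using TP_fibre ys z Suc by auto
    have "card {y. y # ys \<in> TP (Suc v)} = \<kappa>" using TP_fibre_card ys Suc by blast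
    \<comment> \<open>Nonempty fibres are needed to write them as cosets of the kernel.\<close>
    then have "{y. y # ys \<in> TP (Suc v)} \<noteq> {}" using kappa_gt_1 by (metis card.empty not_one_less_zero)
    then obtain y0 where y0: "y0 \<in> K" "tr y0 = z [^] Suc \<kappa>" using eq by blast
    then have "{y. y # ys \<in> TP (Suc v)} = coset y0 (Wc v (m v))"
      using eq tr_fibre[OF y0(1)] W1(1) by (simp add: Wc_def m_def Suc)
    then show ?thesis using fft_class_coset[of "m v" "Wc v" y0] Wc y0(1) by simp
  qed
  define rp where "rp s = (SOME ds. length ds = n \<and> W ds = s \<and> digits_below \<kappa> ds \<and> last ds < q)" for s
  have rp: "length (rp s) = n \<and> W (rp s) = s \<and> digits_below \<kappa> (rp s) \<and> last (rp s) < q" if "s \<in> set (wlist (Suc l))" for s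
    unfolding rp_def by (rule someI_ex[OF wlist_normalize[OF that l]])
  have rpB: "rp s \<in> box Dm n" if "s \<in> set (wlist (Suc l))" for s
    using digits_below_box[of "rp s" \<kappa> q] rp[OF that] n unfolding Dm_def[abs_def] by fastforce
  show ?thesis
  proof (rule tower_encodable[where A = TP and Dm = Dm and b = b and \<tau> = \<tau> and rp = rp and t = "\<lambda>a. a"])
    show "TP 0 = {[]}" by (rule TP_0)
    show "finite (TP v)" for v by (rule TP_finite)
    show "\<exists>y ys. Y = y # ys \<and> ys \<in> TP v \<and> length ys = v" if "Y \<in> TP (Suc v)" for v Y
      using that TP_tl by (cases Y) (auto simp: TP_def)
    show "b v d y \<in> K" if "y # ys \<in> TP (Suc v)" for v d y ys
      unfolding b_def using that by (intro fft_basis_K[OF cls[of ys v]]) (use TP_tl in auto)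
    show "reach Dom G (\<tau> v) ((\<lambda>y x. \<Oplus>d\<in>{..<Dm v}. g d x \<otimes> b v d y) ` {y. y # ys \<in> TP (Suc v)})"
      if "ys \<in> TP v" "\<And>d. d < Dm v \<Longrightarrow> g d \<in> G" "\<And>d x. d < Dm v \<Longrightarrow> x \<in> Dom \<Longrightarrow> g d x \<in> K"
      for v ys G Dom and g :: "nat \<Rightarrow> 'a list \<Rightarrow> 'a"
      using fft_reach[OF cls[OF that(1)], of p g G Dom] that(2,3) p_gt_1 unfolding Dm b_def \<tau>_def by simp
    show "inj_on rp (set (wlist (Suc l)))" using rp by (metis inj_onI)
    show "\<exists>c. lead n (\<lambda>a. level_eval b (rp s) a) s c" if s: "s \<in> set (wlist (Suc l))" for s
    proof -
      have "lead n (level_eval b (rp s)) (W (rp s)) \<one>"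
      proof (rule lead_level_eval)
        show "length (rp s) = n" using rp[OF s] by blast
        fix i assume i: "i < n"
        define v where "v = n - 1 - i"
        have mon: "monic d (b v d) \<or> d \<ge> Dm v" for d
          unfolding b_def Dm[symmetric]
        proof (rule monic_fft_basis)
          fix j assume "j < m v"
          then have "add_sub (Wc v j)" "card (Wc v j) = p ^ j" using Wc(1)[of j v] by auto
          then show "monic (prod (\<lambda>_. p) {..<j}) (vanish (Wc v j))"
            using monic_vanish[of "Wc v j"] add_subD(1,5) by simp
        qed
        have "rp s ! i < Dm v"
        proof -
          have "ds ! i < Dm (u - 1 - i)" if "ds \<in> box Dm u" "i < u" for ds u i
            using that
          proof (induction u arbitrary: ds i)
            case (Suc u)
            then show ?case by (cases i) auto
          qed simp
          then show ?thesis using rpB[OF s] i by (simp add: v_def)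
        qed
        then show "monic (rp s ! i) (b (n - 1 - i) (rp s ! i))" using mon[of "rp s ! i"] by (simp add: v_def)
      qed
      then show ?thesis using rp[OF s] by auto
    qed
    have pD: "prod Dm {Suc v..<n} = \<kappa> ^ (n - Suc v)" for v
      by (simp add: Dm_def)
    have term_le: "card (TP v) * prod Dm {Suc v..<n} * \<tau> v \<le> 4 * p * r * \<kappa> ^ (n + 1)" if v: "v < n" for v
    proof (cases v)
      case 0
      have "\<kappa> ^ (n + 1) = q * \<kappa> ^ (n - 1)" using n by (simp add: q power_add[symmetric])
      then show ?thesis unfolding pD by (simp add: 0 TP_0 \<tau>_def m_def Dm_def)
    next
      case (Suc u)
      obtain j where j: "n = Suc v + j" using v by (metis less_iff_Suc_add add_Suc)
      have e: "\<kappa> ^ (u + 2) * \<kappa> ^ (n - Suc v) * \<kappa> = \<kappa> ^ (n + 1)" by (simp add: j Suc power_add)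
      have "card (TP v) * \<kappa> ^ (n - Suc v) * \<tau> v = 2 * p * r * (\<kappa> ^ (u + 2) * \<kappa> ^ (n - Suc v) * \<kappa>)"
        using TP_card[of u] by (simp add: Suc \<tau>_def m_def Dm_def ac_simps)
      then show ?thesis unfolding pD e by simp
    qed
    have "(\<Sum>v<n. card (TP v) * prod Dm {Suc v..<n} * \<tau> v) \<le> n * (4 * p * r * \<kappa> ^ (n + 1))"
      using sum_bounded_above[of "{..<n}" "\<lambda>v. card (TP v) * prod Dm {Suc v..<n} * \<tau> v"] term_le by simp
    then show "real (\<Sum>v<n. card (TP v) * prod Dm {Suc v..<n} * \<tau> v) \<le> real (n * (4 * p * r * \<kappa> ^ (n + 1)))"
      by (simp only: of_nat_le_iff)
  qed (use rpB pts in auto)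
qed

end

section \<open>Encoding for smooth \<open>q - 1\<close>\<close>

context hermitian begin

lemma herm_appendD: "herm E \<kappa> (as @ bs) \<Longrightarrow> herm E \<kappa> as"
proof (induction as)
  case (Cons a as)
  then show ?case by (cases as) auto
qed simp

lemma herm_snoc:
  "herm E \<kappa> (as @ [z, y]) \<longleftrightarrow> herm E \<kappa> (as @ [z]) \<and> z [^] \<kappa> \<oplus> z = y [^] Suc \<kappa>"
proof (induction as)
  case (Cons a as)
  then show ?case by (cases as) auto
qed simp

lemma tmon_rev: "length ds = length v \<Longrightarrow> set v \<subseteq> carrier E \<Longrightarrow> tmon E (rev ds) (rev v) = tmon E ds v"
proof -
  have snoc: "tmon E (ds @ [d]) (v @ [y]) = tmon E ds v \<otimes> y [^] d"
    if "length ds = length v" "set v \<subseteq> carrier E" "y \<in> carrier E" for ds v d y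
    using that by (induction ds v rule: list_induct2) (auto simp: m_assoc tmon_closed)
  show "length ds = length v \<Longrightarrow> set v \<subseteq> carrier E \<Longrightarrow> tmon E (rev ds) (rev v) = tmon E ds v"
    by (induction ds v rule: list_induct2) (auto simp: snoc m_comm tmon_closed)
qed

lemma level_eval_power: "level_eval (\<lambda>_ d y. y [^] d) ds v = tmon E ds v"
proof (induction ds arbitrary: v)
  case (Cons d ds)
  then show ?case by (cases v) auto
qed simp

text \<open>The constant 8 collects three factors 2: two operations per term of a linear
  combination, two transforms for the first variable, and the enlargement bounded by
  \<open>Suc_pow_le\<close>.\<close>

theorem multiplicative_encodable:
  assumes l: "l < \<kappa> ^ (n + 1)" and pts: "set pts \<subseteq> TP n" and n2: "2 \<le> n" "2 * n \<le> \<kappa>"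
    and rad: "prod rad {..<m::nat} = q - 1" "\<forall>j<m. 0 < rad j \<and> rad j \<le> B"
    and rad': "prod rad' {..<m'::nat} = Suc \<kappa>" "\<forall>j<m'. 0 < rad' j \<and> rad' j \<le> B"
  shows "encodable_within K E Pinf (map Ppt pts) l (real (n * (8 * B * max m m' * \<kappa> ^ (n + 1))))"
proof -
  \<comment> \<open>The relations do not mention the position in the tower, so the last v
    coordinates x_(n-v+1), ..., x_n of a point form a point of the tower with v variables. Reversal
    makes x_n the innermost coordinate.\<close>
  define A where "A v = rev ` TP v" for v
  define b where "b = (\<lambda>(_::nat) (d::nat) y. y [^] d)"
  define Dm where "Dm v = (if v = 0 then q - 1 else Suc \<kappa>)" for v :: nat
  define \<tau> where "\<tau> v = (if v = 0 then 2 * (2 * B * m * (q - 1)) else 2 * B * m' * Suc \<kappa>)" for v :: nat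
  have A_iff: "Y \<in> A v \<longleftrightarrow> rev Y \<in> TP v" for Y v
    unfolding A_def by (metis image_iff rev_rev_ident)
  have A_tl: "ys \<in> A v \<and> y \<in> K \<and> length ys = v" if "y # ys \<in> A (Suc v)" for y ys v
    using that herm_appendD unfolding A_iff by (auto simp: TP_def)
  have cardA: "card (A v) = card (TP v)" for v unfolding A_def by (rule card_image) (auto simp: inj_on_def)
  define rp where "rp s = (SOME ds. length ds = n \<and> wt (Suc \<kappa>) \<kappa> ds = s \<and> digits_below (Suc \<kappa>) ds \<and> last ds < q - 1)" for s
  have rp: "length (rp s) = n \<and> wt (Suc \<kappa>) \<kappa> (rp s) = s \<and> digits_below (Suc \<kappa>) (rp s) \<and> last (rp s) < q - 1"
    if "s \<in> set (wlist (Suc l))" for s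
    unfolding rp_def by (rule someI_ex[OF wlist_normalize'[OF that l n2(1)]])
  have rpB: "rp s \<in> box Dm n" if "s \<in> set (wlist (Suc l))" for s
    using digits_below_box[of "rp s" "Suc \<kappa>" "q - 1"] rp[OF that] n unfolding Dm_def[abs_def] by fastforce
  have fft: "reach Dom G (2 * B * k * prod rd {..<k})
      ((\<lambda>y x. \<Oplus>d\<in>{..<prod rd {..<k}}. g d x \<otimes> y [^] d) ` {y \<in> K. y [^] prod rd {..<k} = \<gamma>})"
    if rd: "\<forall>j<k. 0 < rd j \<and> rd j \<le> B" and \<gamma>: "\<gamma> \<in> K"
      and g: "\<And>d. d < prod rd {..<k} \<Longrightarrow> g d \<in> G" "\<And>d x. d < prod rd {..<k} \<Longrightarrow> x \<in> Dom \<Longrightarrow> g d x \<in> K"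
    for rd :: "nat \<Rightarrow> nat" and k \<gamma> G Dom and g :: "nat \<Rightarrow> 'a list \<Rightarrow> 'a"
  proof -
    have cls: "fft_class rd (\<lambda>j y. y [^] prod rd {..<j}) k {y \<in> K. y [^] prod rd {..<k} = \<gamma>}"
      using rd \<gamma> by (intro fft_class_power) auto
    show ?thesis
    proof (rule reach_cong_image[OF fft_reach[OF cls, of B g G Dom]])
      fix y x assume y: "y \<in> {y \<in> K. y [^] prod rd {..<k} = \<gamma>}" and x: "x \<in> Dom"
      show "(\<Oplus>d\<in>{..<prod rd {..<k}}. g d x \<otimes> y [^] d)
        = (\<Oplus>d\<in>{..<prod rd {..<k}}. g d x \<otimes> fft_basis rd (\<lambda>j y. y [^] prod rd {..<j}) k d y)"
        using y x rd fft_basis_power[of y _ rd k] g(2) by (intro finsum_cong') auto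
    qed (use rd g finite_K in auto)
  qed
  show ?thesis
  proof (rule tower_encodable[where A = A and Dm = Dm and b = b and \<tau> = \<tau> and rp = rp and t = rev])
    show "A 0 = {[]}" by (simp add: A_def TP_0)
    show "finite (A v)" for v by (simp add: A_def TP_finite)
    show "\<exists>y ys. Y = y # ys \<and> ys \<in> A v \<and> length ys = v" if Y: "Y \<in> A (Suc v)" for v Y
    proof -
      have "Y \<noteq> []" using Y unfolding A_iff by (auto simp: TP_def)
      then obtain y ys where "Y = y # ys" by (cases Y) auto
      then show ?thesis using A_tl Y by blast
    qed
    show "b v d y \<in> K" if "y # ys \<in> A (Suc v)" for v d y ys
      using A_tl[OF that] by (simp add: b_def)
    show "reach Dom G (\<tau> v) ((\<lambda>y x. \<Oplus>d\<in>{..<Dm v}. g d x \<otimes> b v d y) ` {y. y # ys \<in> A (Suc v)})"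
      if ys: "ys \<in> A v" and g: "\<And>d. d < Dm v \<Longrightarrow> g d \<in> G" "\<And>d x. d < Dm v \<Longrightarrow> x \<in> Dom \<Longrightarrow> g d x \<in> K"
      for v ys G Dom and g :: "nat \<Rightarrow> 'a list \<Rightarrow> 'a"
    proof (cases v)
      case 0
      have D: "Dm v = q - 1" by (simp add: 0 Dm_def)
      \<comment> \<open>The first variable ranges over all of K, which is not a single class: the
        nonzero elements satisfy y^(q-1) = 1, and zero is a class of its own. Hence the two
        transforms \<open>R1\<close> and \<open>R0\<close> on the same coefficients.\<close>
      have R1: "reach Dom G (2 * B * m * (q - 1)) ((\<lambda>y x. \<Oplus>d\<in>{..<q - 1}. g d x \<otimes> y [^] d) ` {y \<in> K. y [^] (q - 1) = \<one>})"
        using fft[OF rad(2), of \<one> g G Dom] g unfolding rad(1) D by simp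
      have R0: "reach Dom G (2 * B * m * (q - 1)) ((\<lambda>y x. \<Oplus>d\<in>{..<q - 1}. g d x \<otimes> y [^] d) ` {y \<in> K. y [^] (q - 1) = \<zero>})"
        using fft[OF rad(2), of \<zero> g G Dom] g unfolding rad(1) D by simp
      have sub: "{y. y # ys \<in> A (Suc v)} \<subseteq> {y \<in> K. y [^] (q - 1) = \<one>} \<union> {y \<in> K. y [^] (q - 1) = \<zero>}"
      proof
        fix y assume "y \<in> {y. y # ys \<in> A (Suc v)}"
        then have y: "y \<in> K" using A_tl by blast
        show "y \<in> {y \<in> K. y [^] (q - 1) = \<one>} \<union> {y \<in> K. y [^] (q - 1) = \<zero>}"
        proof (cases "y = \<zero>")
          case True
          then show ?thesis using q_gt_1 by (simp add: nat_pow_zero)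
        next
          case False
          have "y \<otimes> y [^] (q - 1) = y [^] Suc (q - 1)" using y by (simp add: m_comm)
          also have "\<dots> = y \<otimes> \<one>" using y q_gt_1 K_pow_q[OF y] by simp
          finally have "y [^] (q - 1) = \<one>" using m_lcancel[of y "y [^] (q - 1)" \<one>] y False by simp
          then show ?thesis using y by simp
        qed
      qed
      have \<tau>0: "\<tau> v = 2 * B * m * (q - 1) + 2 * B * m * (q - 1)" by (simp add: \<tau>_def 0)
      show ?thesis unfolding b_def D \<tau>0
        by (rule reach.weaken[OF reach_both[OF R1 R0] _ order_refl]) (use sub in blast)
    next
      case (Suc u)
      have D: "Dm v = Suc \<kappa>" by (simp add: Suc Dm_def)
      have "length ys = Suc u" using ys unfolding Suc A_iff by (simp add: TP_def)
      then obtain z zs where zs: "ys = z # zs" by (cases ys) auto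
      have "z \<in> K" using A_tl[of z zs u] ys unfolding zs Suc by blast
      note z = zs this
      have R: "reach Dom G (2 * B * m' * Suc \<kappa>) ((\<lambda>y x. \<Oplus>d\<in>{..<Suc \<kappa>}. g d x \<otimes> y [^] d) ` {y \<in> K. y [^] Suc \<kappa> = tr z})"
        using fft[OF rad'(2), of "tr z" g G Dom] g z(2) unfolding rad'(1) D by simp
      \<comment> \<open>Read against the tower, the relation makes y a root of order \<kappa>+1 of
        the trace of z.\<close>
      have sub: "{y. y # ys \<in> A (Suc v)} \<subseteq> {y \<in> K. y [^] Suc \<kappa> = tr z}"
      proof
        fix y assume "y \<in> {y. y # ys \<in> A (Suc v)}"
        then have "rev zs @ [z, y] \<in> TP (Suc v)" by (simp add: A_iff z(1))
        then show "y \<in> {y \<in> K. y [^] Suc \<kappa> = tr z}" unfolding TP_def mem_Collect_eq herm_snoc tr_def by simp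
      qed
      have \<tau>v: "\<tau> v = 2 * B * m' * Suc \<kappa>" by (simp add: \<tau>_def Suc)
      show ?thesis unfolding b_def D \<tau>v
        by (rule reach.weaken[OF R image_mono[OF sub] order_refl])
    qed
    show "rev a \<in> A n" if "a \<in> TP n" for a using that by (simp add: A_iff)
    show "inj_on rp (set (wlist (Suc l)))" using rp by (metis inj_onI)
    show "\<exists>c. lead n (\<lambda>a. level_eval b (rp s) (rev a)) s c" if s: "s \<in> set (wlist (Suc l))" for s
    proof -
      have "lead n (tmon E (rev (rp s))) (W (rev (rp s))) \<one>" using rp[OF s] by (intro lead_tmon) simp
      then have "lead n (\<lambda>a. level_eval b (rp s) (rev a)) (W (rev (rp s))) \<one>"
      proof (rule lead_cong)
        fix v assume "v \<in> Pts n"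
        then show "level_eval b (rp s) (rev v) = tmon E (rev (rp s)) v"
          unfolding b_def level_eval_power using tmon_rev[of "rp s" "rev v"] rp[OF s] by (simp add: Pts_def)
      qed
      then show ?thesis using rp[OF s] by (auto simp: wt_rev)
    qed
    have pD: "prod Dm {Suc v..<n} = Suc \<kappa> ^ (n - Suc v)" for v
      by (simp add: Dm_def)
    have term_le: "card (A v) * prod Dm {Suc v..<n} * \<tau> v \<le> 8 * B * max m m' * \<kappa> ^ (n + 1)" if v: "v < n" for v
    proof (cases v)
      case 0
      have "\<kappa> ^ (n + 1) = q * \<kappa> ^ (n - 1)" using n by (simp add: q power_add[symmetric])
      moreover have "Suc \<kappa> ^ (n - 1) \<le> 2 * \<kappa> ^ (n - 1)" using n2 kappa_gt_1 by (intro Suc_pow_le[of n]) auto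
      then have "Suc \<kappa> ^ (n - 1) * (4 * B * m * (q - 1)) \<le> (2 * \<kappa> ^ (n - 1)) * (4 * B * max m m' * q)"
        by (intro mult_mono) auto
      ultimately show ?thesis unfolding pD cardA by (simp add: 0 TP_0 \<tau>_def ac_simps)
    next
      case (Suc u)
      obtain j where j: "n = Suc v + j" using v by (metis less_iff_Suc_add add_Suc)
      have e: "\<kappa> ^ (u + 2) * \<kappa> ^ Suc j = \<kappa> ^ (n + 1)" by (simp add: j Suc power_add)
      have "Suc \<kappa> ^ Suc j \<le> 2 * \<kappa> ^ Suc j" using n2 kappa_gt_1 j by (intro Suc_pow_le[of n]) auto
      then have "\<kappa> ^ (u + 2) * Suc \<kappa> ^ Suc j * (2 * B * m') \<le> \<kappa> ^ (u + 2) * (2 * \<kappa> ^ Suc j) * (4 * B * max m m')"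
        by (intro mult_mono mult_le_mono2) auto
      also have "\<dots> = 8 * B * max m m' * (\<kappa> ^ (u + 2) * \<kappa> ^ Suc j)" by (simp add: ac_simps)
      finally have "\<kappa> ^ (u + 2) * Suc \<kappa> ^ Suc j * (2 * B * m') \<le> 8 * B * max m m' * \<kappa> ^ (n + 1)" unfolding e .
      moreover have "card (A v) * Suc \<kappa> ^ (n - Suc v) * \<tau> v = \<kappa> ^ (u + 2) * Suc \<kappa> ^ Suc j * (2 * B * m')"
        using TP_card[of u] by (simp add: cardA Suc \<tau>_def j del: mult_Suc mult_Suc_right)
      ultimately show ?thesis unfolding pD by simp
    qed
    have "(\<Sum>v<n. card (A v) * prod Dm {Suc v..<n} * \<tau> v) \<le> n * (8 * B * max m m' * \<kappa> ^ (n + 1))"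
      using sum_bounded_above[of "{..<n}" "\<lambda>v. card (A v) * prod Dm {Suc v..<n} * \<tau> v"] term_le by simp
    then show "real (\<Sum>v<n. card (A v) * prod Dm {Suc v..<n} * \<tau> v) \<le> real (n * (8 * B * max m m' * \<kappa> ^ (n + 1)))"
      by (simp only: of_nat_le_iff)
  qed (use rpB pts in auto)
qed

end

text \<open>The variables are listed from x_n down to x_1, so that each entry is followed by the one
  that its relation refers to.\<close>

lemma hermitian_tower_locale:
  assumes H: "hermitian_tower K E \<kappa> n x" and \<kappa>: "Factorial_Ring.prime p" "0 < r" "\<kappa> = p ^ r" and n: "0 < n"
  shows "hermitian E K p r \<kappa> (\<kappa>\<^sup>2) n (rev (map x [1..<Suc n]))"
proof -
  interpret field E using H by (simp add: hermitian_tower_def)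
  have xc: "x ` {1..n} \<subseteq> carrier E" and rel: "\<And>i. 1 \<le> i \<Longrightarrow> i < n \<Longrightarrow> x (i + 1) [^]\<^bsub>E\<^esub> \<kappa> \<oplus>\<^bsub>E\<^esub> x (i + 1) = x i [^]\<^bsub>E\<^esub> (\<kappa> + 1)"
    using H by (auto simp: hermitian_tower_def)
  have cf: "const_field E K p r \<kappa> (\<kappa>\<^sup>2)"
  proof (intro const_field.intro const_field_axioms.intro)
    show "field E" "subfield K E" "card K = \<kappa>\<^sup>2" using H by (simp_all add: hermitian_tower_def)
  qed (rule \<kappa> refl)+
  interpret const_field E K p r \<kappa> "\<kappa>\<^sup>2" by (rule cf)
  have st: "set (rev (map x [1..<Suc n])) = x ` {1..n}" by auto
  have herm: "herm E \<kappa> (rev (map x [1..<Suc m]))" if "m \<le> n" for m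
    using that
  proof (induction m)
    case (Suc m)
    show ?case
    proof (cases m)
      case (Suc j)
      have "herm E \<kappa> (rev (map x [1..<Suc m]))" using Suc.IH Suc.prems by simp
      moreover have "x (Suc m) [^]\<^bsub>E\<^esub> \<kappa> \<oplus>\<^bsub>E\<^esub> x (Suc m) = x m [^]\<^bsub>E\<^esub> Suc \<kappa>"
        using rel[of m] Suc Suc.prems by simp
      ultimately show ?thesis using Suc by simp
    qed simp
  qed simp
  have "rev (map x [1..<Suc n]) \<in> Pts n" using st xc herm[of n] by (simp add: Pts_def)
  moreover have "last (rev (map x [1..<Suc n])) = x 1"
    using n by (simp add: last_rev hd_map hd_upt del: upt_Suc)
  moreover have "transcendental K (x 1)" "generate_field E (K \<union> x ` {1..n}) = carrier E"
    using H by (simp_all add: hermitian_tower_def)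
  ultimately show ?thesis
    by (intro hermitian.intro hermitian_axioms.intro cf n) (simp_all only: st)
qed

theorem theorem2:
  shows "\<forall>B::nat. \<exists>C::real. \<forall>(\<kappa>::nat) (q::nat) (n::nat) (K::'e set) (E::'e ring) (x::nat \<Rightarrow> 'e).
           primepow \<kappa> \<and> q = \<kappa>\<^sup>2 \<and> 2 \<le> n \<and> 2 * n \<le> \<kappa> \<and>
           hermitian_tower K E \<kappa> n x \<and>
           (smooth B q \<or> smooth B (q - 1)) \<longrightarrow>
           (\<exists>Pinf Ps. one_point_places K E Pinf Ps \<and>
              real (length Ps) = real q powr ((real n + 1) / 2) \<and>
              (\<forall>l < length Ps.
                 encodable_within K E Pinf Ps l
                   (C * real (length Ps) * ln (real (length Ps)))))"
proof (intro allI exI[of _ "16 * real _ / ln 2"] impI)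
  fix B \<kappa> q n :: nat and K :: "'e set" and E :: "'e ring" and x :: "nat \<Rightarrow> 'e"
  assume asm: "primepow \<kappa> \<and> q = \<kappa>\<^sup>2 \<and> 2 \<le> n \<and> 2 * n \<le> \<kappa> \<and> hermitian_tower K E \<kappa> n x \<and>
    (smooth B q \<or> smooth B (q - 1))"
  then obtain p r where pr: "Factorial_Ring.prime p" "0 < r" "\<kappa> = p ^ r" by (auto simp: primepow_def)
  have qk: "q = \<kappa>\<^sup>2" and n2: "2 \<le> n" "2 * n \<le> \<kappa>" and H: "hermitian_tower K E \<kappa> n x"
    and sm: "smooth B q \<or> smooth B (q - 1)" using asm by auto
  let ?xs = "rev (map x [1..<Suc n])"
  interpret hermitian E K p r \<kappa> "\<kappa>\<^sup>2" n ?xs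
    by (rule hermitian_tower_locale[OF H pr]) (use n2 in simp)
  obtain pts where pts: "set pts = TP n" "distinct pts" using finite_distinct_list[OF TP_finite] by blast
  obtain n' where n': "n = Suc n'" using n2 by (cases n) auto
  define N where "N = \<kappa> ^ (n + 1)"
  have len: "length pts = N" using distinct_card[OF pts(2)] pts(1) TP_card[of n'] by (simp add: N_def n')
  have \<kappa>0: "0 < real \<kappa>" using kappa_gt_1 by simp
  have N0: "0 < real N" using \<kappa>0 by (simp add: N_def)
  have lnN: "ln (real N) = (real n + 1) * ln (real \<kappa>)"
    using \<kappa>0 ln_realpow[of "real \<kappa>" "n + 1"] by (simp add: N_def algebra_simps)
  have powr: "real q powr ((real n + 1) / 2) = real N"
  proof -
    have "real q = real \<kappa> powr real 2" unfolding powr_realpow[OF \<kappa>0] by (simp only: qk of_nat_power)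
    then have "real q powr ((real n + 1) / 2) = real \<kappa> powr (real 2 * ((real n + 1) / 2))"
      by (simp only: powr_powr)
    also have "real 2 * ((real n + 1) / 2) = real (n + 1)" by simp
    also have "real \<kappa> powr real (n + 1) = real \<kappa> ^ (n + 1)" by (rule powr_realpow[OF \<kappa>0])
    finally show ?thesis by (simp add: N_def)
  qed
  \<comment> \<open>The constant is determined by the multiplicative case: 8 B from the cost, and 2
    because the number of levels is bounded by the logarithm of q, that is, of \<kappa>^2. The
    additive case fits into the same bound with 4 p, where p is at most B.\<close>
  have enc: "encodable_within K E Pinf (map Ppt pts) l (16 * real B / ln 2 * real N * ln (real N))" if l: "l < N" for l
  proof -
    have l': "l < \<kappa> ^ (n + 1)" using l by (simp add: N_def)
    have mono: "encodable_within K E Pinf Ps l T'" if "encodable_within K E Pinf Ps l T" "T \<le> T'" for Ps T T'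
      using that unfolding encodable_within_def by (meson order_trans)
    have ln\<kappa>: "real n * ln (real \<kappa>) \<le> ln (real N)" using kappa_gt_1 unfolding lnN by (simp add: algebra_simps)
    from sm show ?thesis
    proof
      assume "smooth B q"
      moreover have "p \<in> prime_factors q" using pr p_gt_1 by (auto simp: qk prime_factors_dvd power_mult[symmetric])
      ultimately have pB: "p \<le> B" unfolding smooth_def by blast
      \<comment> \<open>The number r of levels is at most the binary logarithm of \<kappa>, and n
        times the logarithm of \<kappa> is below that of N = \<kappa>^(n+1).\<close>
      have "real r * ln 2 \<le> ln (real \<kappa>)"
      proof -
        have "ln (real \<kappa>) = real r * ln (real p)" using p_gt_1 by (simp add: pr(3) ln_realpow)
        then show ?thesis using p_gt_1 by (simp add: mult_left_mono)
      qed
      then have "real n * (real r * ln 2) \<le> ln (real N)" using ln\<kappa> by (meson mult_left_mono of_nat_0_le_iff order_trans)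
      then have le: "real n * real r \<le> ln (real N) / ln 2" by (simp add: field_simps)
      have "real (n * (4 * p * r * \<kappa> ^ (n + 1))) = 4 * real p * real N * (real n * real r)" by (simp add: N_def)
      also have "\<dots> \<le> 16 * real B * real N * (ln (real N) / ln 2)"
        using pB le N0 by (intro mult_mono) auto
      finally show ?thesis using mono[OF additive_encodable[OF l', of pts]] pts by (simp add: field_simps)
    next
      assume smq: "smooth B (q - 1)"
      have q1: "0 < q - 1" using q_gt_1 qk by simp
      \<comment> \<open>Smoothness passes from q - 1 to its divisor \<kappa>+1, the length of the
        transforms in all variables but x_n.\<close>
      have fac: "q - 1 = (\<kappa> - 1) * Suc \<kappa>" by (simp add: qk power2_eq_square algebra_simps)
      have "Suc \<kappa> dvd q - 1" unfolding fac by (rule dvd_triv_right)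
      then have sm': "\<forall>l\<in>prime_factors (Suc \<kappa>). l \<le> B"
        using smq dvd_prime_factors[of "q - 1" "Suc \<kappa>"] q1 unfolding smooth_def by auto
      obtain m rad where rad: "prod rad {..<m::nat} = q - 1" "\<forall>j<m. 0 < rad j \<and> rad j \<le> B" "2 ^ m \<le> q - 1"
        using smooth_radices[OF q1] smq unfolding smooth_def by blast
      obtain m' rad' where rad': "prod rad' {..<m'::nat} = Suc \<kappa>" "\<forall>j<m'. 0 < rad' j \<and> rad' j \<le> B" "2 ^ m' \<le> Suc \<kappa>"
        using smooth_radices[OF _ sm'] by auto
      have "2 * \<kappa> \<le> \<kappa> * \<kappa>" using kappa_gt_1 by (intro mult_le_mono1) simp
      then have "Suc \<kappa> \<le> q" using kappa_gt_1 unfolding qk power2_eq_square by linarith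
      \<comment> \<open>Both lists of radices are bounded at once, so one logarithm of q covers the
        first variable and all others.\<close>
      then have "2 ^ max m m' \<le> q" using rad(3) rad'(3) by (auto simp: max_def)
      then have "(2::real) ^ max m m' \<le> real q" by (metis of_nat_le_iff of_nat_numeral of_nat_power)
      then have "ln ((2::real) ^ max m m') \<le> ln (real q)" by (intro ln_mono) auto
      then have "real (max m m') * ln 2 \<le> 2 * ln (real \<kappa>)" using \<kappa>0 by (simp add: ln_realpow qk)
      then have "real n * (real (max m m') * ln 2) \<le> real n * (2 * ln (real \<kappa>))" by (rule mult_left_mono) simp
      then have "real n * (real (max m m') * ln 2) \<le> 2 * ln (real N)" using ln\<kappa> by linarith
      then have le: "real n * real (max m m') \<le> 2 * (ln (real N) / ln 2)" by (simp add: field_simps)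
      have "real (n * (8 * B * max m m' * \<kappa> ^ (n + 1))) = 8 * real B * real N * (real n * real (max m m'))"
        by (simp add: N_def del: of_nat_max)
      also have "\<dots> \<le> 8 * real B * real N * (2 * (ln (real N) / ln 2))"
        using le N0 by (intro mult_left_mono) auto
      finally show ?thesis
        using mono[OF multiplicative_encodable[OF l' _ n2 rad(1)[unfolded qk] rad(2) rad'(1,2), of pts]] pts by (simp add: field_simps)
    qed
  qed
  have "one_point_places K E Pinf (map Ppt pts)"
    using pts by (intro one_point_places_pts) (auto simp: TP_Pts)
  then show "\<exists>Pinf Ps. one_point_places K E Pinf Ps \<and>
      real (length Ps) = real q powr ((real n + 1) / 2) \<and>
      (\<forall>l < length Ps. encodable_within K E Pinf Ps l (16 * real B / ln 2 * real (length Ps) * ln (real (length Ps))))"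
    using enc powr len by (intro exI[of _ Pinf] exI[of _ "map Ppt pts"]) auto
qed

end
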